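(* Let $n\ge 2$ be an integer, $(a,b)\subset\mathbb{R}$ an open interval and $f:(a,b)\to\mathbb{R}$. Then the following are equivalent: (1) $f$ is $n$-convex. (2) For any $a<x_0<x_1<\cdots<x_{2n}<b$ and $q\in\mathbb{R}_{n-1}[x]$, $[x_0,x_1,\ldots,x_{2n}]_{fq^2}\ge 0$. (3) For any $a<x_0<x_1<\cdots<x_{2n}<b$ and $q\in\mathbb{C}_{n-1}[x]$, $[x_0,x_1,\ldots,x_{2n}]_{fN(q)}\ge 0$. (4) $f\in C^2(a,b)$ and for any $a<x_1<x_2<\cdots<x_n<b$, $1\le l\le n$ and $q\in\mathbb{C}_{n-1}[x]$, $[x_1,x_1,x_2,x_2,\ldots,x_n,x_n,x_l]_{fN(q)}\ge 0$. (5) $f\in C^2(a,b)$ and for any $a<x_1<x_2<\cdots<x_n<b$, $x_0\in(a,b)$ and $q\in\mathbb{C}_{n-1}[x]$, $[x_1,x_1,x_2,x_2,\ldots,x_n,x_n,x_0]_{fN(q)}\ge 0$. (6) $f\in C^2(a,b)$ and for any $a<x_1<x_2<\cdots<x_n<b$ and $1\le l\le n$ the matrix $([x_i,x_j,x_l]_f)_{1\le i,j\le n}$ is positive semidefinite. (7) $f\in C^2(a,b)$ and for any $a<x_1<x_2<\cdots<x_n<b$ and $x_0\in(a,b)$ the matrix $([x_i,x_j,x_0]_f)_{1\le i,j\le n}$ is positive semidefinite. (8) $f\in C^{2n-2}(a,b)$, $f^{(2n-2)}$ is convex, and for every $q\in\mathbb{C}_{n-1}[x]$ the derivative $(fN(q))^{(2n)}$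 exists almost everywhere and is non-negative. (9) $f\in C^{2n-2}(a,b)$, $f^{(2n-2)}$ is convex, and the matrix $$\left(\frac{f^{(i+j)}(t)}{(i+j)!}\right)_{1\le i,j\le n}$$ exists and is positive semidefinite for almost every $t\in(a,b)$.
   Context: Matrices are ordered by the Loewner order: $A\le B$ iff $B-A$ is positive semidefinite. $f:(a,b)\to\mathbb{R}$ is $n$-convex if for all $t\in[0,1]$ and all $n\times n$ (complex) Hermitian matrices $A,B$ with all eigenvalues in $(a,b)$ one has $f(tA+(1-t)B)\le tf(A)+(1-t)f(B)$ (functional calculus). $\mathbb{R}_m[x]$, $\mathbb{C}_m[x]$ denote real, resp. complex, polynomials of degree at most $m$. For $q\in\mathbb{C}[x]$, $q^*$ is the polynomial with complex-conjugated coefficients and $N(q)=qq^*$ (which has real coefficients and satisfies $N(q)(x)=|q(x)|^2$ for real $x$). For pairwise distinct points, $[\lambda_0,\ldots,\lambda_m]_g=\sum_{i=0}^{m}\frac{g(\lambda_i)}{\prod_{j\ne i}(\lambda_i-\lambda_j)}$. With repeated points: define $\langle g,\frac{1}{(\cdot-c)^{k+1}}\rangle_L=\frac{g^{(k)}(c)}{k!}$ for $g$ that is $k$ times differentiable at $c$, extend linearly (via partial fractions) to rational functions vanishing at infinity, and set $[\lambda_0,\ldots,\lambda_m]_g=\langle g,\frac{1}{(\cdot-\lambda_0)\cdots(\cdot-\lambda_m)}\rangle_L$; this agrees with the previous formula for distinct points. In the conditions using $f\in C^2$ each point occurs at most three times, so only derivatives up to order two are needed. When $f^{(2n-2)}$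 is convex, its derivative $f^{(2n-1)}$ exists off a countable set and is non-decreasing where it exists; $f^{(2n)}(t)$ means the derivative at $t$ of this almost everywhere defined function (and similarly for $(fN(q))^{(2n)}$), which exists for almost every $t$. "Almost everywhere" refers to Lebesgue measure. *)

theory Defs
  imports
    "HOL-Analysis.Analysis"
    "HOL-Computational_Algebra.Polynomial"
    "Jordan_Normal_Form.Spectral_Radius"
    "Jordan_Normal_Form.Schur_Decomposition"
begin

section \<open>Hermitian matrices, Loewner order, functional calculus\<close>

text \<open>
  The library's adjoint works over any field with conjugation, so the following notions cover
  complex matrices and real ones (where conjugation is the identity). For complex scalars the order
  of \<open>HOL-Library.Complex_Order\<close> is meant: \<open>0 \<le> z\<close> says that \<open>z\<close> is real and nonnegative.
\<close>

definition hermitian :: "nat \<Rightarrow> 'a :: conjugatable_field mat \<Rightarrow> bool" where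
  "hermitian n A \<longleftrightarrow> A \<in> carrier_mat n n \<and> mat_adjoint A = A"

definition psd :: "nat \<Rightarrow> 'a :: conjugatable_ordered_field mat \<Rightarrow> bool" where
  "psd n A \<longleftrightarrow> hermitian n A \<and> (\<forall>v\<in>carrier_vec n. 0 \<le> (A *\<^sub>v v) \<bullet>c v)"

definition loewner_le :: "nat \<Rightarrow> complex mat \<Rightarrow> complex mat \<Rightarrow> bool" where
  "loewner_le n A B \<longleftrightarrow> A \<in> carrier_mat n n \<and> B \<in> carrier_mat n n \<and> psd n (B - A)"

definition real_diag :: "nat \<Rightarrow> (nat \<Rightarrow> real) \<Rightarrow> complex mat" where
  "real_diag n d = mat n n (\<lambda>(i, j). if i = j then complex_of_real (d i) else 0)"

definition unitary :: "nat \<Rightarrow> complex mat \<Rightarrow> bool" where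
  "unitary n U \<longleftrightarrow> U \<in> carrier_mat n n \<and> U * mat_adjoint U = 1\<^sub>m n \<and> mat_adjoint U * U = 1\<^sub>m n"

text \<open>
  \<open>f(A) = U diag(f(d\<^sub>0), \<dots>) U\<^sup>*\<close> for a unitary diagonalization \<open>A = U diag(d\<^sub>0, \<dots>) U\<^sup>*\<close>. For Hermitian
  \<open>A\<close> a diagonalization exists and the result does not depend on its choice. Only the values of \<open>f\<close>
  at the eigenvalues of \<open>A\<close> matter.
\<close>

definition mat_fun :: "(real \<Rightarrow> real) \<Rightarrow> complex mat \<Rightarrow> complex mat" where
  "mat_fun f A = (THE B. \<exists>U d. unitary (dim_row A) U
      \<and> A = U * real_diag (dim_row A) d * mat_adjoint U
      \<and> B = U * real_diag (dim_row A) (f \<circ> d) * mat_adjoint U)"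

definition n_convex_on :: "nat \<Rightarrow> real set \<Rightarrow> (real \<Rightarrow> real) \<Rightarrow> bool" where
  "n_convex_on n S f \<longleftrightarrow> (\<forall>t A B. 0 \<le> t \<and> t \<le> 1 \<and> hermitian n A \<and> hermitian n B
      \<and> spectrum A \<subseteq> complex_of_real ` S \<and> spectrum B \<subseteq> complex_of_real ` S
      \<longrightarrow> loewner_le n
            (mat_fun f (complex_of_real t \<cdot>\<^sub>m A + complex_of_real (1 - t) \<cdot>\<^sub>m B))
            (complex_of_real t \<cdot>\<^sub>m mat_fun f A + complex_of_real (1 - t) \<cdot>\<^sub>m mat_fun f B))"


section \<open>The polynomial \<open>N(q) = q q\<^sup>*\<close>\<close>

definition Npoly :: "complex poly \<Rightarrow> real poly" where
  "Npoly q = map_poly Re (q * map_poly cnj q)"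

lemma of_real_Npoly: "map_poly complex_of_real (Npoly q) = q * map_poly cnj q"
proof -
  have "coeff (q * map_poly cnj q) k \<in> \<real>" for k
  proof -
    have "cnj (coeff (q * map_poly cnj q) k) = (\<Sum>i\<le>k. cnj (coeff q i) * coeff q (k - i))"
      by (simp add: coeff_mult coeff_map_poly)
    also have "\<dots> = (\<Sum>i\<le>k. cnj (coeff q (k - i)) * coeff q i)"
      by (rule sum.reindex_bij_witness[of _ "\<lambda>i. k - i" "\<lambda>i. k - i"]) auto
    also have "\<dots> = coeff (q * map_poly cnj q) k"
      by (simp add: coeff_mult coeff_map_poly mult.commute)
    finally show ?thesis by (simp add: Reals_cnj_iff)
  qed
  then show ?thesis
    by (intro poly_eqI) (simp add: Npoly_def coeff_map_poly)
qed


section \<open>Divided differences\<close>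

text \<open>
  \<open>pf_repr r C m \<alpha>\<close>: the function \<open>r\<close> is, off its poles, the proper rational function with partial
  fraction expansion \<open>\<Sum>\<^bsub>c \<in> C, k < m\<^esub> \<alpha> c k / (x - c)\<^bsup>k+1\<^esup>\<close>. Coefficients may be zero.
\<close>

definition pf_repr ::
  "(real \<Rightarrow> real) \<Rightarrow> real set \<Rightarrow> nat \<Rightarrow> (real \<Rightarrow> nat \<Rightarrow> real) \<Rightarrow> bool" where
  "pf_repr r C m \<alpha> \<longleftrightarrow> finite C \<and>
     (\<forall>x. x \<notin> C \<longrightarrow> r x = (\<Sum>c\<in>C. \<Sum>k<m. \<alpha> c k / (x - c) ^ (k + 1)))"

text \<open>
  The linear extension of \<open>\<langle>g, 1 / (\<cdot> - c)\<^bsup>k+1\<^esup>\<rangle> = g\<^bsup>(k)\<^esup>(c) / k!\<close>; it is well defined by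
  \<open>pf_value_unique\<close> below.
\<close>

definition pf_value ::
  "(real \<Rightarrow> real) \<Rightarrow> real set \<Rightarrow> nat \<Rightarrow> (real \<Rightarrow> nat \<Rightarrow> real) \<Rightarrow> real" where
  "pf_value g C m \<alpha> = (\<Sum>c\<in>C. \<Sum>k<m. \<alpha> c k * ((deriv ^^ k) g c / fact k))"

definition L_pairing :: "(real \<Rightarrow> real) \<Rightarrow> (real \<Rightarrow> real) \<Rightarrow> real" where
  "L_pairing g r = (THE v. \<exists>C m \<alpha>. pf_repr r C m \<alpha> \<and> v = pf_value g C m \<alpha>)"

definition divdiff :: "real list \<Rightarrow> (real \<Rightarrow> real) \<Rightarrow> real" where
  "divdiff xs g = L_pairing g (\<lambda>x. 1 / (\<Prod>y\<leftarrow>xs. x - y))"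

lemma pf_coeffs_zero:
  assumes "finite C" "finite F"
    and zero: "\<And>x. x \<notin> F \<Longrightarrow> (\<Sum>c\<in>C. \<Sum>k<m. \<alpha> c k / (x - c) ^ (k + 1)) = (0::real)"
    and c: "c \<in> C" and "k < m"
  shows "\<alpha> c k = 0"
proof (rule ccontr)
  assume "\<alpha> c k \<noteq> 0"
  define P where "P = {k. k < m \<and> \<alpha> c k \<noteq> 0}"
  have finP: "finite P" unfolding P_def by simp
  have "k \<in> P" using \<open>k < m\<close> \<open>\<alpha> c k \<noteq> 0\<close> by (simp add: P_def)
  define K where "K = Max P"
  have "K \<in> P" unfolding K_def using finP \<open>k \<in> P\<close> by (intro Max_in) auto
  then have K: "K < m" "\<alpha> c K \<noteq> 0" by (auto simp: P_def)
  have above: "\<alpha> c j = 0" if "K < j" "j < m" for j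
  proof (rule ccontr)
    assume "\<alpha> c j \<noteq> 0"
    then have "j \<le> K" unfolding K_def using that finP by (intro Max_ge) (auto simp: P_def)
    with that show False by simp
  qed
  define T where "T = (\<lambda>d j x. (x - c) ^ (K + 1) * (\<alpha> d j / (x - d) ^ (j + 1)))"
  have T_lim: "(T d j \<longlongrightarrow> (if d = c \<and> j = K then \<alpha> c K else 0)) (at c)" if "j < m" for d j
  proof (cases "d = c")
    case False
    have "(T d j \<longlongrightarrow> (c - c) ^ (K + 1) * (\<alpha> d j / (c - d) ^ (j + 1))) (at c)"
      unfolding T_def using False by (intro tendsto_intros) auto
    with False show ?thesis by simp
  next
    case True
    show ?thesis
    proof (cases "j \<le> K")
      case le: True
      have "T d j x = (x - c) ^ (K - j) * \<alpha> c j" if "x \<noteq> c" for x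
      proof -
        have "(x - c) ^ (K + 1) = (x - c) ^ (K - j) * (x - c) ^ (j + 1)"
          using le by (subst power_add[symmetric]) simp
        then show ?thesis using that True by (simp add: T_def)
      qed
      then have ev: "\<forall>\<^sub>F x in at c. (x - c) ^ (K - j) * \<alpha> c j = T d j x"
        by (auto simp: eventually_at intro!: exI[of _ 1])
      have "((\<lambda>x. (x - c) ^ (K - j) * \<alpha> c j) \<longlongrightarrow> (c - c) ^ (K - j) * \<alpha> c j) (at c)"
        by (intro tendsto_intros)
      then have "(T d j \<longlongrightarrow> (c - c) ^ (K - j) * \<alpha> c j) (at c)"
        by (rule Lim_transform_eventually[OF _ ev])
      moreover have "(c - c) ^ (K - j) * \<alpha> c j = (if d = c \<and> j = K then \<alpha> c K else 0)"
        using True le by (auto simp: power_0_left)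
      ultimately show ?thesis by simp
    next
      case False
      then have "\<alpha> c j = 0" using above that by simp
      then have "T d j = (\<lambda>x. 0)" using True unfolding T_def by auto
      with False show ?thesis by simp
    qed
  qed
  have "((\<lambda>x. \<Sum>d\<in>C. \<Sum>j<m. T d j x) \<longlongrightarrow>
      (\<Sum>d\<in>C. \<Sum>j<m. if d = c \<and> j = K then \<alpha> c K else 0)) (at c)"
    by (intro tendsto_sum T_lim) simp
  also have "(\<Sum>d\<in>C. \<Sum>j<m. if d = c \<and> j = K then \<alpha> c K else 0)
      = (\<Sum>d\<in>C. if d = c then \<alpha> c K else 0)"
    using K by (intro sum.cong refl) auto
  also have "\<dots> = \<alpha> c K" using \<open>finite C\<close> c by simp
  finally have lim: "((\<lambda>x. \<Sum>d\<in>C. \<Sum>j<m. T d j x) \<longlongrightarrow> \<alpha> c K) (at c)" .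
  have "\<forall>\<^sub>F x in at c. x \<notin> F"
    unfolding eventually_at_topological
    using open_Compl[OF finite_imp_closed[OF finite_Diff[OF \<open>finite F\<close>, of "{c}"]]]
    by (intro exI[of _ "- (F - {c})"]) simp
  then have "\<forall>\<^sub>F x in at c. (\<Sum>d\<in>C. \<Sum>j<m. T d j x) = 0"
  proof eventually_elim
    case (elim x)
    have "(\<Sum>d\<in>C. \<Sum>j<m. T d j x) =
        (x - c) ^ (K + 1) * (\<Sum>d\<in>C. \<Sum>j<m. \<alpha> d j / (x - d) ^ (j + 1))"
      unfolding T_def by (simp only: sum_distrib_left)
    then show ?case using zero[OF elim] by simp
  qed
  then have "((\<lambda>x. \<Sum>d\<in>C. \<Sum>j<m. T d j x) \<longlongrightarrow> 0) (at c)"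
    by (rule tendsto_eventually)
  with lim have "\<alpha> c K = 0" using tendsto_unique trivial_limit_at by blast
  with K show False by simp
qed

lemma pf_extend:
  fixes m p :: nat
  assumes "finite D" "C \<subseteq> D" "m \<le> p"
  shows "(\<Sum>c\<in>C. \<Sum>k<m. h c k) = (\<Sum>c\<in>D. \<Sum>k<p. if c \<in> C \<and> k < m then h c k else (0::real))"
proof -
  have "(\<Sum>k<p. if c \<in> C \<and> k < m then h c k else 0) = (if c \<in> C then \<Sum>k<m. h c k else 0)" for c
  proof (cases "c \<in> C")
    case True
    have "(\<Sum>k<p. if k < m then h c k else 0) = (\<Sum>k<m. if k < m then h c k else 0)"
      using \<open>m \<le> p\<close> by (intro sum.mono_neutral_right) auto
    with True show ?thesis by simp
  qed simp
  then have "(\<Sum>c\<in>D. \<Sum>k<p. if c \<in> C \<and> k < m then h c k else 0)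
      = (\<Sum>c\<in>D. if c \<in> C then \<Sum>k<m. h c k else 0)" by simp
  also have "\<dots> = (\<Sum>c\<in>C. if c \<in> C then \<Sum>k<m. h c k else 0)"
    using assms by (intro sum.mono_neutral_right) auto
  finally show ?thesis by simp
qed

lemma pf_value_unique:
  assumes "pf_repr r C m \<alpha>" "pf_repr r C' m' \<alpha>'"
  shows "pf_value g C m \<alpha> = pf_value g C' m' \<alpha>'"
proof -
  define D p where "D = C \<union> C'" and "p = max m m'"
  define \<beta> where "\<beta> = (\<lambda>c k. (if c \<in> C \<and> k < m then \<alpha> c k else 0)
      - (if c \<in> C' \<and> k < m' then \<alpha>' c k else 0))"
  have fin: "finite D" using assms by (auto simp: D_def pf_repr_def)
  have split: "(\<Sum>c\<in>D. \<Sum>k<p. \<beta> c k * w c k) =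
      (\<Sum>c\<in>C. \<Sum>k<m. \<alpha> c k * w c k) - (\<Sum>c\<in>C'. \<Sum>k<m'. \<alpha>' c k * w c k)" for w
  proof -
    have "(\<Sum>c\<in>C. \<Sum>k<m. \<alpha> c k * w c k)
        = (\<Sum>c\<in>D. \<Sum>k<p. if c \<in> C \<and> k < m then \<alpha> c k * w c k else 0)"
      by (rule pf_extend[OF fin]) (auto simp: D_def p_def)
    moreover have "(\<Sum>c\<in>C'. \<Sum>k<m'. \<alpha>' c k * w c k)
        = (\<Sum>c\<in>D. \<Sum>k<p. if c \<in> C' \<and> k < m' then \<alpha>' c k * w c k else 0)"
      by (rule pf_extend[OF fin]) (auto simp: D_def p_def)
    ultimately show ?thesis
      by (simp only: sum_subtractf[symmetric]) (intro sum.cong refl, auto simp: \<beta>_def algebra_simps)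
  qed
  have "(\<Sum>c\<in>D. \<Sum>k<p. \<beta> c k / (x - c) ^ (k + 1)) = 0" if "x \<notin> D" for x
  proof -
    have "r x = (\<Sum>c\<in>C. \<Sum>k<m. \<alpha> c k / (x - c) ^ (k + 1))"
      "r x = (\<Sum>c\<in>C'. \<Sum>k<m'. \<alpha>' c k / (x - c) ^ (k + 1))"
      using assms that unfolding pf_repr_def D_def by blast+
    then show ?thesis
      using split[of "\<lambda>c k. 1 / (x - c) ^ (k + 1)"] by simp
  qed
  then have "\<beta> c k = 0" if "c \<in> D" "k < p" for c k
    by (rule pf_coeffs_zero[OF fin fin _ that])
  then have "(\<Sum>c\<in>D. \<Sum>k<p. \<beta> c k * ((deriv ^^ k) g c / fact k)) = 0"
    by (intro sum.neutral ballI) simp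
  then show ?thesis by (simp only: split pf_value_def)
qed

lemma L_pairing_eq:
  assumes "pf_repr r C m \<alpha>"
  shows "L_pairing g r = pf_value g C m \<alpha>"
  unfolding L_pairing_def
proof (rule the_equality)
  show "\<exists>C' m' \<alpha>'. pf_repr r C' m' \<alpha>' \<and> pf_value g C m \<alpha> = pf_value g C' m' \<alpha>'"
    using assms by blast
next
  fix v
  assume "\<exists>C' m' \<alpha>'. pf_repr r C' m' \<alpha>' \<and> v = pf_value g C' m' \<alpha>'"
  then show "v = pf_value g C m \<alpha>" using pf_value_unique[OF assms] by metis
qed

lemma pf_distinct:
  assumes "finite S" "S \<noteq> {}" "x \<notin> S"
  shows "1 / (\<Prod>s\<in>S. x - s) = (\<Sum>s\<in>S. 1 / (\<Prod>u\<in>S - {s}. s - u) / (x - s :: real))"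
  using assms
proof (induction S arbitrary: x rule: finite_ne_induct)
  case (singleton s)
  then show ?case by simp
next
  case (insert t S)
  define c where "c = (\<lambda>s. 1 / (\<Prod>u\<in>S - {s}. s - u))"
  have IH: "1 / (\<Prod>s\<in>S. y - s) = (\<Sum>s\<in>S. c s / (y - s))" if "y \<notin> S" for y
    using insert.IH[OF that] by (simp add: c_def)
  have c': "1 / (\<Prod>u\<in>insert t S - {s}. s - u) = c s / (s - t)" if "s \<in> S" for s
  proof -
    have "insert t S - {s} = insert t (S - {s})" using insert.hyps that by auto
    then show ?thesis using insert.hyps by (simp add: c_def)
  qed
  have ct: "1 / (\<Prod>u\<in>insert t S - {t}. t - u) = (\<Sum>s\<in>S. c s / (t - s))"
    using insert.hyps IH[of t] by simp
  have xt: "x \<noteq> t" "x \<notin> S" using insert.prems by auto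
  have step: "c s / (x - s) / (x - t) = c s / (s - t) / (x - s) + c s / (t - s) / (x - t)"
    if "s \<in> S" for s
  proof -
    have "x - s \<noteq> 0" "x - t \<noteq> 0" "s - t \<noteq> 0" "t - s \<noteq> 0" using that xt insert.hyps by auto
    then show ?thesis by (simp add: divide_simps) (simp add: algebra_simps)
  qed
  have "1 / (\<Prod>s\<in>insert t S. x - s) = (\<Sum>s\<in>S. c s / (x - s)) / (x - t)"
    unfolding IH[OF xt(2), symmetric] using insert.hyps by simp
  also have "\<dots> = (\<Sum>s\<in>S. c s / (s - t) / (x - s)) + (\<Sum>s\<in>S. c s / (t - s)) / (x - t)"
    using step by (simp add: sum_divide_distrib sum.distrib)
  also have "\<dots> = (\<Sum>s\<in>insert t S. 1 / (\<Prod>u\<in>insert t S - {s}. s - u) / (x - s))"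
    unfolding sum.insert[OF insert.hyps(1,3)] ct using c' by (simp add: add.commute)
  finally show ?case .
qed

text \<open>Agreement with the classical formula.\<close>

lemma divdiff_distinct:
  assumes "distinct xs" "xs \<noteq> []"
  shows "divdiff xs g = (\<Sum>s\<in>set xs. g s / (\<Prod>u\<in>set xs - {s}. s - u))"
proof -
  have "pf_repr (\<lambda>x. 1 / (\<Prod>y\<leftarrow>xs. x - y)) (set xs) 1 (\<lambda>s k. 1 / (\<Prod>u\<in>set xs - {s}. s - u))"
    using assms pf_distinct[of "set xs"]
    by (auto simp: pf_repr_def prod.distinct_set_conv_list)
  then show ?thesis
    unfolding divdiff_def by (subst L_pairing_eq) (auto simp: pf_value_def)
qed


section \<open>Higher derivatives\<close>

text \<open>
  \<open>deriv_dom S f k\<close> is the set of points of the open set \<open>S\<close> at which \<open>f\<^bsup>(k)\<^esup>\<close> exists, provided the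
  derivatives of order less than \<open>k\<close> exist throughout \<open>S\<close>.
\<close>

definition deriv_dom :: "real set \<Rightarrow> (real \<Rightarrow> real) \<Rightarrow> nat \<Rightarrow> real set" where
  "deriv_dom S f k = {s \<in> S. \<forall>j<k. (deriv ^^ j) f differentiable (at s)}"

definition C_k_on :: "nat \<Rightarrow> (real \<Rightarrow> real) \<Rightarrow> real set \<Rightarrow> bool" where
  "C_k_on k f S \<longleftrightarrow> deriv_dom S f k = S \<and> continuous_on S ((deriv ^^ k) f)"

text \<open>
  The \<open>k\<close>-th derivative of \<open>f\<close> at \<open>t\<close> exists and equals \<open>d\<close>, where \<open>f\<^bsup>(k-1)\<^esup>\<close> need not be defined on
  all of \<open>S\<close>: its difference quotients are formed only over the points where it is defined. If
  \<open>f\<^bsup>(k-1)\<^esup>\<close> is defined on all of the open set \<open>S\<close>, this is the ordinary derivative.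
\<close>

definition has_kth_deriv ::
  "real set \<Rightarrow> nat \<Rightarrow> (real \<Rightarrow> real) \<Rightarrow> real \<Rightarrow> real \<Rightarrow> bool" where
  "has_kth_deriv S k f d t \<longleftrightarrow> (case k of
      0 \<Rightarrow> t \<in> S \<and> d = f t
    | Suc j \<Rightarrow> t \<in> deriv_dom S f j \<and>
        ((deriv ^^ j) f has_real_derivative d) (at t within deriv_dom S f j))"

end

theory Submission
  imports Defs
begin

hide_const (open) module.smult

text \<open>
  All conditions are compared with the nonnegativity of the divided differences of \<open>f q\<^sup>2\<close> over \<open>2 n + 1\<close>
  distinct points, for real \<open>q\<close> of degree less than \<open>n\<close>; complex \<open>q\<close> add nothing, as \<open>N(q)\<close> is a sum of two real
  squares. By partial fractions, \<open>[x\<^sub>1, x\<^sub>1, \<dots>, x\<^sub>n, x\<^sub>n, w]\<close> applied to \<open>f q\<^sup>2\<close> equals \<open>\<Sum> r\<^sub>i r\<^sub>j [x\<^sub>i, x\<^sub>j, w]\<^sub>f\<close>, where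
  \<open>r\<^sub>i = q(x\<^sub>i) / \<Prod>\<^bsub>u \<noteq> i\<^esub> (x\<^sub>i - x\<^sub>u)\<close> is arbitrary, and this is a limit of divided differences over distinct points.

  The second derivative of \<open>\<langle>f(A + s H) v, v\<rangle>\<close> is \<open>2 \<Sum>\<^sub>b \<Sum>\<^sub>a\<^sub>c [d\<^sub>a, d\<^sub>b, d\<^sub>c]\<^sub>f y\<^sub>b\<^sub>a\<^sup>* y\<^sub>b\<^sub>c\<close> in an eigenbasis of \<open>A + s H\<close>. So Kraus
  matrices that are positive semidefinite make \<open>f\<close> \<open>n\<close>-convex, and for \<open>f\<close> in \<open>C\<^sup>2\<close> a suitable choice of \<open>H\<close> and \<open>v\<close>
  isolates a single \<open>b\<close> and gives the converse. For \<open>f\<close> in \<open>C\<^bsup>2n\<^esup>\<close>, merging all nodes turns positive Kraus matrices into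
  a nonnegative \<open>2 n\<close>-th derivative of \<open>f q\<^sup>2\<close>, hence into nonnegative divided differences; a general \<open>n\<close>-convex \<open>f\<close> is
  smoothed by Steklov averages.

  Nonnegative divided differences of order \<open>2 n\<close> make the derivative of order \<open>2 n - 2\<close> convex, hence twice differentiable
  almost everywhere by Lebesgue's theorem on monotone functions. Conversely, the right derivative of order \<open>2 n - 1\<close> of
  \<open>f q\<^sup>2\<close> is increasing up to a Lipschitz function when that of \<open>f\<close> is increasing, so it can only decrease where its
  derivative is negative on a set of positive measure. The matrix condition is the Leibniz formula for
  \<open>q(s) = \<Sum> v\<^sub>i (s - t)\<^bsup>n - i\<^esup>\<close>.
\<close>

section \<open>Divided differences and higher-order convexity\<close>

text \<open>Eigenvectors of \<open>A + s H\<close> may jump with \<open>s\<close>. The second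
  derivative is therefore computed for polynomials only, from powers of \<open>A + s H\<close> in
  the standard basis, and then rewritten at each \<open>s\<close> in some eigenbasis. A function in
  C^2 is replaced by polynomials that are close together with the second derivative, and only
  inequalities with small errors pass to the limit.

  Kraus matrices speak only about node lists in which every node is doubled and one is tripled, so
  arbitrary nodes are no limits of them. They do fix the sign of the derivative of order
  \<open>2 n\<close>, and a mean value theorem leads from there to arbitrary nodes; hence the need
  for smoothness. Smoothing is done for \<open>n\<close>-convexity, which makes sense without
  derivatives and survives averages over translates.

  At the top order the obstacle is a singular part: derivatives almost everywhere do not see it.
  Convexity of the derivative of order \<open>2 n - 2\<close> ensures that it has the right sign for
  \<open>f\<close>, and multiplication by a nonnegative polynomial keeps this sign.\<close>

definition dd :: "real set \<Rightarrow> (real \<Rightarrow> real) \<Rightarrow> real" where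
  "dd S g = (\<Sum>s\<in>S. g s / (\<Prod>u\<in>S - {s}. s - u))"

text \<open>Higher-order convexity, normalized so that \<open>m = 1\<close> is monotonicity and
  \<open>m = 2\<close> is ordinary convexity. Node sets instead of increasing tuples build in the
  symmetry and the distinctness of the nodes.\<close>

definition kconv :: "nat \<Rightarrow> real set \<Rightarrow> (real \<Rightarrow> real) \<Rightarrow> bool" where
  "kconv m I g \<longleftrightarrow> (\<forall>S. finite S \<and> S \<subseteq> I \<and> card S = Suc m \<longrightarrow> 0 \<le> dd S g)"

lemma dd_cong: "(\<And>s. s \<in> S \<Longrightarrow> g s = h s) \<Longrightarrow> dd S g = dd S h"
  unfolding dd_def by (rule sum.cong) auto

lemma dd_singleton [simp]: "dd {x} g = g x"
  by (simp add: dd_def)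

lemma dd_insert:
  assumes "finite S" "x \<notin> S"
  shows "dd (insert x S) g =
    g x / (\<Prod>u\<in>S. x - u) + (\<Sum>s\<in>S. g s / ((\<Prod>u\<in>S - {s}. s - u) * (s - x)))"
proof -
  have "insert x S - {s} = insert x (S - {s})" if "s \<in> S" for s using assms that by auto
  then have "g s / (\<Prod>u\<in>insert x S - {s}. s - u) = g s / ((\<Prod>u\<in>S - {s}. s - u) * (s - x))"
    if "s \<in> S" for s using assms that by (simp add: mult.commute)
  then have "(\<Sum>s\<in>S. g s / (\<Prod>u\<in>insert x S - {s}. s - u))
      = (\<Sum>s\<in>S. g s / ((\<Prod>u\<in>S - {s}. s - u) * (s - x)))"
    by (rule sum.cong[OF refl])
  then show ?thesis unfolding dd_def using assms by simp
qed

text \<open>The recursion of divided differences, cleared of its denominator. At the common nodes it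
  rests on \<open>1 / (s - x) - 1 / (s - y) = (x - y) / ((s - x) (s - y))\<close>.\<close>

lemma dd_exchange:
  assumes S: "finite S" and xy: "x \<notin> S" "y \<notin> S" "x \<noteq> y"
  shows "(x - y) * dd (insert x (insert y S)) g = dd (insert x S) g - dd (insert y S) g"
proof -
  define p where "p = (\<lambda>s. \<Prod>u\<in>S - {s}. s - u)"
  have nz: "(\<Prod>u\<in>S. x - u) \<noteq> 0" "(\<Prod>u\<in>S. y - u) \<noteq> 0" using S xy by auto
  have pn: "p s \<noteq> 0" if "s \<in> S" for s using S by (auto simp: p_def)
  have e: "insert y S - {s} = insert y (S - {s})" if "s \<in> S" for s using xy that by auto
  have "dd (insert x (insert y S)) g = g x / ((x - y) * (\<Prod>u\<in>S. x - u))
      + (g y / ((\<Prod>u\<in>S. y - u) * (y - x)) + (\<Sum>s\<in>S. g s / (p s * (s - y) * (s - x))))"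
    using S xy e by (subst dd_insert) (auto simp: p_def mult.commute intro!: sum.cong)
  then have "(x - y) * dd (insert x (insert y S)) g = g x / (\<Prod>u\<in>S. x - u) - g y / (\<Prod>u\<in>S. y - u)
     + (\<Sum>s\<in>S. (x - y) * (g s / (p s * (s - y) * (s - x))))"
    using nz xy by (simp add: distrib_left sum_distrib_left) (simp add: divide_simps, simp add: algebra_simps)
  also have "(\<Sum>s\<in>S. (x - y) * (g s / (p s * (s - y) * (s - x))))
     = (\<Sum>s\<in>S. g s / (p s * (s - x))) - (\<Sum>s\<in>S. g s / (p s * (s - y)))"
    unfolding sum_subtractf[symmetric]
  proof (rule sum.cong)
    fix s assume s: "s \<in> S"
    then have "s - x \<noteq> 0" "s - y \<noteq> 0" using xy by auto
    then show "(x - y) * (g s / (p s * (s - y) * (s - x))) = g s / (p s * (s - x)) - g s / (p s * (s - y))"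
      using pn[OF s] by (simp add: divide_simps) (simp add: algebra_simps)
  qed simp
  finally show ?thesis
    using dd_insert[OF S xy(1), of g] dd_insert[OF S xy(2), of g] by (simp add: p_def)
qed

text \<open>Lagrange interpolation with the weights of \<open>dd\<close>. The basis products are
  monic, so the coefficient in degree \<open>card S - 1\<close> is the divided difference; this
  evaluates \<open>dd\<close> on polynomials.\<close>

definition lagr :: "real set \<Rightarrow> (real \<Rightarrow> real) \<Rightarrow> real poly" where
  "lagr S g = (\<Sum>s\<in>S. smult (g s / (\<Prod>u\<in>S - {s}. s - u)) (\<Prod>u\<in>S - {s}. [:- u, 1:]))"

lemma degree_prod_linear: "finite S \<Longrightarrow> degree (\<Prod>u\<in>S. [:- u, 1 :: 'a :: idom:]) = card S"
  by (subst degree_prod_eq_sum_degree) auto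

lemma coeff_prod_linear: "finite S \<Longrightarrow> coeff (\<Prod>u\<in>S. [:- u, 1 :: 'a :: idom:]) (card S) = 1"
  using monic_prod[of S "\<lambda>u. [:- u, 1 :: 'a:]"] degree_prod_linear[of S] by auto

lemma degree_lagr: "finite S \<Longrightarrow> degree (lagr S g) \<le> card S - 1"
  unfolding lagr_def
  by (rule degree_sum_le, simp, rule order_trans[OF degree_smult_le])
    (subst degree_prod_linear, auto)

lemma coeff_lagr: "finite S \<Longrightarrow> coeff (lagr S g) (card S - 1) = dd S g"
proof -
  assume "finite S"
  then have "coeff (\<Prod>u\<in>S - {s}. [:- u, 1 :: real:]) (card S - 1) = 1" if "s \<in> S" for s
    using coeff_prod_linear[of "S - {s}"] that by simp
  then show ?thesis by (simp add: lagr_def dd_def coeff_sum)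
qed

lemma poly_lagr:
  assumes "finite S" "x \<in> S" shows "poly (lagr S g) x = g x"
proof -
  have "poly (lagr S g) x = (\<Sum>s\<in>S. g s / (\<Prod>u\<in>S - {s}. s - u) * (\<Prod>u\<in>S - {s}. x - u))"
    by (simp add: lagr_def poly_sum poly_prod)
  also have "\<dots> = (\<Sum>s\<in>S. if s = x then g x else 0)"
    using assms by (intro sum.cong) auto
  finally show ?thesis using assms by simp
qed

lemma lagr_poly:
  assumes "finite S" "degree Q < card S" shows "lagr S (poly Q) = Q"
  using assms degree_lagr[OF assms(1), of "poly Q"] poly_lagr[OF assms(1)]
  by (intro poly_eqI_degree[of S]) auto

lemma dd_poly:
  assumes "finite S" "degree Q < card S" shows "dd S (poly Q) = coeff Q (card S - 1)"
  using coeff_lagr[OF assms(1), of "poly Q"] lagr_poly[OF assms] by simp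

section \<open>Rolle's theorem and mean values for divided differences\<close>

lemma ex_strict_mono_enum:
  fixes S :: "'a :: linorder set"
  assumes "finite S"
  obtains h where "bij_betw h {..<card S} S" "strict_mono_on {..<card S} h"
proof
  let ?l = "sorted_list_of_set S"
  show "bij_betw ((!) ?l) {..<card S} S" using assms by (intro bij_betw_nth) auto
  show "strict_mono_on {..<card S} ((!) ?l)"
    using sorted_wrt_nth_less[OF strict_sorted_list_of_set[of S]] assms
    by (intro strict_mono_onI) auto
qed

text \<open>\<open>g\<close> minus its interpolation polynomial has \<open>m + 1\<close> zeros, so
  \<open>g'\<close> meets the derivative of that polynomial at \<open>m\<close> points in between.
  On these points the divided difference of \<open>g'\<close> is the coefficient
  \<open>m * dd S g\<close> in degree \<open>m - 1\<close>.\<close>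

lemma dd_Rolle:
  fixes g :: "real \<Rightarrow> real"
  assumes I: "convex I" and S: "finite S" "S \<subseteq> I" "card S = Suc m" and m: "m > 0"
    and g: "\<And>x. x \<in> I \<Longrightarrow> (g has_real_derivative g' x) (at x)"
  shows "\<exists>S'. finite S' \<and> S' \<subseteq> I \<and> card S' = m \<and> dd S g = dd S' g' / m"
proof -
  obtain h where h: "bij_betw h {..<Suc m} S" "strict_mono_on {..<Suc m} h"
    using ex_strict_mono_enum[OF S(1)] S(3) by metis
  have hS: "h i \<in> S" if "i \<le> m" for i using h(1) that by (auto simp: bij_betw_def)
  define L where "L = lagr S g"
  have "\<exists>z. h i < z \<and> z < h (Suc i) \<and> g' z = poly (pderiv L) z" if i: "i < m" for i
  proof -
    have lt: "h i < h (Suc i)" using h(2) i by (auto simp: strict_mono_on_def)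
    have sub: "{h i..h (Suc i)} \<subseteq> I"
      using I hS[of i] hS[of "Suc i"] S(2) i
      by (metis Suc_leI closed_segment_eq_real_ivl closed_segment_subset less_imp_le lt subsetD)
    let ?r = "\<lambda>x. g x - poly L x"
    have der: "(?r has_real_derivative g' x - poly (pderiv L) x) (at x)" if "x \<in> I" for x
      by (intro derivative_intros g that poly_DERIV)
    have "\<exists>z>h i. z < h (Suc i) \<and> (?r has_real_derivative 0) (at z)"
    proof (rule Rolle[OF lt])
      show "?r (h i) = ?r (h (Suc i))" using poly_lagr[OF S(1)] hS i by (simp add: L_def)
      show "continuous_on {h i..h (Suc i)} ?r"
        using der sub by (intro continuous_at_imp_continuous_on ballI) (meson DERIV_isCont subsetD)
      show "?r differentiable at x" if "h i < x" "x < h (Suc i)" for x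
        using der[of x] sub that real_differentiable_def by (auto simp: subset_iff)
    qed
    then obtain z where z: "h i < z" "z < h (Suc i)" "(?r has_real_derivative 0) (at z)" by blast
    have "z \<in> I" using sub z by auto
    with der z(3) have "g' z - poly (pderiv L) z = 0" using DERIV_unique by blast
    with z show ?thesis by auto
  qed
  then obtain z where z: "\<And>i. i < m \<Longrightarrow> h i < z i \<and> z i < h (Suc i) \<and> g' (z i) = poly (pderiv L) (z i)"
    by metis
  have zlt: "z i < z j" if "i < j" "j < m" for i j
  proof -
    have "h (Suc i) \<le> h j" using h(2) that by (cases "Suc i = j") (auto simp: strict_mono_on_def less_imp_le)
    with z[of i] z[of j] that show ?thesis by auto
  qed
  have inj: "inj_on z {..<m}"
    by (auto simp: inj_on_def) (metis zlt less_irrefl linorder_neqE_nat)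
  let ?S = "z ` {..<m}"
  have fin: "finite ?S" "card ?S = m" using inj by (auto simp: card_image)
  have "?S \<subseteq> I"
  proof
    fix x assume "x \<in> ?S"
    then obtain i where i: "i < m" "x = z i" by auto
    have "{h i..h (Suc i)} \<subseteq> I"
      using I hS[of i] hS[of "Suc i"] S(2) i z[OF i(1)]
      by (metis Suc_leI closed_segment_eq_real_ivl closed_segment_subset less_imp_le less_trans subsetD)
    with z[OF i(1)] i show "x \<in> I" by auto
  qed
  moreover have "dd ?S g' = dd ?S (poly (pderiv L))" using z by (intro dd_cong) auto
  moreover have "\<dots> = coeff (pderiv L) (m - 1)"
    using degree_lagr[OF S(1), of g] S(3) fin m by (subst dd_poly) (auto simp: degree_pderiv L_def)
  moreover have "\<dots> = real m * dd S g"
    using coeff_lagr[OF S(1), of g] S(3) m by (simp add: coeff_pderiv L_def)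
  ultimately show ?thesis using fin m by (intro exI[of _ ?S]) auto
qed

text \<open>\<open>G\<close> lists the successive derivatives explicitly, so that the induction can
  drop its first entry.\<close>

lemma dd_mean_value:
  assumes I: "convex I" and "finite S" "S \<subseteq> I" "card S = Suc m"
    and "\<And>j x. j < m \<Longrightarrow> x \<in> I \<Longrightarrow> (G j has_real_derivative G (Suc j) x) (at x)"
  shows "\<exists>\<xi>\<in>I. dd S (G 0) = G m \<xi> / fact m"
  using assms(2-)
proof (induction m arbitrary: S G)
  case 0
  then obtain x where "S = {x}" using card_1_singletonE by (metis One_nat_def)
  with 0 show ?case by auto
next
  case (Suc m)
  obtain S' where S': "finite S'" "S' \<subseteq> I" "card S' = Suc m" "dd S (G 0) = dd S' (G 1) / Suc m"
    using dd_Rolle[OF I Suc.prems(1-3), of "G 0" "G 1"] Suc.prems(4)[of 0] by auto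
  have "\<exists>\<xi>\<in>I. dd S' (G (Suc 0)) = G (Suc m) \<xi> / fact m"
    by (rule Suc.IH[OF S'(1-3), of "\<lambda>j. G (Suc j)"]) (use Suc.prems(4) in auto)
  with S'(4) show ?case by (auto simp: mult.commute)
qed

lemma kconv_Suc:
  assumes "convex I" "kconv m I g'" "\<And>x. x \<in> I \<Longrightarrow> (g has_real_derivative g' x) (at x)"
  shows "kconv (Suc m) I g"
  unfolding kconv_def
proof safe
  fix S assume S: "finite S" "S \<subseteq> I" "card S = Suc (Suc m)"
  obtain S' where "finite S'" "S' \<subseteq> I" "card S' = Suc m" "dd S g = dd S' g' / Suc m"
    using dd_Rolle[OF assms(1) S _ assms(3)] by auto
  with assms(2) show "0 \<le> dd S g" unfolding kconv_def by simp
qed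

lemma dd3:
  assumes "0 < t" "t < 1" "x \<noteq> z" "y = (1 - t) * x + t * z"
  shows "dd {x, y, z} g = ((1 - t) * g x + t * g z - g y) / (t * (1 - t) * (z - x)\<^sup>2)"
proof -
  have d: "y - x = t * (z - x)" "z - y = (1 - t) * (z - x)" using assms by (auto simp: algebra_simps)
  then have ne: "y \<noteq> x" "y \<noteq> z" using assms by auto
  have "{x, y, z} - {x} = {y, z}" "{x, y, z} - {y} = {x, z}" "{x, y, z} - {z} = {x, y}"
    using ne assms by auto
  then have "dd {x, y, z} g = g x / ((x - y) * (x - z)) + g y / ((y - x) * (y - z)) + g z / ((z - x) * (z - y))"
    using ne assms by (simp add: dd_def)
  also have "x - y = - (t * (z - x))" using d by linarith
  also have "- (t * (z - x)) * (x - z) = t * (z - x)\<^sup>2" by (simp add: power2_eq_square algebra_simps)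
  also have "(y - x) * (y - z) = - (t * (1 - t) * (z - x)\<^sup>2)"
    using d by (metis minus_diff_eq mult.assoc mult.left_commute mult_minus_right power2_eq_square)
  also have "(z - x) * (z - y) = (1 - t) * (z - x)\<^sup>2" unfolding d by (simp add: power2_eq_square)
  also have "g x / (t * D) + g y / - (t * (1 - t) * D) + g z / ((1 - t) * D)
      = ((1 - t) * g x + t * g z - g y) / (t * (1 - t) * D)" if "D \<noteq> 0" for D
    using that assms(1,2) by (simp add: divide_simps)
  then have "g x / (t * (z - x)\<^sup>2) + g y / - (t * (1 - t) * (z - x)\<^sup>2) + g z / ((1 - t) * (z - x)\<^sup>2)
      = ((1 - t) * g x + t * g z - g y) / (t * (1 - t) * (z - x)\<^sup>2)"
    using assms(3) by simp
  finally show ?thesis .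
qed

lemma kconv_2_iff_convex_on:
  assumes I: "convex I"
  shows "kconv 2 I g \<longleftrightarrow> convex_on I g"
proof
  assume k: "kconv 2 I g"
  show "convex_on I g"
  proof (rule convex_onI[OF _ I])
    fix t x z :: real assume t: "0 < t" "t < 1" and xz: "x \<in> I" "z \<in> I"
    let ?y = "(1 - t) * x + t * z"
    show "g ((1 - t) *\<^sub>R x + t *\<^sub>R z) \<le> (1 - t) * g x + t * g z"
    proof (cases "x = z")
      case True then show ?thesis by (simp add: algebra_simps)
    next
      case False
      have "?y \<in> I" using I xz t by (auto simp: convex_alt)
      moreover have "?y - x = t * (z - x)" "z - ?y = (1 - t) * (z - x)" by (auto simp: algebra_simps)
      then have "?y \<noteq> x" "?y \<noteq> z" using False t by auto
      ultimately have "0 \<le> dd {x, ?y, z} g" using k xz False unfolding kconv_def by auto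
      moreover have "0 < t * (1 - t) * (z - x)\<^sup>2" using t False by simp
      ultimately have "0 \<le> (1 - t) * g x + t * g z - g ?y"
        unfolding dd3[OF t False refl] by (simp only: zero_le_divide_iff) linarith
      then show ?thesis by simp
    qed
  qed
next
  assume g: "convex_on I g"
  show "kconv 2 I g" unfolding kconv_def
  proof safe
    fix S assume S: "finite S" "S \<subseteq> I" "card S = Suc 2"
    have "card S = 3" using S(3) by simp
    then obtain h where h: "bij_betw h {..<3::nat} S" "strict_mono_on {..<3} h"
      using ex_strict_mono_enum[OF S(1)] by metis
    have "{..<3::nat} = {0, 1, 2}" by auto
    then have Seq: "S = {h 0, h 1, h 2}" and lt: "h 0 < h 1" "h 1 < h 2"
      using h by (auto simp: bij_betw_def strict_mono_on_def)
    define t where "t = (h 1 - h 0) / (h 2 - h 0)"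
    have t: "0 < t" "t < 1" using lt by (auto simp: t_def)
    have "t * (h 2 - h 0) = h 1 - h 0" using lt by (simp add: t_def)
    then have y: "h 1 = (1 - t) * h 0 + t * h 2" by (simp add: algebra_simps)
    have "g (h 1) \<le> (1 - t) * g (h 0) + t * g (h 2)"
      using convex_onD[OF g, of t "h 0" "h 2"] t S(2) Seq y by auto
    then show "0 \<le> dd S g"
      unfolding Seq using lt dd3[OF t _ y, of g] t by (auto intro!: divide_nonneg_nonneg mult_nonneg_nonneg)
  qed
qed

text \<open>Nodes move one at a time from \<open>x\<close> to \<open>\<phi> x\<close>.
  \<open>Z\<close> collects the nodes that no longer move, and \<open>l\<close> bounds the effect of
  a single move from below: \<open>l = 0\<close> yields monotonicity, a negative \<open>l\<close> an
  estimate of the difference.\<close>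

lemma dd_exchange_sum:
  assumes "finite X" "inj_on \<phi> X" "X \<inter> \<phi> ` X = {}" "finite Z" "Z \<inter> X = {}" "Z \<inter> \<phi> ` X = {}"
    and "\<And>x W. x \<in> X \<Longrightarrow> finite W \<Longrightarrow> W \<subseteq> X \<union> \<phi> ` X \<union> Z \<Longrightarrow> Suc (card W) = card X + card Z \<Longrightarrow>
      x \<notin> W \<Longrightarrow> \<phi> x \<notin> W \<Longrightarrow> l \<le> dd (insert (\<phi> x) W) g - dd (insert x W) g"
  shows "real (card X) * l \<le> dd (\<phi> ` X \<union> Z) g - dd (X \<union> Z) g"
  using assms
proof (induction X arbitrary: Z rule: finite_induct)
  case empty then show ?case by simp
next
  case (insert x X)
  have fx: "\<phi> x \<notin> X" "\<phi> x \<notin> Z" "x \<notin> Z" "\<phi> x \<noteq> x" using insert.prems by auto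
  have fX: "\<phi> x \<notin> \<phi> ` X" using insert.prems(1) insert.hyps by (auto simp: inj_on_def)
  have "real (card X) * l \<le> dd (\<phi> ` X \<union> insert (\<phi> x) Z) g - dd (X \<union> insert (\<phi> x) Z) g"
  proof (rule insert.IH)
    show "inj_on \<phi> X" using insert.prems(1) by (auto simp: inj_on_def)
    show "X \<inter> \<phi> ` X = {}" "insert (\<phi> x) Z \<inter> X = {}" "insert (\<phi> x) Z \<inter> \<phi> ` X = {}"
      using insert.prems(2,4,5) fX fx by auto
    show "finite (insert (\<phi> x) Z)" using insert.prems by simp
    fix y W assume "y \<in> X" "finite W" "W \<subseteq> X \<union> \<phi> ` X \<union> insert (\<phi> x) Z"
      "Suc (card W) = card X + card (insert (\<phi> x) Z)" "y \<notin> W" "\<phi> y \<notin> W"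
    then show "l \<le> dd (insert (\<phi> y) W) g - dd (insert y W) g"
      using insert.prems(3) insert.hyps fx by (intro insert.prems(6)) auto
  qed
  moreover have "l \<le> dd (insert (\<phi> x) (X \<union> Z)) g - dd (insert x (X \<union> Z)) g"
    using insert.hyps insert.prems fx
    by (intro insert.prems(6)) (auto simp: card_Un_disjoint Int_commute)
  moreover have "X \<union> insert (\<phi> x) Z = insert (\<phi> x) (X \<union> Z)" "\<phi> ` insert x X \<union> Z = \<phi> ` X \<union> insert (\<phi> x) Z"
    by auto
  ultimately show ?case using insert.hyps by (simp add: algebra_simps)
qed

lemma dd_exchange_sum':
  assumes "finite X" "finite Y" "card X = card Y" "X \<inter> Y = {}"
    and "\<And>x y W. x \<in> X \<Longrightarrow> y \<in> Y \<Longrightarrow> finite W \<Longrightarrow> W \<subseteq> X \<union> Y \<Longrightarrow> Suc (card W) = card X \<Longrightarrow>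
      x \<notin> W \<Longrightarrow> y \<notin> W \<Longrightarrow> l \<le> dd (insert y W) g - dd (insert x W) g"
  shows "real (card X) * l \<le> dd Y g - dd X g"
proof -
  obtain \<phi> where "bij_betw \<phi> X Y" using finite_same_card_bij[OF assms(1-3)] by blast
  then have inj: "inj_on \<phi> X" and img: "\<phi> ` X = Y" by (auto simp: bij_betw_def)
  have "real (card X) * l \<le> dd (\<phi> ` X \<union> {}) g - dd (X \<union> {}) g"
    by (rule dd_exchange_sum) (use assms inj img in auto)
  then show ?thesis by (simp add: img)
qed

section \<open>Regularity of functions that are convex of higher order\<close>

lemma finite_subset_left:
  assumes "open I" "{\<alpha>..\<beta>} \<subseteq> I" "\<alpha> \<le> (\<beta>::real)"
  obtains \<alpha>' A where "\<alpha>' < \<alpha>" "{\<alpha>'..\<beta>} \<subseteq> I" "finite A" "card A = k" "A \<subseteq> {\<alpha>'<..<\<alpha>}"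
proof -
  obtain e where e: "e > 0" "cball \<alpha> e \<subseteq> I" using assms open_contains_cball by (metis atLeastAtMost_iff order_refl subsetD)
  define \<alpha>' where "\<alpha>' = \<alpha> - e"
  have sub: "{\<alpha>'..\<beta>} \<subseteq> I"
  proof
    fix x assume "x \<in> {\<alpha>'..\<beta>}"
    then show "x \<in> I" using e assms(2) by (cases "x \<le> \<alpha>") (auto simp: \<alpha>'_def cball_eq_atLeastAtMost subset_iff)
  qed
  have "infinite {\<alpha>'<..<\<alpha>}" using e by (simp add: \<alpha>'_def)
  then obtain A where "finite A" "card A = k" "A \<subseteq> {\<alpha>'<..<\<alpha>}" using infinite_arbitrarily_large by blast
  with sub e show ?thesis by (intro that[of \<alpha>' A]) (auto simp: \<alpha>'_def)
qed

lemma finite_subset_right: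
  assumes "open I" "{\<alpha>..\<beta>} \<subseteq> I" "\<alpha> \<le> (\<beta>::real)"
  obtains B where "finite B" "card B = k" "B \<subseteq> {\<beta><..}" "B \<subseteq> I"
proof -
  obtain e where e: "e > 0" "cball \<beta> e \<subseteq> I" using assms open_contains_cball by (metis atLeastAtMost_iff order_refl subsetD)
  have "infinite {\<beta><..<\<beta>+e}" using e by simp
  then obtain A where A: "finite A" "card A = k" "A \<subseteq> {\<beta><..<\<beta>+e}" using infinite_arbitrarily_large by blast
  then have "A \<subseteq> {\<beta><..}" "A \<subseteq> I" using e by (auto simp: cball_eq_atLeastAtMost subset_iff)
  with A that show ?thesis by blast
qed

text \<open>Exchanging \<open>x\<close> for a larger \<open>y\<close> adds \<open>y - x\<close>
  times a divided difference of the next order, which is nonnegative.\<close>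

lemma kconv_dd_mono:
  assumes "kconv m I g" "finite X" "finite Y" "card X = m" "card Y = m" "X \<subseteq> I" "Y \<subseteq> I"
    and "\<And>x y. x \<in> X \<Longrightarrow> y \<in> Y \<Longrightarrow> x < y"
  shows "dd X g \<le> dd Y g"
proof -
  have "real (card X) * 0 \<le> dd Y g - dd X g"
  proof (rule dd_exchange_sum')
    show "X \<inter> Y = {}" using assms(8) by fastforce
    fix x y W assume *: "x \<in> X" "y \<in> Y" "finite W" "W \<subseteq> X \<union> Y" "Suc (card W) = card X" "x \<notin> W" "y \<notin> W"
    have lt: "x < y" using * assms(8) by simp
    have "0 \<le> dd (insert y (insert x W)) g"
      using assms(1) unfolding kconv_def
    proof (rule allE[of _ "insert y (insert x W)"], elim mp)
      show "finite (insert y (insert x W)) \<and> insert y (insert x W) \<subseteq> I \<and> card (insert y (insert x W)) = Suc m"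
        using *(1-7) assms(2-7) less_imp_neq[OF lt] by auto
    qed
    then have "0 \<le> (y - x) * dd (insert y (insert x W)) g" using lt by simp
    then show "0 \<le> dd (insert y W) g - dd (insert x W) g"
      using dd_exchange[of W y x g] * lt by simp
  qed (use assms in auto)
  then show ?thesis by simp
qed

text \<open>Downward induction on the order. At the top, monotonicity places the value over
  \<open>S\<close> between those over fixed sets to the left and to the right of the interval.
  Below, the bound of the next order limits the effect of every exchange, and \<open>S\<close> is
  compared with a fixed set \<open>A\<close>. Taking \<open>A\<close> outside the interval makes it
  disjoint from \<open>S\<close>; the induction hypothesis is then used on a larger
  interval.\<close>

lemma kconv_dd_bounded:
  assumes I: "open I" and g: "kconv m I g" and k: "k < m" "{\<alpha>..\<beta>} \<subseteq> I" "\<alpha> \<le> \<beta>"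
  shows "\<exists>M. \<forall>S. finite S \<and> S \<subseteq> {\<alpha>..\<beta>} \<and> card S = Suc k \<longrightarrow> \<bar>dd S g\<bar> \<le> M"
  using k
proof (induction "m - Suc k" arbitrary: k \<alpha> \<beta>)
  case 0
  then have mk: "m = Suc k" by simp
  obtain \<alpha>' A where A: "\<alpha>' < \<alpha>" "{\<alpha>'..\<beta>} \<subseteq> I" "finite A" "card A = m" "A \<subseteq> {\<alpha>'<..<\<alpha>}"
    using finite_subset_left[OF I 0(3,4)] by blast
  obtain B where B: "finite B" "card B = m" "B \<subseteq> {\<beta><..}" "B \<subseteq> I"
    using finite_subset_right[OF I 0(3,4)] by blast
  have AI: "A \<subseteq> I" using A 0 by fastforce
  have "\<bar>dd S g\<bar> \<le> max \<bar>dd A g\<bar> \<bar>dd B g\<bar>" if S: "finite S" "S \<subseteq> {\<alpha>..\<beta>}" "card S = Suc k" for S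
  proof -
    have SI: "S \<subseteq> I" using S 0 by auto
    have "dd A g \<le> dd S g" using S A SI AI mk by (intro kconv_dd_mono[OF g]) fastforce+
    moreover have "dd S g \<le> dd B g" using S B SI mk by (intro kconv_dd_mono[OF g]) fastforce+
    ultimately show ?thesis by linarith
  qed
  then show ?case by blast
next
  case (Suc d)
  obtain \<alpha>' A where A: "\<alpha>' < \<alpha>" "{\<alpha>'..\<beta>} \<subseteq> I" "finite A" "card A = Suc k" "A \<subseteq> {\<alpha>'<..<\<alpha>}"
    using finite_subset_left[OF I Suc(4,5)] by blast
  have "\<exists>M. \<forall>S. finite S \<and> S \<subseteq> {\<alpha>'..\<beta>} \<and> card S = Suc (Suc k) \<longrightarrow> \<bar>dd S g\<bar> \<le> M"
    using Suc A by (intro Suc(1)) auto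
  then obtain M where M: "\<And>S. finite S \<Longrightarrow> S \<subseteq> {\<alpha>'..\<beta>} \<Longrightarrow> card S = Suc (Suc k) \<Longrightarrow> \<bar>dd S g\<bar> \<le> M"
    by blast
  \<comment> \<open>The worst loss in one exchange: the distance of the two nodes, at most
    \<open>\<beta> - \<alpha>'\<close>, times the bound of the next order.\<close>
  define l where "l = - (\<bar>M\<bar> * (\<beta> - \<alpha>'))"
  have ex: "l \<le> dd (insert y W) g - dd (insert x W) g"
    if "x \<in> {\<alpha>'..\<beta>}" "y \<in> {\<alpha>'..\<beta>}" "finite W" "W \<subseteq> {\<alpha>'..\<beta>}" "card W = k" "x \<notin> W" "y \<notin> W" "x \<noteq> y" for x y W
  proof -
    have "\<bar>dd (insert y (insert x W)) g\<bar> \<le> M" using that by (intro M) auto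
    then have "\<bar>y - x\<bar> * \<bar>dd (insert y (insert x W)) g\<bar> \<le> (\<beta> - \<alpha>') * \<bar>M\<bar>"
      using that A by (intro mult_mono) auto
    then have "\<bar>dd (insert y W) g - dd (insert x W) g\<bar> \<le> (\<beta> - \<alpha>') * \<bar>M\<bar>"
      using dd_exchange[of W y x g] that by (metis abs_mult)
    then show ?thesis by (simp add: l_def algebra_simps)
  qed
  have "\<bar>dd S g\<bar> \<le> \<bar>dd A g\<bar> - real (Suc k) * l" if S: "finite S" "S \<subseteq> {\<alpha>..\<beta>}" "card S = Suc k" for S
  proof -
    have dis: "A \<inter> S = {}" using A S by fastforce
    have subs: "A \<subseteq> {\<alpha>'..\<beta>}" "S \<subseteq> {\<alpha>'..\<beta>}" using A S Suc by fastforce+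
    have "real (card A) * l \<le> dd S g - dd A g"
      using A S dis subs by (intro dd_exchange_sum' ex) (auto; blast)+
    moreover have "real (card S) * l \<le> dd A g - dd S g"
      using A S dis subs by (intro dd_exchange_sum' ex) (auto; blast)+
    ultimately show ?thesis using A S by simp
  qed
  then show ?case by blast
qed

lemma dd_pair:
  assumes "x \<noteq> y" shows "dd {x, y} g = (g y - g x) / (y - x)"
proof -
  have "(y - x) * dd {x, y} g = g y - g x"
    using dd_exchange[of "{}" y x g] assms by (simp add: insert_commute)
  with assms show ?thesis by (simp add: eq_divide_eq mult.commute)
qed

text \<open>Bounded divided differences over three nodes make the difference quotient at
  \<open>x\<close> Lipschitz off \<open>x\<close>, so it has a limit there. Their order 2 has to lie
  below \<open>m\<close>, hence the 3.\<close>

lemma kconv_differentiable: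
  assumes I: "open I" and g: "kconv m I g" and m: "3 \<le> m" and x: "x \<in> I"
  shows "g differentiable (at x)"
proof -
  obtain e where e: "e > 0" "cball x e \<subseteq> I" using I x open_contains_cball by blast
  obtain M where M: "\<And>S. finite S \<Longrightarrow> S \<subseteq> {x-e..x+e} \<Longrightarrow> card S = Suc 2 \<Longrightarrow> \<bar>dd S g\<bar> \<le> M"
    using kconv_dd_bounded[OF I g, of 2 "x-e" "x+e"] m e by (auto simp: cball_eq_atLeastAtMost)
  define q where "q = (\<lambda>y. (g y - g x) / (y - x))"
  have L: "\<bar>q y - q z\<bar> \<le> \<bar>M\<bar> * \<bar>y - z\<bar>" if "y \<in> {x-e..x+e}" "z \<in> {x-e..x+e}" "y \<noteq> x" "z \<noteq> x" for y z
  proof (cases "y = z")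
    case False
    have "\<bar>dd {y, z, x} g\<bar> \<le> M" using that False e by (intro M) auto
    then have "\<bar>y - z\<bar> * \<bar>dd {y, z, x} g\<bar> \<le> \<bar>y - z\<bar> * \<bar>M\<bar>" by (intro mult_left_mono) auto
    moreover have "(y - z) * dd {y, z, x} g = q y - q z"
      using dd_exchange[of "{x}" y z g] that False dd_pair[of x y g] dd_pair[of x z g]
      by (auto simp: q_def insert_commute)
    ultimately show ?thesis by (metis abs_mult mult.commute)
  qed simp
  \<comment> \<open>Any sequence tending to \<open>x\<close> would serve: it only produces the
    candidate \<open>D\<close>, and the Lipschitz estimate carries the limit over to all points near
    \<open>x\<close>.\<close>
  define y where "y = (\<lambda>n::nat. x + e / real (Suc n))"
  have yI: "y n \<in> {x-e..x+e}" "y n \<noteq> x" for n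
    using e by (auto simp: y_def field_simps intro: add_nonneg_nonneg mult_nonneg_nonneg)
  have yx: "y \<longlonglongrightarrow> x"
    unfolding y_def using tendsto_add[OF tendsto_const[of x] tendsto_mult[OF tendsto_const[of e] LIMSEQ_inverse_real_of_nat]]
    by (simp add: divide_inverse)
  have "Cauchy (\<lambda>n. q (y n))"
  proof (rule metric_CauchyI)
    fix \<epsilon> :: real assume "\<epsilon> > 0"
    then obtain N where N: "\<And>m n. m \<ge> N \<Longrightarrow> n \<ge> N \<Longrightarrow> dist (y m) (y n) < \<epsilon> / (\<bar>M\<bar> + 1)"
      using LIMSEQ_imp_Cauchy[OF yx] metric_CauchyD[of y "\<epsilon> / (\<bar>M\<bar> + 1)"] by (auto simp: divide_pos_pos)
    have "dist (q (y m)) (q (y n)) < \<epsilon>" if "m \<ge> N" "n \<ge> N" for m n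
    proof -
      have "dist (q (y m)) (q (y n)) \<le> (\<bar>M\<bar> + 1) * \<bar>y m - y n\<bar>"
        using L[OF yI(1) yI(1) yI(2) yI(2), of m n] by (simp add: dist_real_def distrib_right)
      also have "\<dots> < \<epsilon>" using N[OF that] by (simp add: dist_real_def field_simps)
      finally show ?thesis .
    qed
    then show "\<exists>N. \<forall>m\<ge>N. \<forall>n\<ge>N. dist (q (y m)) (q (y n)) < \<epsilon>" by blast
  qed
  then obtain D where D: "(\<lambda>n. q (y n)) \<longlonglongrightarrow> D" using Cauchy_convergent convergent_def by blast
  have qD: "\<bar>q z - D\<bar> \<le> \<bar>M\<bar> * \<bar>z - x\<bar>" if "z \<in> {x-e..x+e}" "z \<noteq> x" for z
  proof (rule tendsto_le[OF sequentially_bot])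
    show "(\<lambda>n. \<bar>M\<bar> * \<bar>z - y n\<bar>) \<longlonglongrightarrow> \<bar>M\<bar> * \<bar>z - x\<bar>" by (intro tendsto_intros yx)
    show "(\<lambda>n. \<bar>q z - q (y n)\<bar>) \<longlonglongrightarrow> \<bar>q z - D\<bar>" by (intro tendsto_intros D)
  qed (use L that yI in auto)
  have "(q \<longlongrightarrow> D) (at x)"
  proof (rule LIM_zero_cancel, rule Lim_null_comparison)
    show "((\<lambda>z. \<bar>M\<bar> * \<bar>z - x\<bar>) \<longlongrightarrow> 0) (at x)" by (auto intro!: tendsto_eq_intros)
    have "\<forall>\<^sub>F z in at x. z \<in> {x-e..x+e} \<and> z \<noteq> x"
      unfolding eventually_at using e by (intro exI[of _ e]) (auto simp: dist_real_def)
    then show "\<forall>\<^sub>F z in at x. norm (q z - D) \<le> \<bar>M\<bar> * \<bar>z - x\<bar>"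
      by eventually_elim (use qD in auto)
  qed
  then show ?thesis unfolding real_differentiable_def has_field_derivative_iff q_def by blast
qed

text \<open>Over \<open>X\<close>, the divided difference of \<open>(g (s + e) - g s) / e\<close> is
  \<open>1 / e\<close> times the difference of those of \<open>g\<close> over the translate of
  \<open>X\<close> by \<open>e\<close> and over \<open>X\<close>. For small \<open>e\<close> the
  translate is disjoint from \<open>X\<close> and inside \<open>I\<close>, and moving the nodes to
  the right one by one cannot lower the value.\<close>

lemma kconv_deriv:
  assumes I: "open I" and g: "kconv (Suc m) I g" and der: "\<And>x. x \<in> I \<Longrightarrow> (g has_real_derivative g' x) (at x)"
  shows "kconv m I g'"
  unfolding kconv_def
proof safe
  fix X assume X: "finite X" "X \<subseteq> I" "card X = Suc m"
  have "((\<lambda>e. (g (s + e) - g s) / e) \<longlongrightarrow> g' s) (at_right 0)" if "s \<in> X" for s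
  proof -
    have "((\<lambda>e. (g (s + e) - g s) / e) \<longlongrightarrow> g' s) (at 0)"
      using der[of s] that X(2) unfolding DERIV_def by blast
    then show ?thesis by (rule tendsto_within_subset) simp
  qed
  then have lim: "((\<lambda>e. dd X (\<lambda>s. (g (s + e) - g s) / e)) \<longlongrightarrow> dd X g') (at_right 0)"
    unfolding dd_def using X(1) by (intro tendsto_sum tendsto_divide tendsto_const) auto
  have evI: "\<forall>\<^sub>F e in at_right 0. \<forall>x\<in>X. x + e \<in> I \<and> x + e \<notin> X"
  proof (subst eventually_ball_finite_distrib[OF X(1)], intro ballI)
    fix x assume x: "x \<in> X"
    have "open (I - (X - {x}))" using I X by (intro open_Diff finite_imp_closed) auto
    moreover have "((\<lambda>e. x + e) \<longlongrightarrow> x) (at_right 0)" by (auto intro!: tendsto_eq_intros)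
    ultimately have "\<forall>\<^sub>F e in at_right 0. x + e \<in> I - (X - {x})"
      using x X by (intro topological_tendstoD) auto
    moreover have "\<forall>\<^sub>F e in at_right (0::real). 0 < e" by (rule eventually_at_right_less)
    ultimately show "\<forall>\<^sub>F e in at_right 0. x + e \<in> I \<and> x + e \<notin> X"
      by eventually_elim auto
  qed
  have ev: "\<forall>\<^sub>F e in at_right 0. 0 \<le> dd X (\<lambda>s. (g (s + e) - g s) / e)"
    using evI eventually_at_right_less[of 0]
  proof eventually_elim
    case (elim e)
    let ?\<phi> = "\<lambda>s. s + e"
    have inj: "inj_on ?\<phi> X" by (auto simp: inj_on_def)
    have "real (card X) * 0 \<le> dd (?\<phi> ` X \<union> {}) g - dd (X \<union> {}) g"
    proof (rule dd_exchange_sum)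
      fix x W assume *: "x \<in> X" "finite W" "W \<subseteq> X \<union> ?\<phi> ` X \<union> {}" "Suc (card W) = card X + card ({}::real set)"
        "x \<notin> W" "?\<phi> x \<notin> W"
      have "W \<subseteq> I" "x \<in> I" "x + e \<in> I" using *(1,3) X(2) elim(1) by auto
      moreover have "card (insert (x + e) (insert x W)) = Suc (Suc m)"
        using *(2,4,5,6) X(3) elim(2) by simp
      ultimately have "0 \<le> dd (insert (x + e) (insert x W)) g"
        using *(2) by (intro g[unfolded kconv_def, rule_format]) simp
      then have "0 \<le> (x + e - x) * dd (insert (x + e) (insert x W)) g" using elim by simp
      then show "0 \<le> dd (insert (?\<phi> x) W) g - dd (insert x W) g"
        using dd_exchange[of W "x + e" x g] * elim by simp
    qed (use X elim inj in auto)
    moreover have "dd (?\<phi> ` X) g = dd X (\<lambda>s. g (s + e))"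
    proof -
      have "(\<Prod>u\<in>?\<phi> ` X - {s + e}. s + e - u) = (\<Prod>u\<in>X - {s}. s - u)" for s
      proof -
        have "?\<phi> ` X - {s + e} = ?\<phi> ` (X - {s})" by auto
        then show ?thesis by (simp add: prod.reindex)
      qed
      then show ?thesis unfolding dd_def by (simp add: sum.reindex)
    qed
    moreover have "dd X (\<lambda>s. (g (s + e) - g s) / e) = (dd X (\<lambda>s. g (s + e)) - dd X g) / e"
      by (simp add: dd_def sum_subtractf[symmetric] sum_divide_distrib diff_divide_distrib mult.commute)
    ultimately show ?case using elim by simp
  qed
  show "0 \<le> dd X g'" by (rule tendsto_lowerbound[OF lim ev]) simp
qed

lemma higher_deriv_Suc: "(deriv ^^ Suc k) g = (deriv ^^ k) (deriv g)"
  by (simp add: funpow_swap1)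

lemma C_k_on_Suc:
  "C_k_on (Suc k) g I \<longleftrightarrow> (\<forall>x\<in>I. g differentiable (at x)) \<and> C_k_on k (deriv g) I"
proof -
  have "deriv_dom I g (Suc k) = I \<longleftrightarrow> (\<forall>x\<in>I. \<forall>j<Suc k. (deriv ^^ j) g differentiable (at x))"
    by (auto simp: deriv_dom_def)
  also have "\<dots> \<longleftrightarrow> (\<forall>x\<in>I. g differentiable (at x)) \<and> (\<forall>x\<in>I. \<forall>j<k. (deriv ^^ j) (deriv g) differentiable (at x))"
    unfolding All_less_Suc2 by (auto simp del: funpow.simps simp: higher_deriv_Suc)
  also have "(\<forall>x\<in>I. \<forall>j<k. (deriv ^^ j) (deriv g) differentiable (at x)) \<longleftrightarrow> deriv_dom I (deriv g) k = I"
    by (auto simp: deriv_dom_def)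
  finally show ?thesis unfolding C_k_on_def by (auto simp del: funpow.simps simp: higher_deriv_Suc)
qed

lemma C_k_onD: "C_k_on k g I \<Longrightarrow> j < k \<Longrightarrow> x \<in> I \<Longrightarrow> ((deriv ^^ j) g has_real_derivative (deriv ^^ Suc j) g x) (at x)"
  unfolding C_k_on_def deriv_dom_def by (auto simp: DERIV_deriv_iff_real_differentiable)

text \<open>Differentiation lowers the order by one, and is possible while the order is at least 3;
  what remains at order 2 is convexity.\<close>

lemma kconv_regularity:
  assumes "open I" "convex I" "kconv (Suc (Suc k)) I g"
  shows "C_k_on k g I \<and> convex_on I ((deriv ^^ k) g)"
  using assms(3)
proof (induction k arbitrary: g)
  case 0
  then have "convex_on I g" using kconv_2_iff_convex_on[OF assms(2)] by (simp add: numeral_2_eq_2)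
  then show ?case using convex_on_continuous[OF assms(1)] by (auto simp: C_k_on_def deriv_dom_def)
next
  case (Suc k)
  have d: "g differentiable (at x)" if "x \<in> I" for x
    using kconv_differentiable[OF assms(1) Suc.prems _ that] by simp
  then have "kconv (Suc (Suc k)) I (deriv g)"
    by (intro kconv_deriv[OF assms(1) Suc.prems]) (simp add: DERIV_deriv_iff_real_differentiable)
  from Suc.IH[OF this] d show ?case by (simp add: C_k_on_Suc higher_deriv_Suc del: funpow.simps)
qed

lemma kconv_of_convex_deriv:
  assumes "convex I" "C_k_on k g I" "convex_on I ((deriv ^^ k) g)"
  shows "kconv (Suc (Suc k)) I g"
  using assms(2,3)
proof (induction k arbitrary: g)
  case 0
  then show ?case using kconv_2_iff_convex_on[OF assms(1)] by (simp add: numeral_2_eq_2)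
next
  case (Suc k)
  then have "kconv (Suc (Suc k)) I (deriv g)" by (simp add: C_k_on_Suc higher_deriv_Suc del: funpow.simps)
  then show ?case using Suc.prems(1)
    by (intro kconv_Suc[OF assms(1) \<open>kconv _ I (deriv g)\<close>])
      (auto simp: C_k_on_Suc DERIV_deriv_iff_real_differentiable)
qed

section \<open>Divided differences with repeated nodes\<close>

text \<open>The Leibniz formula for the \<open>m\<close>-th derivative of \<open>a 0 * P\<close>, with \<open>a j\<close> in the role of the \<open>j\<close>-th derivative
  of \<open>a 0\<close>.\<close>

definition leibniz :: "(nat \<Rightarrow> real \<Rightarrow> real) \<Rightarrow> real poly \<Rightarrow> nat \<Rightarrow> real \<Rightarrow> real" where
  "leibniz a P m s = (\<Sum>k\<le>m. real (m choose k) * (a (m - k) s * poly ((pderiv ^^ k) P) s))"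

text \<open>Pascal's rule. Derivatives are required at the one point \<open>s\<close> and within an
  arbitrary \<open>T\<close> only, so that the list \<open>a\<close> may end in a one-sided
  derivative, or in a constant that stands for the value of a derivative at
  \<open>s\<close>.\<close>

lemma leibniz_derivative:
  assumes "\<And>j. j \<le> m \<Longrightarrow> (a j has_real_derivative a (Suc j) s) (at s within T)"
  shows "(leibniz a P m has_real_derivative leibniz a P (Suc m) s) (at s within T)"
proof -
  define F where "F = (\<lambda>i k. a i s * poly ((pderiv ^^ k) P) s)"
  have P: "(poly ((pderiv ^^ k) P) has_real_derivative poly ((pderiv ^^ Suc k) P) s) (at s within T)" for k
    using poly_DERIV[of "(pderiv ^^ k) P" s] by (simp add: has_field_derivative_at_within)
  have "(leibniz a P m has_real_derivative
      (\<Sum>k\<le>m. real (m choose k) * (a (Suc (m - k)) s * poly ((pderiv ^^ k) P) s + poly ((pderiv ^^ Suc k) P) s * a (m - k) s))) (at s within T)"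
    unfolding leibniz_def by (intro DERIV_sum DERIV_cmult DERIV_mult assms P) simp
  also have "(\<Sum>k\<le>m. real (m choose k) * (a (Suc (m - k)) s * poly ((pderiv ^^ k) P) s + poly ((pderiv ^^ Suc k) P) s * a (m - k) s))
      = (\<Sum>k\<le>m. real (m choose k) * F (Suc m - k) k) + (\<Sum>k\<le>m. real (m choose k) * F (m - k) (Suc k))"
    unfolding sum.distrib[symmetric] by (intro sum.cong) (auto simp: F_def Suc_diff_le algebra_simps)
  also have "(\<Sum>k\<le>m. real (m choose k) * F (Suc m - k) k) = (\<Sum>k\<le>Suc m. real (m choose k) * F (Suc m - k) k)"
    by simp
  also have "\<dots> = F (Suc m) 0 + (\<Sum>k\<le>m. real (m choose Suc k) * F (m - k) (Suc k))"
    by (subst sum.atMost_Suc_shift) simp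
  also have "\<dots> + (\<Sum>k\<le>m. real (m choose k) * F (m - k) (Suc k))
      = F (Suc m) 0 + (\<Sum>k\<le>m. real (Suc m choose Suc k) * F (m - k) (Suc k))"
    by (simp add: sum.distrib distrib_right)
  also have "\<dots> = (\<Sum>k\<le>Suc m. real (Suc m choose k) * F (Suc m - k) k)"
    by (simp add: sum.atMost_Suc_shift del: sum.atMost_Suc)
  also have "\<dots> = leibniz a P (Suc m) s" by (simp only: leibniz_def F_def)
  finally show ?thesis .
qed

section \<open>Calculus of \<open>C_k_on\<close>\<close>

lemma higher_deriv_cong:
  assumes "open I" "\<And>x. x \<in> I \<Longrightarrow> f x = g x" "x \<in> I"
  shows "deriv f x = deriv g x"
  using assms by (intro deriv_cong_ev refl) (auto simp: eventually_nhds)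

lemma higher_deriv_leibniz:
  assumes I: "open I" and f: "C_k_on N f I"
  shows "j \<le> N \<Longrightarrow> x \<in> I \<Longrightarrow>
    (deriv ^^ j) (\<lambda>s. f s * poly P s) x = leibniz (\<lambda>i. (deriv ^^ i) f) P j x"
proof (induction j arbitrary: x)
  case 0 then show ?case by (simp add: leibniz_def)
next
  case (Suc j)
  have "(deriv ^^ Suc j) (\<lambda>s. f s * poly P s) x = deriv (leibniz (\<lambda>i. (deriv ^^ i) f) P j) x"
    using Suc by (simp, intro higher_deriv_cong[OF I]) auto
  also have "\<dots> = leibniz (\<lambda>i. (deriv ^^ i) f) P (Suc j) x"
    using Suc.prems by (intro DERIV_imp_deriv leibniz_derivative C_k_onD[OF f]) auto
  finally show ?case .
qed

lemma C_k_on_mult_poly: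
  assumes I: "open I" and f: "C_k_on N f I"
  shows "C_k_on N (\<lambda>s. f s * poly P s) I"
proof -
  have cont: "continuous_on I ((deriv ^^ j) f)" if "j \<le> N" for j
  proof (cases "j = N")
    case True then show ?thesis using f by (simp add: C_k_on_def)
  next
    case False
    then show ?thesis using that C_k_onD[OF f, of j]
      by (intro continuous_at_imp_continuous_on ballI DERIV_isCont) auto
  qed
  have "continuous_on I (leibniz (\<lambda>i. (deriv ^^ i) f) P N)"
    unfolding leibniz_def by (intro continuous_intros cont) auto
  then have "continuous_on I ((deriv ^^ N) (\<lambda>s. f s * poly P s))"
    by (subst continuous_on_cong[OF refl higher_deriv_leibniz[OF I f]]) auto
  moreover have "(deriv ^^ j) (\<lambda>s. f s * poly P s) differentiable (at x)" if "j < N" "x \<in> I" for j x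
  proof -
    have d: "(leibniz (\<lambda>i. (deriv ^^ i) f) P j has_real_derivative leibniz (\<lambda>i. (deriv ^^ i) f) P (Suc j) x) (at x)"
      using that by (intro leibniz_derivative C_k_onD[OF f]) auto
    have "((deriv ^^ j) (\<lambda>s. f s * poly P s) has_real_derivative leibniz (\<lambda>i. (deriv ^^ i) f) P (Suc j) x) (at x)"
      using that higher_deriv_leibniz[OF I f]
      by (intro DERIV_cong_ev[THEN iffD2, OF refl _ refl d]) (auto simp: eventually_nhds I intro!: exI[of _ I])
    then show ?thesis by (auto simp: real_differentiable_def)
  qed
  ultimately show ?thesis by (auto simp: C_k_on_def deriv_dom_def)
qed

lemma C_k_on_mono:
  assumes "C_k_on N f I" "k \<le> N" shows "C_k_on k f I"
proof (cases "k = N")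
  case False
  then have "continuous_on I ((deriv ^^ k) f)" using assms C_k_onD[OF assms(1), of k]
    by (intro continuous_at_imp_continuous_on ballI DERIV_isCont) auto
  moreover have "(deriv ^^ j) f differentiable (at x)" if "j < k" "x \<in> I" for j x
    using C_k_onD[OF assms(1), of j x] that assms(2) real_differentiable_def
    by (auto simp del: funpow.simps)
  then have "deriv_dom I f k = I" unfolding deriv_dom_def by auto
  ultimately show ?thesis by (simp add: C_k_on_def)
qed (use assms in simp)

lemma higher_deriv_lincomb:
  assumes I: "open I" and f: "C_k_on N f I" and g: "C_k_on N g I"
  shows "j \<le> N \<Longrightarrow> x \<in> I \<Longrightarrow>
    (deriv ^^ j) (\<lambda>s. a * f s + b * g s) x = a * (deriv ^^ j) f x + b * (deriv ^^ j) g x"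
proof (induction j arbitrary: x)
  case 0 then show ?case by simp
next
  case (Suc j)
  have "(deriv ^^ Suc j) (\<lambda>s. a * f s + b * g s) x = deriv (\<lambda>x. a * (deriv ^^ j) f x + b * (deriv ^^ j) g x) x"
    using Suc by (simp, intro higher_deriv_cong[OF I]) auto
  also have "\<dots> = a * (deriv ^^ Suc j) f x + b * (deriv ^^ Suc j) g x"
    using Suc.prems by (intro DERIV_imp_deriv DERIV_add DERIV_cmult C_k_onD[OF f] C_k_onD[OF g]) auto
  finally show ?case .
qed

lemma C_k_on_lincomb:
  assumes I: "open I" and f: "C_k_on N f I" and g: "C_k_on N g I"
  shows "C_k_on N (\<lambda>s. a * f s + b * g s) I"
proof -
  have "continuous_on I (\<lambda>x. a * (deriv ^^ N) f x + b * (deriv ^^ N) g x)"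
    using f g by (intro continuous_intros) (auto simp: C_k_on_def)
  then have "continuous_on I ((deriv ^^ N) (\<lambda>s. a * f s + b * g s))"
    by (subst continuous_on_cong[OF refl higher_deriv_lincomb[OF I f g]]) auto
  moreover have "(deriv ^^ j) (\<lambda>s. a * f s + b * g s) differentiable (at x)" if "j < N" "x \<in> I" for j x
  proof -
    have d: "((\<lambda>x. a * (deriv ^^ j) f x + b * (deriv ^^ j) g x) has_real_derivative
        a * (deriv ^^ Suc j) f x + b * (deriv ^^ Suc j) g x) (at x)"
      using that by (intro DERIV_add DERIV_cmult C_k_onD[OF f] C_k_onD[OF g]) auto
    have "((deriv ^^ j) (\<lambda>s. a * f s + b * g s) has_real_derivative
        a * (deriv ^^ Suc j) f x + b * (deriv ^^ Suc j) g x) (at x)"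
      using that higher_deriv_lincomb[OF I f g]
      by (intro DERIV_cong_ev[THEN iffD2, OF refl _ refl d]) (auto simp: eventually_nhds I intro!: exI[of _ I])
    then show ?thesis by (auto simp: real_differentiable_def)
  qed
  ultimately show ?thesis by (auto simp: C_k_on_def deriv_dom_def)
qed

lemma higher_deriv_zero [simp]: "(deriv ^^ k) (\<lambda>_. 0 :: real) = (\<lambda>_. 0)"
  by (induction k) auto

lemma C_k_on_const: "C_k_on k (\<lambda>_. c) I"
proof -
  have "(deriv ^^ j) (\<lambda>_. c) = (\<lambda>_. if j = 0 then c else 0)" for j
  proof (induction j)
    case (Suc j) then show ?case by (cases j) auto
  qed simp
  then show ?thesis by (auto simp: C_k_on_def deriv_dom_def)
qed

lemma C_k_on_poly: "open I \<Longrightarrow> C_k_on k (poly p) I"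
  using C_k_on_mult_poly[OF _ C_k_on_const[of k 1], of I p] by simp

lemma higher_deriv_poly: "(deriv ^^ k) (poly p) = poly ((pderiv ^^ k) (p :: real poly))"
proof (induction k)
  case (Suc k) then show ?case by (auto intro!: DERIV_imp_deriv)
qed simp

section \<open>Moving polynomial factors through the partial fraction pairing\<close>

lemma pf_value_lincomb:
  assumes "open I" "C \<subseteq> I" "C_k_on 2 f I" "C_k_on 2 g I"
  shows "pf_value (\<lambda>s. a * f s + b * g s) C 3 \<alpha> = a * pf_value f C 3 \<alpha> + b * pf_value g C 3 \<alpha>"
proof -
  have "pf_value (\<lambda>s. a * f s + b * g s) C 3 \<alpha> = (\<Sum>c\<in>C. \<Sum>k<3.
      a * (\<alpha> c k * ((deriv ^^ k) f c / fact k)) + b * (\<alpha> c k * ((deriv ^^ k) g c / fact k)))"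
    unfolding pf_value_def
  proof (intro sum.cong refl)
    fix c and k :: nat assume "c \<in> C" "k \<in> {..<3}"
    then show "\<alpha> c k * ((deriv ^^ k) (\<lambda>s. a * f s + b * g s) c / fact k) =
        a * (\<alpha> c k * ((deriv ^^ k) f c / fact k)) + b * (\<alpha> c k * ((deriv ^^ k) g c / fact k))"
      using higher_deriv_lincomb[OF assms(1,3,4), of k c a b] assms(2) by (auto simp: field_simps)
  qed
  then show ?thesis by (simp add: pf_value_def sum_distrib_left sum.distrib)
qed

lemma pf_repr_lincomb:
  "pf_repr r1 C m \<beta>1 \<Longrightarrow> pf_repr r2 C m \<beta>2 \<Longrightarrow>
    pf_repr (\<lambda>x. a * r1 x + b * r2 x) C m (\<lambda>c k. a * \<beta>1 c k + b * \<beta>2 c k)"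
  by (simp add: pf_repr_def sum_distrib_left sum.distrib add_divide_distrib)

lemma pf_value_coeff_lincomb:
  "pf_value g C m (\<lambda>c k. a * \<beta>1 c k + b * \<beta>2 c k) = a * pf_value g C m \<beta>1 + b * pf_value g C m \<beta>2"
  by (simp add: pf_value_def sum_distrib_left sum.distrib distrib_right add_divide_distrib mult.assoc)

lemma lessThan_3: "{..<3::nat} = {0, 1, 2}" by auto

text \<open>The partial fraction coefficients of \<open>x \<mapsto> x r(x)\<close>, up to a constant.\<close>

definition pf_shift :: "(real \<Rightarrow> nat \<Rightarrow> real) \<Rightarrow> real \<Rightarrow> nat \<Rightarrow> real" where
  "pf_shift \<alpha> c k = c * \<alpha> c k + (if k < 2 then \<alpha> c (Suc k) else 0)"

text \<open>The Taylor coefficient of \<open>g s\<close> at \<open>c\<close> of order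
  \<open>k\<close> is \<open>c\<close> times that of \<open>g\<close> plus the preceding one.
  Collected by derivatives of \<open>g\<close>, this is the action of multiplication by
  \<open>x\<close> on partial fraction coefficients.\<close>

lemma pf_value_mult_id:
  assumes I: "open I" "C \<subseteq> I" and g: "C_k_on 2 g I"
  shows "pf_value (\<lambda>s. g s * s) C 3 \<alpha> = pf_value g C 3 (pf_shift \<alpha>)"
  unfolding pf_value_def
proof (rule sum.cong[OF refl])
  fix c assume c: "c \<in> C"
  have "(deriv ^^ k) (\<lambda>s. g s * s) c = leibniz (\<lambda>i. (deriv ^^ i) g) [:0, 1:] k c" if "k \<le> 2" for k
    using higher_deriv_leibniz[OF I(1) g that, of c "[:0, 1:]"] c I(2) by auto
  from this[of 0] this[of 1] this[of 2]
  show "(\<Sum>k<3. \<alpha> c k * ((deriv ^^ k) (\<lambda>s. g s * s) c / fact k)) =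
      (\<Sum>k<3. pf_shift \<alpha> c k * ((deriv ^^ k) g c / fact k))"
    by (simp add: lessThan_3 leibniz_def pf_shift_def numeral_2_eq_2 pderiv_pCons field_simps)
qed

text \<open>\<open>x / (x - c)^(k+1) = c / (x - c)^(k+1) + 1 / (x - c)^k\<close>. For
  \<open>k = 0\<close> the last term is a constant, which is split off.\<close>

lemma pf_mult_id:
  fixes C :: "real set"
  assumes "x \<notin> C"
  shows "(\<Sum>c\<in>C. \<Sum>k<3. \<alpha> c k / (x - c) ^ (k + 1)) * x =
    (\<Sum>c\<in>C. \<alpha> c 0) + (\<Sum>c\<in>C. \<Sum>k<3. pf_shift \<alpha> c k / (x - c) ^ (k + 1))"
  unfolding sum_distrib_right sum.distrib[symmetric]
proof (intro sum.cong refl)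
  fix c assume "c \<in> C"
  then have y: "x - c \<noteq> 0" using assms by auto
  define y where "y = x - c"
  have x: "x = y + c" by (simp add: y_def)
  have "y \<noteq> 0" using y by (simp add: y_def)
  then show "(\<Sum>k<3. \<alpha> c k / (x - c) ^ (k + 1) * x) = \<alpha> c 0 + (\<Sum>k<3. pf_shift \<alpha> c k / (x - c) ^ (k + 1))"
    unfolding y_def[symmetric] x
    by (simp add: lessThan_3 pf_shift_def divide_simps) (simp add: algebra_simps eval_nat_numeral)
qed

lemma tendsto_inverse_shift: "((\<lambda>x. K / (x - c) ^ Suc k) \<longlongrightarrow> 0) (at_top :: real filter)"
proof (rule tendsto_divide_0[OF tendsto_const])
  have "filterlim (\<lambda>x. - c + x) at_top (at_top :: real filter)"
    by (rule filterlim_tendsto_add_at_top[OF tendsto_const filterlim_ident])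
  then have "filterlim (\<lambda>x. x - c) at_top (at_top :: real filter)" by simp
  then show "filterlim (\<lambda>x. (x - c) ^ Suc k) at_infinity (at_top :: real filter)"
    by (intro filterlim_at_top_imp_at_infinity filterlim_pow_at_top) auto
qed

lemma pf_tendsto_0: "finite C \<Longrightarrow> ((\<lambda>x. \<Sum>c\<in>C. \<Sum>k<m. \<alpha> c k / (x - c) ^ (k + 1)) \<longlongrightarrow> 0) (at_top :: real filter)"
proof -
  have "((\<lambda>x. \<Sum>c\<in>C. \<Sum>k<m. \<alpha> c k / (x - c) ^ (k + 1)) \<longlongrightarrow> (\<Sum>c\<in>C. \<Sum>k<m. 0)) (at_top :: real filter)"
    unfolding Suc_eq_plus1[symmetric] by (intro tendsto_sum tendsto_inverse_shift)
  then show ?thesis by simp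
qed

lemma eventually_not_in_finite: "finite C \<Longrightarrow> \<forall>\<^sub>F x in at_top. x \<notin> (C :: real set)"
proof -
  assume "finite C"
  then show ?thesis
    by (intro eventually_mono[OF eventually_gt_at_top[of "Max C"]]) (auto dest: Max_ge[of C])
qed

text \<open>If \<open>x r(x)\<close> tends to zero, the constant split off by the multiplication,
  which is the sum of the residues, has to vanish.\<close>

lemma pf_repr_mult_id:
  assumes "pf_repr r C 3 \<alpha>" "((\<lambda>x. x * r x) \<longlongrightarrow> 0) at_top"
  shows "pf_repr (\<lambda>x. r x * x) C 3 (pf_shift \<alpha>)" and "(\<Sum>c\<in>C. \<alpha> c 0) = 0"
proof -
  have fin: "finite C" using assms by (simp add: pf_repr_def)
  have eq: "r x * x = (\<Sum>c\<in>C. \<alpha> c 0) + (\<Sum>c\<in>C. \<Sum>k<3. pf_shift \<alpha> c k / (x - c) ^ (k + 1))" if "x \<notin> C" for x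
    using assms(1) pf_mult_id[OF that] that by (simp add: pf_repr_def)
  have "((\<lambda>x. (\<Sum>c\<in>C. \<alpha> c 0) + (\<Sum>c\<in>C. \<Sum>k<3. pf_shift \<alpha> c k / (x - c) ^ (k + 1))) \<longlongrightarrow> (\<Sum>c\<in>C. \<alpha> c 0) + 0) at_top"
    by (intro tendsto_add tendsto_const pf_tendsto_0 fin)
  moreover have "((\<lambda>x. (\<Sum>c\<in>C. \<alpha> c 0) + (\<Sum>c\<in>C. \<Sum>k<3. pf_shift \<alpha> c k / (x - c) ^ (k + 1))) \<longlongrightarrow> 0) at_top"
    by (rule Lim_transform_eventually[OF assms(2)])
      (use eventually_not_in_finite[OF fin] eq in \<open>auto elim!: eventually_mono simp: mult.commute\<close>)
  ultimately have "(\<Sum>c\<in>C. \<alpha> c 0) + 0 = 0" by (rule tendsto_unique[rotated]) simp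
  then show "(\<Sum>c\<in>C. \<alpha> c 0) = 0" "pf_repr (\<lambda>x. r x * x) C 3 (pf_shift \<alpha>)"
    using eq fin by (simp_all add: pf_repr_def)
qed

text \<open>A polynomial factor moves from the function to the rational function as long as the
  product vanishes at infinity. The induction follows Horner's scheme, and the decay hypothesis is
  what permits each single multiplication by \<open>x\<close>.\<close>

lemma pf_mult_poly:
  assumes I: "open I" "C \<subseteq> I" and g: "C_k_on 2 g I"
  shows "pf_repr r C 3 \<alpha> \<Longrightarrow> ((\<lambda>x. x ^ degree P * r x) \<longlongrightarrow> 0) at_top \<Longrightarrow>
    \<exists>\<beta>. pf_repr (\<lambda>x. r x * poly P x) C 3 \<beta> \<and> pf_value (\<lambda>x. g x * poly P x) C 3 \<alpha> = pf_value g C 3 \<beta>"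
proof (induction P arbitrary: r \<alpha>)
  case 0
  then show ?case by (intro exI[of _ "\<lambda>_ _. 0"]) (auto simp: pf_repr_def pf_value_def)
next
  case (pCons a P)
  have fin: "finite C" using pCons.prems by (simp add: pf_repr_def)
  define h where "h = (\<lambda>s. g s * poly P s)"
  have h: "C_k_on 2 h I" unfolding h_def by (rule C_k_on_mult_poly[OF I(1) g])
  have hx: "C_k_on 2 (\<lambda>s. h s * s) I" using C_k_on_mult_poly[OF I(1) h, of "[:0, 1:]"] by simp
  have eq: "(\<lambda>s. g s * poly (pCons a P) s) = (\<lambda>s. a * g s + 1 * (h s * s))"
    by (auto simp: h_def algebra_simps)
  have val: "pf_value (\<lambda>s. g s * poly (pCons a P) s) C 3 \<alpha> = a * pf_value g C 3 \<alpha> + pf_value (\<lambda>s. h s * s) C 3 \<alpha>"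
    unfolding eq pf_value_lincomb[OF I g hx] by simp
  have lin: "\<exists>\<gamma>. pf_repr (\<lambda>x. a * r x + r' x) C 3 \<gamma> \<and> pf_value g C 3 \<gamma> = a * pf_value g C 3 \<alpha> + pf_value g C 3 \<beta>"
    if "pf_repr r' C 3 \<beta>" for r' \<beta>
    using pf_repr_lincomb[OF pCons.prems(1) that, of a 1] pf_value_coeff_lincomb[of g C 3 a \<alpha> 1 \<beta>]
    by (intro exI[of _ "\<lambda>c k. a * \<alpha> c k + 1 * \<beta> c k"]) simp
  have "\<exists>\<beta>. pf_repr (\<lambda>x. r x * x * poly P x) C 3 \<beta> \<and> pf_value (\<lambda>s. h s * s) C 3 \<alpha> = pf_value g C 3 \<beta>"
  proof (cases "P = 0")
    case True
    then show ?thesis using fin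
      by (intro exI[of _ "\<lambda>_ _. 0"]) (auto simp: pf_repr_def pf_value_def h_def)
  next
    case False
    then have deg: "degree (pCons a P) = Suc (degree P)" by simp
    have "((\<lambda>x. x * r x) \<longlongrightarrow> 0) at_top"
    proof (rule Lim_null_comparison[OF _ tendsto_rabs_zero[OF pCons.prems(2)]])
      show "\<forall>\<^sub>F x in at_top. norm (x * r x) \<le> \<bar>x ^ degree (pCons a P) * r x\<bar>"
        using eventually_ge_at_top[of 1]
      proof eventually_elim
        case (elim x)
        then have "\<bar>x\<bar> * 1 * \<bar>r x\<bar> \<le> \<bar>x\<bar> * \<bar>x ^ degree P\<bar> * \<bar>r x\<bar>"
          by (intro mult_right_mono mult_left_mono) (auto simp: one_le_power)
        then show ?case unfolding deg by (simp add: abs_mult)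
      qed
    qed
    from pf_repr_mult_id(1)[OF pCons.prems(1) this]
    have r': "pf_repr (\<lambda>x. r x * x) C 3 (pf_shift \<alpha>)" .
    have "((\<lambda>x. x ^ degree P * (r x * x)) \<longlongrightarrow> 0) at_top"
      using pCons.prems(2) unfolding deg by (simp add: algebra_simps)
    from pCons.IH[OF r' this] show ?thesis
      unfolding pf_value_mult_id[OF I h] unfolding h_def by blast
  qed
  then obtain \<beta> where \<beta>: "pf_repr (\<lambda>x. r x * x * poly P x) C 3 \<beta>" "pf_value (\<lambda>s. h s * s) C 3 \<alpha> = pf_value g C 3 \<beta>"
    by blast
  have "(\<lambda>x. r x * poly (pCons a P) x) = (\<lambda>x. a * r x + r x * x * poly P x)" by (auto simp: algebra_simps)
  then show ?case using lin[OF \<beta>(1)] val \<beta>(2) by auto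
qed

section \<open>Existence of partial fraction expansions\<close>

lemma pf_repr_cong: "pf_repr r C m \<alpha> \<Longrightarrow> (\<And>x. x \<notin> C \<Longrightarrow> r x = r' x) \<Longrightarrow> pf_repr r' C m \<alpha>"
  by (simp add: pf_repr_def)

lemma pf_repr_cong_ex:
  "\<exists>\<alpha>. pf_repr r C m \<alpha> \<Longrightarrow> (\<And>x. x \<notin> C \<Longrightarrow> r x = r' x) \<Longrightarrow> \<exists>\<alpha>. pf_repr r' C m \<alpha>"
  using pf_repr_cong by blast

lemma pf_repr_sum:
  assumes "finite C" "\<And>i. i \<in> A \<Longrightarrow> pf_repr (r i) C m (\<alpha> i)"
  shows "pf_repr (\<lambda>x. \<Sum>i\<in>A. w i * r i x) C m (\<lambda>c k. \<Sum>i\<in>A. w i * \<alpha> i c k)"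
  unfolding pf_repr_def
proof (intro conjI allI impI assms(1))
  fix x assume x: "x \<notin> C"
  have "(\<Sum>i\<in>A. w i * r i x) = (\<Sum>i\<in>A. \<Sum>c\<in>C. \<Sum>k<m. w i * \<alpha> i c k / (x - c) ^ (k + 1))"
    using assms(2) x by (intro sum.cong) (auto simp: pf_repr_def sum_distrib_left)
  also have "\<dots> = (\<Sum>c\<in>C. \<Sum>k<m. \<Sum>i\<in>A. w i * \<alpha> i c k / (x - c) ^ (k + 1))"
    by (subst sum.swap, intro sum.cong refl, subst sum.swap) simp
  finally show "(\<Sum>i\<in>A. w i * r i x) = (\<Sum>c\<in>C. \<Sum>k<m. (\<Sum>i\<in>A. w i * \<alpha> i c k) / (x - c) ^ (k + 1))"
    by (simp add: sum_divide_distrib)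
qed

lemma pf_value_sum:
  "pf_value g C m (\<lambda>c k. \<Sum>i\<in>A. w i * \<alpha> i c k) = (\<Sum>i\<in>A. w i * pf_value g C m (\<alpha> i))"
proof -
  have "pf_value g C m (\<lambda>c k. \<Sum>i\<in>A. w i * \<alpha> i c k)
      = (\<Sum>c\<in>C. \<Sum>k<m. \<Sum>i\<in>A. w i * (\<alpha> i c k * ((deriv ^^ k) g c / fact k)))"
    by (simp add: pf_value_def sum_distrib_right sum_divide_distrib mult.assoc)
  also have "\<dots> = (\<Sum>i\<in>A. \<Sum>c\<in>C. \<Sum>k<m. w i * (\<alpha> i c k * ((deriv ^^ k) g c / fact k)))"
  proof -
    have "(\<Sum>c\<in>C. \<Sum>k<m. \<Sum>i\<in>A. w i * (\<alpha> i c k * ((deriv ^^ k) g c / fact k)))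
        = (\<Sum>c\<in>C. \<Sum>i\<in>A. \<Sum>k<m. w i * (\<alpha> i c k * ((deriv ^^ k) g c / fact k)))"
      by (intro sum.cong refl sum.swap)
    also have "\<dots> = (\<Sum>i\<in>A. \<Sum>c\<in>C. \<Sum>k<m. w i * (\<alpha> i c k * ((deriv ^^ k) g c / fact k)))"
      by (rule sum.swap)
    finally show ?thesis .
  qed
  finally show ?thesis by (simp add: pf_value_def sum_distrib_left)
qed

text \<open>Distinct poles separate by \<open>1 / ((x - d) (x - c)) = (1 / (x - c) - 1 / (x - d)) /
  (c - d)\<close>, which lowers the power of \<open>x - d\<close> step by step. Equal poles raise
  the order, hence \<open>Suc m\<close>.\<close>

lemma pf_repr_div_linear:
  assumes "pf_repr r C m \<alpha>" "c \<in> C"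
  shows "\<exists>\<beta>. pf_repr (\<lambda>x. r x / (x - c)) C (Suc m) \<beta>"
proof -
  have fin: "finite C" using assms by (simp add: pf_repr_def)
  have single: "\<exists>\<beta>. pf_repr (\<lambda>x. 1 / (x - d) ^ Suc k) C (Suc m) \<beta>" if "d \<in> C" "k < Suc m" for d k
  proof (intro exI)
    show "pf_repr (\<lambda>x. 1 / (x - d) ^ Suc k) C (Suc m) (\<lambda>d' k'. if d' = d then if k' = k then 1 else 0 else 0)"
      unfolding pf_repr_def
    proof (intro conjI fin allI impI)
      fix x assume "x \<notin> C"
      have "(\<Sum>c\<in>C. \<Sum>ka<Suc m. (if c = d then if ka = k then 1 else 0 else 0) / (x - c) ^ (ka + 1))
          = (\<Sum>c\<in>C. if c = d then 1 / (x - c) ^ Suc k else 0)"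
      proof (intro sum.cong refl)
        fix c
        have "(\<Sum>ka<Suc m. (if ka = k then 1 else 0) / (x - c) ^ (ka + 1)) = (\<Sum>ka<Suc m. if ka = k then 1 / (x - c) ^ Suc k else 0)"
          by (intro sum.cong) auto
        then show "(\<Sum>ka<Suc m. (if c = d then if ka = k then 1 else 0 else 0) / (x - c) ^ (ka + 1)) =
            (if c = d then 1 / (x - c) ^ Suc k else 0)"
          using that by (cases "c = d") (simp_all del: sum.lessThan_Suc power_Suc)
      qed
      then show "1 / (x - d) ^ Suc k = (\<Sum>c\<in>C. \<Sum>ka<Suc m. (if c = d then if ka = k then 1 else 0 else 0) / (x - c) ^ (ka + 1))"
        using fin that by simp
    qed
  qed
  have lin: "\<exists>\<gamma>. pf_repr (\<lambda>x. a * r1 x + b * r2 x) C (Suc m) \<gamma>"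
    if "\<exists>\<beta>. pf_repr r1 C (Suc m) \<beta>" "\<exists>\<beta>. pf_repr r2 C (Suc m) \<beta>" for r1 r2 and a b :: real
  proof -
    from that obtain \<beta>1 \<beta>2 where "pf_repr r1 C (Suc m) \<beta>1" "pf_repr r2 C (Suc m) \<beta>2" by blast
    from pf_repr_lincomb[OF this] show ?thesis by blast
  qed
  have two: "\<exists>\<beta>. pf_repr (\<lambda>x. 1 / (x - d) ^ Suc k / (x - c)) C (Suc m) \<beta>" if "d \<in> C" "k < m" for d k
  proof (cases "d = c")
    case True
    then show ?thesis using single[of c "Suc k"] that assms(2) by (simp add: field_simps)
  next
    case False
    show ?thesis using that(2)
    proof (induction k)
      case 0
      have "\<exists>\<beta>. pf_repr (\<lambda>x. (1 / (c - d)) * (1 / (x - c) ^ Suc 0) + (- 1 / (c - d)) * (1 / (x - d) ^ Suc 0)) C (Suc m) \<beta>"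
        using that assms(2) by (intro lin single) auto
      then show ?case
      proof (rule pf_repr_cong_ex)
        fix x assume "x \<notin> C"
        then have "x - c \<noteq> 0" "x - d \<noteq> 0" "c - d \<noteq> 0" using that assms(2) False by auto
        then show "(1 / (c - d)) * (1 / (x - c) ^ Suc 0) + (- 1 / (c - d)) * (1 / (x - d) ^ Suc 0) = 1 / (x - d) ^ Suc 0 / (x - c)"
          by (simp add: divide_simps)
      qed
    next
      case (Suc k)
      have "\<exists>\<beta>. pf_repr (\<lambda>x. (1 / (c - d)) * (1 / (x - d) ^ Suc k / (x - c)) + (- 1 / (c - d)) * (1 / (x - d) ^ Suc (Suc k))) C (Suc m) \<beta>"
        using that Suc by (intro lin single) auto
      then show ?case
      proof (rule pf_repr_cong_ex)
        fix x assume "x \<notin> C"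
        then have "x - c \<noteq> 0" "x - d \<noteq> 0" "c - d \<noteq> 0" "(x - d) ^ k \<noteq> 0" using that assms(2) False by auto
        then show "(1 / (c - d)) * (1 / (x - d) ^ Suc k / (x - c)) + (- 1 / (c - d)) * (1 / (x - d) ^ Suc (Suc k))
            = 1 / (x - d) ^ Suc (Suc k) / (x - c)"
          by (simp add: divide_simps)
      qed
    qed
  qed
  then obtain \<beta> where \<beta>: "\<And>d k. d \<in> C \<Longrightarrow> k < m \<Longrightarrow> pf_repr (\<lambda>x. 1 / (x - d) ^ Suc k / (x - c)) C (Suc m) (\<beta> d k)"
    by metis
  have "pf_repr (\<lambda>x. \<Sum>i\<in>C \<times> {..<m}. case i of (d, k) \<Rightarrow> \<alpha> d k * (1 / (x - d) ^ Suc k / (x - c))) C (Suc m)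
      (\<lambda>e j. \<Sum>i\<in>C \<times> {..<m}. \<alpha> (fst i) (snd i) * \<beta> (fst i) (snd i) e j)"
    using pf_repr_sum[OF fin, of "C \<times> {..<m}" "\<lambda>i x. 1 / (x - fst i) ^ Suc (snd i) / (x - c)" "Suc m" "\<lambda>i. \<beta> (fst i) (snd i)" "\<lambda>i. \<alpha> (fst i) (snd i)"] \<beta>
    by (auto simp: case_prod_beta)
  then have "pf_repr (\<lambda>x. r x / (x - c)) C (Suc m) (\<lambda>e j. \<Sum>i\<in>C \<times> {..<m}. \<alpha> (fst i) (snd i) * \<beta> (fst i) (snd i) e j)"
    by (rule pf_repr_cong)
      (use assms(1) in \<open>auto simp: pf_repr_def sum.cartesian_product[symmetric] sum_divide_distrib\<close>)
  then show ?thesis by blast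
qed

text \<open>\<open>C\<close> may contain further points, so that all triples of nodes share one set
  of poles.\<close>

lemma triple_repr:
  assumes "finite C" "x \<in> C" "y \<in> C" "w \<in> C"
  shows "\<exists>\<alpha>. pf_repr (\<lambda>t. 1 / ((t - x) * (t - y) * (t - w))) C 3 \<alpha>"
proof -
  have "pf_repr (\<lambda>t. 1 / (t - x)) C 1 (\<lambda>c k. if c = x then 1 else 0)"
    unfolding pf_repr_def
  proof (intro conjI assms(1) allI impI)
    fix t assume "t \<notin> C"
    have "(\<Sum>c\<in>C. \<Sum>k<1. (if c = x then 1 else 0) / (t - c) ^ (k + 1)) = (\<Sum>c\<in>C. if c = x then 1 / (t - x) else 0)"
      by (intro sum.cong) auto
    then show "1 / (t - x) = (\<Sum>c\<in>C. \<Sum>k<1. (if c = x then 1 else 0) / (t - c) ^ (k + 1))"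
      using assms by simp
  qed
  from pf_repr_div_linear[OF this assms(3)] obtain \<beta>
    where "pf_repr (\<lambda>t. 1 / (t - x) / (t - y)) C (Suc 1) \<beta>" by blast
  from pf_repr_div_linear[OF this assms(4)]
  show ?thesis by (simp add: numeral_3_eq_3 mult.assoc)
qed

lemma divdiff_3_pf_value:
  assumes "pf_repr (\<lambda>t. 1 / ((t - x) * (t - y) * (t - w))) C m \<alpha>"
  shows "divdiff [x, y, w] f = pf_value f C m \<alpha>"
  using L_pairing_eq[OF assms, of f] by (simp add: divdiff_def mult.assoc)

section \<open>Squares of polynomials over two node sets and one extra node\<close>

definition lcoef :: "real set \<Rightarrow> real poly \<Rightarrow> real \<Rightarrow> real" where
  "lcoef X q x = poly q x / (\<Prod>u\<in>X - {x}. x - u)"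

lemma lagr_fraction:
  assumes "finite X" "degree q < card X" "z \<notin> X"
  shows "poly q z / (\<Prod>x\<in>X. z - x) = (\<Sum>x\<in>X. lcoef X q x / (z - x))"
proof -
  have "poly q z = (\<Sum>s\<in>X. lcoef X q s * (\<Prod>u\<in>X - {s}. z - u))"
    using arg_cong[OF lagr_poly[OF assms(1,2)], of "\<lambda>p. poly p z"]
    by (simp add: lagr_def poly_sum poly_prod lcoef_def)
  then have "poly q z / (\<Prod>x\<in>X. z - x) = (\<Sum>s\<in>X. lcoef X q s * (\<Prod>u\<in>X - {s}. z - u) / (\<Prod>x\<in>X. z - x))"
    by (simp add: sum_divide_distrib)
  also have "\<dots> = (\<Sum>x\<in>X. lcoef X q x / (z - x))"
  proof (rule sum.cong[OF refl])
    fix s assume s: "s \<in> X"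
    have "(\<Prod>x\<in>X. z - x) = (z - s) * (\<Prod>u\<in>X - {s}. z - u)"
      using assms(1) s by (rule prod.remove)
    moreover have "(\<Prod>u\<in>X - {s}. z - u) \<noteq> 0" using assms by auto
    ultimately show "lcoef X q s * (\<Prod>u\<in>X - {s}. z - u) / (\<Prod>x\<in>X. z - x) = lcoef X q s / (z - s)"
      by simp
  qed
  finally show ?thesis .
qed

lemma pf_repr_square:
  assumes XY: "finite X" "finite Y" "card X = card Y" and p: "degree p < card X"
    and \<alpha>: "\<And>x y. x \<in> X \<Longrightarrow> y \<in> Y \<Longrightarrow> pf_repr (\<lambda>t. 1 / ((t - x) * (t - y) * (t - w))) (insert w (X \<union> Y)) 3 (\<alpha> x y)"
  shows "pf_repr (\<lambda>z. (poly p z)\<^sup>2 / ((\<Prod>x\<in>X. z - x) * (\<Prod>y\<in>Y. z - y) * (z - w))) (insert w (X \<union> Y)) 3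
    (\<lambda>c k. \<Sum>i\<in>X \<times> Y. (lcoef X p (fst i) * lcoef Y p (snd i)) * \<alpha> (fst i) (snd i) c k)"
proof -
  let ?R = "\<lambda>z. (poly p z)\<^sup>2 / ((\<Prod>x\<in>X. z - x) * (\<Prod>y\<in>Y. z - y) * (z - w))"
  have "pf_repr (\<lambda>z. \<Sum>i\<in>X \<times> Y. (lcoef X p (fst i) * lcoef Y p (snd i)) *
      (1 / ((z - fst i) * (z - snd i) * (z - w)))) (insert w (X \<union> Y)) 3
      (\<lambda>c k. \<Sum>i\<in>X \<times> Y. (lcoef X p (fst i) * lcoef Y p (snd i)) * \<alpha> (fst i) (snd i) c k)"
    by (rule pf_repr_sum) (use XY \<alpha> in auto)
  then show ?thesis
  proof (rule pf_repr_cong)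
    fix z assume z: "z \<notin> insert w (X \<union> Y)"
    have "?R z = (poly p z / (\<Prod>x\<in>X. z - x)) * (poly p z / (\<Prod>y\<in>Y. z - y)) * (1 / (z - w))"
      by (simp add: power2_eq_square)
    also have "\<dots> = (\<Sum>x\<in>X. lcoef X p x / (z - x)) * (\<Sum>y\<in>Y. lcoef Y p y / (z - y)) * (1 / (z - w))"
      using lagr_fraction[of X p z] lagr_fraction[of Y p z] z p XY by simp
    also have "(\<Sum>x\<in>X. lcoef X p x / (z - x)) * (\<Sum>y\<in>Y. lcoef Y p y / (z - y)) =
        (\<Sum>i\<in>X \<times> Y. (lcoef X p (fst i) / (z - fst i)) * (lcoef Y p (snd i) / (z - snd i)))"
      by (simp only: sum_product sum.cartesian_product split_def)
    also have "\<dots> * (1 / (z - w)) = (\<Sum>i\<in>X \<times> Y. (lcoef X p (fst i) * lcoef Y p (snd i)) * (1 / ((z - fst i) * (z - snd i) * (z - w))))"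
      by (simp add: sum_divide_distrib)
    finally show "(\<Sum>i\<in>X \<times> Y. (lcoef X p (fst i) * lcoef Y p (snd i)) * (1 / ((z - fst i) * (z - snd i) * (z - w)))) = ?R z"
      by simp
  qed
qed

text \<open>Divided by the node polynomial, \<open>q^2\<close> is the product of
  \<open>q / \<Prod>(z - x)\<close>, \<open>q / \<Prod>(z - y)\<close> and
  \<open>1 / (z - w)\<close>, and the first two factors have simple poles only. The sets
  \<open>X\<close> and \<open>Y\<close> are kept apart because both cases are used:
  \<open>Y = X\<close> for doubled nodes, and a translate of \<open>X\<close> for distinct
  ones.\<close>

lemma L_pairing_square:
  assumes I: "open I" "X \<subseteq> I" "Y \<subseteq> I" "w \<in> I" and f: "C_k_on 2 f I"
    and XY: "finite X" "finite Y" "card X = card Y" and q: "degree q < card X"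
  shows "L_pairing (\<lambda>s. f s * (poly q s)\<^sup>2) (\<lambda>z. 1 / ((\<Prod>x\<in>X. z - x) * (\<Prod>y\<in>Y. z - y) * (z - w)))
    = (\<Sum>x\<in>X. \<Sum>y\<in>Y. lcoef X q x * lcoef Y q y * divdiff [x, y, w] f)"
proof -
  define C where "C = insert w (X \<union> Y)"
  have C: "finite C" "C \<subseteq> I" using XY I by (auto simp: C_def)
  have "\<forall>x\<in>X. \<forall>y\<in>Y. \<exists>\<alpha>. pf_repr (\<lambda>t. 1 / ((t - x) * (t - y) * (t - w))) C 3 \<alpha>"
    using C by (intro ballI triple_repr) (auto simp: C_def)
  then obtain \<alpha> where \<alpha>: "\<And>x y. x \<in> X \<Longrightarrow> y \<in> Y \<Longrightarrow> pf_repr (\<lambda>t. 1 / ((t - x) * (t - y) * (t - w))) C 3 (\<alpha> x y)"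
    by metis
  define R where "R = (\<lambda>p z. (poly p z)\<^sup>2 / ((\<Prod>x\<in>X. z - x) * (\<Prod>y\<in>Y. z - y) * (z - w)))"
  define A where "A = (\<lambda>p c k. \<Sum>i\<in>X \<times> Y. (lcoef X p (fst i) * lcoef Y p (snd i)) * \<alpha> (fst i) (snd i) c k)"
  have R: "pf_repr (R p) C 3 (A p)" if p: "degree p < card X" for p
    unfolding R_def A_def C_def by (rule pf_repr_square[OF XY p]) (use \<alpha> in \<open>simp add: C_def\<close>)
  define r0 where "r0 = R 1"
  have r0: "r0 = (\<lambda>z. 1 / ((\<Prod>x\<in>X. z - x) * (\<Prod>y\<in>Y. z - y) * (z - w)))"
    by (simp add: r0_def R_def)
  have r0_pf: "pf_repr r0 C 3 (A 1)" using R[of 1] q by (simp add: r0_def)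
  have deg: "degree (q * q) = degree q * 2" by (cases "q = 0") (auto simp: degree_mult_eq)
  have "((\<lambda>x. x ^ degree (q * q) * r0 x) \<longlongrightarrow> 0) at_top"
  proof (rule Lim_transform_eventually[OF pf_tendsto_0[OF C(1)]])
    \<comment> \<open>The decay at infinity is read off the expansion for the square of a monomial
      of the same degree, which is a sum of proper fractions.\<close>
    let ?m = "monom 1 (degree q) :: real poly"
    have m: "degree ?m < card X" using q by (simp add: degree_monom_eq)
    show "\<forall>\<^sub>F x in at_top. (\<Sum>c\<in>C. \<Sum>k<3. A ?m c k / (x - c) ^ (k + 1)) = x ^ degree (q * q) * r0 x"
      using eventually_not_in_finite[OF C(1)]
    proof eventually_elim
      case (elim x)
      then have "(\<Sum>c\<in>C. \<Sum>k<3. A ?m c k / (x - c) ^ (k + 1)) = R ?m x"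
        using R[OF m] by (simp add: pf_repr_def)
      then show ?case unfolding deg r0 R_def by (simp add: poly_monom power_mult)
    qed
  qed
  from pf_mult_poly[OF I(1) C(2) f r0_pf this]
  obtain \<beta> where \<beta>: "pf_repr (\<lambda>x. r0 x * poly (q * q) x) C 3 \<beta>"
    "pf_value (\<lambda>x. f x * poly (q * q) x) C 3 (A 1) = pf_value f C 3 \<beta>" by blast
  have "(\<lambda>x. r0 x * poly (q * q) x) = R q" by (auto simp: r0 R_def power2_eq_square)
  then have "pf_value f C 3 \<beta> = pf_value f C 3 (A q)"
    using pf_value_unique[OF \<beta>(1)] R[OF q] by simp
  moreover have "(\<lambda>x. f x * poly (q * q) x) = (\<lambda>s. f s * (poly q s)\<^sup>2)" by (auto simp: power2_eq_square)
  ultimately have "L_pairing (\<lambda>s. f s * (poly q s)\<^sup>2) r0 = pf_value f C 3 (A q)"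
    using L_pairing_eq[OF r0_pf, of "\<lambda>s. f s * (poly q s)\<^sup>2"] \<beta>(2) by simp
  also have "\<dots> = (\<Sum>i\<in>X \<times> Y. (lcoef X q (fst i) * lcoef Y q (snd i)) * pf_value f C 3 (\<alpha> (fst i) (snd i)))"
    unfolding A_def by (rule pf_value_sum)
  also have "\<dots> = (\<Sum>i\<in>X \<times> Y. (lcoef X q (fst i) * lcoef Y q (snd i)) * divdiff [fst i, snd i, w] f)"
    by (intro sum.cong refl) (auto simp: divdiff_3_pf_value[OF \<alpha>])
  finally show ?thesis by (simp add: r0 sum.cartesian_product case_prod_beta)
qed

section \<open>Mean values of three-point divided differences\<close>

lemma divdiff_lincomb:
  assumes "open I" "{x, y, w} \<subseteq> I" "C_k_on 2 f I" "C_k_on 2 g I"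
  shows "divdiff [x, y, w] (\<lambda>s. a * f s + b * g s) = a * divdiff [x, y, w] f + b * divdiff [x, y, w] g"
proof -
  obtain \<alpha> where "pf_repr (\<lambda>t. 1 / ((t - x) * (t - y) * (t - w))) {x, y, w} 3 \<alpha>"
    using triple_repr[of "{x, y, w}" x y w] by auto
  then show ?thesis using pf_value_lincomb[OF assms] by (simp add: divdiff_3_pf_value)
qed

lemma divdiff_3_swap: "divdiff [y, x, w] f = divdiff [x, y, w] f" "divdiff [x, w, y] f = divdiff [x, y, w] f"
  by (simp_all add: divdiff_def mult.left_commute mult.commute)

text \<open>For \<open>w\<close> different from \<open>x\<close> the value is
  \<open>(f w - f x - f' x (w - x)) / (w - x)^2\<close>, and Taylor's formula applies; for
  \<open>w = x\<close> it is half the second derivative.\<close>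

lemma divdiff_3_mean_value_double:
  assumes f: "C_k_on 2 f I" and I: "{\<alpha>..\<beta>} \<subseteq> I" and xw: "x \<in> {\<alpha>..\<beta>}" "w \<in> {\<alpha>..\<beta>}"
  shows "\<exists>\<xi>\<in>{\<alpha>..\<beta>}. divdiff [x, x, w] f = (deriv ^^ 2) f \<xi> / 2"
proof (cases "x = w")
  case True
  have "pf_repr (\<lambda>t. 1 / ((t - x) * (t - x) * (t - w))) {x} 3 (\<lambda>c k. if k = 2 then 1 else 0)"
    using True by (auto simp: pf_repr_def lessThan_3 eval_nat_numeral)
  then have "divdiff [x, x, w] f = (deriv ^^ 2) f x / 2"
    by (simp add: divdiff_3_pf_value pf_value_def lessThan_3)
  with xw show ?thesis by blast
next
  case False
  define \<gamma> where "\<gamma> = (\<lambda>c k. if c = w then (if k = 0 then 1 / (w - x)\<^sup>2 else 0)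
    else (if k = 0 then - 1 / (w - x)\<^sup>2 else if k = Suc 0 then 1 / (x - w) else (0 :: real)))"
  have "pf_repr (\<lambda>t. 1 / ((t - x) * (t - x) * (t - w))) {x, w} 3 \<gamma>"
    unfolding pf_repr_def
  proof (intro conjI allI impI)
    fix t assume "t \<notin> {x, w}"
    then have nz: "t - x \<noteq> 0" "t - w \<noteq> 0" "w - x \<noteq> 0" "x - w \<noteq> 0" using False by auto
    have "(\<Sum>c\<in>{x, w}. \<Sum>k<3. \<gamma> c k / (t - c) ^ (k + 1)) =
        - 1 / (w - x)\<^sup>2 / (t - x) + 1 / (x - w) / (t - x)\<^sup>2 + 1 / (w - x)\<^sup>2 / (t - w)"
      using False by (simp add: \<gamma>_def lessThan_3 power2_eq_square)
    also have "\<dots> = 1 / ((t - x) * (t - x) * (t - w))"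
    proof -
      have "t - x = (t - w) + (w - x)" by simp
      define u where "u = t - w" define v where "v = w - x"
      have e: "t - x = u + v" "t - w = u" "w - x = v" "x - w = - v" by (auto simp: u_def v_def)
      have "u + v \<noteq> 0" "u \<noteq> 0" "v \<noteq> 0" using nz e by auto
      then show ?thesis unfolding e by (simp add: divide_simps) (simp add: algebra_simps power2_eq_square)
    qed
    finally show "1 / ((t - x) * (t - x) * (t - w)) = (\<Sum>c\<in>{x, w}. \<Sum>k<3. \<gamma> c k / (t - c) ^ (k + 1))" by simp
  qed simp
  then have val: "divdiff [x, x, w] f = - f x / (w - x)\<^sup>2 + deriv f x / (x - w) + f w / (w - x)\<^sup>2"
    using False by (simp add: divdiff_3_pf_value pf_value_def lessThan_3 \<gamma>_def)
  have "\<exists>t. (if w < x then w < t \<and> t < x else x < t \<and> t < w) \<and>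
      f w = (\<Sum>m<2. (deriv ^^ m) f x / fact m * (w - x) ^ m) + (deriv ^^ 2) f t / fact 2 * (w - x) ^ 2"
    by (rule Taylor[of 2 "\<lambda>m. (deriv ^^ m) f" f \<alpha> \<beta> x w]) (use False xw I C_k_onD[OF f] in auto)
  then obtain t where t: "if w < x then w < t \<and> t < x else x < t \<and> t < w"
    "f w = f x + deriv f x * (w - x) + (deriv ^^ 2) f t / 2 * (w - x)\<^sup>2"
    by (auto simp: numeral_2_eq_2)
  have "t \<in> {\<alpha>..\<beta>}" using t(1) xw by (auto split: if_splits)
  moreover have "divdiff [x, x, w] f = (deriv ^^ 2) f t / 2"
  proof -
    define v where "v = w - x"
    have e: "w - x = v" "x - w = - v" "v \<noteq> 0" using False by (auto simp: v_def)
    show ?thesis unfolding val t(2) e(1,2) using e(3)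
      by (simp add: divide_simps) (simp add: algebra_simps power2_eq_square)
  qed
  ultimately show ?thesis by blast
qed

lemma divdiff_3_mean_value:
  assumes f: "C_k_on 2 f I" and I: "{\<alpha>..\<beta>} \<subseteq> I" and xyw: "x \<in> {\<alpha>..\<beta>}" "y \<in> {\<alpha>..\<beta>}" "w \<in> {\<alpha>..\<beta>}"
  shows "\<exists>\<xi>\<in>{\<alpha>..\<beta>}. divdiff [x, y, w] f = (deriv ^^ 2) f \<xi> / 2"
proof -
  consider "x = y" | "y = w" | "x = w" | "distinct [x, y, w]" by auto
  then show ?thesis
  proof cases
    case 1 then show ?thesis using divdiff_3_mean_value_double[OF f I] xyw by auto
  next
    case 2 then show ?thesis using divdiff_3_mean_value_double[OF f I, of y x] xyw
      by (metis divdiff_3_swap)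
  next
    case 3 then show ?thesis using divdiff_3_mean_value_double[OF f I, of x y] xyw
      by (metis divdiff_3_swap)
  next
    case 4
    then have "divdiff [x, y, w] f = dd {x, y, w} f" by (simp add: divdiff_distinct dd_def del: distinct.simps)
    moreover have "\<exists>\<xi>\<in>{\<alpha>..\<beta>}. dd {x, y, w} ((deriv ^^ 0) f) = (deriv ^^ 2) f \<xi> / fact 2"
      by (rule dd_mean_value[where G = "\<lambda>j. (deriv ^^ j) f"])
        (use 4 xyw I C_k_onD[OF f] in \<open>auto simp del: funpow.simps\<close>)
    ultimately show ?thesis by simp
  qed
qed

lemma divdiff_3_bound:
  assumes f: "C_k_on 2 f I" and I: "{\<alpha>..\<beta>} \<subseteq> I" and xyw: "x \<in> {\<alpha>..\<beta>}" "y \<in> {\<alpha>..\<beta>}" "w \<in> {\<alpha>..\<beta>}"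
    and B: "\<And>s. s \<in> {\<alpha>..\<beta>} \<Longrightarrow> \<bar>(deriv ^^ 2) f s\<bar> \<le> B"
  shows "\<bar>divdiff [x, y, w] f\<bar> \<le> B / 2"
  using divdiff_3_mean_value[OF f I xyw] B by fastforce

text \<open>\<open>hom1 m\<close> and \<open>hom2 m\<close> are the complete homogeneous symmetric
  polynomials of degree \<open>m - 1\<close> in two and \<open>m - 2\<close> in three variables,
  that is, the divided differences of the power \<open>s^m\<close>. This form of the recursion is
  the one that the derivatives of matrix powers obey.\<close>

primrec hom1 :: "nat \<Rightarrow> real \<Rightarrow> real \<Rightarrow> real" where
  "hom1 0 x y = 0"
| "hom1 (Suc m) x y = x * hom1 m x y + y ^ m"

primrec hom2 :: "nat \<Rightarrow> real \<Rightarrow> real \<Rightarrow> real \<Rightarrow> real" where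
  "hom2 0 x y w = 0"
| "hom2 (Suc m) x y w = x * hom2 m x y w + hom1 m y w"

lemma C_k_on_power: "C_k_on k (\<lambda>s. s ^ m) UNIV"
proof -
  have "(\<lambda>s. s ^ m) = poly (monom 1 m :: real poly)" by (auto simp: poly_monom)
  then show ?thesis using C_k_on_poly[of UNIV] by simp
qed

lemma pf_repr_single: "finite C \<Longrightarrow> w \<in> C \<Longrightarrow> pf_repr (\<lambda>t. 1 / (t - w)) C 3 (\<lambda>c k. if c = w then if k = 0 then 1 else 0 else 0)"
  and pf_value_single: "finite C \<Longrightarrow> w \<in> C \<Longrightarrow> pf_value g C 3 (\<lambda>c k. if c = w then if k = 0 then 1 else 0 else 0) = g w"
proof -
  assume C: "finite C" "w \<in> C"
  have "(\<Sum>c\<in>C. \<Sum>k<3. (if c = w then if k = 0 then 1 else 0 else 0) * F c k)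
      = (\<Sum>c\<in>C. if c = w then F w 0 else 0)" for F :: "real \<Rightarrow> nat \<Rightarrow> real"
    by (intro sum.cong) (auto simp: lessThan_3)
  then have *: "(\<Sum>c\<in>C. \<Sum>k<3. (if c = w then if k = 0 then 1 else 0 else 0) * F c k) = F w 0" for F :: "real \<Rightarrow> nat \<Rightarrow> real"
    using C by simp
  from *[of "\<lambda>c k. (deriv ^^ k) g c / fact k"]
  show "pf_value g C 3 (\<lambda>c k. if c = w then if k = 0 then 1 else 0 else 0) = g w"
    by (simp add: pf_value_def)
  show "pf_repr (\<lambda>t. 1 / (t - w)) C 3 (\<lambda>c k. if c = w then if k = 0 then 1 else 0 else 0)"
    using C *[of "\<lambda>c k. 1 / (t - c) ^ (k + 1)" for t] by (simp add: pf_repr_def)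
qed

text \<open>\<open>r'\<close> is \<open>r\<close> with a factor \<open>t - y\<close> of the
  denominator removed; the result is the recursion behind \<open>hom1\<close> and
  \<open>hom2\<close>.\<close>

lemma pf_value_power_Suc:
  assumes r: "pf_repr r C 3 \<alpha>" "((\<lambda>t. t * r t) \<longlongrightarrow> 0) at_top" and r': "pf_repr r' C 3 \<gamma>"
    and eq: "\<And>t. t \<notin> C \<Longrightarrow> r t * t = y * r t + r' t"
  shows "pf_value (\<lambda>s. s ^ Suc m) C 3 \<alpha> = y * pf_value (\<lambda>s. s ^ m) C 3 \<alpha> + pf_value (\<lambda>s. s ^ m) C 3 \<gamma>"
proof -
  have "pf_value (\<lambda>s. s ^ Suc m) C 3 \<alpha> = pf_value (\<lambda>s. s ^ m) C 3 (pf_shift \<alpha>)"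
    using pf_value_mult_id[OF open_UNIV subset_UNIV C_k_on_power] by (simp add: mult.commute)
  also have "\<dots> = pf_value (\<lambda>s. s ^ m) C 3 (\<lambda>c k. y * \<alpha> c k + 1 * \<gamma> c k)"
  proof (rule pf_value_unique[OF pf_repr_mult_id(1)[OF r]])
    show "pf_repr (\<lambda>x. r x * x) C 3 (\<lambda>c k. y * \<alpha> c k + 1 * \<gamma> c k)"
      by (rule pf_repr_cong[OF pf_repr_lincomb[OF r(1) r']]) (simp add: eq)
  qed
  also have "\<dots> = y * pf_value (\<lambda>s. s ^ m) C 3 \<alpha> + 1 * pf_value (\<lambda>s. s ^ m) C 3 \<gamma>"
    by (rule pf_value_coeff_lincomb)
  finally show ?thesis by simp
qed

lemma pf_value_one:
  assumes r: "pf_repr r C 3 \<alpha>" "((\<lambda>t. t * r t) \<longlongrightarrow> 0) at_top"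
  shows "pf_value (\<lambda>s. s ^ 0) C 3 \<alpha> = 0"
proof -
  have "(deriv ^^ 2) (\<lambda>_. 1 :: real) = (\<lambda>_. 0)" "(deriv ^^ 1) (\<lambda>_. 1 :: real) = (\<lambda>_. 0)"
    by (auto simp: numeral_2_eq_2)
  then show ?thesis using pf_repr_mult_id(2)[OF r] by (simp add: pf_value_def lessThan_3)
qed

lemma tendsto_inverse_shift_1: "((\<lambda>x. 1 / (x - c)) \<longlongrightarrow> 0) (at_top :: real filter)"
  using tendsto_inverse_shift[of 1 c 0] by simp

lemma tendsto_frac_2: "((\<lambda>t. t * (1 / ((t - y) * (t - w)))) \<longlongrightarrow> 0) (at_top :: real filter)"
proof -
  have "((\<lambda>t. (1 + y * (1 / (t - y))) * (1 / (t - w))) \<longlongrightarrow> (1 + y * 0) * 0) (at_top :: real filter)"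
    by (intro tendsto_intros tendsto_inverse_shift_1)
  then have "((\<lambda>t. (1 + y * (1 / (t - y))) * (1 / (t - w))) \<longlongrightarrow> 0) (at_top :: real filter)" by simp
  then show ?thesis
  proof (rule Lim_transform_eventually)
    show "\<forall>\<^sub>F t in at_top. (1 + y * (1 / (t - y))) * (1 / (t - w)) = t * (1 / ((t - y) * (t - w)))"
      using eventually_gt_at_top[of y] by eventually_elim (simp add: field_simps)
  qed
qed

lemma tendsto_frac_3: "((\<lambda>t. t * (1 / ((t - x) * (t - y) * (t - w)))) \<longlongrightarrow> 0) (at_top :: real filter)"
  using tendsto_mult[OF tendsto_frac_2[of x y] tendsto_inverse_shift_1[of w]] by (simp add: mult.assoc)

lemma divdiff_3_power: "divdiff [x, y, w] (\<lambda>s. s ^ m) = hom2 m x y w"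
proof -
  define C where "C = {x, y, w}"
  have C: "finite C" "x \<in> C" "y \<in> C" "w \<in> C" by (auto simp: C_def)
  let ?r2 = "\<lambda>t. 1 / ((t - y) * (t - w))" and ?r3 = "\<lambda>t. 1 / ((t - x) * (t - y) * (t - w))"
  obtain \<alpha> where \<alpha>: "pf_repr ?r3 C 3 \<alpha>" using triple_repr[OF C] by blast
  have "pf_repr (\<lambda>t. 1 / (t - w)) C 1 (\<lambda>c k. if c = w then 1 else 0)"
    using C(1,4) by (auto simp: pf_repr_def if_distrib[of "\<lambda>u. u / _"] cong: if_cong)
  from pf_repr_div_linear[OF this C(3)] obtain \<beta>' where b2: "pf_repr ?r2 C 2 \<beta>'"
    by (auto simp: mult.commute numeral_2_eq_2)
  have "pf_repr ?r2 C 3 (\<lambda>c k. if c \<in> C \<and> k < 2 then \<beta>' c k else 0)"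
    unfolding pf_repr_def
  proof (intro conjI C(1) allI impI)
    fix t assume "t \<notin> C"
    then have "?r2 t = (\<Sum>c\<in>C. \<Sum>k<2. \<beta>' c k / (t - c) ^ (k + 1))" using b2 by (simp add: pf_repr_def)
    also have "\<dots> = (\<Sum>c\<in>C. \<Sum>k<3. if c \<in> C \<and> k < 2 then \<beta>' c k / (t - c) ^ (k + 1) else 0)"
      using C(1) by (intro pf_extend) auto
    finally show "?r2 t = (\<Sum>c\<in>C. \<Sum>k<3. (if c \<in> C \<and> k < 2 then \<beta>' c k else 0) / (t - c) ^ (k + 1))"
      by (simp add: if_distrib[of "\<lambda>u. u / _"] cong: if_cong)
  qed
  then obtain \<beta> where \<beta>: "pf_repr ?r2 C 3 \<beta>" by blast
  have val2: "pf_value (\<lambda>s. s ^ m) C 3 \<beta> = hom1 m y w" for m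
  proof (induction m)
    case 0
    show ?case using pf_value_one[OF \<beta> tendsto_frac_2] by simp
  next
    case (Suc m)
    have "pf_value (\<lambda>s. s ^ Suc m) C 3 \<beta> = y * pf_value (\<lambda>s. s ^ m) C 3 \<beta>
        + pf_value (\<lambda>s. s ^ m) C 3 (\<lambda>c k. if c = w then if k = 0 then 1 else 0 else 0)"
    proof (rule pf_value_power_Suc[OF \<beta> tendsto_frac_2 pf_repr_single[OF C(1,4)]])
      fix t assume "t \<notin> C"
      then have "t - y \<noteq> 0" "t - w \<noteq> 0" using C by auto
      then show "?r2 t * t = y * ?r2 t + 1 / (t - w)" by (simp add: divide_simps)
    qed
    then show ?case using Suc pf_value_single[OF C(1,4)] by simp
  qed
  have "pf_value (\<lambda>s. s ^ m) C 3 \<alpha> = hom2 m x y w"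
  proof (induction m)
    case 0
    show ?case using pf_value_one[OF \<alpha> tendsto_frac_3] by simp
  next
    case (Suc m)
    have "pf_value (\<lambda>s. s ^ Suc m) C 3 \<alpha> = x * pf_value (\<lambda>s. s ^ m) C 3 \<alpha> + pf_value (\<lambda>s. s ^ m) C 3 \<beta>"
    proof (rule pf_value_power_Suc[OF \<alpha> tendsto_frac_3 \<beta>])
      fix t assume "t \<notin> C"
      then have "t - x \<noteq> 0" "t - y \<noteq> 0" "t - w \<noteq> 0" using C by auto
      then show "?r3 t * t = x * ?r3 t + ?r2 t" by (simp add: divide_simps)
    qed
    then show ?case using Suc val2 by simp
  qed
  then show ?thesis using divdiff_3_pf_value[OF \<alpha>] by simp
qed

lemma divdiff_3_poly: "divdiff [x, y, w] (poly p) = (\<Sum>i\<le>degree p. coeff p i * hom2 i x y w)"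
proof -
  have "divdiff [x, y, w] (poly (\<Sum>i\<in>A. monom (coeff p i) i)) = (\<Sum>i\<in>A. coeff p i * hom2 i x y w)"
    if "finite A" for A
    using that
  proof induction
    case empty
    have "divdiff [x, y, w] (\<lambda>s. 0 * s ^ 0 + 0 * s ^ 0) = 0 * hom2 0 x y w + 0 * hom2 0 x y w"
      unfolding divdiff_lincomb[OF open_UNIV subset_UNIV C_k_on_power C_k_on_power] by simp
    then show ?case by simp
  next
    case (insert i A)
    have "poly (\<Sum>i\<in>insert i A. monom (coeff p i) i) = (\<lambda>s. coeff p i * s ^ i + 1 * poly (\<Sum>i\<in>A. monom (coeff p i) i) s)"
      using insert by (auto simp: poly_monom)
    then show ?case using insert
      by (simp only: divdiff_lincomb[OF open_UNIV subset_UNIV C_k_on_power C_k_on_poly[OF open_UNIV]] divdiff_3_power)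
        simp
  qed
  from this[of "{..degree p}"] show ?thesis by (simp add: poly_as_sum_of_monoms)
qed

section \<open>Continuity of three-point divided differences in the nodes\<close>

lemma tendsto_hom1:
  "(X \<longlongrightarrow> x) F \<Longrightarrow> (Y \<longlongrightarrow> y) F \<Longrightarrow> ((\<lambda>k. hom1 m (X k) (Y k)) \<longlongrightarrow> hom1 m x y) F"
  by (induction m) (auto intro!: tendsto_intros)

lemma tendsto_hom2:
  "(X \<longlongrightarrow> x) F \<Longrightarrow> (Y \<longlongrightarrow> y) F \<Longrightarrow> (W \<longlongrightarrow> w) F \<Longrightarrow>
    ((\<lambda>k. hom2 m (X k) (Y k) (W k)) \<longlongrightarrow> hom2 m x y w) F"
  by (induction m) (auto intro!: tendsto_intros tendsto_hom1)

lemma poly_antiderivative: "\<exists>P. pderiv P = (r :: real poly)"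
proof -
  have "pderiv (\<Sum>i\<le>degree r. monom (coeff r i / real (Suc i)) (Suc i)) = (\<Sum>i\<le>degree r. monom (coeff r i) i)"
    by (simp add: pderiv_sum pderiv_monom del: of_nat_Suc)
  then show ?thesis by (metis poly_as_sum_of_monoms)
qed

text \<open>Weierstrass' theorem is applied to the second derivative. Integrating the approximant
  twice, with the values of \<open>f\<close> and \<open>f'\<close> at \<open>\<alpha>\<close> as
  initial data, controls the function as well.\<close>

lemma C2_poly_approx:
  assumes f: "C_k_on 2 f I" and ab: "{\<alpha>..\<beta>} \<subseteq> I" "\<alpha> \<le> \<beta>" and e: "e > 0"
  obtains p :: "real poly" where "\<And>s. s \<in> {\<alpha>..\<beta>} \<Longrightarrow> \<bar>f s - poly p s\<bar> \<le> e"
    "\<And>s. s \<in> {\<alpha>..\<beta>} \<Longrightarrow> \<bar>(deriv ^^ 2) f s - poly ((pderiv ^^ 2) p) s\<bar> \<le> e"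
proof -
  \<comment> \<open>The error after two integrations is at most
    \<open>d (\<beta> - \<alpha>)^2\<close>; the summand 1 yields \<open>d \<le> e\<close> for the
    second derivative itself.\<close>
  define d where "d = e / (1 + (\<beta> - \<alpha>)\<^sup>2)"
  have den: "1 + (\<beta> - \<alpha>)\<^sup>2 > 0" by (simp add: add_pos_nonneg)
  have d: "d > 0" "d \<le> e" using e den by (auto simp: d_def field_simps)
  have "continuous_on {\<alpha>..\<beta>} ((deriv ^^ 2) f)" using f ab by (auto simp: C_k_on_def intro: continuous_on_subset)
  then have "\<exists>g. (\<exists>r. g = poly r) \<and> (\<forall>x\<in>{\<alpha>..\<beta>}. \<bar>(deriv ^^ 2) f x - g x\<bar> < d)"
  proof (intro Stone_Weierstrass_HOL)
    show "\<exists>p. (\<lambda>x. c) = poly p" for c :: real by (intro exI[of _ "[:c:]"]) auto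
    show "\<exists>r. (\<lambda>x. f x + g x) = poly r" if "(\<exists>r. f = poly r) \<and> (\<exists>r. g = poly r)" for f g :: "real \<Rightarrow> real"
    proof -
      from that obtain r1 r2 where "f = poly r1" "g = poly r2" by blast
      then show ?thesis by (intro exI[of _ "r1 + r2"]) auto
    qed
    show "\<exists>r. (\<lambda>x. f x * g x) = poly r" if "(\<exists>r. f = poly r) \<and> (\<exists>r. g = poly r)" for f g :: "real \<Rightarrow> real"
    proof -
      from that obtain r1 r2 where "f = poly r1" "g = poly r2" by blast
      then show ?thesis by (intro exI[of _ "r1 * r2"]) auto
    qed
    show "\<exists>f. (\<exists>r. f = poly r) \<and> f x \<noteq> f y" if "x \<in> {\<alpha>..\<beta>} \<and> y \<in> {\<alpha>..\<beta>} \<and> x \<noteq> y" for x y :: real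
      using that by (intro exI[of _ "poly [:0, 1:]"]) auto
  qed (use d in \<open>auto intro: continuous_intros\<close>)
  then obtain r where r: "\<And>x. x \<in> {\<alpha>..\<beta>} \<Longrightarrow> \<bar>(deriv ^^ 2) f x - poly r x\<bar> < d" by blast
  obtain P where P: "pderiv P = r" using poly_antiderivative by blast
  obtain Q where Q: "pderiv Q = P + [:deriv f \<alpha> - poly P \<alpha>:]" using poly_antiderivative by blast
  define p where "p = Q + [:f \<alpha> - poly Q \<alpha>:]"
  have p1: "pderiv p = P + [:deriv f \<alpha> - poly P \<alpha>:]" by (simp add: p_def Q pderiv_add pderiv_pCons)
  have p2: "(pderiv ^^ 2) p = r" by (simp add: numeral_2_eq_2 p1 P pderiv_add pderiv_pCons)
  have at\<alpha>: "poly p \<alpha> = f \<alpha>" "poly (pderiv p) \<alpha> = deriv f \<alpha>" by (simp_all add: p1) (simp add: p_def)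
  define D where "D = (\<lambda>m s. (deriv ^^ m) f s - poly ((pderiv ^^ m) p) s)"
  have D: "(D m has_real_derivative D (Suc m) s) (at s)" if "m < 2" "s \<in> {\<alpha>..\<beta>}" for m s
    unfolding D_def using that ab C_k_onD[OF f, of m s] poly_DERIV[of "(pderiv ^^ m) p" s]
    by (auto intro!: DERIV_diff)
  have bound: "\<bar>f s - poly p s\<bar> \<le> e" if s: "s \<in> {\<alpha>..\<beta>}" for s
  proof (cases "s = \<alpha>")
    case True then show ?thesis using at\<alpha> e by simp
  next
    case False
    have "\<exists>t. (if s < \<alpha> then s < t \<and> t < \<alpha> else \<alpha> < t \<and> t < s) \<and>
        D 0 s = (\<Sum>m<2. D m \<alpha> / fact m * (s - \<alpha>) ^ m) + D 2 t / fact 2 * (s - \<alpha>) ^ 2"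
      by (rule Taylor[of 2 D "D 0" \<alpha> \<beta> \<alpha> s]) (use False s ab D in auto)
    then obtain t where t: "\<alpha> < t" "t < s" "D 0 s = D 2 t / 2 * (s - \<alpha>)\<^sup>2"
      using s False at\<alpha> by (auto simp: numeral_2_eq_2 D_def split: if_splits)
    have "\<bar>D 2 t\<bar> \<le> d" using r[of t] t s unfolding D_def p2 by auto
    then have "\<bar>D 2 t / 2\<bar> * \<bar>(s - \<alpha>)\<^sup>2\<bar> \<le> d * (1 + (\<beta> - \<alpha>)\<^sup>2)"
      using s by (intro mult_mono) (auto simp: power_mono intro: add_increasing)
    also have "\<dots> = e" using den by (simp add: d_def)
    finally have "\<bar>D 0 s\<bar> \<le> e" unfolding t(3) by (simp add: abs_mult)
    then show ?thesis by (simp add: D_def)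
  qed
  show ?thesis
    by (rule that[of p]) (use bound r d p2 in fastforce)+
qed

lemma divdiff_3_approx:
  assumes f: "C_k_on 2 f I" and I: "open I" "{\<alpha>..\<beta>} \<subseteq> I" and xyw: "x \<in> {\<alpha>..\<beta>}" "y \<in> {\<alpha>..\<beta>}" "w \<in> {\<alpha>..\<beta>}"
    and p: "\<And>s. s \<in> {\<alpha>..\<beta>} \<Longrightarrow> \<bar>(deriv ^^ 2) f s - poly ((pderiv ^^ 2) p) s\<bar> \<le> e"
  shows "\<bar>divdiff [x, y, w] f - divdiff [x, y, w] (poly p)\<bar> \<le> e / 2"
proof -
  have "\<bar>divdiff [x, y, w] (\<lambda>s. 1 * f s + (- 1) * poly p s)\<bar> \<le> e / 2"
  proof (rule divdiff_3_bound[OF C_k_on_lincomb[OF I(1) f C_k_on_poly[OF I(1)]] I(2) xyw])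
    fix s assume s: "s \<in> {\<alpha>..\<beta>}"
    then show "\<bar>(deriv ^^ 2) (\<lambda>s. 1 * f s + - 1 * poly p s) s\<bar> \<le> e"
      using higher_deriv_lincomb[OF I(1) f C_k_on_poly[OF I(1), of 2 p], of 2 s 1 "-1"] I(2) p[OF s]
        higher_deriv_poly[of 2 p] by auto
  qed
  then show ?thesis
    using xyw I by (subst (asm) divdiff_lincomb[OF I(1) _ f C_k_on_poly[OF I(1)]]) auto
qed

text \<open>On polynomials the divided difference is a polynomial in the nodes, so it is continuous
  where nodes coincide, too. By the mean value theorem the approximation in C^2 is uniform in the
  nodes, which carries continuity over to \<open>f\<close>.\<close>

lemma tendsto_divdiff_3:
  assumes f: "C_k_on 2 f I" and I: "open I" "{\<alpha>..\<beta>} \<subseteq> I"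
    and lim: "(X \<longlongrightarrow> x) F" "(Y \<longlongrightarrow> y) F" "(W \<longlongrightarrow> w) F"
    and ev: "\<forall>\<^sub>F k in F. X k \<in> {\<alpha>..\<beta>}" "\<forall>\<^sub>F k in F. Y k \<in> {\<alpha>..\<beta>}" "\<forall>\<^sub>F k in F. W k \<in> {\<alpha>..\<beta>}"
    and xyw: "x \<in> {\<alpha>..\<beta>}" "y \<in> {\<alpha>..\<beta>}" "w \<in> {\<alpha>..\<beta>}"
  shows "((\<lambda>k. divdiff [X k, Y k, W k] f) \<longlongrightarrow> divdiff [x, y, w] f) F"
proof (rule tendstoI)
  fix e :: real assume e: "e > 0"
  have ab: "\<alpha> \<le> \<beta>" using xyw by simp
  obtain p where p: "\<And>s. s \<in> {\<alpha>..\<beta>} \<Longrightarrow> \<bar>(deriv ^^ 2) f s - poly ((pderiv ^^ 2) p) s\<bar> \<le> e / 2"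
    using C2_poly_approx[OF f I(2) ab, of "e / 2"] e by (metis half_gt_zero)
  have "((\<lambda>k. divdiff [X k, Y k, W k] (poly p)) \<longlongrightarrow> divdiff [x, y, w] (poly p)) F"
    unfolding divdiff_3_poly by (intro tendsto_intros tendsto_hom2 lim)
  then have "\<forall>\<^sub>F k in F. dist (divdiff [X k, Y k, W k] (poly p)) (divdiff [x, y, w] (poly p)) < e / 2"
    using e by (intro tendstoD) auto
  with ev show "\<forall>\<^sub>F k in F. dist (divdiff [X k, Y k, W k] f) (divdiff [x, y, w] f) < e"
  proof eventually_elim
    case (elim k)
    have "\<bar>divdiff [X k, Y k, W k] f - divdiff [X k, Y k, W k] (poly p)\<bar> \<le> e / 2 / 2"
      by (rule divdiff_3_approx[OF f I elim(1-3) p])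
    moreover have "\<bar>divdiff [x, y, w] f - divdiff [x, y, w] (poly p)\<bar> \<le> e / 2 / 2"
      by (rule divdiff_3_approx[OF f I xyw p])
    ultimately show ?case using elim(4) unfolding dist_real_def by linarith
  qed
qed

section \<open>Differentiability of monotone functions almost everywhere\<close>

abbreviation ivl :: "real \<times> real \<Rightarrow> real set" where "ivl i \<equiv> {fst i..snd i}"

text \<open>An interval is the ball around its midpoint, and a point only has to lie in its covering
  balls. Thus \<open>x\<close> may sit anywhere in its interval, also at an endpoint.\<close>

lemma Vitali_intervals:
  fixes A U :: "real set"
  assumes A: "\<And>x \<delta>. x \<in> A \<Longrightarrow> \<delta> > 0 \<Longrightarrow> \<exists>u v. u < v \<and> v - u < \<delta> \<and> x \<in> {u..v} \<and> R u v"
  obtains K where "countable K" "\<And>i. i \<in> K \<Longrightarrow> fst i < snd i \<and> R (fst i) (snd i)"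
    "pairwise (\<lambda>i j. disjnt (ivl i) (ivl j)) K" "negligible (A - (\<Union>i\<in>K. ivl i))"
proof -
  define K0 where "K0 = {i. fst i < snd i \<and> R (fst i) (snd i)}"
  define a r :: "real \<times> real \<Rightarrow> real" where "a = (\<lambda>i. (fst i + snd i) / 2)" and "r = (\<lambda>i. (snd i - fst i) / 2)"
  have cb: "cball (a i) (r i) = ivl i" for i
    by (auto simp: a_def r_def cball_eq_atLeastAtMost field_simps)
  obtain C where C: "countable C" "C \<subseteq> K0"
    "pairwise (\<lambda>i j. disjnt (cball (a i) (r i)) (cball (a j) (r j))) C"
    "negligible (A - (\<Union>i\<in>C. cball (a i) (r i)))"
  proof (rule Vitali_covering_theorem_cballs[of K0 r A a])
    show "0 < r i" if "i \<in> K0" for i using that by (auto simp: K0_def r_def)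
    show "\<exists>i. i \<in> K0 \<and> x \<in> cball (a i) (r i) \<and> r i < d" if x: "x \<in> A" and d: "0 < d" for x d
    proof -
      obtain u v where uv: "u < v" "v - u < d" "x \<in> {u..v}" "R u v" using A[OF x d] by blast
      then show ?thesis unfolding cb by (intro exI[of _ "(u, v)"]) (auto simp: K0_def r_def)
    qed
  qed blast
  then show ?thesis unfolding cb by (intro that[of C]) (auto simp: K0_def)
qed

context
  fixes K :: "(real \<times> real) set" and H :: "real \<Rightarrow> real"
  assumes K: "countable K" "\<And>i. i \<in> K \<Longrightarrow> fst i < snd i" "pairwise (\<lambda>i j. disjnt (ivl i) (ivl j)) K"
    and H: "mono H"
begin

lemma emeasure_UN_ivl: "emeasure lborel (\<Union>i\<in>K. ivl i) = (\<integral>\<^sup>+i. ennreal (snd i - fst i) \<partial>count_space K)"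
proof -
  have "emeasure lborel (\<Union>i\<in>K. ivl i) = (\<integral>\<^sup>+i. emeasure lborel (ivl i) \<partial>count_space K)"
    using K(1,3) by (intro emeasure_UN_countable) (auto simp: disjoint_family_on_def pairwise_def disjnt_def)
  also have "\<dots> = (\<integral>\<^sup>+i. ennreal (snd i - fst i) \<partial>count_space K)"
    using K(2) by (intro nn_integral_cong) (auto simp: less_imp_le)
  finally show ?thesis .
qed

text \<open>The image intervals are open because images of disjoint intervals may share an endpoint,
  when \<open>H\<close> is constant in between.\<close>

lemma emeasure_UN_image_ivl:
  "emeasure lborel (\<Union>i\<in>K. {H (fst i)<..<H (snd i)}) = (\<integral>\<^sup>+i. ennreal (H (snd i) - H (fst i)) \<partial>count_space K)"
proof -
  have dis: "{H (fst i)<..<H (snd i)} \<inter> {H (fst j)<..<H (snd j)} = {}" if "i \<in> K" "j \<in> K" "i \<noteq> j" for i j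
  proof -
    have "ivl i \<inter> ivl j = {}" using K(3) that by (auto simp: pairwise_def disjnt_def)
    then have "snd i < fst j \<or> snd j < fst i" using K(2)[OF that(1)] K(2)[OF that(2)]
      by (auto simp: Int_atLeastAtMost max_def min_def split: if_splits)
    then have "H (snd i) \<le> H (fst j) \<or> H (snd j) \<le> H (fst i)" using monoD[OF H] by (meson less_imp_le)
    then show ?thesis by auto
  qed
  have "emeasure lborel (\<Union>i\<in>K. {H (fst i)<..<H (snd i)}) = (\<integral>\<^sup>+i. emeasure lborel {H (fst i)<..<H (snd i)} \<partial>count_space K)"
    using K(1) dis by (intro emeasure_UN_countable) (auto simp: disjoint_family_on_def)
  also have "\<dots> = (\<integral>\<^sup>+i. ennreal (H (snd i) - H (fst i)) \<partial>count_space K)"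
    using K(2) monoD[OF H] by (intro nn_integral_cong) (auto simp: less_imp_le)
  finally show ?thesis .
qed

lemma emeasure_steep:
  assumes q: "q \<ge> 0" "\<And>i. i \<in> K \<Longrightarrow> q * (snd i - fst i) \<le> H (snd i) - H (fst i)"
  shows "ennreal q * emeasure lborel (\<Union>i\<in>K. ivl i) \<le> emeasure lborel (\<Union>i\<in>K. {H (fst i)<..<H (snd i)})"
proof -
  have "ennreal q * emeasure lborel (\<Union>i\<in>K. ivl i) = (\<integral>\<^sup>+i. ennreal q * ennreal (snd i - fst i) \<partial>count_space K)"
    unfolding emeasure_UN_ivl by (simp add: nn_integral_cmult)
  also have "\<dots> \<le> (\<integral>\<^sup>+i. ennreal (H (snd i) - H (fst i)) \<partial>count_space K)"
    using q K(2) by (intro nn_integral_mono) (auto simp: ennreal_mult[symmetric] less_imp_le intro!: ennreal_leI)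
  finally show ?thesis unfolding emeasure_UN_image_ivl .
qed

lemma emeasure_flat:
  assumes p: "p \<ge> 0" "\<And>i. i \<in> K \<Longrightarrow> H (snd i) - H (fst i) \<le> p * (snd i - fst i)"
  shows "emeasure lborel (\<Union>i\<in>K. {H (fst i)<..<H (snd i)}) \<le> ennreal p * emeasure lborel (\<Union>i\<in>K. ivl i)"
proof -
  have "(\<integral>\<^sup>+i. ennreal (H (snd i) - H (fst i)) \<partial>count_space K) \<le> (\<integral>\<^sup>+i. ennreal p * ennreal (snd i - fst i) \<partial>count_space K)"
    using p K(2) by (intro nn_integral_mono) (auto simp: ennreal_mult[symmetric] less_imp_le intro!: ennreal_leI)
  also have "\<dots> = ennreal p * emeasure lborel (\<Union>i\<in>K. ivl i)"
    unfolding emeasure_UN_ivl by (simp add: nn_integral_cmult)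
  finally show ?thesis unfolding emeasure_UN_image_ivl .
qed

lemma emeasure_image_ivl_le:
  assumes "\<And>i. i \<in> K \<Longrightarrow> ivl i \<subseteq> {\<alpha>..\<beta>}" "\<alpha> \<le> \<beta>"
  shows "emeasure lborel (\<Union>i\<in>K. {H (fst i)<..<H (snd i)}) \<le> ennreal (H \<beta> - H \<alpha>)"
proof -
  have "(\<Union>i\<in>K. {H (fst i)<..<H (snd i)}) \<subseteq> {H \<alpha>..H \<beta>}"
  proof (rule UN_least)
    fix i assume i: "i \<in> K"
    have "\<alpha> \<le> fst i" "snd i \<le> \<beta>" using assms(1)[OF i] K(2)[OF i] by auto
    then have "H \<alpha> \<le> H (fst i)" "H (snd i) \<le> H \<beta>" using monoD[OF H] by auto
    then show "{H (fst i)<..<H (snd i)} \<subseteq> {H \<alpha>..H \<beta>}" by auto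
  qed
  then have "emeasure lborel (\<Union>i\<in>K. {H (fst i)<..<H (snd i)}) \<le> emeasure lborel {H \<alpha>..H \<beta>}"
    by (intro emeasure_mono) auto
  then show ?thesis using assms(2) monoD[OF H] by simp
qed

end

lemma negligible_borel_cover:
  assumes "negligible N" obtains N' where "N' \<in> null_sets lborel" "N \<subseteq> N'"
  using assms negligible_iff_null_sets null_sets_completion_iff2 by metis

text \<open>Inside an open \<open>U\<close> around \<open>A\<close>, disjoint flat intervals
  \<open>J\<close> of slope below \<open>p\<close> cover almost all of \<open>A\<close>, and inside
  their interiors disjoint steep intervals \<open>K\<close> of slope above \<open>q\<close> do so
  again. As \<open>H\<close> is monotone, \<open>q |K| \<le> rise over K \<le> rise over J \<le> p
  |J| \<le> p |U|\<close>. Up to a null set, \<open>A\<close> thus lies in a set of measure at most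
  \<open>p / q\<close> times that of \<open>U\<close>, and iteration drives the outer measure to
  zero.\<close>

lemma negligible_oscillation:
  fixes H :: "real \<Rightarrow> real"
  assumes H: "mono H" and A: "A \<subseteq> {\<alpha><..<\<beta>}" and pq: "0 < p" "p < q"
    and P: "\<And>x \<delta>. x \<in> A \<Longrightarrow> \<delta> > 0 \<Longrightarrow> \<exists>u v. u < v \<and> v - u < \<delta> \<and> x \<in> {u..v} \<and> H v - H u < p * (v - u)"
    and Q: "\<And>x \<delta>. x \<in> A \<Longrightarrow> \<delta> > 0 \<Longrightarrow> \<exists>u v. u < v \<and> v - u < \<delta> \<and> x \<in> {u..v} \<and> H v - H u > q * (v - u)"
  shows "negligible A"
proof -
  \<comment> \<open>Halfway between \<open>p / q\<close> and 1: the gap above \<open>p / q\<close>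
    pays for enlarging the steep intervals and a null set to an open set, and
    \<open>\<rho> < 1\<close> still forces decay.\<close>
  define \<rho> where "\<rho> = (1 + p / q) / 2"
  have \<rho>: "0 < \<rho>" "\<rho> < 1" "p / q < \<rho>" using pq by (auto simp: \<rho>_def field_simps)
  define c where "c = \<bar>\<beta> - \<alpha>\<bar> + 1"
  have c: "c > 0" by (simp add: c_def)
  have step: "\<exists>U. open U \<and> A \<subseteq> U \<and> emeasure lborel U \<le> ennreal (\<rho> ^ k * c)" for k
  proof (induction k)
    case 0
    have "emeasure lborel {\<alpha><..<\<beta>} \<le> ennreal c"
      by (cases "\<alpha> \<le> \<beta>") (auto simp: c_def intro!: ennreal_leI)
    then show ?case using A by (intro exI[of _ "{\<alpha><..<\<beta>}"]) auto
  next
    case (Suc k)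
    then obtain U where U: "open U" "A \<subseteq> U" "emeasure lborel U \<le> ennreal (\<rho> ^ k * c)" by blast
    define e where "e = \<rho> ^ k * c"
    have e: "e > 0" using \<rho> c by (simp add: e_def)
    have cov: "\<exists>u v. u < v \<and> v - u < \<delta> \<and> x \<in> {u..v} \<and> {u..v} \<subseteq> U \<and> H v - H u < p * (v - u)"
      if x: "x \<in> A" and d: "\<delta> > 0" for x \<delta>
    proof -
      obtain r where r: "r > 0" "ball x r \<subseteq> U" using U x open_contains_ball by blast
      obtain u v where uv: "u < v" "v - u < min \<delta> r" "x \<in> {u..v}" "H v - H u < p * (v - u)"
        using P[OF x, of "min \<delta> r"] r d by auto
      then have "{u..v} \<subseteq> ball x r" by (auto simp: dist_real_def)
      with uv r show ?thesis by (intro exI[of _ u] exI[of _ v]) auto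
    qed
    obtain J where J: "countable J" "\<And>i. i \<in> J \<Longrightarrow> fst i < snd i \<and> ivl i \<subseteq> U \<and> H (snd i) - H (fst i) < p * (snd i - fst i)"
      "pairwise (\<lambda>i j. disjnt (ivl i) (ivl j)) J" "negligible (A - (\<Union>i\<in>J. ivl i))"
      by (rule Vitali_intervals[where A = A and R = "\<lambda>u v. {u..v} \<subseteq> U \<and> H v - H u < p * (v - u)", OF cov]) (assumption, assumption, rule that, assumption+)
    \<comment> \<open>With interiors, all small intervals around a point of \<open>V\<close> stay
      inside a single member of \<open>J\<close>; the endpoints that get lost are countably
      many.\<close>
    define V where "V = (\<Union>i\<in>J. {fst i<..<snd i})"
    have AV: "negligible (A - V)"
    proof (rule negligible_subset)
      show "negligible ((A - (\<Union>i\<in>J. ivl i)) \<union> (fst ` J \<union> snd ` J))"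
        using J by (intro negligible_Un) (auto simp: negligible_iff_null_sets intro!: null_sets_completionI countable_imp_null_set_lborel)
      show "A - V \<subseteq> (A - (\<Union>i\<in>J. ivl i)) \<union> (fst ` J \<union> snd ` J)"
      proof
        fix x assume x: "x \<in> A - V"
        show "x \<in> (A - (\<Union>i\<in>J. ivl i)) \<union> (fst ` J \<union> snd ` J)"
        proof (cases "\<exists>i\<in>J. x \<in> ivl i")
          case True
          then obtain i where i: "i \<in> J" "x \<in> ivl i" by blast
          with x have "x \<notin> {fst i<..<snd i}" by (auto simp: V_def)
          with i have "x = fst i \<or> x = snd i" by auto
          then show ?thesis using i(1) by auto
        qed (use x in auto)
      qed
    qed
    have cov2: "\<exists>u v. u < v \<and> v - u < \<delta> \<and> x \<in> {u..v} \<and> (\<exists>i\<in>J. {u..v} \<subseteq> {fst i<..<snd i}) \<and> H v - H u > q * (v - u)"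
      if x: "x \<in> A \<inter> V" and d: "\<delta> > 0" for x \<delta>
    proof -
      obtain i where i: "i \<in> J" "x \<in> {fst i<..<snd i}" using x by (auto simp: V_def)
      obtain r where r: "r > 0" "ball x r \<subseteq> {fst i<..<snd i}" using openE[OF open_greaterThanLessThan i(2)] by blast
      obtain u v where uv: "u < v" "v - u < min \<delta> r" "x \<in> {u..v}" "H v - H u > q * (v - u)"
        using Q[of x "min \<delta> r"] x r d by auto
      then have "{u..v} \<subseteq> ball x r" by (auto simp: dist_real_def)
      with uv r i show ?thesis by (intro exI[of _ u] exI[of _ v]) auto
    qed
    obtain K where K: "countable K"
      "\<And>i. i \<in> K \<Longrightarrow> fst i < snd i \<and> (\<exists>j\<in>J. ivl i \<subseteq> {fst j<..<snd j}) \<and> H (snd i) - H (fst i) > q * (snd i - fst i)"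
      "pairwise (\<lambda>i j. disjnt (ivl i) (ivl j)) K" "negligible (A \<inter> V - (\<Union>i\<in>K. ivl i))"
      by (rule Vitali_intervals[where A = "A \<inter> V" and R = "\<lambda>u v. (\<exists>i\<in>J. {u..v} \<subseteq> {fst i<..<snd i}) \<and> H v - H u > q * (v - u)", OF cov2]) (assumption, assumption, rule that, assumption+)
    have "negligible (A - (\<Union>i\<in>K. ivl i))"
      by (rule negligible_subset[OF negligible_Un[OF AV K(4)]]) auto
    then obtain N where N: "N \<in> null_sets lborel" "A - (\<Union>i\<in>K. ivl i) \<subseteq> N" using negligible_borel_cover by blast
    have "ennreal q * emeasure lborel (\<Union>i\<in>K. ivl i) \<le> emeasure lborel (\<Union>i\<in>K. {H (fst i)<..<H (snd i)})"
      using K pq H by (intro emeasure_steep) (auto simp: less_imp_le)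
    also have "\<dots> \<le> emeasure lborel (\<Union>i\<in>J. {H (fst i)<..<H (snd i)})"
    proof (rule emeasure_mono)
      show "(\<Union>i\<in>K. {H (fst i)<..<H (snd i)}) \<subseteq> (\<Union>i\<in>J. {H (fst i)<..<H (snd i)})"
      proof (rule UN_least)
        fix i assume i: "i \<in> K"
        then obtain j where j: "j \<in> J" "ivl i \<subseteq> {fst j<..<snd j}" using K(2) by blast
        have "fst i \<in> {fst j<..<snd j}" "snd i \<in> {fst j<..<snd j}"
          using subsetD[OF j(2)] K(2)[OF i] by auto
        then have "H (fst j) \<le> H (fst i)" "H (snd i) \<le> H (snd j)" by (auto intro!: monoD[OF H])
        then show "{H (fst i)<..<H (snd i)} \<subseteq> (\<Union>i\<in>J. {H (fst i)<..<H (snd i)})"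
          using j(1) by (intro subset_trans[OF _ UN_upper[OF j(1)]]) auto
      qed
    qed (auto intro!: borel_open)
    also have "\<dots> \<le> ennreal p * emeasure lborel (\<Union>i\<in>J. ivl i)"
      using J pq H by (intro emeasure_flat) (auto simp: less_imp_le)
    also have "\<dots> \<le> ennreal p * emeasure lborel U"
      using J U by (intro mult_left_mono emeasure_mono) auto
    also have "\<dots> \<le> ennreal p * ennreal e" using U(3) by (intro mult_left_mono) (auto simp: e_def)
    also have "\<dots> = ennreal q * ennreal (p / q * e)" using pq e by (simp add: ennreal_mult[symmetric])
    finally have "ennreal q * emeasure lborel (\<Union>i\<in>K. ivl i) \<le> ennreal q * ennreal (p / q * e)" .
    then have small: "emeasure lborel (\<Union>i\<in>K. ivl i) \<le> ennreal (p / q * e)"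
      using pq by (subst (asm) ennreal_mult_le_mult_iff) auto
    define B where "B = (\<Union>i\<in>K. ivl i) \<union> N"
    have ms: "(\<Union>i\<in>K. ivl i) \<in> sets borel" using K(1) by auto
    have B: "B \<in> sets borel" "emeasure lborel B = emeasure lborel (\<Union>i\<in>K. ivl i)"
      using ms N by (auto simp: B_def intro!: emeasure_Un_null_set)
    obtain W where W: "open W" "B \<subseteq> W" "emeasure lborel (W - B) < ennreal ((\<rho> - p / q) * e)"
      using outer_regular_lborel[OF B(1), of "(\<rho> - p / q) * e"] \<rho> e by auto
    have "emeasure lborel W \<le> emeasure lborel B + emeasure lborel (W - B)"
      using B W by (intro order_trans[OF _ emeasure_subadditive]) (auto intro!: emeasure_mono)
    also have "\<dots> \<le> ennreal (p / q * e) + ennreal ((\<rho> - p / q) * e)"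
      using small B W by (intro add_mono) auto
    also have "\<dots> = ennreal (\<rho> ^ Suc k * c)"
    proof -
      have nn: "0 \<le> p / q * e" "0 \<le> (\<rho> - p / q) * e" using pq \<rho> e by auto
      have "p / q * e + (\<rho> - p / q) * e = \<rho> ^ Suc k * c" by (simp add: e_def left_diff_distrib)
      then show ?thesis unfolding ennreal_plus[OF nn, symmetric] by simp
    qed
    finally have "emeasure lborel W \<le> ennreal (\<rho> ^ Suc k * c)" .
    moreover have "A \<subseteq> W" using N(2) W(2) by (auto simp: B_def)
    ultimately show ?case using W(1) by blast
  qed
  show ?thesis unfolding negligible_outer
  proof (intro allI impI)
    fix e :: real assume e: "e > 0"
    have "(\<lambda>k. \<rho> ^ k * c) \<longlonglongrightarrow> 0 * c" using \<rho> by (intro tendsto_mult LIMSEQ_power_zero tendsto_const) auto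
    then have "\<forall>\<^sub>F k in sequentially. \<rho> ^ k * c < e" using e by (intro order_tendstoD(2)) auto
    then obtain k where k: "\<rho> ^ k * c < e" by (auto simp: eventually_sequentially)
    obtain U where U: "open U" "A \<subseteq> U" "emeasure lborel U \<le> ennreal (\<rho> ^ k * c)" using step by blast
    have em: "emeasure lebesgue U \<le> ennreal (\<rho> ^ k * c)" using U by (simp add: borel_open)
    moreover have "U \<in> sets lebesgue" using U(1) by (intro sets_completionI_sets) (simp add: borel_open)
    ultimately have m1: "U \<in> lmeasurable" by (intro fmeasurableI le_less_trans[OF em]) (auto simp: ennreal_less_top)
    have m2: "measure lebesgue U \<le> \<rho> ^ k * c"
      using em \<rho> c unfolding measure_def by (intro enn2real_leI) auto
    show "\<exists>T. A \<subseteq> T \<and> T \<in> lmeasurable \<and> Sigma_Algebra.measure lebesgue T < e"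
      by (intro exI[of _ U] conjI U(2) m1 le_less_trans[OF m2 k])
  qed
qed

text \<open>Disjoint intervals of slope above \<open>q\<close> have total length at most the rise of
  \<open>H\<close> divided by \<open>q\<close>, and \<open>q\<close> is arbitrary.\<close>

lemma negligible_infinite_slope:
  fixes H :: "real \<Rightarrow> real"
  assumes H: "mono H" and A: "A \<subseteq> {\<alpha><..<\<beta>}"
    and Q: "\<And>x q \<delta>. x \<in> A \<Longrightarrow> \<delta> > 0 \<Longrightarrow> \<exists>u v. u < v \<and> v - u < \<delta> \<and> x \<in> {u..v} \<and> H v - H u > q * (v - u)"
  shows "negligible A"
proof (cases "\<alpha> < \<beta>")
  case False then show ?thesis using A by auto
next
  case ab: True
  show ?thesis unfolding negligible_outer
  proof (intro allI impI)
    fix e :: real assume e: "e > 0"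
    \<comment> \<open>The summand 1 makes \<open>q\<close> positive and the rise divided by
      \<open>q\<close> strictly smaller than \<open>e\<close>.\<close>
    define q where "q = (H \<beta> - H \<alpha> + 1) / e"
    have inc: "H \<alpha> \<le> H \<beta>" using ab monoD[OF H] by simp
    have q: "q > 0" using inc e by (simp add: q_def)
    have cov: "\<exists>u v. u < v \<and> v - u < \<delta> \<and> x \<in> {u..v} \<and> {u..v} \<subseteq> {\<alpha>..\<beta>} \<and> H v - H u > q * (v - u)"
      if x: "x \<in> A" and d: "\<delta> > 0" for x \<delta>
    proof -
      obtain r where r: "r > 0" "ball x r \<subseteq> {\<alpha><..<\<beta>}" using A x openE[OF open_greaterThanLessThan, of x \<alpha> \<beta>] by blast
      obtain u v where uv: "u < v" "v - u < min \<delta> r" "x \<in> {u..v}" "H v - H u > q * (v - u)"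
        using Q[where x = x and q = q and \<delta> = "min \<delta> r"] x r d by auto
      then have "{u..v} \<subseteq> ball x r" by (auto simp: dist_real_def)
      then have "{u..v} \<subseteq> {\<alpha>..\<beta>}" using r(2) by fastforce
      with uv show ?thesis by (intro exI[of _ u] exI[of _ v]) auto
    qed
    obtain K where K: "countable K" "\<And>i. i \<in> K \<Longrightarrow> fst i < snd i \<and> ivl i \<subseteq> {\<alpha>..\<beta>} \<and> H (snd i) - H (fst i) > q * (snd i - fst i)"
      "pairwise (\<lambda>i j. disjnt (ivl i) (ivl j)) K" "negligible (A - (\<Union>i\<in>K. ivl i))"
      by (rule Vitali_intervals[where A = A and R = "\<lambda>u v. {u..v} \<subseteq> {\<alpha>..\<beta>} \<and> H v - H u > q * (v - u)", OF cov]) (assumption, assumption, rule that, assumption+)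
    have "ennreal q * emeasure lborel (\<Union>i\<in>K. ivl i) \<le> emeasure lborel (\<Union>i\<in>K. {H (fst i)<..<H (snd i)})"
      using K q H by (intro emeasure_steep) (auto simp: less_imp_le)
    also have "\<dots> \<le> ennreal (H \<beta> - H \<alpha>)"
      using K H ab by (intro emeasure_image_ivl_le) auto
    also have "\<dots> = ennreal q * ennreal ((H \<beta> - H \<alpha>) / q)" using q inc by (simp add: ennreal_mult[symmetric])
    finally have small: "emeasure lborel (\<Union>i\<in>K. ivl i) \<le> ennreal ((H \<beta> - H \<alpha>) / q)"
      using q by (subst (asm) ennreal_mult_le_mult_iff) auto
    obtain N where N: "N \<in> null_sets lborel" "A - (\<Union>i\<in>K. ivl i) \<subseteq> N" using negligible_borel_cover[OF K(4)] by blast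
    define B where "B = (\<Union>i\<in>K. ivl i) \<union> N"
    have ms: "(\<Union>i\<in>K. ivl i) \<in> sets borel" using K(1) by auto
    have B: "B \<in> sets borel" "emeasure lborel B = emeasure lborel (\<Union>i\<in>K. ivl i)"
      using ms N by (auto simp: B_def intro!: emeasure_Un_null_set)
    have em: "emeasure lebesgue B \<le> ennreal ((H \<beta> - H \<alpha>) / q)" using B small by simp
    moreover have "B \<in> sets lebesgue" using B(1) by (intro sets_completionI_sets) simp
    ultimately have "B \<in> lmeasurable" by (intro fmeasurableI le_less_trans[OF em]) (auto simp: ennreal_less_top)
    moreover have "measure lebesgue B \<le> (H \<beta> - H \<alpha>) / q"
      using em q inc unfolding measure_def by (intro enn2real_leI) auto
    moreover have "(H \<beta> - H \<alpha>) / q < e" using e inc by (simp add: q_def field_simps)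
    ultimately show "\<exists>T. A \<subseteq> T \<and> T \<in> lmeasurable \<and> Sigma_Algebra.measure lebesgue T < e"
      using N(2) by (intro exI[of _ B]) (auto simp: B_def)
  qed
qed

text \<open>\<open>L\<close> is the limes superior. If values frequently fell below some
  \<open>a < L\<close>, two rationals between \<open>a\<close> and \<open>L\<close> would frequently
  be undershot and exceeded. Rational thresholds make the exceptional set a countable union later
  on.\<close>

lemma tendsto_if_no_oscillation:
  fixes g :: "'a \<Rightarrow> real"
  assumes F: "F \<noteq> bot" and ev: "\<forall>\<^sub>F x in F. 0 \<le> g x" "\<forall>\<^sub>F x in F. g x \<le> c0"
    and osc: "\<And>p q. p \<in> \<rat> \<Longrightarrow> q \<in> \<rat> \<Longrightarrow> 0 < p \<Longrightarrow> p < q \<Longrightarrow> \<not> ((\<exists>\<^sub>F x in F. g x < p) \<and> (\<exists>\<^sub>F x in F. g x > q))"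
  shows "\<exists>L. (g \<longlongrightarrow> L) F"
proof -
  define S where "S = {c. \<forall>\<^sub>F x in F. g x \<le> c}"
  have S0: "0 \<le> c" if "c \<in> S" for c
  proof -
    have "\<forall>\<^sub>F x in F. 0 \<le> c" using ev(1) that unfolding S_def mem_Collect_eq by eventually_elim simp
    then show ?thesis using F by (simp add: eventually_const)
  qed
  have S: "S \<noteq> {}" "bdd_below S" using ev(2) S0 by (auto simp: S_def bdd_below_def)
  define L where "L = Inf S"
  have "(g \<longlongrightarrow> L) F"
  proof (rule order_tendstoI)
    fix a assume "a < L"
    show "\<forall>\<^sub>F x in F. a < g x"
    proof (cases "a < 0")
      case True then show ?thesis using ev(1) by (auto elim: eventually_mono)
    next
      case False
      obtain q where q: "q \<in> \<rat>" "a < q" "q < L" using Rats_dense_in_real[OF \<open>a < L\<close>] by blast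
      obtain p where p: "p \<in> \<rat>" "a < p" "p < q" using Rats_dense_in_real[OF q(2)] by blast
      have "q \<notin> S" using q(3) S(2) cInf_lower[of q S] by (auto simp: L_def)
      then have "\<exists>\<^sub>F x in F. g x > q" by (simp add: S_def frequently_def not_less)
      then have "\<not> (\<exists>\<^sub>F x in F. g x < p)" using osc[of p q] p q False by auto
      then have "\<forall>\<^sub>F x in F. p \<le> g x" by (simp add: frequently_def not_less)
      then show ?thesis by eventually_elim (use p in auto)
    qed
  next
    fix a assume "L < a"
    then obtain c where c: "c \<in> S" "c < a" using S cInf_lessD[of S a] by (auto simp: L_def)
    then have "\<forall>\<^sub>F x in F. g x \<le> c" by (simp add: S_def)
    then show "\<forall>\<^sub>F x in F. g x < a" by eventually_elim (use c in auto)
  qed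
  then show ?thesis by blast
qed

section \<open>Lebesgue's theorem and increments of monotone functions\<close>

lemma frequently_at_intervals:
  fixes H :: "real \<Rightarrow> real"
  assumes fr: "\<exists>\<^sub>F y in at x. P ((H y - H x) / (y - x))" and d: "\<delta> > 0"
  shows "\<exists>u v. u < v \<and> v - u < \<delta> \<and> x \<in> {u..v} \<and> P ((H v - H u) / (v - u))"
proof -
  have "\<forall>\<^sub>F y in at x. \<bar>y - x\<bar> < \<delta> \<and> y \<noteq> x"
    unfolding eventually_at using d by (intro exI[of _ \<delta>]) (auto simp: dist_real_def)
  with fr have "\<exists>\<^sub>F y in at x. P ((H y - H x) / (y - x)) \<and> \<bar>y - x\<bar> < \<delta> \<and> y \<noteq> x"
    by (rule frequently_eventually_frequently)
  then obtain y where y: "P ((H y - H x) / (y - x))" "\<bar>y - x\<bar> < \<delta>" "y \<noteq> x"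
    using frequently_ex by blast
  show ?thesis
  proof (cases "y < x")
    case True
    have "(H y - H x) / (y - x) = (H x - H y) / (x - y)" using True by (simp add: field_simps)
    with True y show ?thesis by (intro exI[of _ y] exI[of _ x]) auto
  qed (use y in \<open>intro exI[of _ x] exI[of _ y], auto\<close>)
qed

text \<open>Countably many null sets account for infinite upper slope and for oscillation between
  rational slopes. The windows indexed by \<open>k\<close> are there because the covering arguments
  start from a bounded interval.\<close>

theorem mono_differentiable_ae:
  fixes H :: "real \<Rightarrow> real"
  assumes H: "mono H"
  shows "negligible {x. \<not> H differentiable (at x)}"
proof -
  define P where "P = (\<lambda>p x. \<forall>\<delta>>0. \<exists>u v. u < v \<and> v - u < \<delta> \<and> x \<in> {u..v} \<and> H v - H u < p * (v - u))"
  define Q where "Q = (\<lambda>q x. \<forall>\<delta>>0. \<exists>u v. u < v \<and> v - u < \<delta> \<and> x \<in> {u..v} \<and> H v - H u > q * (v - u))"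
  define T :: "(real \<times> real) set" where "T = {(p, q). p \<in> \<rat> \<and> q \<in> \<rat> \<and> 0 < p \<and> p < q}"
  define B where "B = (\<lambda>k::nat. {x. x \<in> {- real k<..<real k} \<and> (\<forall>q. Q q x)})"
  define A where "A = (\<lambda>(k::nat) (p, q). {x. x \<in> {- real k<..<real k} \<and> P p x \<and> Q q x})"
  have "T \<subseteq> \<rat> \<times> \<rat>" by (auto simp: T_def)
  then have T: "countable T" using countable_SIGMA countable_rat by (metis countable_subset)
  have "negligible (B k)" for k
    by (rule negligible_infinite_slope[OF H, of _ "- real k" "real k"]) (auto simp: B_def Q_def)
  moreover have "negligible (A k t)" if "t \<in> T" for k t
  proof -
    obtain p q where t: "t = (p, q)" by fastforce
    show ?thesis unfolding t
      by (rule negligible_oscillation[OF H, of _ "- real k" "real k" p q])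
        (use that t in \<open>auto simp: A_def P_def Q_def T_def\<close>)
  qed
  ultimately have neg: "negligible ((\<Union>k. B k) \<union> (\<Union>k. \<Union>t\<in>T. A k t))"
    using T by (intro negligible_Un negligible_countable_Union) (auto intro!: negligible_countable_Union)
  show ?thesis
  proof (rule negligible_subset[OF neg], rule subsetI, rule ccontr)
    fix x assume "x \<in> {x. \<not> H differentiable (at x)}" and x: "x \<notin> (\<Union>k. B k) \<union> (\<Union>k. \<Union>t\<in>T. A k t)"
    obtain k :: nat where "\<bar>x\<bar> < real k" using reals_Archimedean2 by blast
    then have k: "x \<in> {- real k<..<real k}" by auto
    have "x \<notin> B k" using x by blast
    then obtain q0 where q0: "\<not> Q q0 x" using k by (auto simp: B_def)
    define g where "g = (\<lambda>y. (H y - H x) / (y - x))"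
    have slope: "(H v - H u > c * (v - u)) = ((H v - H u) / (v - u) > c)"
      "(H v - H u < c * (v - u)) = ((H v - H u) / (v - u) < c)" if "u < v" for u v c
      using that by (auto simp: field_simps)
    have frQ: "Q c x" if "\<exists>\<^sub>F y in at x. g y > c" for c
      unfolding Q_def
    proof (intro allI impI)
      fix \<delta> :: real assume "\<delta> > 0"
      from frequently_at_intervals[of "\<lambda>s. s > c", OF that[unfolded g_def] this]
      show "\<exists>u v. u < v \<and> v - u < \<delta> \<and> x \<in> {u..v} \<and> H v - H u > c * (v - u)"
        using slope(1) by blast
    qed
    have frP: "P c x" if "\<exists>\<^sub>F y in at x. g y < c" for c
      unfolding P_def
    proof (intro allI impI)
      fix \<delta> :: real assume "\<delta> > 0"
      from frequently_at_intervals[of "\<lambda>s. s < c", OF that[unfolded g_def] this]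
      show "\<exists>u v. u < v \<and> v - u < \<delta> \<and> x \<in> {u..v} \<and> H v - H u < c * (v - u)"
        using slope(2) by blast
    qed
    have "\<exists>L. (g \<longlongrightarrow> L) (at x)"
    proof (rule tendsto_if_no_oscillation)
      show "\<forall>\<^sub>F y in at x. 0 \<le> g y"
      proof (rule always_eventually, rule allI)
        fix y show "0 \<le> g y" using monoD[OF H, of x y] monoD[OF H, of y x]
          by (cases "x \<le> y") (auto simp: g_def divide_nonneg_nonneg divide_nonpos_nonpos)
      qed
      show "\<forall>\<^sub>F y in at x. g y \<le> q0" using frQ[of q0] q0 by (auto simp: frequently_def not_less)
      show "\<not> ((\<exists>\<^sub>F x in at x. g x < p) \<and> (\<exists>\<^sub>F x in at x. q < g x))"
        if "p \<in> \<rat>" "q \<in> \<rat>" "0 < p" "p < q" for p q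
      proof
        assume "(\<exists>\<^sub>F x in at x. g x < p) \<and> (\<exists>\<^sub>F x in at x. q < g x)"
        then have "x \<in> A k (p, q)" using frP frQ k by (auto simp: A_def)
        moreover have "(p, q) \<in> T" using that by (auto simp: T_def)
        ultimately show False using x by blast
      qed
    qed simp
    then have "H differentiable (at x)"
      unfolding g_def real_differentiable_def has_field_derivative_iff .
    then show False using \<open>x \<in> {x. \<not> H differentiable (at x)}\<close> by simp
  qed
qed

text \<open>Otherwise the average slope \<open>s\<close> is below \<open>L\<close>, and with
  \<open>s < l < L\<close> disjoint intervals of slope above \<open>l\<close> cover almost all of
  the interval, which gives too large a rise. Only a lower bound can be expected, because jumps and
  singular parts of \<open>H\<close> add to the increment.\<close>

theorem mono_increment_ge:
  fixes H :: "real \<Rightarrow> real"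
  assumes H: "mono H" and ab: "\<alpha> \<le> \<beta>" and L: "L \<ge> 0"
    and neg: "negligible {x \<in> {\<alpha><..<\<beta>}. \<not> (\<exists>d\<ge>L. (H has_real_derivative d) (at x))}"
  shows "L * (\<beta> - \<alpha>) \<le> H \<beta> - H \<alpha>"
proof (rule ccontr)
  assume "\<not> ?thesis"
  then have lt: "H \<beta> - H \<alpha> < L * (\<beta> - \<alpha>)" by simp
  have inc: "H \<alpha> \<le> H \<beta>" using ab monoD[OF H] by simp
  have ba: "\<beta> - \<alpha> > 0" using lt inc ab by (cases "\<alpha> = \<beta>") auto
  define s where "s = (H \<beta> - H \<alpha>) / (\<beta> - \<alpha>)"
  have s: "0 \<le> s" "s < L" using lt inc ba by (auto simp: s_def field_simps)
  define l where "l = (s + L) / 2"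
  have l: "s < l" "l < L" "0 < l" using s by (auto simp: l_def)
  define A where "A = {x \<in> {\<alpha><..<\<beta>}. \<exists>d\<ge>L. (H has_real_derivative d) (at x)}"
  have cov: "\<exists>u v. u < v \<and> v - u < \<delta> \<and> x \<in> {u..v} \<and> {u..v} \<subseteq> {\<alpha>..\<beta>} \<and> H v - H u > l * (v - u)"
    if x: "x \<in> A" and d: "\<delta> > 0" for x \<delta>
  proof -
    obtain r where r: "r > 0" "ball x r \<subseteq> {\<alpha><..<\<beta>}" using x openE[OF open_greaterThanLessThan, of x \<alpha> \<beta>] unfolding A_def by blast
    obtain d where "d \<ge> L" "(H has_real_derivative d) (at x)" using x by (auto simp: A_def)
    then have "((\<lambda>y. (H y - H x) / (y - x)) \<longlongrightarrow> d) (at x)" "l < d" using l by (auto simp: has_field_derivative_iff)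
    then have "\<exists>\<^sub>F y in at x. (H y - H x) / (y - x) > l"
      by (intro eventually_frequently order_tendstoD(1)) auto
    from frequently_at_intervals[of "\<lambda>c. c > l", OF this, of "min \<delta> r"] obtain u v
      where uv: "u < v" "v - u < min \<delta> r" "x \<in> {u..v}" "(H v - H u) / (v - u) > l" using r \<open>\<delta> > 0\<close> by auto
    then have "{u..v} \<subseteq> ball x r" by (auto simp: dist_real_def)
    then have "{u..v} \<subseteq> {\<alpha>..\<beta>}" using r(2) by fastforce
    with uv show ?thesis by (intro exI[of _ u] exI[of _ v]) (auto simp: field_simps)
  qed
  obtain K where K: "countable K" "\<And>i. i \<in> K \<Longrightarrow> fst i < snd i \<and> ivl i \<subseteq> {\<alpha>..\<beta>} \<and> H (snd i) - H (fst i) > l * (snd i - fst i)"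
    "pairwise (\<lambda>i j. disjnt (ivl i) (ivl j)) K" "negligible (A - (\<Union>i\<in>K. ivl i))"
    by (rule Vitali_intervals[where A = A and R = "\<lambda>u v. {u..v} \<subseteq> {\<alpha>..\<beta>} \<and> H v - H u > l * (v - u)", OF cov]) (assumption, assumption, rule that, assumption+)
  have "negligible ({\<alpha><..<\<beta>} - (\<Union>i\<in>K. ivl i))"
    by (rule negligible_subset[OF negligible_Un[OF neg K(4)]]) (auto simp: A_def)
  then obtain N where N: "N \<in> null_sets lborel" "{\<alpha><..<\<beta>} - (\<Union>i\<in>K. ivl i) \<subseteq> N" using negligible_borel_cover by blast
  have ms: "(\<Union>i\<in>K. ivl i) \<in> sets borel" using K(1) by auto
  have "ennreal (\<beta> - \<alpha>) = emeasure lborel {\<alpha><..<\<beta>}" using ab by simp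
  also have "\<dots> \<le> emeasure lborel ((\<Union>i\<in>K. ivl i) \<union> N)" using N ms by (intro emeasure_mono) auto
  also have "\<dots> = emeasure lborel (\<Union>i\<in>K. ivl i)" using N ms by (intro emeasure_Un_null_set) auto
  finally have "ennreal l * ennreal (\<beta> - \<alpha>) \<le> ennreal l * emeasure lborel (\<Union>i\<in>K. ivl i)" by (intro mult_left_mono) auto
  also have "\<dots> \<le> emeasure lborel (\<Union>i\<in>K. {H (fst i)<..<H (snd i)})"
    using K l H by (intro emeasure_steep) (auto simp: less_imp_le)
  also have "\<dots> \<le> ennreal (H \<beta> - H \<alpha>)"
    using K H ab by (intro emeasure_image_ivl_le) auto
  finally have "ennreal (l * (\<beta> - \<alpha>)) \<le> ennreal (H \<beta> - H \<alpha>)" using l ba by (simp add: ennreal_mult)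
  then have "l * (\<beta> - \<alpha>) \<le> H \<beta> - H \<alpha>" using inc by (simp add: ennreal_le_iff)
  then have "l \<le> s" using ba by (simp add: s_def field_simps)
  with l show False by simp
qed

section \<open>Almost everywhere derivatives of higher-order convex functions\<close>

text \<open>For convex \<open>u\<close> the slopes are monotone in \<open>t\<close>, so the infimum is the right derivative.\<close>

definition rderiv :: "real set \<Rightarrow> (real \<Rightarrow> real) \<Rightarrow> real \<Rightarrow> real" where
  "rderiv I u s = Inf ((\<lambda>t. (u s - u t) / (s - t)) ` ({s<..} \<inter> I))"

section \<open>Right derivatives of convex functions\<close>

context
  fixes I :: "real set" and u :: "real \<Rightarrow> real"
  assumes I: "open I" and u: "convex_on I u"
begin

lemma rderiv_subgradient: "s \<in> I \<Longrightarrow> y \<in> I \<Longrightarrow> u s + rderiv I u s * (y - s) \<le> u y"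
  unfolding rderiv_def using convex_le_Inf_differential[OF u, of s y] interior_open[OF I] by simp

lemma rderiv_mono: "s \<in> I \<Longrightarrow> t \<in> I \<Longrightarrow> s \<le> t \<Longrightarrow> rderiv I u s \<le> rderiv I u t"
proof -
  assume st: "s \<in> I" "t \<in> I" "s \<le> t"
  have "(rderiv I u s - rderiv I u t) * (t - s) \<le> 0"
    using rderiv_subgradient[OF st(1,2)] rderiv_subgradient[OF st(2,1)] by (simp add: algebra_simps)
  then show ?thesis using st(3) by (cases "s = t") (auto simp: mult_le_0_iff)
qed

lemma rderiv_eq_derivative:
  assumes s: "s \<in> I" and d: "(u has_real_derivative d) (at s)"
  shows "rderiv I u s = d"
proof -
  obtain e where e: "e > 0" "ball s e \<subseteq> I" using openE[OF I s] by blast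
  have "((\<lambda>y. u y - rderiv I u s * y) has_real_derivative d - rderiv I u s) (at s)"
    using d by (auto intro!: derivative_eq_intros)
  then have "d - rderiv I u s = 0"
  proof (rule DERIV_local_min[OF _ e(1)], intro allI impI)
    fix y assume "\<bar>s - y\<bar> < e"
    then have "y \<in> I" using e by (auto simp: dist_real_def)
    from rderiv_subgradient[OF s this]
    show "u s - rderiv I u s * s \<le> u y - rderiv I u s * y" by (simp add: algebra_simps)
  qed
  then show ?thesis by simp
qed

lemma rderiv_has_right_derivative:
  assumes s: "s \<in> I" shows "(u has_real_derivative rderiv I u s) (at s within {s..})"
proof -
  define g where "g = (\<lambda>t. (u t - u s) / (t - s))"
  have g: "g t = (u s - u t) / (s - t)" for t unfolding g_def by (metis minus_diff_eq minus_divide_divide)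
  obtain e where e: "e > 0" "ball s e \<subseteq> I" using openE[OF I s] by blast
  have lower: "rderiv I u s \<le> g t" if "t \<in> I" "s < t" for t
    using rderiv_subgradient[OF s that(1)] that(2) by (simp add: g_def field_simps)
  have "s + e / 2 \<in> ball s e" using e by (auto simp: dist_real_def)
  then have ne: "{s<..} \<inter> I \<noteq> {}" using e by (intro ex_in_conv[THEN iffD1] exI[of _ "s + e / 2"]) auto
  have "(g \<longlongrightarrow> rderiv I u s) (at_right s)"
  proof (rule order_tendstoI)
    fix a assume a: "a < rderiv I u s"
    have "\<forall>\<^sub>F t in at_right s. t \<in> {s<..<s + e}" by (rule eventually_at_right_real) (use e in simp)
    then show "\<forall>\<^sub>F t in at_right s. a < g t"
    proof eventually_elim
      case (elim t)
      then have "t \<in> I" using e by (auto simp: dist_real_def)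
      with lower[of t] elim a show ?case by auto
    qed
  next
    fix a assume "rderiv I u s < a"
    then obtain t0 where t0: "t0 \<in> I" "s < t0" "g t0 < a"
      using cInf_lessD[of "(\<lambda>t. (u s - u t) / (s - t)) ` ({s<..} \<inter> I)" a] ne
      unfolding rderiv_def g by auto
    have "\<forall>\<^sub>F t in at_right s. t \<in> {s<..<t0}" by (rule eventually_at_right_real) (use t0 in simp)
    then show "\<forall>\<^sub>F t in at_right s. g t < a"
    proof eventually_elim
      case (elim t)
      define k where "k = (t - s) / (t0 - s)"
      have "k * (t0 - s) = t - s" using elim t0 by (simp add: k_def)
      then have "t = (1 - k) * s + k * t0" by (simp add: algebra_simps)
      moreover have "0 < k" "k < 1" using elim t0 by (auto simp: k_def)
      ultimately have k: "0 < k" "k < 1" "t = (1 - k) * s + k * t0" by auto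
      then have "u t \<le> (1 - k) * u s + k * u t0"
        using convex_onD[OF u, of k s t0] s t0 by auto
      then have "u t - u s \<le> (u t0 - u s) * k" by (simp add: algebra_simps)
      then have "g t \<le> g t0" using elim t0 by (simp add: g_def k_def field_simps)
      then show ?case using t0 by simp
    qed
  qed
  moreover have "at s within {s..} = at_right s"
    by (metis at_within_Icc_at_right at_within_Ici_at_right)
  ultimately show ?thesis unfolding has_field_derivative_iff g_def by simp
qed

text \<open>The difference quotient between \<open>s\<close> and \<open>y\<close> lies between the
  right derivatives at these two points.\<close>

lemma derivative_of_rderiv_isCont:
  assumes s: "s \<in> I" and c: "isCont (rderiv I u) s"
  shows "(u has_real_derivative rderiv I u s) (at s)"
  unfolding has_field_derivative_iff
proof (rule LIM_zero_cancel, rule Lim_null_comparison)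
  show "((\<lambda>y. \<bar>rderiv I u y - rderiv I u s\<bar>) \<longlongrightarrow> 0) (at s)"
    using c by (intro tendsto_rabs_zero LIM_zero) (simp add: isCont_def)
  obtain e where e: "e > 0" "ball s e \<subseteq> I" using openE[OF I s] by blast
  have "\<forall>\<^sub>F y in at s. y \<in> I \<and> y \<noteq> s"
    unfolding eventually_at using e by (intro exI[of _ e]) (auto simp: dist_commute)
  then show "\<forall>\<^sub>F y in at s. norm ((u y - u s) / (y - s) - rderiv I u s) \<le> \<bar>rderiv I u y - rderiv I u s\<bar>"
  proof eventually_elim
    case (elim y)
    then have y: "y \<in> I" "y \<noteq> s" by auto
    have 1: "rderiv I u s * (y - s) \<le> u y - u s" using rderiv_subgradient[OF s y(1)] by simp
    have 2: "u y - u s \<le> rderiv I u y * (y - s)" using rderiv_subgradient[OF y(1) s] by (simp add: algebra_simps)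
    show ?case
    proof (cases "s < y")
      case True
      then have "rderiv I u s \<le> (u y - u s) / (y - s)" "(u y - u s) / (y - s) \<le> rderiv I u y"
        using 1 2 by (auto simp: field_simps)
      then show ?thesis by simp
    next
      case False
      then have "y < s" using y by simp
      then have "(u y - u s) / (y - s) \<le> rderiv I u s" "rderiv I u y \<le> (u y - u s) / (y - s)"
        using 1 2 by (auto simp: field_simps)
      then show ?thesis by simp
    qed
  qed
qed

lemma convex_on_lipschitz:
  assumes "{\<alpha>..\<beta>} \<subseteq> I" "x \<in> {\<alpha>..\<beta>}" "y \<in> {\<alpha>..\<beta>}"
  shows "\<bar>u y - u x\<bar> \<le> (\<bar>rderiv I u \<alpha>\<bar> + \<bar>rderiv I u \<beta>\<bar>) * \<bar>y - x\<bar>"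
proof -
  let ?M = "\<bar>rderiv I u \<alpha>\<bar> + \<bar>rderiv I u \<beta>\<bar>"
  have M: "\<bar>rderiv I u z\<bar> \<le> ?M" if "z \<in> {\<alpha>..\<beta>}" for z
    using rderiv_mono[of \<alpha> z] rderiv_mono[of z \<beta>] assms that by (auto simp: subset_iff)
  have "u y - u x \<le> \<bar>rderiv I u y\<bar> * \<bar>y - x\<bar>" "u x - u y \<le> \<bar>rderiv I u x\<bar> * \<bar>y - x\<bar>"
  proof -
    have xy: "x \<in> I" "y \<in> I" using assms by auto
    have "u y - u x \<le> rderiv I u y * (y - x)" using rderiv_subgradient[OF xy(2,1)] by (simp add: algebra_simps)
    also have "\<dots> \<le> \<bar>rderiv I u y\<bar> * \<bar>y - x\<bar>" by (metis abs_ge_self abs_mult)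
    finally show "u y - u x \<le> \<bar>rderiv I u y\<bar> * \<bar>y - x\<bar>" .
    have "u x - u y \<le> rderiv I u x * (x - y)" using rderiv_subgradient[OF xy] by (simp add: algebra_simps)
    also have "\<dots> \<le> \<bar>rderiv I u x\<bar> * \<bar>y - x\<bar>" by (metis abs_ge_self abs_minus_commute abs_mult)
    finally show "u x - u y \<le> \<bar>rderiv I u x\<bar> * \<bar>y - x\<bar>" .
  qed
  moreover have "\<bar>rderiv I u z\<bar> * \<bar>y - x\<bar> \<le> ?M * \<bar>y - x\<bar>" if "z \<in> {\<alpha>..\<beta>}" for z
    using M[OF that] by (intro mult_right_mono) auto
  ultimately show ?thesis using assms(2,3) by (smt (verit))
qed

end

text \<open>Freezing a function outside \<open>[\<alpha>, \<beta>]\<close> turns monotonicity on the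
  interval into monotonicity on the line, to which the theorems above apply, and changes no
  derivative inside.\<close>

definition clamp_real :: "real \<Rightarrow> real \<Rightarrow> real \<Rightarrow> real" where
  "clamp_real \<alpha> \<beta> x = max \<alpha> (min \<beta> x)"

lemma mono_clamp:
  assumes "\<alpha> \<le> \<beta>" "\<And>x y. \<alpha> \<le> x \<Longrightarrow> x \<le> y \<Longrightarrow> y \<le> \<beta> \<Longrightarrow> H x \<le> (H y :: real)"
  shows "mono (\<lambda>x. H (clamp_real \<alpha> \<beta> x))"
  by (rule monoI, rule assms(2)) (use assms(1) in \<open>auto simp: clamp_real_def\<close>)

lemma clamp_derivative_iff:
  assumes "x \<in> {\<alpha><..<\<beta>}"
  shows "((\<lambda>x. H (clamp_real \<alpha> \<beta> x)) has_real_derivative d) (at x) \<longleftrightarrow> (H has_real_derivative d) (at x)"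
  by (rule DERIV_cong_ev)
    (use assms in \<open>auto simp: clamp_real_def eventually_nhds intro!: exI[of _ "{\<alpha><..<\<beta>}"]\<close>)

lemma mono_on_differentiable_ae:
  fixes I :: "real set"
  assumes I: "open I" and H: "\<And>x y. x \<in> I \<Longrightarrow> y \<in> I \<Longrightarrow> x \<le> y \<Longrightarrow> H x \<le> (H y :: real)"
  shows "negligible {t \<in> I. \<not> H differentiable (at t)}"
proof -
  \<comment> \<open>Countably many intervals with rational endpoints and closure in \<open>I\<close>
    are enough to cover \<open>I\<close>.\<close>
  define T :: "(real \<times> real) set" where "T = {(p, q). p \<in> \<rat> \<and> q \<in> \<rat> \<and> {p..q} \<subseteq> I \<and> p < q}"
  have "T \<subseteq> \<rat> \<times> \<rat>" by (auto simp: T_def)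
  then have T: "countable T" using countable_SIGMA countable_rat by (metis countable_subset)
  have "negligible {t \<in> {fst i<..<snd i}. \<not> H differentiable (at t)}" if "i \<in> T" for i
  proof (rule negligible_subset[OF mono_differentiable_ae[OF mono_clamp[of "fst i" "snd i" H]]])
    show "{t \<in> {fst i<..<snd i}. \<not> H differentiable (at t)}
        \<subseteq> {x. \<not> (\<lambda>x. H (clamp_real (fst i) (snd i) x)) differentiable (at x)}"
      by (auto simp: real_differentiable_def clamp_derivative_iff)
  qed (use that H in \<open>auto simp: T_def subset_iff\<close>)
  then have "negligible (\<Union>i\<in>T. {t \<in> {fst i<..<snd i}. \<not> H differentiable (at t)})"
    using T by (intro negligible_countable_Union) auto
  then show ?thesis
  proof (rule negligible_subset, intro subsetI)
    fix t assume t: "t \<in> {t \<in> I. \<not> H differentiable (at t)}"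
    then obtain e where e: "e > 0" "ball t e \<subseteq> I" using openE[OF I] by blast
    obtain p where p: "p \<in> \<rat>" "t - e < p" "p < t" using Rats_dense_in_real[of "t - e" t] e by auto
    obtain q where q: "q \<in> \<rat>" "t < q" "q < t + e" using Rats_dense_in_real[of t "t + e"] e by auto
    have "{p..q} \<subseteq> ball t e" using p q by (auto simp: dist_real_def)
    then have "(p, q) \<in> T" using p q e by (auto simp: T_def)
    then show "t \<in> (\<Union>i\<in>T. {t \<in> {fst i<..<snd i}. \<not> H differentiable (at t)})"
      using t p q by force
  qed
qed

text \<open>Continuous induction: the inequality with the smaller slope \<open>c - e\<close> holds
  up to a supremum \<open>z\<close>, at \<open>z\<close> by continuity, and beyond \<open>z\<close>
  by the right derivative there, unless \<open>z = y\<close>. The loss \<open>e\<close> provides the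
  strict inequality needed to pass beyond \<open>z\<close>.\<close>

lemma right_derivative_ge_imp_increment:
  fixes K :: "real \<Rightarrow> real"
  assumes xy: "x \<le> y" and cont: "continuous_on {x..y} K"
    and der: "\<And>s. x \<le> s \<Longrightarrow> s < y \<Longrightarrow> \<exists>d\<ge>c. (K has_real_derivative d) (at s within {s..})"
  shows "c * (y - x) \<le> K y - K x"
proof (rule field_le_epsilon)
  fix e0 :: real assume e0: "e0 > 0"
  define e where "e = e0 / (1 + (y - x))"
  have e: "e > 0" "e * (y - x) \<le> e0" using e0 xy by (auto simp: e_def field_simps)
  define G where "G = (\<lambda>s. K s - K x - (c - e) * (s - x))"
  define A where "A = {s \<in> {x..y}. \<forall>r\<in>{x..s}. 0 \<le> G r}"
  have xA: "x \<in> A" using xy by (auto simp: A_def G_def)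
  have bdd: "bdd_above A" by (auto simp: A_def intro!: bdd_aboveI[of _ y])
  define z where "z = Sup A"
  have zxy: "x \<le> z" "z \<le> y"
    using xA bdd by (auto simp: z_def A_def intro!: cSup_upper cSup_least)
  have Gc: "continuous_on {x..y} G" unfolding G_def by (intro continuous_intros cont)
  have below: "0 \<le> G r" if r: "x \<le> r" "r < z" for r
  proof -
    obtain s where "s \<in> A" "r < s" using less_cSupD[of A r] r xA by (auto simp: z_def)
    then show ?thesis using r by (auto simp: A_def)
  qed
  have Gz: "0 \<le> G z"
  proof (cases "x = z")
    case True then show ?thesis by (simp add: G_def)
  next
    case False
    then have xz: "x < z" using zxy by simp
    have "(G \<longlongrightarrow> G z) (at z within {x..y})" using Gc zxy by (simp add: continuous_on_def)
    then have "(G \<longlongrightarrow> G z) (at z within {x..z})" by (rule tendsto_within_subset) (use zxy in auto)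
    then have lim: "(G \<longlongrightarrow> G z) (at_left z)" using at_within_Icc_at_left[OF xz] by simp
    have "\<forall>\<^sub>F r in at_left z. r \<in> {x<..<z}" by (rule eventually_at_left_real) (use xz in simp)
    then have "\<forall>\<^sub>F r in at_left z. 0 \<le> G r" by eventually_elim (use below in auto)
    then show ?thesis by (rule tendsto_lowerbound[OF lim]) simp
  qed
  have upto: "0 \<le> G r" if "x \<le> r" "r \<le> z" for r
    using below[of r] Gz that by (cases "r = z") auto
  have "z = y"
  proof (rule ccontr)
    assume "z \<noteq> y"
    then have zy: "z < y" using zxy by simp
    obtain d where d: "d \<ge> c" "(K has_real_derivative d) (at z within {z..})" using der[OF zxy(1) zy] by blast
    have "((\<lambda>r. (K r - K z) / (r - z)) \<longlongrightarrow> d) (at_right z)"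
      using d(2) by (auto simp: has_field_derivative_iff intro: tendsto_within_subset)
    then have "\<forall>\<^sub>F r in at_right z. c - e < (K r - K z) / (r - z)"
      by (rule order_tendstoD(1)) (use d e in auto)
    then obtain b where b: "b > z" "\<And>r. z < r \<Longrightarrow> r < b \<Longrightarrow> c - e < (K r - K z) / (r - z)"
      unfolding eventually_at_right[OF zy] by blast
    define w where "w = min y ((z + b) / 2)"
    have "(z + b) / 2 < b" using b(1) by simp
    then have w: "z < w" "w < b" "w \<le> y" using zy b(1) by (auto simp: w_def min_less_iff_disj)
    have "w \<in> A" unfolding A_def
    proof (intro CollectI conjI ballI)
      show "w \<in> {x..y}" using w zxy by auto
      fix r assume r: "r \<in> {x..w}"
      show "0 \<le> G r"
      proof (cases "r \<le> z")
        case True then show ?thesis using upto r by auto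
      next
        case False
        then have "c - e < (K r - K z) / (r - z)" using b r w by auto
        then have "(c - e) * (r - z) \<le> K r - K z" using False by (simp add: field_simps)
        then have "G z \<le> G r" by (simp add: G_def algebra_simps)
        then show ?thesis using Gz by simp
      qed
    qed
    then have "w \<le> z" using bdd by (auto simp: z_def intro: cSup_upper)
    then show False using w by simp
  qed
  then show "c * (y - x) \<le> K y - K x + e0" using Gz e(2) by (simp add: G_def algebra_simps)
qed

text \<open>An increasing right derivative yields a supporting line of slope \<open>F x\<close> at
  each \<open>x\<close>: to the right of \<open>x\<close> by the increment lemma for
  \<open>G\<close>, to the left by the same lemma for \<open>- G\<close>.\<close>

lemma convex_on_of_right_derivative:
  assumes I: "convex I" and cont: "continuous_on I G"
    and der: "\<And>s. s \<in> I \<Longrightarrow> (G has_real_derivative F s) (at s within {s..})"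
    and mono: "\<And>x y. x \<in> I \<Longrightarrow> y \<in> I \<Longrightarrow> x \<le> y \<Longrightarrow> F x \<le> (F y :: real)"
  shows "convex_on I G"
proof -
  have sub: "{x..y} \<subseteq> I" if "x \<in> I" "y \<in> I" for x y
    using I that by (metis atLeastatMost_empty_iff closed_segment_eq_real_ivl closed_segment_subset empty_subsetI)
  have grad: "G x + F x * (y - x) \<le> G y" if x: "x \<in> I" and y: "y \<in> I" for x y
  proof (cases "x \<le> y")
    case True
    have "F x * (y - x) \<le> G y - G x"
    proof (rule right_derivative_ge_imp_increment[OF True])
      show "continuous_on {x..y} G" using cont sub[OF x y] by (rule continuous_on_subset)
      show "\<exists>d\<ge>F x. (G has_real_derivative d) (at s within {s..})" if "x \<le> s" "s < y" for s
      proof -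
        have "s \<in> I" using sub[OF x y] that by auto
        then show ?thesis using that der[of s] mono[of x s] x by (intro exI[of _ "F s"]) auto
      qed
    qed
    then show ?thesis by simp
  next
    case False
    have "- F x * (x - y) \<le> - G x - - G y"
    proof (rule right_derivative_ge_imp_increment)
      show "continuous_on {y..x} (\<lambda>s. - G s)"
        using cont sub[OF y x] by (intro continuous_on_minus) (rule continuous_on_subset)
      show "\<exists>d\<ge>- F x. ((\<lambda>s. - G s) has_real_derivative d) (at s within {s..})" if "y \<le> s" "s < x" for s
      proof -
        have "s \<in> I" using sub[OF y x] that by auto
        then show ?thesis using that der[of s] mono[of s x] x by (intro exI[of _ "- F s"]) (auto intro!: DERIV_minus)
      qed
    qed (use False in simp)
    then show ?thesis by (simp add: algebra_simps)
  qed
  show ?thesis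
  proof (rule convex_onI[OF _ I])
    fix t x y :: real assume t: "0 < t" "t < 1" and x: "x \<in> I" and y: "y \<in> I"
    define z where "z = (1 - t) * x + t * y"
    have z: "z \<in> I" using I x y t by (auto simp: convex_alt z_def)
    have "(1 - t) * (G z + F z * (x - z)) + t * (G z + F z * (y - z)) \<le> (1 - t) * G x + t * G y"
      using grad[OF z x] grad[OF z y] t by (intro add_mono mult_left_mono) auto
    moreover have "(1 - t) * (G z + F z * (x - z)) + t * (G z + F z * (y - z)) = G z + F z * ((1 - t) * x + t * y - z)"
      by (simp add: algebra_simps)
    ultimately show "G ((1 - t) *\<^sub>R x + t *\<^sub>R y) \<le> (1 - t) * G x + t * G y" by (simp add: z_def)
  qed
qed

text \<open>Lipschitz functions are the admissible errors at the top order: a function that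
  increases up to such an error becomes increasing when a multiple of the identity is added.\<close>

definition lip :: "real set \<Rightarrow> (real \<Rightarrow> real) \<Rightarrow> bool" where
  "lip A g \<longleftrightarrow> (\<exists>L\<ge>0. \<forall>x\<in>A. \<forall>y\<in>A. \<bar>g y - g x\<bar> \<le> L * \<bar>y - x\<bar>)"

lemma lip_add: "lip A g \<Longrightarrow> lip A h \<Longrightarrow> lip A (\<lambda>s. g s + h s)"
proof -
  assume "lip A g" "lip A h"
  then obtain L M where LM: "L \<ge> 0" "M \<ge> 0" "\<And>x y. x \<in> A \<Longrightarrow> y \<in> A \<Longrightarrow> \<bar>g y - g x\<bar> \<le> L * \<bar>y - x\<bar>"
    "\<And>x y. x \<in> A \<Longrightarrow> y \<in> A \<Longrightarrow> \<bar>h y - h x\<bar> \<le> M * \<bar>y - x\<bar>" unfolding lip_def by metis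
  have "\<bar>(g y + h y) - (g x + h x)\<bar> \<le> (L + M) * \<bar>y - x\<bar>" if "x \<in> A" "y \<in> A" for x y
    using LM(3,4)[OF that] unfolding distrib_right by linarith
  then show ?thesis unfolding lip_def using LM(1,2) by (intro exI[of _ "L + M"]) auto
qed

lemma lip_const: "lip A (\<lambda>_. c)"
  by (auto simp: lip_def intro!: exI[of _ 0])

lemma lip_sum: "(\<And>i. i \<in> J \<Longrightarrow> lip A (g i)) \<Longrightarrow> lip A (\<lambda>s. \<Sum>i\<in>J. g i s)"
  by (induction J rule: infinite_finite_induct) (auto intro: lip_add lip_const)

lemma lip_bounded:
  assumes "lip {\<alpha>..\<beta>} g" shows "\<exists>B\<ge>0. \<forall>x\<in>{\<alpha>..\<beta>}. \<bar>g x\<bar> \<le> B"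
proof -
  obtain L where L: "L \<ge> 0" "\<And>x y. x \<in> {\<alpha>..\<beta>} \<Longrightarrow> y \<in> {\<alpha>..\<beta>} \<Longrightarrow> \<bar>g y - g x\<bar> \<le> L * \<bar>y - x\<bar>"
    using assms unfolding lip_def by blast
  have "\<bar>g x\<bar> \<le> \<bar>g \<alpha>\<bar> + L * \<bar>\<beta> - \<alpha>\<bar>" if x: "x \<in> {\<alpha>..\<beta>}" for x
  proof -
    have "\<bar>g x - g \<alpha>\<bar> \<le> L * \<bar>x - \<alpha>\<bar>" using x by (intro L(2)) auto
    also have "\<dots> \<le> L * \<bar>\<beta> - \<alpha>\<bar>" using x L(1) by (intro mult_left_mono) auto
    finally show ?thesis by linarith
  qed
  then show ?thesis using L(1) by (intro exI[of _ "\<bar>g \<alpha>\<bar> + L * \<bar>\<beta> - \<alpha>\<bar>"]) auto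
qed

lemma lip_mult:
  assumes "lip {\<alpha>..\<beta>} g" "lip {\<alpha>..\<beta>} h" shows "lip {\<alpha>..\<beta>} (\<lambda>s. g s * h s)"
proof -
  obtain L M where LM: "L \<ge> 0" "M \<ge> 0" "\<And>x y. x \<in> {\<alpha>..\<beta>} \<Longrightarrow> y \<in> {\<alpha>..\<beta>} \<Longrightarrow> \<bar>g y - g x\<bar> \<le> L * \<bar>y - x\<bar>"
    "\<And>x y. x \<in> {\<alpha>..\<beta>} \<Longrightarrow> y \<in> {\<alpha>..\<beta>} \<Longrightarrow> \<bar>h y - h x\<bar> \<le> M * \<bar>y - x\<bar>" using assms unfolding lip_def by metis
  obtain B C where BC: "B \<ge> 0" "C \<ge> 0" "\<And>x. x \<in> {\<alpha>..\<beta>} \<Longrightarrow> \<bar>g x\<bar> \<le> B" "\<And>x. x \<in> {\<alpha>..\<beta>} \<Longrightarrow> \<bar>h x\<bar> \<le> C"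
    using lip_bounded[OF assms(1)] lip_bounded[OF assms(2)] by blast
  have "\<bar>g y * h y - g x * h x\<bar> \<le> (B * M + L * C) * \<bar>y - x\<bar>" if xy: "x \<in> {\<alpha>..\<beta>}" "y \<in> {\<alpha>..\<beta>}" for x y
  proof -
    have "g y * h y - g x * h x = g y * (h y - h x) + (g y - g x) * h x" by (simp add: algebra_simps)
    also have "\<bar>\<dots>\<bar> \<le> \<bar>g y\<bar> * \<bar>h y - h x\<bar> + \<bar>g y - g x\<bar> * \<bar>h x\<bar>"
      using abs_triangle_ineq by (simp add: abs_mult[symmetric])
    also have "\<dots> \<le> B * (M * \<bar>y - x\<bar>) + (L * \<bar>y - x\<bar>) * C"
      using LM BC xy by (intro add_mono mult_mono) auto
    finally show ?thesis by (simp add: algebra_simps)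
  qed
  then show ?thesis unfolding lip_def using LM(1,2) BC(1,2) by (intro exI[of _ "B * M + L * C"]) auto
qed

lemma lip_of_continuous_derivative:
  assumes "\<And>s. s \<in> {\<alpha>..\<beta>} \<Longrightarrow> (g has_real_derivative g' s) (at s)" "continuous_on {\<alpha>..\<beta>} g'"
  shows "lip {\<alpha>..\<beta>} g"
proof -
  have "bounded (g' ` {\<alpha>..\<beta>})" using assms(2) by (intro compact_imp_bounded compact_continuous_image) auto
  then obtain B where "B > 0" "\<forall>z\<in>g' ` {\<alpha>..\<beta>}. norm z \<le> B" unfolding bounded_pos by blast
  then have B: "\<And>s. s \<in> {\<alpha>..\<beta>} \<Longrightarrow> \<bar>g' s\<bar> \<le> B" "B > 0" by auto
  have "\<bar>g y - g x\<bar> \<le> B * \<bar>y - x\<bar>" if "x \<in> {\<alpha>..\<beta>}" "y \<in> {\<alpha>..\<beta>}" for x y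
    using field_differentiable_bound[of "{\<alpha>..\<beta>}" g g' B y x] assms(1) B(1) that
    by (auto intro: has_field_derivative_at_within)
  then show ?thesis unfolding lip_def using B(2) by (intro exI[of _ B]) auto
qed

lemma lip_poly: "lip {\<alpha>..\<beta>} (poly p)"
  by (rule lip_of_continuous_derivative[OF poly_DERIV]) (intro continuous_intros)

lemma leibniz_cong: "(\<And>j. j \<le> m \<Longrightarrow> a j s = b j s) \<Longrightarrow> leibniz a P m s = leibniz b P m s"
  unfolding leibniz_def by (intro sum.cong) auto

text \<open>Above order \<open>N\<close> the right derivative takes over: in contrast to the derivative of order \<open>N + 1\<close>, it exists
  everywhere when the derivative of order \<open>N\<close> is convex.\<close>

definition jet :: "(real \<Rightarrow> real) \<Rightarrow> real set \<Rightarrow> nat \<Rightarrow> nat \<Rightarrow> real \<Rightarrow> real" where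
  "jet f I N j = (if j \<le> N then (deriv ^^ j) f else rderiv I ((deriv ^^ N) f))"

text \<open>Top-order derivatives are formed only over the set where the preceding one exists. A
  subset \<open>D\<close> on which \<open>\<phi>\<close> agrees with the everywhere defined
  \<open>F\<close> already determines the value, provided that it accumulates at
  \<open>t\<close>.\<close>

lemma derivative_unique_on_subset:
  fixes F \<phi> :: "real \<Rightarrow> real"
  assumes "(\<phi> has_real_derivative d) (at t within A)" "D \<subseteq> A" "\<And>s. s \<in> D \<Longrightarrow> \<phi> s = F s" "t \<in> D"
    and "(F has_real_derivative e) (at t)" and lp: "t islimpt D"
  shows "d = e"
proof -
  have "(\<phi> has_real_derivative d) (at t within D)" using assms(1,2) by (rule has_field_derivative_subset)
  then have "(F has_real_derivative d) (at t within D)"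
    by (rule has_field_derivative_transform_within[where d = 1]) (use assms(3,4) in auto)
  moreover have "(F has_real_derivative e) (at t within D)" using assms(5) by (rule has_field_derivative_at_within)
  ultimately show ?thesis
    using lp unfolding has_field_derivative_iff by (meson tendsto_unique trivial_limit_within)
qed

text \<open>A neighbourhood of \<open>t\<close> without further points of \<open>D\<close> would
  meet \<open>I\<close> in an open null set.\<close>

lemma negligible_complement_islimpt:
  fixes I :: "real set"
  assumes "open I" "negligible (I - D)" "t \<in> I" shows "t islimpt D"
proof (rule islimptI)
  fix T assume T: "t \<in> T" "open T"
  show "\<exists>y\<in>D. y \<in> T \<and> y \<noteq> t"
  proof (rule ccontr)
    assume "\<not> ?thesis"
    then have "T \<inter> I \<subseteq> (I - D) \<union> {t}" by auto
    then have "negligible (T \<inter> I)" using assms(2) by (meson negligible_Un negligible_sing negligible_subset)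
    moreover have "open (T \<inter> I)" "T \<inter> I \<noteq> {}" using assms T by auto
    ultimately show False using open_not_negligible by blast
  qed
qed

lemma AE_lborel_iff_negligible: "(AE t in lborel. Q t) \<longleftrightarrow> negligible {t :: real. \<not> Q t}"
proof -
  have "(AE t in lborel. Q t) \<longleftrightarrow> (AE t in lebesgue. Q t)" by (simp add: AE_completion_iff)
  also have "\<dots> \<longleftrightarrow> {t. \<not> Q t} \<in> null_sets lebesgue"
  proof
    assume "AE t in lebesgue. Q t"
    then obtain N where "N \<in> null_sets lebesgue" "{t. \<not> Q t} \<subseteq> N" unfolding eventually_ae_filter by auto
    then show "{t. \<not> Q t} \<in> null_sets lebesgue" using null_sets_completion_subset by blast
  qed (auto simp: eventually_ae_filter)
  finally show ?thesis by (simp add: negligible_iff_null_sets)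
qed

section \<open>Products with a polynomial at the top order of differentiability\<close>

context
  fixes I :: "real set" and f :: "real \<Rightarrow> real" and N :: nat
  assumes I: "open I" "convex I" and C: "C_k_on N f I" and cv: "convex_on I ((deriv ^^ N) f)"
begin

private abbreviation (input) "H \<equiv> rderiv I ((deriv ^^ N) f)"

lemma jet_le: "j \<le> N \<Longrightarrow> jet f I N j = (deriv ^^ j) f"
  by (simp add: jet_def)

lemma jet_top: "jet f I N (Suc N) = H"
  by (simp add: jet_def)

lemma jet_derivative_lt: "s \<in> I \<Longrightarrow> j < N \<Longrightarrow> (jet f I N j has_real_derivative jet f I N (Suc j) s) (at s within T)"
  using C_k_onD[OF C, of j s] by (simp add: jet_def has_field_derivative_at_within)

lemma jet_derivative:
  assumes "s \<in> I" "j \<le> N" "(deriv ^^ N) f differentiable (at s)"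
  shows "(jet f I N j has_real_derivative jet f I N (Suc j) s) (at s)"
proof (cases "j = N")
  case True
  obtain d where d: "((deriv ^^ N) f has_real_derivative d) (at s)"
    using assms(3) by (auto simp: real_differentiable_def)
  with rderiv_eq_derivative[OF I(1) cv assms(1) d] True show ?thesis by (simp add: jet_def)
qed (use assms jet_derivative_lt in auto)

lemma differentiable_of_rderiv:
  assumes "s \<in> I" "H differentiable (at s)"
  shows "(deriv ^^ N) f differentiable (at s)"
  using derivative_of_rderiv_isCont[OF I(1) cv assms(1)] assms(2) real_differentiable_def
    differentiable_imp_continuous_within by blast

lemma higher_deriv_eq_leibniz_jet:
  assumes "s \<in> I" shows "(deriv ^^ N) (\<lambda>s. f s * poly P s) s = leibniz (jet f I N) P N s"
  using higher_deriv_leibniz[OF I(1) C order_refl assms] by (simp add: leibniz_def jet_le)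

lemma product_derivative:
  assumes "s \<in> I" "(deriv ^^ N) f differentiable (at s)"
  shows "((deriv ^^ N) (\<lambda>s. f s * poly P s) has_real_derivative leibniz (jet f I N) P (Suc N) s) (at s)"
proof -
  have "(leibniz (jet f I N) P N has_real_derivative leibniz (jet f I N) P (Suc N) s) (at s)"
    using assms by (intro leibniz_derivative jet_derivative) auto
  then show ?thesis
    by (rule DERIV_cong_ev[THEN iffD2, OF refl _ refl, rotated])
      (use assms(1) I(1) higher_deriv_eq_leibniz_jet in \<open>auto simp: eventually_nhds intro!: exI[of _ I]\<close>)
qed

lemma product_right_derivative:
  assumes "s \<in> I"
  shows "(leibniz (jet f I N) P N has_real_derivative leibniz (jet f I N) P (Suc N) s) (at s within {s..})"
proof (rule leibniz_derivative)
  fix j assume "j \<le> N"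
  then show "(jet f I N j has_real_derivative jet f I N (Suc j) s) (at s within {s..})"
    using jet_derivative_lt[OF assms] rderiv_has_right_derivative[OF I(1) cv assms]
    by (cases "j = N") (auto simp: jet_def)
qed

text \<open>The entry of order \<open>N + 2\<close> is the constant \<open>h\<close>, because the
  derivative of the right derivative is known at \<open>s\<close> only; the formula evaluates this
  entry nowhere else.\<close>

lemma leibniz_top_derivative:
  assumes s: "s \<in> I" and h: "(H has_real_derivative h) (at s)"
  shows "(leibniz (jet f I N) P (Suc N) has_real_derivative
    leibniz ((jet f I N)(Suc (Suc N) := \<lambda>_. h)) P (Suc (Suc N)) s) (at s)"
proof -
  have diff: "(deriv ^^ N) f differentiable (at s)"
    using differentiable_of_rderiv[OF s] h real_differentiable_def by blast
  let ?a = "(jet f I N)(Suc (Suc N) := \<lambda>_. h)"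
  have "(leibniz ?a P (Suc N) has_real_derivative leibniz ?a P (Suc (Suc N)) s) (at s)"
  proof (rule leibniz_derivative)
    fix j assume "j \<le> Suc N"
    then show "(?a j has_real_derivative ?a (Suc j) s) (at s)"
      using jet_derivative[OF s _ diff, of j] h by (cases "j = Suc N") (auto simp: jet_top)
  qed
  moreover have "leibniz ?a P (Suc N) = leibniz (jet f I N) P (Suc N)"
    by (intro ext leibniz_cong) auto
  ultimately show ?thesis by simp
qed

lemma negligible_not_twice_differentiable: "negligible {t \<in> I. \<not> H differentiable (at t)}"
  by (rule mono_on_differentiable_ae[OF I(1) rderiv_mono[OF I(1) cv]])

lemma islimpt_differentiable:
  assumes "t \<in> I" shows "t islimpt {s \<in> I. (deriv ^^ N) f differentiable (at s)}"
proof (rule negligible_complement_islimpt[OF I(1) _ assms])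
  show "negligible (I - {s \<in> I. (deriv ^^ N) f differentiable (at s)})"
    by (rule negligible_subset[OF negligible_not_twice_differentiable]) (use differentiable_of_rderiv in auto)
qed

text \<open>Only the term \<open>H * P\<close> of the Leibniz sum contains the right derivative. The
  others, collected in \<open>c\<close>, involve derivatives of order at most \<open>N\<close>,
  which are Lipschitz on compact intervals. Since \<open>P\<close> is nonnegative and Lipschitz
  while \<open>H\<close> is increasing and bounded, \<open>H * P\<close> can decrease at most
  linearly.\<close>

lemma leibniz_top_quasi_mono:
  assumes P: "\<And>s. 0 \<le> poly P s" and ab: "{\<alpha>..\<beta>} \<subseteq> I"
  shows "\<exists>L\<ge>0. \<forall>x y. \<alpha> \<le> x \<and> x \<le> y \<and> y \<le> \<beta> \<longrightarrow>
    leibniz (jet f I N) P (Suc N) x + L * x \<le> leibniz (jet f I N) P (Suc N) y + L * y"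
proof -
  define c where "c = (\<lambda>s. \<Sum>k\<le>N. real (Suc N choose Suc k) * (jet f I N (N - k) s * poly ((pderiv ^^ Suc k) P) s))"
  have F: "leibniz (jet f I N) P (Suc N) s = H s * poly P s + c s" for s
    unfolding leibniz_def c_def by (subst sum.atMost_Suc_shift) (simp add: jet_top)
  have ljet: "lip {\<alpha>..\<beta>} (jet f I N j)" if "j \<le> N" for j
  proof (cases "j = N")
    case True
    then show ?thesis using convex_on_lipschitz[OF I(1) cv ab] unfolding lip_def jet_le[OF that]
      by (intro exI[of _ "\<bar>H \<alpha>\<bar> + \<bar>H \<beta>\<bar>"]) auto
  next
    case False
    have "C_k_on (Suc j) f I" using C_k_on_mono[OF C] that False by simp
    then have "continuous_on {\<alpha>..\<beta>} ((deriv ^^ Suc j) f)"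
      using ab unfolding C_k_on_def by (meson continuous_on_subset)
    then show ?thesis unfolding jet_le[OF that]
      using C_k_onD[OF C, of j] ab that False by (intro lip_of_continuous_derivative) auto
  qed
  have "lip {\<alpha>..\<beta>} c" unfolding c_def
    by (intro lip_sum lip_mult lip_const ljet lip_poly) auto
  then obtain Lc where Lc: "Lc \<ge> 0" "\<And>x y. x \<in> {\<alpha>..\<beta>} \<Longrightarrow> y \<in> {\<alpha>..\<beta>} \<Longrightarrow> \<bar>c y - c x\<bar> \<le> Lc * \<bar>y - x\<bar>"
    unfolding lip_def by blast
  obtain Lp where Lp: "Lp \<ge> 0" "\<And>x y. x \<in> {\<alpha>..\<beta>} \<Longrightarrow> y \<in> {\<alpha>..\<beta>} \<Longrightarrow> \<bar>poly P y - poly P x\<bar> \<le> Lp * \<bar>y - x\<bar>"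
    using lip_poly[of \<alpha> \<beta> P] unfolding lip_def by blast
  define B where "B = \<bar>H \<alpha>\<bar> + \<bar>H \<beta>\<bar>"
  have HB: "\<bar>H x\<bar> \<le> B" if "x \<in> {\<alpha>..\<beta>}" for x
    using rderiv_mono[OF I(1) cv, of \<alpha> x] rderiv_mono[OF I(1) cv, of x \<beta>] ab that
    by (auto simp: B_def subset_iff)
  show ?thesis
  proof (intro exI[of _ "B * Lp + Lc"] conjI allI impI)
    show "0 \<le> B * Lp + Lc" using Lp Lc by (simp add: B_def)
    fix x y assume xy: "\<alpha> \<le> x \<and> x \<le> y \<and> y \<le> \<beta>"
    have xyI: "x \<in> I" "y \<in> I" using xy ab by (auto simp: subset_iff)
    have 1: "0 \<le> poly P y * (H y - H x)" using P rderiv_mono[OF I(1) cv xyI] xy by simp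
    have "\<bar>H x * (poly P y - poly P x)\<bar> \<le> B * (Lp * \<bar>y - x\<bar>)"
      unfolding abs_mult using HB[of x] Lp(2)[of x y] xy by (intro mult_mono) (auto simp: B_def)
    then have 2: "- (B * Lp * (y - x)) \<le> H x * (poly P y - poly P x)" using xy by (simp add: mult.assoc abs_le_iff)
    have 3: "- (Lc * (y - x)) \<le> c y - c x" using Lc(2)[of x y] xy by (simp add: abs_le_iff)
    have "H y * poly P y + c y - (H x * poly P x + c x) =
        poly P y * (H y - H x) + H x * (poly P y - poly P x) + (c y - c x)" by (simp add: algebra_simps)
    moreover have "(B * Lp + Lc) * y - (B * Lp + Lc) * x = B * Lp * (y - x) + Lc * (y - x)" by (simp add: algebra_simps)
    ultimately show "leibniz (jet f I N) P (Suc N) x + (B * Lp + Lc) * x \<le> leibniz (jet f I N) P (Suc N) y + (B * Lp + Lc) * y"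
      unfolding F using 1 2 3 by linarith
  qed
qed

text \<open>Adding \<open>L s\<close> makes the expression increasing, with derivative at least
  \<open>L\<close> almost everywhere. The increment of the sum is then at least
  \<open>L (y - x)\<close>, which is exactly what \<open>L s\<close> contributes.\<close>

lemma leibniz_top_mono:
  assumes P: "\<And>s. 0 \<le> poly P s"
    and ae: "negligible {t \<in> I. \<not> (\<exists>d\<ge>0. (leibniz (jet f I N) P (Suc N) has_real_derivative d) (at t))}"
    and xy: "x \<in> I" "y \<in> I" "x \<le> y"
  shows "leibniz (jet f I N) P (Suc N) x \<le> leibniz (jet f I N) P (Suc N) y"
proof -
  let ?F = "leibniz (jet f I N) P (Suc N)"
  have sub: "{x..y} \<subseteq> I" using I(2) xy by (metis closed_segment_eq_real_ivl closed_segment_subset)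
  obtain L where L: "L \<ge> 0" "\<And>s t. x \<le> s \<Longrightarrow> s \<le> t \<Longrightarrow> t \<le> y \<Longrightarrow> ?F s + L * s \<le> ?F t + L * t"
    using leibniz_top_quasi_mono[OF P sub] by blast
  let ?\<Phi> = "\<lambda>s. ?F s + L * s"
  have "L * (y - x) \<le> ?\<Phi> (clamp_real x y y) - ?\<Phi> (clamp_real x y x)"
  proof (rule mono_increment_ge[OF mono_clamp[OF xy(3)] xy(3) L(1)])
    show "negligible {s \<in> {x<..<y}. \<not> (\<exists>d\<ge>L. ((\<lambda>s. ?\<Phi> (clamp_real x y s)) has_real_derivative d) (at s))}"
    proof (rule negligible_subset[OF ae], rule subsetI)
      fix s assume s: "s \<in> {s \<in> {x<..<y}. \<not> (\<exists>d\<ge>L. ((\<lambda>s. ?\<Phi> (clamp_real x y s)) has_real_derivative d) (at s))}"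
      then have sI: "s \<in> I" using sub by auto
      have "\<not> (\<exists>d\<ge>0. (?F has_real_derivative d) (at s))"
      proof
        assume "\<exists>d\<ge>0. (?F has_real_derivative d) (at s)"
        then obtain d where d: "d \<ge> 0" "(?F has_real_derivative d) (at s)" by blast
        have "(?\<Phi> has_real_derivative (d + L)) (at s)" using d(2) by (auto intro!: derivative_eq_intros)
        then have "((\<lambda>s. ?\<Phi> (clamp_real x y s)) has_real_derivative (d + L)) (at s)"
          using s clamp_derivative_iff[of s x y ?\<Phi> "d + L"] by auto
        then show False using s d(1) by (auto intro: exI[of _ "d + L"])
      qed
      with sI show "s \<in> {t \<in> I. \<not> (\<exists>d\<ge>0. (?F has_real_derivative d) (at t))}" by simp
    qed
  qed (use L in auto)
  then show ?thesis using xy(3) by (simp add: clamp_real_def algebra_simps)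
qed

lemma kconv_product:
  assumes P: "\<And>s. 0 \<le> poly P s"
    and ae: "negligible {t \<in> I. \<not> (\<exists>d\<ge>0. (leibniz (jet f I N) P (Suc N) has_real_derivative d) (at t))}"
  shows "kconv (Suc (Suc N)) I (\<lambda>s. f s * poly P s)"
proof (rule kconv_of_convex_deriv[OF I(2) C_k_on_mult_poly[OF I(1) C]])
  have eq: "(deriv ^^ N) (\<lambda>s. f s * poly P s) s = leibniz (jet f I N) P N s" if "s \<in> I" for s
    by (rule higher_deriv_eq_leibniz_jet[OF that])
  have "continuous_on I ((deriv ^^ N) (\<lambda>s. f s * poly P s))"
    using C_k_on_mult_poly[OF I(1) C] by (simp add: C_k_on_def)
  then have "continuous_on I (leibniz (jet f I N) P N)" by (subst (asm) continuous_on_cong[OF refl eq]) auto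
  then have cx: "convex_on I (leibniz (jet f I N) P N)"
    by (rule convex_on_of_right_derivative[OF I(2) _ product_right_derivative leibniz_top_mono[OF P ae]])
  show "convex_on I ((deriv ^^ N) (\<lambda>s. f s * poly P s))"
  proof (rule convex_onI[OF _ I(2)])
    fix t x y :: real assume t: "0 < t" "t < 1" and xy: "x \<in> I" "y \<in> I"
    then have "(1 - t) *\<^sub>R x + t *\<^sub>R y \<in> I" using I(2) by (auto simp: convex_alt)
    then show "(deriv ^^ N) (\<lambda>s. f s * poly P s) ((1 - t) *\<^sub>R x + t *\<^sub>R y)
        \<le> (1 - t) * (deriv ^^ N) (\<lambda>s. f s * poly P s) x + t * (deriv ^^ N) (\<lambda>s. f s * poly P s) y"
      using convex_onD[OF cx, of t x y] t xy by (simp add: eq)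
  qed
qed

lemma deriv_dom_full: "j \<le> N \<Longrightarrow> deriv_dom I f j = I"
  using C_k_on_mono[OF C] by (simp add: C_k_on_def)

lemma deriv_dom_top: "deriv_dom I f (Suc N) = {s \<in> I. (deriv ^^ N) f differentiable (at s)}"
  using deriv_dom_full[OF order_refl] by (auto simp: deriv_dom_def less_Suc_eq)

lemma higher_deriv_top:
  assumes "s \<in> I" "(deriv ^^ N) f differentiable (at s)"
  shows "(deriv ^^ Suc N) f s = H s"
  using jet_derivative[OF assms(1) order_refl assms(2)] by (simp add: jet_def DERIV_imp_deriv)

text \<open>Where the derivative of order \<open>N + 1\<close> exists it equals \<open>H\<close>.
  This set contains \<open>t\<close>, because \<open>H\<close> is differentiable there, and
  accumulates at \<open>t\<close>, so both functions have the same derivative at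
  \<open>t\<close>.\<close>

lemma has_kth_deriv_top:
  assumes t: "t \<in> I" and h: "(H has_real_derivative h) (at t)"
  shows "has_kth_deriv I (Suc (Suc N)) f d t \<longleftrightarrow> d = h"
proof -
  have diff: "(deriv ^^ N) f differentiable (at t)"
    using differentiable_of_rderiv[OF t] h real_differentiable_def by blast
  let ?D = "deriv_dom I f (Suc N)"
  have tD: "t \<in> ?D" using t diff by (simp add: deriv_dom_top)
  have eqD: "(deriv ^^ Suc N) f s = H s" if "s \<in> ?D" for s
    using that higher_deriv_top by (auto simp: deriv_dom_top simp del: funpow.simps)
  have "((deriv ^^ Suc N) f has_real_derivative h) (at t within ?D)"
    by (rule has_field_derivative_transform_within[where d = 1 and f = H])
      (use h tD eqD in \<open>auto intro: has_field_derivative_at_within simp del: funpow.simps\<close>)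
  moreover have "d = h" if "((deriv ^^ Suc N) f has_real_derivative d) (at t within ?D)"
    by (rule derivative_unique_on_subset[OF that order_refl eqD tD h])
      (use islimpt_differentiable[OF t] in \<open>simp_all add: deriv_dom_top\<close>)
  ultimately show ?thesis using tD by (auto simp: has_kth_deriv_def simp del: funpow.simps)
qed

lemma has_kth_deriv_lower:
  assumes t: "t \<in> I" "(deriv ^^ N) f differentiable (at t)" and j: "j \<le> N"
  shows "has_kth_deriv I (Suc j) f d t \<longleftrightarrow> d = jet f I N (Suc j) t"
proof -
  have "((deriv ^^ j) f has_real_derivative d) (at t within I) \<longleftrightarrow> ((deriv ^^ j) f has_real_derivative d) (at t)"
    using at_within_open[OF t(1) I(1)] by simp
  also have "\<dots> \<longleftrightarrow> d = jet f I N (Suc j) t"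
    using jet_derivative[OF t(1) j t(2)] DERIV_unique unfolding jet_le[OF j] by blast
  finally show ?thesis using t j by (simp add: has_kth_deriv_def deriv_dom_full)
qed

text \<open>The product may be differentiable where \<open>f\<close> is not, for instance at zeros
  of \<open>P\<close>. The comparison is therefore made on the possibly smaller set where
  \<open>f\<close> has a derivative of order \<open>N + 1\<close>, which still accumulates at
  \<open>t\<close>.\<close>

lemma has_kth_deriv_product:
  assumes t: "t \<in> I" and e: "(leibniz (jet f I N) P (Suc N) has_real_derivative e) (at t)"
    and diff: "(deriv ^^ N) f differentiable (at t)"
    and d: "has_kth_deriv I (Suc (Suc N)) (\<lambda>s. f s * poly P s) d t"
  shows "d = e"
proof -
  let ?g = "\<lambda>s. f s * poly P s" and ?D = "{s \<in> I. (deriv ^^ N) f differentiable (at s)}"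
  have dg: "((deriv ^^ Suc N) ?g has_real_derivative d) (at t within deriv_dom I ?g (Suc N))"
    using d by (simp add: has_kth_deriv_def del: funpow.simps)
  have full: "deriv_dom I ?g N = I" using C_k_on_mult_poly[OF I(1) C] by (simp add: C_k_on_def)
  show ?thesis
  proof (rule derivative_unique_on_subset[OF dg _ _ _ e islimpt_differentiable[OF t]])
    show "?D \<subseteq> deriv_dom I ?g (Suc N)"
    proof
      fix s assume s: "s \<in> ?D"
      then have "(deriv ^^ N) ?g differentiable (at s)"
        using product_derivative[of s P] real_differentiable_def by blast
      moreover have "s \<in> deriv_dom I ?g N" using full s by simp
      ultimately show "s \<in> deriv_dom I ?g (Suc N)" by (auto simp: deriv_dom_def less_Suc_eq)
    qed
    show "(deriv ^^ Suc N) ?g s = leibniz (jet f I N) P (Suc N) s" if "s \<in> ?D" for s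
      using product_derivative[of s P] that by (simp add: DERIV_imp_deriv)
  qed (use t diff in auto)
qed

text \<open>The derivative of order \<open>N\<close> of the product is convex, and the Leibniz
  expression is its right derivative, hence increasing. The conclusion holds at every point of
  differentiability, not merely almost everywhere; this later permits polynomials that depend on
  \<open>t\<close>.\<close>

lemma leibniz_top_derivative_nonneg:
  assumes k: "kconv (Suc (Suc N)) I (\<lambda>s. f s * poly P s)" and t: "t \<in> I"
    and e: "(leibniz (jet f I N) P (Suc N) has_real_derivative e) (at t)"
  shows "0 \<le> e"
proof (rule ccontr)
  assume "\<not> 0 \<le> e"
  let ?G = "(deriv ^^ N) (\<lambda>s. f s * poly P s)" and ?F = "leibniz (jet f I N) P (Suc N)"
  have cx: "convex_on I ?G" using kconv_regularity[OF I k] by simp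
  have F: "?F s = rderiv I ?G s" if s: "s \<in> I" for s
  proof -
    obtain r where r: "r > 0" "ball s r \<subseteq> I" using openE[OF I(1) s] by blast
    have "(?G has_real_derivative ?F s) (at s within {s..})"
    proof (rule has_field_derivative_transform_within[OF product_right_derivative[OF s] r(1)])
      show "leibniz (jet f I N) P N x' = ?G x'" if "x' \<in> {s..}" "dist x' s < r" for x'
        using higher_deriv_eq_leibniz_jet[of x' P] r that by (auto simp: dist_commute subset_iff)
    qed simp
    moreover have "(?G has_real_derivative rderiv I ?G s) (at s within {s..})"
      by (rule rderiv_has_right_derivative[OF I(1) cx s])
    moreover have "at s within {s..} \<noteq> bot"
      by (metis at_within_Icc_at_right at_within_Ici_at_right trivial_limit_at_right_real)
    ultimately show ?thesis unfolding has_field_derivative_iff by (meson tendsto_unique)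
  qed
  obtain r where r: "r > 0" "ball t r \<subseteq> I" using openE[OF I(1) t] by blast
  obtain d where d: "d > 0" "\<And>h. h > 0 \<Longrightarrow> h < d \<Longrightarrow> ?F (t + h) < ?F t"
    using DERIV_neg_dec_right[OF e] \<open>\<not> 0 \<le> e\<close> by auto
  define h where "h = min r d / 2"
  have h: "h > 0" "h < d" "h < r" using d r by (auto simp: h_def)
  then have "t + h \<in> ball t r" by (simp add: dist_real_def)
  then have tI: "t + h \<in> I" using r by blast
  then show False using d(2)[OF h(1,2)] rderiv_mono[OF I(1) cx t tI] h F[OF t] F[OF tI] by simp
qed

end

lemma kconv_has_kth_deriv_ae:
  assumes I: "open I" "convex I" and g: "kconv (Suc (Suc N)) I g"
  shows "negligible {t \<in> I. \<not> (\<exists>d. has_kth_deriv I (Suc (Suc N)) g d t \<and> 0 \<le> d)}"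
proof -
  have C: "C_k_on N g I" and cv: "convex_on I ((deriv ^^ N) g)" using kconv_regularity[OF I g] by auto
  show ?thesis
  proof (rule negligible_subset[OF negligible_not_twice_differentiable[OF I C cv]], safe)
    fix t assume t: "t \<in> I" and no: "\<not> (\<exists>d. has_kth_deriv I (Suc (Suc N)) g d t \<and> 0 \<le> d)"
      and diff: "rderiv I ((deriv ^^ N) g) differentiable (at t)"
    obtain h where h: "(rderiv I ((deriv ^^ N) g) has_real_derivative h) (at t)"
      using diff by (auto simp: real_differentiable_def)
    have "kconv (Suc (Suc N)) I (\<lambda>s. g s * poly 1 s)" using g by simp
    moreover have "leibniz (jet g I N) 1 (Suc N) = rderiv I ((deriv ^^ N) g)"
    proof
      fix s
      have z: "(pderiv ^^ Suc k) (1 :: real poly) = 0" for k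
        by (induction k) (auto simp: pderiv_1)
      show "leibniz (jet g I N) 1 (Suc N) s = rderiv I ((deriv ^^ N) g) s"
        unfolding leibniz_def by (subst sum.atMost_Suc_shift) (simp only: z poly_0 mult_zero_right sum.neutral_const, simp add: jet_top[OF I C cv])
    qed
    ultimately have "0 \<le> h" using leibniz_top_derivative_nonneg[OF I C cv, of 1 t h] t h by simp
    then show False using no has_kth_deriv_top[OF I C cv t h] by blast
  qed
qed

section \<open>The Leibniz formula for squares of shifted polynomials\<close>

lemma coeff_higher_pderiv:
  fixes p :: "real poly"
  shows "coeff ((pderiv ^^ k) p) j * fact j = fact (j + k) * coeff p (j + k)"
proof (induction k arbitrary: j)
  case (Suc k)
  have "coeff ((pderiv ^^ Suc k) p) j * fact j = coeff ((pderiv ^^ k) p) (Suc j) * fact (Suc j)"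
    by (simp add: coeff_pderiv algebra_simps)
  also have "\<dots> = fact (Suc j + k) * coeff p (Suc j + k)" by (rule Suc.IH)
  finally show ?case by simp
qed simp

lemma higher_pderiv_shift:
  fixes p :: "real poly"
  shows "poly ((pderiv ^^ k) (p \<circ>\<^sub>p [:- t, 1:])) t = fact k * coeff p k"
proof -
  have "(pderiv ^^ k) (p \<circ>\<^sub>p [:- t, 1:]) = ((pderiv ^^ k) p) \<circ>\<^sub>p [:- t, 1:]"
    by (induction k) (auto simp: pderiv_pcompose pderiv_pCons)
  then have "poly ((pderiv ^^ k) (p \<circ>\<^sub>p [:- t, 1:])) t = coeff ((pderiv ^^ k) p) 0"
    by (simp add: poly_pcompose poly_0_coeff_0)
  then show ?thesis using coeff_higher_pderiv[of k p 0] by simp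
qed

text \<open>As \<open>r\<close> has its coefficients in reverse order, the pair \<open>i\<close>,
  \<open>j\<close> contributes to degree \<open>2 (n - 1) - i - j\<close> of the square, and at the
  centre \<open>t\<close> this degree meets the Taylor coefficient of complementary order. Hence the
  dependence on \<open>i + j\<close> only; for \<open>m = 2 n\<close> the orders start at 2.\<close>

lemma leibniz_square:
  fixes v :: "nat \<Rightarrow> real"
  assumes m: "2 * (n - 1) \<le> m" and n: "n > 0"
    and r: "r = (\<Sum>i<n. monom (v i) (n - 1 - i))"
  shows "leibniz a ((r \<circ>\<^sub>p [:- t, 1:])\<^sup>2) m t =
    fact m * (\<Sum>i<n. \<Sum>j<n. v i * v j * (a (m - 2 * (n - 1) + i + j) t / fact (m - 2 * (n - 1) + i + j)))"
proof -
  have sq: "(r \<circ>\<^sub>p [:- t, 1:])\<^sup>2 = (r * r) \<circ>\<^sub>p [:- t, 1:]" by (simp add: power2_eq_square pcompose_mult)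
  have rr: "r * r = (\<Sum>i<n. \<Sum>j<n. monom (v i * v j) ((n - 1 - i) + (n - 1 - j)))"
    unfolding r sum_product by (simp add: mult_monom)
  have "leibniz a ((r \<circ>\<^sub>p [:- t, 1:])\<^sup>2) m t = (\<Sum>k\<le>m. fact m * (a (m - k) t / fact (m - k)) * coeff (r * r) k)"
    unfolding leibniz_def sq higher_pderiv_shift
    by (intro sum.cong refl) (simp add: binomial_fact)
  also have "\<dots> = (\<Sum>k\<le>m. \<Sum>i<n. \<Sum>j<n. if (n - 1 - i) + (n - 1 - j) = k then fact m * (a (m - k) t / fact (m - k)) * (v i * v j) else 0)"
    unfolding rr by (simp add: coeff_sum sum_distrib_left if_distrib[of "\<lambda>u. _ * u"] cong: if_cong)
  also have "\<dots> = (\<Sum>i<n. \<Sum>j<n. \<Sum>k\<le>m. if (n - 1 - i) + (n - 1 - j) = k then fact m * (a (m - k) t / fact (m - k)) * (v i * v j) else 0)"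
    by (subst sum.swap, rule sum.cong[OF refl], rule sum.swap)
  also have "\<dots> = (\<Sum>i<n. \<Sum>j<n. fact m * (v i * v j * (a (m - 2 * (n - 1) + i + j) t / fact (m - 2 * (n - 1) + i + j))))"
  proof (intro sum.cong refl)
    fix i j assume ij: "i \<in> {..<n}" "j \<in> {..<n}"
    have le: "(n - 1 - i) + (n - 1 - j) \<le> m" using m by linarith
    have eq: "m - ((n - 1 - i) + (n - 1 - j)) = m - 2 * (n - 1) + i + j" using m ij by auto
    show "(\<Sum>k\<le>m. if (n - 1 - i) + (n - 1 - j) = k then fact m * (a (m - k) t / fact (m - k)) * (v i * v j) else 0)
        = fact m * (v i * v j * (a (m - 2 * (n - 1) + i + j) t / fact (m - 2 * (n - 1) + i + j)))"
      using le by (simp add: eq[simplified])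
  qed
  finally show ?thesis by (simp add: sum_distrib_left)
qed

section \<open>Hermitian matrices and the functional calculus\<close>

lemma adjoint_carrier: "A \<in> carrier_mat n m \<Longrightarrow> mat_adjoint A \<in> carrier_mat m n"
  by (auto simp: mat_adjoint_def)

lemma adjoint_index:
  "A \<in> carrier_mat n m \<Longrightarrow> i < m \<Longrightarrow> j < n \<Longrightarrow> mat_adjoint A $$ (i, j) = conjugate (A $$ (j, i))"
  by (auto simp: mat_adjoint_def mat_of_rows_def)

lemma mult_index:
  "A \<in> carrier_mat n m \<Longrightarrow> B \<in> carrier_mat m l \<Longrightarrow> i < n \<Longrightarrow> j < l \<Longrightarrow>
    (A * B) $$ (i, j) = (\<Sum>k<m. A $$ (i, k) * B $$ (k, j))"
  by (auto simp: scalar_prod_def atLeast0LessThan)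

lemma adjoint_mult:
  fixes A B :: "complex mat"
  assumes "A \<in> carrier_mat n m" "B \<in> carrier_mat m l"
  shows "mat_adjoint (A * B) = mat_adjoint B * mat_adjoint A"
proof (rule eq_matI)
  note ca = adjoint_carrier[OF assms(1)] adjoint_carrier[OF assms(2)] adjoint_carrier[OF mult_carrier_mat[OF assms]]
  fix i j assume "i < dim_row (mat_adjoint B * mat_adjoint A)" "j < dim_col (mat_adjoint B * mat_adjoint A)"
  then have ij: "i < l" "j < n" using ca by auto
  show "mat_adjoint (A * B) $$ (i, j) = (mat_adjoint B * mat_adjoint A) $$ (i, j)"
    unfolding adjoint_index[OF mult_carrier_mat[OF assms] ij] mult_index[OF assms ij(2,1)] mult_index[OF ca(2,1) ij]
    using ij by (simp add: adjoint_index[OF assms(1)] adjoint_index[OF assms(2)] mult.commute)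
qed (use assms in \<open>auto simp: mat_adjoint_def\<close>)

lemma real_diag_carrier [simp]: "real_diag n d \<in> carrier_mat n n"
  by (simp add: real_diag_def)

lemma conj_diag_index:
  assumes U: "U \<in> carrier_mat n n" and ij: "i < n" "j < n"
  shows "(U * real_diag n d * mat_adjoint U) $$ (i, j) = (\<Sum>k<n. U $$ (i, k) * of_real (d k) * cnj (U $$ (j, k)))"
proof -
  have "(U * real_diag n d) $$ (i, k) = U $$ (i, k) * of_real (d k)" if "k < n" for k
  proof -
    have "(U * real_diag n d) $$ (i, k) = (\<Sum>l<n. if l = k then U $$ (i, k) * of_real (d k) else 0)"
      unfolding mult_index[OF U real_diag_carrier ij(1) that]
      using that by (intro sum.cong) (auto simp: real_diag_def)
    then show ?thesis using that by simp
  qed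
  then show ?thesis
    using mult_index[OF mult_carrier_mat[OF U real_diag_carrier] adjoint_carrier[OF U] ij] adjoint_index[OF U] ij(2)
    by simp
qed

lemma mat_eq_iff:
  "A \<in> carrier_mat n m \<Longrightarrow> B \<in> carrier_mat n m \<Longrightarrow>
    A = B \<longleftrightarrow> (\<forall>i<n. \<forall>j<m. A $$ (i, j) = B $$ (i, j))"
  by (auto intro: eq_matI)

lemma unitary_iff:
  "unitary n U \<longleftrightarrow> U \<in> carrier_mat n n \<and>
    (\<forall>i<n. \<forall>j<n. (\<Sum>k<n. U $$ (i, k) * cnj (U $$ (j, k))) = (if i = j then 1 else 0)) \<and>
    (\<forall>i<n. \<forall>j<n. (\<Sum>k<n. cnj (U $$ (k, i)) * U $$ (k, j)) = (if i = j then 1 else 0))"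
proof (cases "U \<in> carrier_mat n n")
  case U: True
  have "U * mat_adjoint U = 1\<^sub>m n \<longleftrightarrow> (\<forall>i<n. \<forall>j<n. (U * mat_adjoint U) $$ (i, j) = 1\<^sub>m n $$ (i, j))"
    by (rule mat_eq_iff[OF mult_carrier_mat[OF U adjoint_carrier[OF U]] one_carrier_mat])
  also have "\<dots> \<longleftrightarrow> (\<forall>i<n. \<forall>j<n. (\<Sum>k<n. U $$ (i, k) * cnj (U $$ (j, k))) = (if i = j then 1 else 0))"
    by (simp add: mult_index[OF U adjoint_carrier[OF U]] adjoint_index[OF U] del: index_mult_mat(1))
  finally have 1: "U * mat_adjoint U = 1\<^sub>m n \<longleftrightarrow> \<dots>" .
  have "mat_adjoint U * U = 1\<^sub>m n \<longleftrightarrow> (\<forall>i<n. \<forall>j<n. (mat_adjoint U * U) $$ (i, j) = 1\<^sub>m n $$ (i, j))"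
    by (rule mat_eq_iff[OF mult_carrier_mat[OF adjoint_carrier[OF U] U] one_carrier_mat])
  also have "\<dots> \<longleftrightarrow> (\<forall>i<n. \<forall>j<n. (\<Sum>k<n. cnj (U $$ (k, i)) * U $$ (k, j)) = (if i = j then 1 else 0))"
    by (simp add: mult_index[OF adjoint_carrier[OF U] U] adjoint_index[OF U] del: index_mult_mat(1))
  finally show ?thesis using 1 U by (simp add: unitary_def)
qed (simp add: unitary_def)

lemma unitaryD:
  assumes "unitary n U"
  shows "U \<in> carrier_mat n n"
    "i < n \<Longrightarrow> j < n \<Longrightarrow> (\<Sum>k<n. U $$ (i, k) * cnj (U $$ (j, k))) = (if i = j then 1 else 0)"
    "i < n \<Longrightarrow> j < n \<Longrightarrow> (\<Sum>k<n. cnj (U $$ (k, i)) * U $$ (k, j)) = (if i = j then 1 else 0)"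
  using assms unfolding unitary_iff by auto

lemma unitary_mult:
  assumes "unitary n U" "unitary n V" shows "unitary n (U * V)"
proof -
  have c: "U \<in> carrier_mat n n" "V \<in> carrier_mat n n" using assms by (auto simp: unitary_def)
  note ca = c adjoint_carrier[OF c(1)] adjoint_carrier[OF c(2)]
  have "U * V * (mat_adjoint V * mat_adjoint U) = U * (V * mat_adjoint V) * mat_adjoint U"
    using ca by (simp add: assoc_mult_mat[of _ n n _ n _ n] mult_carrier_mat[of _ n n _ n])
  moreover have "mat_adjoint V * mat_adjoint U * (U * V) = mat_adjoint V * (mat_adjoint U * U) * V"
    using ca by (simp add: assoc_mult_mat[of _ n n _ n _ n] mult_carrier_mat[of _ n n _ n])
  ultimately show ?thesis using assms ca by (simp add: unitary_def adjoint_mult[OF c])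
qed

section \<open>Spectral theorem and well-definedness of the functional calculus\<close>

definition spectral :: "nat \<Rightarrow> complex mat \<Rightarrow> complex mat \<Rightarrow> (nat \<Rightarrow> real) \<Rightarrow> bool" where
  "spectral n A U d \<longleftrightarrow> unitary n U \<and> A = U * real_diag n d * mat_adjoint U"

lemma hermitian_index:
  "hermitian n A \<longleftrightarrow> A \<in> carrier_mat n n \<and> (\<forall>i<n. \<forall>j<n. conjugate (A $$ (j, i)) = A $$ (i, j))"
proof (cases "A \<in> carrier_mat n n")
  case A: True
  have "mat_adjoint A = A \<longleftrightarrow> (\<forall>i<n. \<forall>j<n. mat_adjoint A $$ (i, j) = A $$ (i, j))"
    using A adjoint_carrier[OF A] by (auto intro: eq_matI)
  then show ?thesis using A by (simp add: hermitian_def adjoint_index[OF A])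
qed (simp add: hermitian_def)

text \<open>A Householder reflection carries the first basis vector to a given unit vector whose first
  coordinate is real. For \<open>u = e\<^sub>0\<close> the coefficient \<open>2 / s\<close> is \<open>2 / 0 = 0\<close> and the reflection degenerates to
  the identity, as it should.\<close>

lemma householder:
  fixes u :: "nat \<Rightarrow> complex"
  assumes nrm: "(\<Sum>i<Suc n. u i * cnj (u i)) = 1" and u0: "cnj (u 0) = u 0"
  obtains R where "R \<in> carrier_mat (Suc n) (Suc n)" "mat_adjoint R = R" "R * R = 1\<^sub>m (Suc n)"
    "\<And>i. i < Suc n \<Longrightarrow> R $$ (i, 0) = u i"
proof -
  define w where "w = (\<lambda>i. u i - (if i = 0 then 1 else 0))"
  define s where "s = (\<Sum>i<Suc n. w i * cnj (w i))"
  define c where "c = 2 / s"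
  define h where "h = (\<lambda>i j. (if i = j then 1 else 0) - c * w i * cnj (w j))"
  have "s = (\<Sum>i<Suc n. u i * cnj (u i) - (if i = 0 then u 0 else 0) - (if i = 0 then cnj (u 0) else 0) + (if i = 0 then 1 else 0))"
    unfolding s_def w_def by (intro sum.cong) (auto simp: algebra_simps)
  also have "\<dots> = 1 - u 0 - cnj (u 0) + 1"
    unfolding sum.distrib sum_subtractf nrm by simp
  finally have s: "s = - 2 * w 0" using u0 by (simp add: w_def)
  have w0: "cnj (w 0) = w 0" using u0 by (simp add: w_def)
  have cs: "cnj c = c" using w0 by (simp add: c_def s)
  have cc: "c * c * s = 2 * c" by (cases "s = 0") (auto simp: c_def)
  have wz: "w i = 0" if "s = 0" "i < Suc n" for i
  proof -
    have "of_real (\<Sum>i<Suc n. (cmod (w i))\<^sup>2) = s" unfolding s_def of_real_sum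
      by (intro sum.cong refl complex_norm_square)
    then have "(\<Sum>i<Suc n. (cmod (w i))\<^sup>2) = 0" using that(1) by (metis of_real_eq_0_iff)
    then have "\<forall>i\<in>{..<Suc n}. (cmod (w i))\<^sup>2 = 0" by (subst (asm) sum_nonneg_eq_0_iff) auto
    then show ?thesis using that(2) by simp
  qed
  have hh: "(\<Sum>k<Suc n. h i k * h k j) = (if i = j then 1 else 0)" if "i < Suc n" "j < Suc n" for i j
  proof -
    have "(\<Sum>k<Suc n. h i k * h k j) = (\<Sum>k<Suc n. (if k = i then (if i = j then 1 else 0) else 0)
        - (if k = i then c * w i * cnj (w j) else 0) - (if k = j then c * w i * cnj (w j) else 0)
        + c * c * (w i * cnj (w j)) * (w k * cnj (w k)))"
      unfolding h_def by (intro sum.cong) (auto simp: algebra_simps)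
    also have "\<dots> = (if i = j then 1 else 0) - c * w i * cnj (w j) - c * w i * cnj (w j) + c * c * (w i * cnj (w j)) * s"
      unfolding sum.distrib sum_subtractf s_def sum_distrib_left using that by simp
    also have "c * c * (w i * cnj (w j)) * s = 2 * c * (w i * cnj (w j))" using cc by (metis mult.commute mult.left_commute)
    finally show ?thesis by simp
  qed
  have h0: "h i 0 = u i" if "i < Suc n" for i
  proof (cases "s = 0")
    case True
    then have "h i 0 = (if i = 0 then 1 else 0)" by (simp add: h_def c_def)
    with wz[OF True that] show ?thesis by (auto simp: w_def)
  next
    case False
    then have "c * w 0 = - 1" by (simp add: c_def s field_simps)
    then have "c * w i * cnj (w 0) = - w i" unfolding w0 by (metis mult.commute mult.left_commute mult_minus1_right)
    then show ?thesis by (auto simp: h_def w_def)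
  qed
  let ?R = "mat (Suc n) (Suc n) (\<lambda>(i, j). h i j)"
  have R: "?R \<in> carrier_mat (Suc n) (Suc n)" by simp
  have "cnj (h j i) = h i j" for i j using cs by (auto simp: h_def)
  then have herm: "mat_adjoint ?R = ?R"
    using adjoint_carrier[OF R] by (intro eq_matI) (auto simp: adjoint_index[OF R])
  have "?R * ?R = 1\<^sub>m (Suc n)"
  proof (rule eq_matI)
    fix i j assume "i < dim_row (1\<^sub>m (Suc n))" "j < dim_col (1\<^sub>m (Suc n))"
    then have ij: "i < Suc n" "j < Suc n" by auto
    show "(?R * ?R) $$ (i, j) = 1\<^sub>m (Suc n) $$ (i, j)"
      unfolding mult_index[OF R R ij] using hh[OF ij] ij by (simp del: sum.lessThan_Suc)
  qed auto
  then show ?thesis using R herm h0 by (intro that[of ?R]) auto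
qed

lemma hermitian_eigenvector:
  fixes A :: "complex mat"
  assumes A: "A \<in> carrier_mat (Suc n) (Suc n)"
  obtains u ev where "(\<Sum>i<Suc n. u i * cnj (u i)) = 1" "cnj (u 0) = u 0"
    "\<And>i. i < Suc n \<Longrightarrow> (\<Sum>j<Suc n. A $$ (i, j) * u j) = ev * u i"
proof -
  obtain ev where "ev \<in> spectrum A" using spectrum_non_empty[OF A] by auto
  then obtain v where v: "v \<in> carrier_vec (Suc n)" "v \<noteq> 0\<^sub>v (Suc n)" "A *\<^sub>v v = ev \<cdot>\<^sub>v v"
    using A by (auto simp: spectrum_def eigenvalue_def eigenvector_def)
  define N where "N = (\<Sum>i<Suc n. (cmod (v $ i))\<^sup>2)"
  have "\<exists>i<Suc n. v $ i \<noteq> 0" using v(1,2) by (metis carrier_vecD eq_vecI index_zero_vec)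
  then obtain i0 where i0: "i0 < Suc n" "v $ i0 \<noteq> 0" by blast
  have "0 < (cmod (v $ i0))\<^sup>2" using i0 by simp
  also have "\<dots> \<le> N" unfolding N_def using i0 by (intro member_le_sum) auto
  finally have N: "N > 0" .
  \<comment> \<open>A phase that makes the first coordinate real, as \<open>householder\<close>
    requires. If this coordinate vanishes, the phase is arbitrary and 1 is taken.\<close>
  define c where "c = (if v $ 0 = 0 then 1 else cnj (v $ 0) / cmod (v $ 0))"
  have "cmod c = 1" by (auto simp: c_def norm_divide)
  then have cc: "c * cnj c = 1" using complex_norm_square[of c] by simp
  have c0: "cnj (c * v $ 0) = c * v $ 0" by (auto simp: c_def mult.commute)
  define u where "u = (\<lambda>i. c * v $ i / sqrt N)"
  have "(\<Sum>i<Suc n. u i * cnj (u i)) = (\<Sum>i<Suc n. of_real ((cmod (v $ i))\<^sup>2 / N))"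
  proof (intro sum.cong refl)
    fix i
    have "u i * cnj (u i) = (c * cnj c) * (v $ i * cnj (v $ i)) / (of_real (sqrt N) * of_real (sqrt N))"
      by (simp add: u_def)
    also have "\<dots> = of_real ((cmod (v $ i))\<^sup>2) / of_real (sqrt N * sqrt N)"
      unfolding cc by (simp only: complex_norm_square[symmetric] of_real_mult mult_1_left)
    also have "\<dots> = of_real ((cmod (v $ i))\<^sup>2 / N)" using N by simp
    finally show "u i * cnj (u i) = of_real ((cmod (v $ i))\<^sup>2 / N)" .
  qed
  also have "\<dots> = of_real ((\<Sum>i<Suc n. (cmod (v $ i))\<^sup>2) / N)" by (simp only: of_real_sum sum_divide_distrib)
  also have "\<dots> = 1" using N by (simp add: N_def del: sum.lessThan_Suc)
  finally have 1: "(\<Sum>i<Suc n. u i * cnj (u i)) = 1" .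
  have 2: "cnj (u 0) = u 0" using c0 by (simp add: u_def)
  have 3: "(\<Sum>j<Suc n. A $$ (i, j) * u j) = ev * u i" if i: "i < Suc n" for i
  proof -
    have "(\<Sum>j<Suc n. A $$ (i, j) * v $ j) = (A *\<^sub>v v) $ i"
      using A v(1) i by (auto simp: scalar_prod_def atLeast0LessThan intro!: sum.cong)
    also have "\<dots> = ev * v $ i" using v i by simp
    finally have *: "(\<Sum>j<Suc n. A $$ (i, j) * v $ j) = ev * v $ i" .
    have "(\<Sum>j<Suc n. A $$ (i, j) * u j) = (c / sqrt N) * (\<Sum>j<Suc n. A $$ (i, j) * v $ j)"
      unfolding sum_distrib_left by (intro sum.cong) (auto simp: u_def)
    then show ?thesis unfolding * by (simp add: u_def)
  qed
  show ?thesis by (rule that[OF 1 2 3])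
qed

text \<open>Deflation: \<open>R\<close> is a reflection with a unit eigenvector as first column, so
  the first column of \<open>R A R\<close> is \<open>ev\<close> times the first basis vector, and by
  symmetry so is the first row. The remaining block is Hermitian of smaller size.\<close>

theorem hermitian_spectral:
  "hermitian n A \<Longrightarrow> \<exists>U d. spectral n A U d"
proof (induction n arbitrary: A)
  case 0
  then have "A \<in> carrier_mat 0 0" by (simp add: hermitian_def)
  then have "spectral 0 A (1\<^sub>m 0) d" for d by (auto simp: spectral_def unitary_iff mat_adjoint_def intro!: eq_matI)
  then show ?case by blast
next
  case (Suc n)
  have A: "A \<in> carrier_mat (Suc n) (Suc n)" and herm: "mat_adjoint A = A" using Suc.prems by (auto simp: hermitian_def)
  obtain u ev where u: "(\<Sum>i<Suc n. u i * cnj (u i)) = 1" "cnj (u 0) = u 0"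
    "\<And>i. i < Suc n \<Longrightarrow> (\<Sum>j<Suc n. A $$ (i, j) * u j) = ev * u i" using hermitian_eigenvector[OF A] by blast
  obtain R where R: "R \<in> carrier_mat (Suc n) (Suc n)" "mat_adjoint R = R" "R * R = 1\<^sub>m (Suc n)"
    "\<And>i. i < Suc n \<Longrightarrow> R $$ (i, 0) = u i" using householder[OF u(1,2)] by metis
  define B where "B = R * (A * R)"
  note AR = mult_carrier_mat[OF A R(1)]
  have B: "B \<in> carrier_mat (Suc n) (Suc n)" unfolding B_def by (rule mult_carrier_mat[OF R(1) AR])
  have Bherm: "mat_adjoint B = B"
    unfolding B_def adjoint_mult[OF R(1) AR] adjoint_mult[OF A R(1)] R(2) herm
    by (rule assoc_mult_mat[OF R(1) A R(1)])
  have Bsym: "cnj (B $$ (j, i)) = B $$ (i, j)" if "i < Suc n" "j < Suc n" for i j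
    using adjoint_index[OF B that] Bherm by simp
  have B0: "B $$ (i, 0) = (if i = 0 then ev else 0)" if i: "i < Suc n" for i
  proof -
    have "B $$ (i, 0) = (\<Sum>k<Suc n. R $$ (i, k) * (A * R) $$ (k, 0))"
      unfolding B_def by (rule mult_index[OF R(1) AR i]) simp
    also have "\<dots> = (\<Sum>k<Suc n. ev * (R $$ (i, k) * R $$ (k, 0)))"
    proof (intro sum.cong refl)
      fix k assume "k \<in> {..<Suc n}"
      then have k: "k < Suc n" by simp
      have "(A * R) $$ (k, 0) = (\<Sum>j<Suc n. A $$ (k, j) * R $$ (j, 0))" by (rule mult_index[OF A R(1) k]) simp
      also have "\<dots> = (\<Sum>j<Suc n. A $$ (k, j) * u j)" using R(4) by (intro sum.cong) auto
      also have "\<dots> = ev * R $$ (k, 0)" using u(3)[OF k] R(4)[OF k] by simp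
      finally show "R $$ (i, k) * (A * R) $$ (k, 0) = ev * (R $$ (i, k) * R $$ (k, 0))" by simp
    qed
    also have "\<dots> = ev * (R * R) $$ (i, 0)"
      unfolding sum_distrib_left[symmetric] using mult_index[OF R(1) R(1) i, of 0] by simp
    finally show ?thesis using R(3) i by simp
  qed
  have evr: "of_real (Re ev) = ev" using Bsym[of 0 0] B0[of 0] by (simp add: complex_eq_iff)
  have B0': "B $$ (0, j) = (if j = 0 then ev else 0)" if "j < Suc n" for j
    using Bsym[of 0 j] B0[OF that] Bsym[of 0 0] B0[of 0] that by (auto split: if_splits)
  define A3 where "A3 = mat n n (\<lambda>(i, j). B $$ (Suc i, Suc j))"
  have "hermitian n A3" unfolding hermitian_index A3_def using Bsym by auto
  then obtain U3 d3 where U3: "unitary n U3" "A3 = U3 * real_diag n d3 * mat_adjoint U3"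
    using Suc.IH unfolding spectral_def by blast
  note U3c = unitaryD(1)[OF U3(1)]
  define V where "V = mat (Suc n) (Suc n) (\<lambda>(i, j). case i of 0 \<Rightarrow> (if j = 0 then 1 else 0)
      | Suc i' \<Rightarrow> (case j of 0 \<Rightarrow> 0 | Suc j' \<Rightarrow> U3 $$ (i', j')))"
  define d where "d = case_nat (Re ev) d3"
  have V: "V \<in> carrier_mat (Suc n) (Suc n)" by (simp add: V_def)
  have Vi: "V $$ (0, 0) = 1" "\<And>j. j < n \<Longrightarrow> V $$ (0, Suc j) = 0" "\<And>i. i < n \<Longrightarrow> V $$ (Suc i, 0) = 0"
    "\<And>i j. i < n \<Longrightarrow> j < n \<Longrightarrow> V $$ (Suc i, Suc j) = U3 $$ (i, j)" by (auto simp: V_def)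
  have "unitary (Suc n) V"
    unfolding unitary_iff
  proof (intro conjI V allI impI)
    fix i j assume ij: "i < Suc n" "j < Suc n"
    show "(\<Sum>k<Suc n. V $$ (i, k) * cnj (V $$ (j, k))) = (if i = j then 1 else 0)"
      unfolding sum.lessThan_Suc_shift using ij
      by (cases i; cases j) (simp_all add: Vi unitaryD(2)[OF U3(1)])
    show "(\<Sum>k<Suc n. cnj (V $$ (k, i)) * V $$ (k, j)) = (if i = j then 1 else 0)"
      unfolding sum.lessThan_Suc_shift using ij
      by (cases i; cases j) (simp_all add: Vi unitaryD(3)[OF U3(1)])
  qed
  have BV: "B = V * real_diag (Suc n) d * mat_adjoint V"
  proof (rule eq_matI)
    fix i j assume "i < dim_row (V * real_diag (Suc n) d * mat_adjoint V)" "j < dim_col (V * real_diag (Suc n) d * mat_adjoint V)"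
    then have ij: "i < Suc n" "j < Suc n" using V adjoint_carrier[OF V] by auto
    have sub: "B $$ (Suc i', Suc j') = (\<Sum>k<n. U3 $$ (i', k) * of_real (d3 k) * cnj (U3 $$ (j', k)))"
      if "i' < n" "j' < n" for i' j'
    proof -
      have "B $$ (Suc i', Suc j') = A3 $$ (i', j')" using that by (simp add: A3_def)
      then show ?thesis unfolding U3(2) using conj_diag_index[OF U3c that] by simp
    qed
    show "B $$ (i, j) = (V * real_diag (Suc n) d * mat_adjoint V) $$ (i, j)"
      unfolding conj_diag_index[OF V ij] sum.lessThan_Suc_shift using ij
      by (cases i; cases j) (simp_all add: Vi d_def evr B0 B0' sub)
  qed (use B V adjoint_carrier[OF V] in auto)
  have "unitary (Suc n) R" using R by (simp add: unitary_def)
  then have UU: "unitary (Suc n) (R * V)" using \<open>unitary (Suc n) V\<close> by (rule unitary_mult)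
  have Va: "mat_adjoint V \<in> carrier_mat (Suc n) (Suc n)" by (rule adjoint_carrier[OF V])
  have VD: "V * real_diag (Suc n) d \<in> carrier_mat (Suc n) (Suc n)" using V by simp
  have "A = (R * R) * A * (R * R)" using R(3) A by simp
  also have "\<dots> = R * B * R" unfolding B_def using A R(1)
    by (simp add: assoc_mult_mat[of _ "Suc n" "Suc n" _ "Suc n" _ "Suc n"] mult_carrier_mat[of _ "Suc n" "Suc n" _ "Suc n"])
  also have "\<dots> = (R * V) * real_diag (Suc n) d * (mat_adjoint V * R)"
    unfolding BV using V VD Va R(1)
    by (simp add: assoc_mult_mat[of _ "Suc n" "Suc n" _ "Suc n" _ "Suc n"] mult_carrier_mat[of _ "Suc n" "Suc n" _ "Suc n"])
  also have "mat_adjoint V * R = mat_adjoint (R * V)" using adjoint_mult[OF R(1) V] R(2) by simp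
  finally show ?case using UU unfolding spectral_def by blast
qed

text \<open>The change of basis \<open>W\<close> intertwines the two diagonal matrices, that is,
  \<open>W i j * d j = e i * W i j\<close>. An entry can be nonzero only where
  \<open>d j = e i\<close>, hence \<open>W\<close> intertwines the images under \<open>f\<close> as
  well.\<close>

lemma spectral_mat_fun_unique:
  assumes "spectral n A U d" "spectral n A V e"
  shows "U * real_diag n (f \<circ> d) * mat_adjoint U = V * real_diag n (f \<circ> e) * mat_adjoint V"
proof -
  have U: "U \<in> carrier_mat n n" "unitary n U" and V: "V \<in> carrier_mat n n" "unitary n V"
    and eq: "U * real_diag n d * mat_adjoint U = V * real_diag n e * mat_adjoint V"
    using assms by (auto simp: spectral_def unitary_def)
  note Ua = adjoint_carrier[OF U(1)] and Va = adjoint_carrier[OF V(1)]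
  have Ui: "mat_adjoint U * U = 1\<^sub>m n" "U * mat_adjoint U = 1\<^sub>m n" and Vi: "mat_adjoint V * V = 1\<^sub>m n" "V * mat_adjoint V = 1\<^sub>m n"
    using U(2) V(2) by (auto simp: unitary_def)
  note as = assoc_mult_mat[of _ n n _ n _ n] mult_carrier_mat[of _ n n _ n]
  define W where "W = mat_adjoint V * U"
  have W: "W \<in> carrier_mat n n" unfolding W_def using Va U(1) by simp
  have "W * real_diag n d = mat_adjoint V * (U * real_diag n d * (mat_adjoint U * U))"
    unfolding W_def Ui(1) using Va U(1) by (simp add: as right_mult_one_mat[OF real_diag_carrier])
  also have "\<dots> = mat_adjoint V * (U * real_diag n d * mat_adjoint U) * U"
    using Va Ua U(1) by (simp add: as)
  also have "\<dots> = (mat_adjoint V * V) * real_diag n e * W"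
    unfolding eq W_def using Va U(1) V(1) by (simp add: as)
  finally have WD: "W * real_diag n d = real_diag n e * W" unfolding Vi(1) using W by (simp add: left_mult_one_mat[OF real_diag_carrier])
  have left: "(W * real_diag n g) $$ (i, j) = W $$ (i, j) * of_real (g j)" if "i < n" "j < n" for i j g
  proof -
    have "(W * real_diag n g) $$ (i, j) = (\<Sum>l<n. if l = j then W $$ (i, j) * of_real (g j) else 0)"
      unfolding mult_index[OF W real_diag_carrier that] using that by (intro sum.cong) (auto simp: real_diag_def)
    then show ?thesis using that by simp
  qed
  have right: "(real_diag n g * W) $$ (i, j) = of_real (g i) * W $$ (i, j)" if "i < n" "j < n" for i j g
  proof -
    have "(real_diag n g * W) $$ (i, j) = (\<Sum>l<n. if l = i then of_real (g i) * W $$ (i, j) else 0)"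
      unfolding mult_index[OF real_diag_carrier W that] using that by (intro sum.cong) (auto simp: real_diag_def)
    then show ?thesis using that by simp
  qed
  have WF: "W * real_diag n (f \<circ> d) = real_diag n (f \<circ> e) * W"
  proof (rule eq_matI)
    fix i j assume "i < dim_row (real_diag n (f \<circ> e) * W)" "j < dim_col (real_diag n (f \<circ> e) * W)"
    then have ij: "i < n" "j < n" using W by (auto simp: real_diag_def)
    have "W $$ (i, j) * of_real (d j) = of_real (e i) * W $$ (i, j)"
      using arg_cong[OF WD, of "\<lambda>M. M $$ (i, j)"] left[OF ij] right[OF ij] by simp
    then have "W $$ (i, j) = 0 \<or> d j = e i" by (auto simp: mult.commute)
    then show "(W * real_diag n (f \<circ> d)) $$ (i, j) = (real_diag n (f \<circ> e) * W) $$ (i, j)"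
      unfolding left[OF ij] right[OF ij] by auto
  qed (use W in \<open>auto simp: real_diag_def\<close>)
  have "U * real_diag n (f \<circ> d) * mat_adjoint U = (V * mat_adjoint V) * U * real_diag n (f \<circ> d) * mat_adjoint U"
    unfolding Vi(2) using U(1) by simp
  also have "\<dots> = V * (W * real_diag n (f \<circ> d)) * mat_adjoint U"
    unfolding W_def using U(1) V(1) Va Ua by (simp add: as)
  also have "\<dots> = V * real_diag n (f \<circ> e) * (mat_adjoint V * (U * mat_adjoint U))"
    unfolding WF unfolding W_def using U(1) V(1) Va Ua by (simp add: as)
  also have "\<dots> = V * real_diag n (f \<circ> e) * mat_adjoint V" unfolding Ui(2) using Va by simp
  finally show ?thesis .
qed

lemma spectralD:
  assumes "spectral n A U d"
  shows "A \<in> carrier_mat n n" "unitary n U" "U \<in> carrier_mat n n"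
    "i < n \<Longrightarrow> j < n \<Longrightarrow> A $$ (i, j) = (\<Sum>k<n. U $$ (i, k) * of_real (d k) * cnj (U $$ (j, k)))"
proof -
  show U: "unitary n U" "U \<in> carrier_mat n n" using assms by (auto simp: spectral_def unitary_def)
  have eq: "A = U * real_diag n d * mat_adjoint U" using assms by (simp add: spectral_def)
  show "A \<in> carrier_mat n n" unfolding eq by (rule mult_carrier_mat[OF mult_carrier_mat[OF U(2) real_diag_carrier] adjoint_carrier[OF U(2)]])
  show "i < n \<Longrightarrow> j < n \<Longrightarrow> A $$ (i, j) = (\<Sum>k<n. U $$ (i, k) * of_real (d k) * cnj (U $$ (j, k)))"
    unfolding eq by (rule conj_diag_index[OF U(2)])
qed

lemma mat_fun_spectral:
  assumes "spectral n A U d"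
  shows "spectral n (mat_fun f A) U (f \<circ> d)"
proof -
  have n: "dim_row A = n" using spectralD(1)[OF assms] by simp
  have "mat_fun f A = U * real_diag n (f \<circ> d) * mat_adjoint U"
    unfolding mat_fun_def n
  proof (rule the_equality)
    show "\<exists>U' d'. unitary n U' \<and> A = U' * real_diag n d' * mat_adjoint U' \<and>
        U * real_diag n (f \<circ> d) * mat_adjoint U = U' * real_diag n (f \<circ> d') * mat_adjoint U'"
      using assms by (auto simp: spectral_def)
    show "B = U * real_diag n (f \<circ> d) * mat_adjoint U"
      if "\<exists>U' d'. unitary n U' \<and> A = U' * real_diag n d' * mat_adjoint U' \<and> B = U' * real_diag n (f \<circ> d') * mat_adjoint U'" for B
      using that spectral_mat_fun_unique[OF assms, of _ _ f] by (auto simp: spectral_def)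
  qed
  then show ?thesis using assms by (simp add: spectral_def)
qed

lemma spectral_hermitian: "spectral n A U d \<Longrightarrow> hermitian n A"
  unfolding hermitian_index
  by (auto simp: spectralD(1) spectralD(4) intro!: sum.cong)

section \<open>Quadratic forms in an eigenbasis\<close>

definition qform :: "nat \<Rightarrow> complex mat \<Rightarrow> complex vec \<Rightarrow> real" where
  "qform n A v = Re (\<Sum>i<n. \<Sum>j<n. A $$ (i, j) * v $ j * cnj (v $ i))"

definition ucoef :: "nat \<Rightarrow> complex mat \<Rightarrow> complex vec \<Rightarrow> nat \<Rightarrow> complex" where
  "ucoef n U v k = (\<Sum>i<n. cnj (U $$ (i, k)) * v $ i)"

lemma inner_eq_sum:
  assumes "A \<in> carrier_mat n n" "v \<in> carrier_vec n"
  shows "(A *\<^sub>v v) \<bullet>c v = (\<Sum>i<n. \<Sum>j<n. A $$ (i, j) * v $ j * cnj (v $ i))"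
  using assms by (auto simp: scalar_prod_def atLeast0LessThan sum_distrib_right intro!: sum.cong)

lemma hermitian_inner_real:
  assumes A: "hermitian n A" and v: "v \<in> carrier_vec n"
  shows "(A *\<^sub>v v) \<bullet>c v = of_real (qform n A v)"
proof -
  have Ac: "A \<in> carrier_mat n n" and sym: "\<And>i j. i < n \<Longrightarrow> j < n \<Longrightarrow> cnj (A $$ (j, i)) = A $$ (i, j)"
    using A by (auto simp: hermitian_index)
  let ?s = "\<Sum>i<n. \<Sum>j<n. A $$ (i, j) * v $ j * cnj (v $ i)"
  have "cnj ?s = (\<Sum>i<n. \<Sum>j<n. A $$ (j, i) * v $ i * cnj (v $ j))"
    unfolding cnj_sum by (intro sum.cong refl) (auto simp: sym mult_ac)
  also have "\<dots> = ?s" by (rule sum.swap)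
  finally have "?s \<in> \<real>" by (simp only: Reals_cnj_iff)
  then have "of_real (Re ?s) = ?s" by (rule of_real_Re)
  then show ?thesis unfolding inner_eq_sum[OF Ac v] qform_def by simp
qed

lemma qform_spectral:
  assumes "spectral n A U d"
  shows "qform n A v = (\<Sum>k<n. d k * (cmod (ucoef n U v k))\<^sup>2)"
proof -
  have "(\<Sum>i<n. \<Sum>j<n. A $$ (i, j) * v $ j * cnj (v $ i)) =
      (\<Sum>i<n. \<Sum>j<n. \<Sum>k<n. of_real (d k) * ((cnj (U $$ (j, k)) * v $ j) * cnj (cnj (U $$ (i, k)) * v $ i)))"
  proof (intro sum.cong refl)
    fix i j assume "i \<in> {..<n}" "j \<in> {..<n}"
    then have "A $$ (i, j) = (\<Sum>k<n. U $$ (i, k) * of_real (d k) * cnj (U $$ (j, k)))"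
      by (intro spectralD(4)[OF assms]) auto
    then show "A $$ (i, j) * v $ j * cnj (v $ i) =
        (\<Sum>k<n. of_real (d k) * ((cnj (U $$ (j, k)) * v $ j) * cnj (cnj (U $$ (i, k)) * v $ i)))"
      by (simp only: sum_distrib_right) (intro sum.cong refl, simp add: mult_ac)
  qed
  also have "\<dots> = (\<Sum>i<n. \<Sum>k<n. \<Sum>j<n. of_real (d k) * ((cnj (U $$ (j, k)) * v $ j) * cnj (cnj (U $$ (i, k)) * v $ i)))"
    by (intro sum.cong refl sum.swap)
  also have "\<dots> = (\<Sum>k<n. \<Sum>i<n. \<Sum>j<n. of_real (d k) * ((cnj (U $$ (j, k)) * v $ j) * cnj (cnj (U $$ (i, k)) * v $ i)))"
    by (rule sum.swap)
  also have "\<dots> = (\<Sum>k<n. of_real (d k) * (ucoef n U v k * cnj (ucoef n U v k)))"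
  proof (intro sum.cong refl)
    fix k
    show "(\<Sum>i<n. \<Sum>j<n. of_real (d k) * ((cnj (U $$ (j, k)) * v $ j) * cnj (cnj (U $$ (i, k)) * v $ i)))
        = of_real (d k) * (ucoef n U v k * cnj (ucoef n U v k))"
      unfolding ucoef_def cnj_sum sum_product by (subst sum.swap) (simp only: sum_distrib_left)
  qed
  also have "\<dots> = (\<Sum>k<n. of_real (d k * (cmod (ucoef n U v k))\<^sup>2))"
    by (intro sum.cong refl) (simp add: complex_norm_square[symmetric])
  finally show ?thesis unfolding qform_def by simp
qed

lemma ucoef_norm:
  assumes "unitary n U"
  shows "(\<Sum>k<n. (cmod (ucoef n U v k))\<^sup>2) = (\<Sum>i<n. (cmod (v $ i))\<^sup>2)"
proof -
  have "spectral n (1\<^sub>m n) U (\<lambda>_. 1)"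
  proof -
    have "real_diag n (\<lambda>_. 1) = 1\<^sub>m n" by (auto simp: real_diag_def intro!: eq_matI)
    then show ?thesis using assms by (auto simp: spectral_def unitary_def)
  qed
  from qform_spectral[OF this, of v]
  have "(\<Sum>k<n. (cmod (ucoef n U v k))\<^sup>2) = qform n (1\<^sub>m n) v" by simp
  also have "\<dots> = Re (\<Sum>i<n. \<Sum>j<n. if j = i then v $ i * cnj (v $ i) else 0)"
    unfolding qform_def by (intro arg_cong[of _ _ Re] sum.cong) auto
  also have "\<dots> = (\<Sum>i<n. (cmod (v $ i))\<^sup>2)"
    by (simp add: complex_norm_square[symmetric] flip: of_real_power)
  finally show ?thesis .
qed

lemma spectral_eigenvector:
  assumes "spectral n A U d" "i < n" "k < n"
  shows "(\<Sum>j<n. A $$ (i, j) * U $$ (j, k)) = of_real (d k) * U $$ (i, k)"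
proof -
  have "(\<Sum>j<n. A $$ (i, j) * U $$ (j, k)) =
      (\<Sum>j<n. \<Sum>l<n. U $$ (i, l) * of_real (d l) * (cnj (U $$ (j, l)) * U $$ (j, k)))"
    using assms by (intro sum.cong refl) (simp add: spectralD(4)[OF assms(1)] sum_distrib_right mult.assoc)
  also have "\<dots> = (\<Sum>l<n. \<Sum>j<n. U $$ (i, l) * of_real (d l) * (cnj (U $$ (j, l)) * U $$ (j, k)))"
    by (rule sum.swap)
  also have "\<dots> = (\<Sum>l<n. if l = k then U $$ (i, l) * of_real (d l) else 0)"
    using assms unitaryD(3)[OF spectralD(2)[OF assms(1)]]
    by (intro sum.cong refl) (simp add: sum_distrib_left[symmetric])
  also have "\<dots> = of_real (d k) * U $$ (i, k)" using assms(3) by simp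
  finally show ?thesis .
qed

lemma spectral_spectrum:
  assumes "spectral n A U d"
  shows "spectrum A = (\<lambda>k. complex_of_real (d k)) ` {..<n}"
proof (intro equalityI subsetI)
  have A: "A \<in> carrier_mat n n" and U: "U \<in> carrier_mat n n" using spectralD[OF assms] by auto
  have Av: "(A *\<^sub>v v) $ i = (\<Sum>j<n. A $$ (i, j) * v $ j)" if "v \<in> carrier_vec n" "i < n" for v i
    using A that by (auto simp: scalar_prod_def atLeast0LessThan intro!: sum.cong)
  {
    fix z assume "z \<in> (\<lambda>k. complex_of_real (d k)) ` {..<n}"
    then obtain k where k: "k < n" "z = of_real (d k)" by auto
    have "A *\<^sub>v col U k = z \<cdot>\<^sub>v col U k"
      using A U k Av[of "col U k"] spectral_eigenvector[OF assms _ k(1)] by (intro eq_vecI) auto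
    moreover have "col U k \<noteq> 0\<^sub>v n"
    proof
      assume "col U k = 0\<^sub>v n"
      then have "U $$ (i, k) = 0" if "i < n" for i using U k that by (metis carrier_matD index_col index_zero_vec(1))
      then have "(\<Sum>i<n. cnj (U $$ (i, k)) * U $$ (i, k)) = 0" by simp
      then show False using unitaryD(3)[OF spectralD(2)[OF assms] k(1) k(1)] by simp
    qed
    ultimately have "eigenvector A (col U k) z" using A U k by (auto simp: eigenvector_def)
    then show "z \<in> spectrum A" by (auto simp: spectrum_def eigenvalue_def)
  next
    fix z assume "z \<in> spectrum A"
    then obtain v where v: "v \<in> carrier_vec n" "v \<noteq> 0\<^sub>v n" "A *\<^sub>v v = z \<cdot>\<^sub>v v"
      using A by (auto simp: spectrum_def eigenvalue_def eigenvector_def)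
    have "\<exists>k<n. ucoef n U v k \<noteq> 0"
    proof (rule ccontr)
      assume "\<not> ?thesis"
      then have "(\<Sum>i<n. (cmod (v $ i))\<^sup>2) = 0" using ucoef_norm[OF spectralD(2)[OF assms], of v] by simp
      then have "\<forall>i<n. v $ i = 0" by (subst (asm) sum_nonneg_eq_0_iff) auto
      then show False using v(1,2) by (metis carrier_vecD eq_vecI index_zero_vec)
    qed
    then obtain k where k: "k < n" "ucoef n U v k \<noteq> 0" by blast
    have conj_ev: "(\<Sum>i<n. cnj (U $$ (i, k)) * A $$ (i, j)) = of_real (d k) * cnj (U $$ (j, k))" if "j < n" for j
    proof -
      have herm: "\<And>i. i < n \<Longrightarrow> A $$ (i, j) = cnj (A $$ (j, i))"
        using spectral_hermitian[OF assms] that by (auto simp: hermitian_index)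
      have "(\<Sum>i<n. cnj (U $$ (i, k)) * A $$ (i, j)) = cnj (\<Sum>i<n. A $$ (j, i) * U $$ (i, k))"
        unfolding cnj_sum by (intro sum.cong) (auto simp: herm mult.commute)
      then show ?thesis unfolding spectral_eigenvector[OF assms that k(1)] by simp
    qed
    have "z * ucoef n U v k = (\<Sum>i<n. cnj (U $$ (i, k)) * (A *\<^sub>v v) $ i)"
      unfolding v(3) ucoef_def sum_distrib_left using v(1) by (intro sum.cong) auto
    also have "\<dots> = (\<Sum>i<n. \<Sum>j<n. cnj (U $$ (i, k)) * A $$ (i, j) * v $ j)"
      using Av[OF v(1)] by (intro sum.cong refl) (simp add: sum_distrib_left mult.assoc)
    also have "\<dots> = (\<Sum>j<n. \<Sum>i<n. cnj (U $$ (i, k)) * A $$ (i, j) * v $ j)" by (rule sum.swap)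
    also have "\<dots> = (\<Sum>j<n. of_real (d k) * cnj (U $$ (j, k)) * v $ j)"
      using conj_ev by (intro sum.cong refl) (simp add: sum_distrib_right[symmetric])
    also have "\<dots> = of_real (d k) * ucoef n U v k" by (simp add: ucoef_def sum_distrib_left mult.assoc)
    finally have "z = of_real (d k)" using k(2) by simp
    then show "z \<in> (\<lambda>k. complex_of_real (d k)) ` {..<n}" using k(1) by auto
  }
qed

lemma spectral_spectrum_subset:
  assumes "spectral n A U d"
  shows "spectrum A \<subseteq> complex_of_real ` S \<longleftrightarrow> (\<forall>k<n. d k \<in> S)"
  unfolding spectral_spectrum[OF assms] by auto

lemma hermitian_combination:
  assumes "hermitian n A" "hermitian n B"
  shows "hermitian n (complex_of_real s \<cdot>\<^sub>m A + complex_of_real t \<cdot>\<^sub>m B)"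
    "hermitian n (A - B)"
  using assms by (auto simp: hermitian_index)

lemma qform_combination:
  assumes "A \<in> carrier_mat n n" "B \<in> carrier_mat n n"
  shows "qform n (complex_of_real s \<cdot>\<^sub>m A + complex_of_real t \<cdot>\<^sub>m B) v = s * qform n A v + t * qform n B v"
    "qform n (A - B) v = qform n A v - qform n B v"
proof -
  have "qform n (complex_of_real s \<cdot>\<^sub>m A + complex_of_real t \<cdot>\<^sub>m B) v =
      Re (\<Sum>i<n. \<Sum>j<n. of_real s * (A $$ (i, j) * v $ j * cnj (v $ i)) + of_real t * (B $$ (i, j) * v $ j * cnj (v $ i)))"
    unfolding qform_def using assms by (intro arg_cong[of _ _ Re] sum.cong refl) (simp add: algebra_simps)
  then show "qform n (complex_of_real s \<cdot>\<^sub>m A + complex_of_real t \<cdot>\<^sub>m B) v = s * qform n A v + t * qform n B v"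
    by (simp add: sum.distrib sum_distrib_left[symmetric] qform_def)
  have "qform n (A - B) v = Re (\<Sum>i<n. \<Sum>j<n. A $$ (i, j) * v $ j * cnj (v $ i) - B $$ (i, j) * v $ j * cnj (v $ i))"
    unfolding qform_def using assms by (intro arg_cong[of _ _ Re] sum.cong refl) (simp add: algebra_simps)
  then show "qform n (A - B) v = qform n A v - qform n B v" by (simp add: sum_subtractf qform_def)
qed

text \<open>Hermitian matrices have real quadratic forms, so for each fixed \<open>v\<close> the
  Loewner order becomes an inequality of real numbers, accessible to calculus in one
  variable.\<close>

lemma n_convex_on_iff_qform:
  "n_convex_on n S f \<longleftrightarrow> (\<forall>t A B v. 0 \<le> t \<and> t \<le> 1 \<and> hermitian n A \<and> hermitian n B
      \<and> spectrum A \<subseteq> complex_of_real ` S \<and> spectrum B \<subseteq> complex_of_real ` S \<and> v \<in> carrier_vec n \<longrightarrow>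
      qform n (mat_fun f (complex_of_real t \<cdot>\<^sub>m A + complex_of_real (1 - t) \<cdot>\<^sub>m B)) v
        \<le> t * qform n (mat_fun f A) v + (1 - t) * qform n (mat_fun f B) v)"
proof -
  have *: "loewner_le n (mat_fun f (complex_of_real t \<cdot>\<^sub>m A + complex_of_real (1 - t) \<cdot>\<^sub>m B))
      (complex_of_real t \<cdot>\<^sub>m mat_fun f A + complex_of_real (1 - t) \<cdot>\<^sub>m mat_fun f B) \<longleftrightarrow>
      (\<forall>v\<in>carrier_vec n. qform n (mat_fun f (complex_of_real t \<cdot>\<^sub>m A + complex_of_real (1 - t) \<cdot>\<^sub>m B)) v
        \<le> t * qform n (mat_fun f A) v + (1 - t) * qform n (mat_fun f B) v)"
    if A: "hermitian n A" and B: "hermitian n B" for t A B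
  proof -
    have mf: "hermitian n (mat_fun f M)" if "hermitian n M" for M
      using hermitian_spectral[OF that] mat_fun_spectral spectral_hermitian by blast
    let ?C = "mat_fun f (complex_of_real t \<cdot>\<^sub>m A + complex_of_real (1 - t) \<cdot>\<^sub>m B)"
    let ?D = "complex_of_real t \<cdot>\<^sub>m mat_fun f A + complex_of_real (1 - t) \<cdot>\<^sub>m mat_fun f B"
    have C: "hermitian n ?C" by (rule mf[OF hermitian_combination(1)[OF A B]])
    have D: "hermitian n ?D" by (rule hermitian_combination(1)[OF mf[OF A] mf[OF B]])
    have c: "?C \<in> carrier_mat n n" "?D \<in> carrier_mat n n" "mat_fun f A \<in> carrier_mat n n" "mat_fun f B \<in> carrier_mat n n"
      using C D mf[OF A] mf[OF B] by (auto simp: hermitian_def)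
    have "loewner_le n ?C ?D \<longleftrightarrow> (\<forall>v\<in>carrier_vec n. 0 \<le> ((?D - ?C) *\<^sub>v v) \<bullet>c v)"
      using c hermitian_combination(2)[OF D C] by (simp add: loewner_le_def psd_def)
    also have "\<dots> \<longleftrightarrow> (\<forall>v\<in>carrier_vec n. 0 \<le> qform n (?D - ?C) v)"
      using hermitian_inner_real[OF hermitian_combination(2)[OF D C]] by (simp add: less_eq_complex_def)
    finally show ?thesis
      unfolding qform_combination(2)[OF c(2,1)] qform_combination(1)[OF c(3,4)] by (simp only: diff_ge_0_iff_ge)
  qed
  show ?thesis unfolding n_convex_on_def using * by blast
qed

section \<open>The second-order perturbation expansion\<close>

definition lin :: "complex mat \<Rightarrow> complex mat \<Rightarrow> real \<Rightarrow> complex mat" where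
  "lin A H s = A + complex_of_real s \<cdot>\<^sub>m H"

lemma lin_index: "A \<in> carrier_mat n n \<Longrightarrow> H \<in> carrier_mat n n \<Longrightarrow> i < n \<Longrightarrow> j < n \<Longrightarrow>
    lin A H s $$ (i, j) = A $$ (i, j) + of_real s * H $$ (i, j)"
  by (simp add: lin_def)

lemma lin_hermitian: "hermitian n A \<Longrightarrow> hermitian n H \<Longrightarrow> hermitian n (lin A H s)"
  by (auto simp: hermitian_index lin_def)

lemma lin_zero: "A \<in> carrier_mat n n \<Longrightarrow> H \<in> carrier_mat n n \<Longrightarrow> lin A H 0 = A"
  by (auto simp: lin_def)

lemma lin_combination:
  assumes "A \<in> carrier_mat n n" "H \<in> carrier_mat n n"
  shows "complex_of_real t \<cdot>\<^sub>m lin A H x + complex_of_real (1 - t) \<cdot>\<^sub>m lin A H y = lin A H (t * x + (1 - t) * y)"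
  using assms by (intro eq_matI) (auto simp: lin_def algebra_simps)

lemma lin_segment:
  assumes "A \<in> carrier_mat n n" "B \<in> carrier_mat n n"
  shows "lin B (A - B) t = complex_of_real t \<cdot>\<^sub>m A + complex_of_real (1 - t) \<cdot>\<^sub>m B"
  using assms by (intro eq_matI) (auto simp: lin_def algebra_simps)

lemma qform_lin:
  assumes "A \<in> carrier_mat n n" "H \<in> carrier_mat n n"
  shows "qform n (lin A H s) v = qform n A v + s * qform n H v"
proof -
  have "qform n (lin A H s) v = Re (\<Sum>i<n. \<Sum>j<n. A $$ (i, j) * v $ j * cnj (v $ i) + of_real s * (H $$ (i, j) * v $ j * cnj (v $ i)))"
    unfolding qform_def using assms by (intro arg_cong[of _ _ Re] sum.cong refl) (simp add: lin_index algebra_simps)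
  then show ?thesis by (simp add: sum.distrib sum_distrib_left[symmetric] qform_def)
qed

text \<open>The vector \<open>(A + s H)\<^sup>m v\<close> and its first and second derivative in \<open>s\<close>.\<close>

primrec pw0 :: "nat \<Rightarrow> complex mat \<Rightarrow> complex mat \<Rightarrow> complex vec \<Rightarrow> nat \<Rightarrow> real \<Rightarrow> nat \<Rightarrow> complex" where
  "pw0 n A H v 0 s i = v $ i"
| "pw0 n A H v (Suc m) s i = (\<Sum>j<n. (A $$ (i, j) + of_real s * H $$ (i, j)) * pw0 n A H v m s j)"

primrec pw1 :: "nat \<Rightarrow> complex mat \<Rightarrow> complex mat \<Rightarrow> complex vec \<Rightarrow> nat \<Rightarrow> real \<Rightarrow> nat \<Rightarrow> complex" where
  "pw1 n A H v 0 s i = 0"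
| "pw1 n A H v (Suc m) s i = (\<Sum>j<n. (A $$ (i, j) + of_real s * H $$ (i, j)) * pw1 n A H v m s j)
    + (\<Sum>j<n. H $$ (i, j) * pw0 n A H v m s j)"

primrec pw2 :: "nat \<Rightarrow> complex mat \<Rightarrow> complex mat \<Rightarrow> complex vec \<Rightarrow> nat \<Rightarrow> real \<Rightarrow> nat \<Rightarrow> complex" where
  "pw2 n A H v 0 s i = 0"
| "pw2 n A H v (Suc m) s i = (\<Sum>j<n. (A $$ (i, j) + of_real s * H $$ (i, j)) * pw2 n A H v m s j)
    + 2 * (\<Sum>j<n. H $$ (i, j) * pw1 n A H v m s j)"

lemma lin_entry_derivative: "((\<lambda>s. a + of_real s * h) has_vector_derivative (h :: complex)) (at s)"
proof -
  have "((\<lambda>s. a + s *\<^sub>R h) has_vector_derivative 0 + (1 *\<^sub>R h)) (at s)"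
    by (intro has_vector_derivative_add has_vector_derivative_const has_vector_derivative_scaleR[where f' = 0, simplified] derivative_eq_intros) (auto intro!: derivative_eq_intros)
  then show ?thesis by (simp add: scaleR_conv_of_real)
qed

lemma pw0_derivative: "((\<lambda>s. pw0 n A H v m s i) has_vector_derivative pw1 n A H v m s i) (at s)"
proof (induction m arbitrary: i)
  case (Suc m)
  have "((\<lambda>s. \<Sum>j<n. (A $$ (i, j) + of_real s * H $$ (i, j)) * pw0 n A H v m s j) has_vector_derivative
      (\<Sum>j<n. (A $$ (i, j) + of_real s * H $$ (i, j)) * pw1 n A H v m s j + H $$ (i, j) * pw0 n A H v m s j)) (at s)"
    by (intro has_vector_derivative_sum has_vector_derivative_mult lin_entry_derivative Suc)
  then show ?case by (simp add: sum.distrib)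
qed simp

lemma pw1_derivative: "((\<lambda>s. pw1 n A H v m s i) has_vector_derivative pw2 n A H v m s i) (at s)"
proof (induction m arbitrary: i)
  case (Suc m)
  have "((\<lambda>s. (\<Sum>j<n. (A $$ (i, j) + of_real s * H $$ (i, j)) * pw1 n A H v m s j)
      + (\<Sum>j<n. H $$ (i, j) * pw0 n A H v m s j)) has_vector_derivative
      (\<Sum>j<n. (A $$ (i, j) + of_real s * H $$ (i, j)) * pw2 n A H v m s j + H $$ (i, j) * pw1 n A H v m s j)
      + (\<Sum>j<n. H $$ (i, j) * pw1 n A H v m s j + 0 * pw0 n A H v m s j)) (at s)"
    by (intro has_vector_derivative_add has_vector_derivative_sum has_vector_derivative_mult
        lin_entry_derivative Suc pw0_derivative has_vector_derivative_const)
  then show ?case by (simp add: sum.distrib add.commute add.left_commute)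
qed simp

lemma continuous_pw: "continuous_on UNIV (\<lambda>s. pw0 n A H v m s i)" "continuous_on UNIV (\<lambda>s. pw1 n A H v m s i)"
  using pw0_derivative pw1_derivative
  by (auto intro!: continuous_at_imp_continuous_on has_vector_derivative_continuous)

lemma continuous_pw2: "continuous_on UNIV (\<lambda>s. pw2 n A H v m s i)"
  by (induction m arbitrary: i) (auto intro!: continuous_intros continuous_pw)

text \<open>The matrix \<open>H\<close> in the orthonormal basis given by the columns of \<open>U\<close>.\<close>

definition ht :: "nat \<Rightarrow> complex mat \<Rightarrow> complex mat \<Rightarrow> nat \<Rightarrow> nat \<Rightarrow> complex" where
  "ht n H U a b = (\<Sum>k<n. cnj (U $$ (k, a)) * (\<Sum>j<n. H $$ (k, j) * U $$ (j, b)))"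

lemma unitary_complete:
  assumes "unitary n U" "i < n"
  shows "(\<Sum>a<n. U $$ (i, a) * (\<Sum>k<n. cnj (U $$ (k, a)) * x k)) = x i"
proof -
  have "(\<Sum>a<n. U $$ (i, a) * (\<Sum>k<n. cnj (U $$ (k, a)) * x k)) = (\<Sum>a<n. \<Sum>k<n. U $$ (i, a) * cnj (U $$ (k, a)) * x k)"
    by (simp add: sum_distrib_left mult.assoc)
  also have "\<dots> = (\<Sum>k<n. \<Sum>a<n. U $$ (i, a) * cnj (U $$ (k, a)) * x k)" by (rule sum.swap)
  also have "\<dots> = (\<Sum>k<n. if k = i then x k else 0)"
    using assms unitaryD(2)[OF assms(1,2)] by (intro sum.cong refl) (simp add: sum_distrib_right[symmetric])
  also have "\<dots> = x i" using assms by simp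
  finally show ?thesis .
qed

context
  fixes n :: nat and A H U :: "complex mat" and v :: "complex vec" and d :: "nat \<Rightarrow> real" and s :: real
  assumes A: "A \<in> carrier_mat n n" and H: "hermitian n H" and sp: "spectral n (lin A H s) U d"
begin

lemma lin_apply_coords:
  assumes "\<And>j. j < n \<Longrightarrow> x j = (\<Sum>a<n. U $$ (j, a) * c a)" "i < n"
  shows "(\<Sum>j<n. (A $$ (i, j) + of_real s * H $$ (i, j)) * x j) = (\<Sum>a<n. U $$ (i, a) * (of_real (d a) * c a))"
proof -
  have Hc: "H \<in> carrier_mat n n" using H by (simp add: hermitian_def)
  have "(\<Sum>j<n. (A $$ (i, j) + of_real s * H $$ (i, j)) * x j) = (\<Sum>j<n. \<Sum>a<n. lin A H s $$ (i, j) * U $$ (j, a) * c a)"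
    using assms by (intro sum.cong refl) (simp add: lin_index[OF A Hc] sum_distrib_left mult.assoc)
  also have "\<dots> = (\<Sum>a<n. \<Sum>j<n. lin A H s $$ (i, j) * U $$ (j, a) * c a)" by (rule sum.swap)
  also have "\<dots> = (\<Sum>a<n. U $$ (i, a) * (of_real (d a) * c a))"
  proof (rule sum.cong[OF refl])
    fix a assume "a \<in> {..<n}"
    then have "(\<Sum>j<n. lin A H s $$ (i, j) * U $$ (j, a)) = of_real (d a) * U $$ (i, a)"
      using spectral_eigenvector[OF sp assms(2)] by simp
    then show "(\<Sum>j<n. lin A H s $$ (i, j) * U $$ (j, a) * c a) = U $$ (i, a) * (of_real (d a) * c a)"
      by (simp add: sum_distrib_right[symmetric])
  qed
  finally show ?thesis .
qed

lemma H_apply_coords: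
  assumes "\<And>j. j < n \<Longrightarrow> x j = (\<Sum>a<n. U $$ (j, a) * c a)" "i < n"
  shows "(\<Sum>j<n. H $$ (i, j) * x j) = (\<Sum>a<n. U $$ (i, a) * (\<Sum>b<n. ht n H U a b * c b))"
proof -
  have "(\<Sum>j<n. H $$ (i, j) * x j) = (\<Sum>j<n. \<Sum>b<n. H $$ (i, j) * U $$ (j, b) * c b)"
    using assms by (intro sum.cong refl) (simp add: sum_distrib_left mult.assoc)
  also have "\<dots> = (\<Sum>b<n. (\<Sum>j<n. H $$ (i, j) * U $$ (j, b)) * c b)"
    by (subst sum.swap) (simp add: sum_distrib_right)
  also have "\<dots> = (\<Sum>b<n. (\<Sum>a<n. U $$ (i, a) * ht n H U a b) * c b)"
    unfolding ht_def using unitary_complete[OF spectralD(2)[OF sp] assms(2)] by simp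
  also have "\<dots> = (\<Sum>b<n. \<Sum>a<n. U $$ (i, a) * (ht n H U a b * c b))"
    by (simp add: sum_distrib_right mult.assoc)
  also have "\<dots> = (\<Sum>a<n. \<Sum>b<n. U $$ (i, a) * (ht n H U a b * c b))" by (rule sum.swap)
  finally show ?thesis by (simp add: sum_distrib_left)
qed

lemma pw0_coords: "i < n \<Longrightarrow> pw0 n A H v m s i = (\<Sum>a<n. U $$ (i, a) * (of_real (d a ^ m) * ucoef n U v a))"
proof (induction m arbitrary: i)
  case 0
  then show ?case using unitary_complete[OF spectralD(2)[OF sp], of i "\<lambda>k. v $ k"] by (simp add: ucoef_def)
next
  case (Suc m)
  have "pw0 n A H v (Suc m) s i = (\<Sum>a<n. U $$ (i, a) * (of_real (d a) * (of_real (d a ^ m) * ucoef n U v a)))"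
    unfolding pw0.simps by (rule lin_apply_coords[OF Suc.IH Suc.prems])
  then show ?case by (simp add: mult.assoc)
qed

text \<open>In an eigenbasis at \<open>s\<close> the matrix \<open>A + s H\<close> multiplies the
  coordinate \<open>a\<close> by \<open>d a\<close>, which turns the recursion of \<open>pw1\<close>
  into that of \<open>hom1\<close>; one order higher, \<open>pw2\<close> leads to
  \<open>hom2\<close>.\<close>

lemma pw1_coords: "i < n \<Longrightarrow> pw1 n A H v m s i =
    (\<Sum>a<n. U $$ (i, a) * (\<Sum>b<n. of_real (hom1 m (d a) (d b)) * (ht n H U a b * ucoef n U v b)))"
proof (induction m arbitrary: i)
  case 0 then show ?case by simp
next
  case (Suc m)
  have 1: "(\<Sum>j<n. (A $$ (i, j) + of_real s * H $$ (i, j)) * pw1 n A H v m s j) = (\<Sum>a<n. U $$ (i, a) *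
      (of_real (d a) * (\<Sum>b<n. of_real (hom1 m (d a) (d b)) * (ht n H U a b * ucoef n U v b))))"
    by (rule lin_apply_coords[OF Suc.IH Suc.prems])
  have 2: "(\<Sum>j<n. H $$ (i, j) * pw0 n A H v m s j) =
      (\<Sum>a<n. U $$ (i, a) * (\<Sum>b<n. ht n H U a b * (of_real (d b ^ m) * ucoef n U v b)))"
    by (rule H_apply_coords[OF pw0_coords Suc.prems])
  have 3: "of_real (d a) * (\<Sum>b<n. of_real (hom1 m (d a) (d b)) * (ht n H U a b * ucoef n U v b))
      + (\<Sum>b<n. ht n H U a b * (of_real (d b ^ m) * ucoef n U v b))
      = (\<Sum>b<n. of_real (hom1 (Suc m) (d a) (d b)) * (ht n H U a b * ucoef n U v b))" for a
    unfolding sum_distrib_left sum.distrib[symmetric] by (intro sum.cong refl) (simp add: algebra_simps)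
  show ?case unfolding pw1.simps 1 2 sum.distrib[symmetric] distrib_left[symmetric] 3 by (rule refl)
qed

lemma pw2_coords: "i < n \<Longrightarrow> pw2 n A H v m s i =
    (\<Sum>a<n. U $$ (i, a) * (2 * (\<Sum>b<n. \<Sum>c<n. of_real (hom2 m (d a) (d b) (d c)) * (ht n H U a b * (ht n H U b c * ucoef n U v c)))))"
proof (induction m arbitrary: i)
  case 0 then show ?case by simp
next
  case (Suc m)
  define S1 where "S1 = (\<lambda>m a. \<Sum>b<n. \<Sum>c<n. of_real (hom2 m (d a) (d b) (d c)) * (ht n H U a b * (ht n H U b c * ucoef n U v c)))"
  define S2 where "S2 = (\<lambda>a. \<Sum>b<n. ht n H U a b * (\<Sum>c<n. of_real (hom1 m (d b) (d c)) * (ht n H U b c * ucoef n U v c)))"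
  have 1: "(\<Sum>j<n. (A $$ (i, j) + of_real s * H $$ (i, j)) * pw2 n A H v m s j) =
      (\<Sum>a<n. U $$ (i, a) * (of_real (d a) * (2 * S1 m a)))"
    unfolding S1_def by (rule lin_apply_coords[OF Suc.IH Suc.prems])
  have 2: "(\<Sum>j<n. H $$ (i, j) * pw1 n A H v m s j) = (\<Sum>a<n. U $$ (i, a) * S2 a)"
    unfolding S2_def by (rule H_apply_coords[OF pw1_coords Suc.prems])
  have 3: "S1 (Suc m) a = of_real (d a) * S1 m a + S2 a" for a
    unfolding S1_def S2_def sum_distrib_left sum.distrib[symmetric]
    by (intro sum.cong refl) (simp add: algebra_simps)
  have "pw2 n A H v (Suc m) s i = (\<Sum>a<n. U $$ (i, a) * (of_real (d a) * (2 * S1 m a)) + 2 * (U $$ (i, a) * S2 a))"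
    unfolding pw2.simps 1 2 by (simp add: sum.distrib sum_distrib_left)
  also have "\<dots> = (\<Sum>a<n. U $$ (i, a) * (2 * S1 (Suc m) a))"
    unfolding 3 by (intro sum.cong refl) (simp add: algebra_simps)
  finally show ?case unfolding S1_def .
qed

lemma ucoef_cnj: "a < n \<Longrightarrow> (\<Sum>i<n. U $$ (i, a) * cnj (v $ i)) = cnj (ucoef n U v a)"
  by (simp add: ucoef_def cnj_sum)

lemma coords_inner:
  assumes "\<And>j. j < n \<Longrightarrow> x j = (\<Sum>a<n. U $$ (j, a) * c a)"
  shows "(\<Sum>i<n. x i * cnj (v $ i)) = (\<Sum>a<n. c a * cnj (ucoef n U v a))"
proof -
  have "(\<Sum>i<n. x i * cnj (v $ i)) = (\<Sum>i<n. \<Sum>a<n. c a * (U $$ (i, a) * cnj (v $ i)))"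
    using assms by (intro sum.cong refl) (simp add: sum_distrib_left sum_distrib_right mult_ac)
  also have "\<dots> = (\<Sum>a<n. \<Sum>i<n. c a * (U $$ (i, a) * cnj (v $ i)))" by (rule sum.swap)
  also have "\<dots> = (\<Sum>a<n. c a * cnj (ucoef n U v a))"
    using ucoef_cnj by (intro sum.cong refl) (simp add: sum_distrib_left[symmetric])
  finally show ?thesis .
qed

lemma ht_hermitian: "a < n \<Longrightarrow> b < n \<Longrightarrow> cnj (ht n H U b a) = ht n H U a b"
proof -
  have sym: "\<And>i j. i < n \<Longrightarrow> j < n \<Longrightarrow> cnj (H $$ (j, i)) = H $$ (i, j)" using H by (auto simp: hermitian_index)
  have "cnj (ht n H U b a) = (\<Sum>k<n. \<Sum>j<n. cnj (U $$ (j, a)) * (H $$ (j, k) * U $$ (k, b)))"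
    unfolding ht_def cnj_sum complex_cnj_mult complex_cnj_cnj sum_distrib_left
    by (intro sum.cong refl) (auto simp: sym mult_ac)
  also have "\<dots> = (\<Sum>j<n. \<Sum>k<n. cnj (U $$ (j, a)) * (H $$ (j, k) * U $$ (k, b)))" by (rule sum.swap)
  finally show ?thesis by (simp add: ht_def sum_distrib_left)
qed

lemma pw0_inner: "Re (\<Sum>i<n. pw0 n A H v m s i * cnj (v $ i)) = (\<Sum>a<n. d a ^ m * (cmod (ucoef n U v a))\<^sup>2)"
proof -
  have "(\<Sum>i<n. pw0 n A H v m s i * cnj (v $ i)) = (\<Sum>a<n. (of_real (d a ^ m) * ucoef n U v a) * cnj (ucoef n U v a))"
    by (rule coords_inner[OF pw0_coords])
  also have "\<dots> = (\<Sum>a<n. of_real (d a ^ m * (cmod (ucoef n U v a))\<^sup>2))"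
    by (simp only: of_real_mult complex_norm_square mult.assoc)
  finally have "(\<Sum>i<n. pw0 n A H v m s i * cnj (v $ i)) = (\<Sum>a<n. of_real (d a ^ m * (cmod (ucoef n U v a))\<^sup>2))" .
  then show ?thesis by simp
qed

text \<open>Because \<open>ht\<close> is Hermitian, each term pairs two entries of the row with the
  middle index \<open>b\<close>. Pulling \<open>b\<close> outside exhibits the sum as one quadratic
  form for each \<open>b\<close>, which is the shape of a Kraus matrix with distinguished node
  \<open>d b\<close>.\<close>

lemma pw2_inner: "Re (\<Sum>i<n. pw2 n A H v m s i * cnj (v $ i)) =
    2 * (\<Sum>b<n. \<Sum>a<n. \<Sum>c<n. Re (cnj (ht n H U b a * ucoef n U v a) * (ht n H U b c * ucoef n U v c)) * hom2 m (d a) (d b) (d c))"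
proof -
  have "(\<Sum>i<n. pw2 n A H v m s i * cnj (v $ i)) = (\<Sum>a<n. (2 * (\<Sum>b<n. \<Sum>c<n.
      of_real (hom2 m (d a) (d b) (d c)) * (ht n H U a b * (ht n H U b c * ucoef n U v c)))) * cnj (ucoef n U v a))"
    by (rule coords_inner[OF pw2_coords])
  also have "\<dots> =
      (\<Sum>a<n. \<Sum>b<n. \<Sum>c<n. of_real (2 * hom2 m (d a) (d b) (d c)) * (cnj (ht n H U b a * ucoef n U v a) * (ht n H U b c * ucoef n U v c)))"
    unfolding sum_distrib_right sum_distrib_left
    by (intro sum.cong refl) (simp add: ht_hermitian mult_ac)
  also have "\<dots> = (\<Sum>b<n. \<Sum>a<n. \<Sum>c<n. of_real (2 * hom2 m (d a) (d b) (d c)) * (cnj (ht n H U b a * ucoef n U v a) * (ht n H U b c * ucoef n U v c)))"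
    by (rule sum.swap)
  finally have *: "(\<Sum>i<n. pw2 n A H v m s i * cnj (v $ i)) = \<dots>" .
  have re: "Re (of_real r * z) = r * Re z" for r z by simp
  show ?thesis unfolding * Re_sum re sum_distrib_left by (intro sum.cong refl) (simp only: mult_ac)
qed

end

text \<open>With \<open>A + s H = U diag(d) U\<^sup>*\<close> and \<open>y\<close> as in \<open>yvec\<close> below, \<open>2 * Qd n f d y\<close> is the second derivative in \<open>s\<close> of
  \<open>\<langle>f(A + s H) v, v\<rangle>\<close>.\<close>

definition Qd :: "nat \<Rightarrow> (real \<Rightarrow> real) \<Rightarrow> (nat \<Rightarrow> real) \<Rightarrow> (nat \<Rightarrow> nat \<Rightarrow> complex) \<Rightarrow> real" where
  "Qd n f d y = (\<Sum>b<n. \<Sum>a<n. \<Sum>c<n. Re (cnj (y b a) * y b c) * divdiff [d a, d b, d c] f)"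

definition yvec :: "nat \<Rightarrow> complex mat \<Rightarrow> complex mat \<Rightarrow> complex vec \<Rightarrow> nat \<Rightarrow> nat \<Rightarrow> complex" where
  "yvec n H U v b c = ht n H U b c * ucoef n U v c"

text \<open>All differentiation takes place in the standard basis. The formula with
  \<open>Qd\<close> is then obtained separately at each \<open>s\<close>, for whatever
  diagonalization is given there, so nothing has to depend continuously on \<open>s\<close>.\<close>

lemma poly_path_derivatives:
  assumes A: "hermitian n A" and H: "hermitian n H"
  obtains \<phi>1 \<phi>2 where
    "\<And>s. ((\<lambda>s. qform n (mat_fun (poly p) (lin A H s)) v) has_real_derivative \<phi>1 s) (at s)"
    "\<And>s. (\<phi>1 has_real_derivative \<phi>2 s) (at s)" "continuous_on UNIV \<phi>2"
    "\<And>s U d. spectral n (lin A H s) U d \<Longrightarrow> \<phi>2 s = 2 * Qd n (poly p) d (yvec n H U v)"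
proof -
  have Ac: "A \<in> carrier_mat n n" using A by (simp add: hermitian_def)
  define \<phi> where "\<phi> = (\<lambda>(w :: nat \<Rightarrow> real \<Rightarrow> nat \<Rightarrow> complex) s. \<Sum>m\<le>degree p. coeff p m * Re (\<Sum>i<n. w m s i * cnj (v $ i)))"
  have vd: "((\<lambda>s. Re (\<Sum>i<n. w s i * cnj (v $ i))) has_real_derivative Re (\<Sum>i<n. w' i * cnj (v $ i))) (at s)"
    if "\<And>i. ((\<lambda>s. w s i) has_vector_derivative w' i) (at s)" for w :: "real \<Rightarrow> nat \<Rightarrow> complex" and w' s
  proof -
    have "((\<lambda>s. \<Sum>i<n. w s i * cnj (v $ i)) has_vector_derivative (\<Sum>i<n. w' i * cnj (v $ i))) (at s)"
      by (intro has_vector_derivative_sum has_vector_derivative_mult_left that)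
    from bounded_linear.has_vector_derivative[OF bounded_linear_Re this] show ?thesis
      by (simp add: has_real_derivative_iff_has_vector_derivative)
  qed
  have qf: "(\<lambda>s. qform n (mat_fun (poly p) (lin A H s)) v) = \<phi> (pw0 n A H v)"
  proof
    fix s
    obtain U d where sp: "spectral n (lin A H s) U d" using hermitian_spectral[OF lin_hermitian[OF A H]] by blast
    have "qform n (mat_fun (poly p) (lin A H s)) v = (\<Sum>k<n. poly p (d k) * (cmod (ucoef n U v k))\<^sup>2)"
      using qform_spectral[OF mat_fun_spectral[OF sp]] by simp
    also have "\<dots> = (\<Sum>k<n. \<Sum>m\<le>degree p. coeff p m * (d k ^ m * (cmod (ucoef n U v k))\<^sup>2))"
      by (simp add: poly_altdef sum_distrib_right mult.assoc)
    also have "\<dots> = (\<Sum>m\<le>degree p. \<Sum>k<n. coeff p m * (d k ^ m * (cmod (ucoef n U v k))\<^sup>2))" by (rule sum.swap)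
    also have "\<dots> = \<phi> (pw0 n A H v) s"
      unfolding \<phi>_def pw0_inner[OF Ac H sp] by (simp add: sum_distrib_left)
    finally show "qform n (mat_fun (poly p) (lin A H s)) v = \<phi> (pw0 n A H v) s" .
  qed
  show ?thesis
  proof (rule that[of "\<phi> (pw1 n A H v)" "\<phi> (pw2 n A H v)"], unfold qf)
    show "(\<phi> (pw0 n A H v) has_real_derivative \<phi> (pw1 n A H v) s) (at s)" for s
      unfolding \<phi>_def by (intro DERIV_sum DERIV_cmult vd pw0_derivative)
    show "(\<phi> (pw1 n A H v) has_real_derivative \<phi> (pw2 n A H v) s) (at s)" for s
      unfolding \<phi>_def by (intro DERIV_sum DERIV_cmult vd pw1_derivative)
    show "continuous_on UNIV (\<phi> (pw2 n A H v))"
      unfolding \<phi>_def by (intro continuous_intros continuous_pw2)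
    show "\<phi> (pw2 n A H v) s = 2 * Qd n (poly p) d (yvec n H U v)" if sp: "spectral n (lin A H s) U d" for s U d
    proof -
      define R where "R = (\<lambda>b a c. Re (cnj (ht n H U b a * ucoef n U v a) * (ht n H U b c * ucoef n U v c)))"
      have "Qd n (poly p) d (yvec n H U v) = (\<Sum>b<n. \<Sum>a<n. \<Sum>c<n. \<Sum>m\<le>degree p. coeff p m * (R b a c * hom2 m (d a) (d b) (d c)))"
        unfolding Qd_def yvec_def divdiff_3_poly R_def sum_distrib_left
        by (intro sum.cong refl) (simp only: mult.left_commute)
      also have "\<dots> = (\<Sum>m\<le>degree p. \<Sum>b<n. \<Sum>a<n. \<Sum>c<n. coeff p m * (R b a c * hom2 m (d a) (d b) (d c)))"
        unfolding sum.swap[of _ "{..degree p}" "{..<n}"] by (rule refl)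
      moreover have "Re (cnj (ht n H U b a * ucoef n U v a) * (ht n H U b c * ucoef n U v c)) = R b a c" for b a c
        by (simp only: R_def)
      ultimately show ?thesis
        unfolding \<phi>_def pw2_inner[OF Ac H sp] by (simp only: sum_distrib_left mult.left_commute)
    qed
  qed
qed

section \<open>Estimates uniform over all diagonalizations\<close>

lemma unitary_entry_le: "unitary n U \<Longrightarrow> i < n \<Longrightarrow> k < n \<Longrightarrow> cmod (U $$ (i, k)) \<le> 1"
proof -
  assume U: "unitary n U" and ik: "i < n" "k < n"
  have "of_real (\<Sum>k<n. (cmod (U $$ (i, k)))\<^sup>2) = (\<Sum>k<n. U $$ (i, k) * cnj (U $$ (i, k)))"
    unfolding of_real_sum by (intro sum.cong refl complex_norm_square)
  also have "\<dots> = of_real 1" using unitaryD(2)[OF U ik(1) ik(1)] by simp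
  finally have "(\<Sum>k<n. (cmod (U $$ (i, k)))\<^sup>2) = 1" by (simp only: of_real_eq_iff)
  moreover have "(cmod (U $$ (i, k)))\<^sup>2 \<le> (\<Sum>k<n. (cmod (U $$ (i, k)))\<^sup>2)"
    using ik by (intro member_le_sum) auto
  ultimately show ?thesis using power2_le_imp_le[of _ "1 :: real"] by simp
qed

definition hnorm :: "nat \<Rightarrow> complex mat \<Rightarrow> real" where "hnorm n H = (\<Sum>k<n. \<Sum>j<n. cmod (H $$ (k, j)))"

text \<open>Uniformity in \<open>U\<close> matters because the diagonalization changes along the
  path in an uncontrolled way.\<close>

lemma yvec_bound:
  assumes U: "unitary n U" and bc: "b < n" "c < n"
  shows "cmod (yvec n H U v b c) \<le> hnorm n H * (\<Sum>i<n. cmod (v $ i))"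
proof -
  have "cmod (ht n H U b c) \<le> (\<Sum>k<n. \<Sum>j<n. cmod (H $$ (k, j)))"
    unfolding ht_def
  proof (intro order_trans[OF norm_sum] sum_mono)
    fix k assume k: "k \<in> {..<n}"
    have "cmod (cnj (U $$ (k, b)) * (\<Sum>j<n. H $$ (k, j) * U $$ (j, c))) \<le> 1 * (\<Sum>j<n. cmod (H $$ (k, j)))"
      unfolding norm_mult
    proof (intro mult_mono order_trans[OF norm_sum] sum_mono)
      show "cmod (H $$ (k, j) * U $$ (j, c)) \<le> cmod (H $$ (k, j))" if "j \<in> {..<n}" for j
        using unitary_entry_le[OF U, of j c] that bc by (simp add: norm_mult mult_left_le)
    qed (use unitary_entry_le[OF U] k bc in auto)
    then show "cmod (cnj (U $$ (k, b)) * (\<Sum>j<n. H $$ (k, j) * U $$ (j, c))) \<le> (\<Sum>j<n. cmod (H $$ (k, j)))" by simp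
  qed
  moreover have "cmod (ucoef n U v c) \<le> (\<Sum>i<n. cmod (v $ i))"
    unfolding ucoef_def
  proof (intro order_trans[OF norm_sum] sum_mono)
    show "cmod (cnj (U $$ (i, c)) * v $ i) \<le> cmod (v $ i)" if "i \<in> {..<n}" for i
      using unitary_entry_le[OF U, of i c] that bc by (simp add: norm_mult mult_left_le_one_le)
  qed
  ultimately show ?thesis unfolding yvec_def norm_mult hnorm_def by (intro mult_mono) (auto intro!: sum_nonneg)
qed

text \<open>There are \<open>n^3\<close> triples, and each divided difference is off by at most
  \<open>e / 2\<close>.\<close>

lemma Qd_approx:
  assumes f: "C_k_on 2 f I" and I: "open I" "{\<alpha>..\<beta>} \<subseteq> I" and d: "\<And>k. k < n \<Longrightarrow> d k \<in> {\<alpha>..\<beta>}"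
    and p: "\<And>s. s \<in> {\<alpha>..\<beta>} \<Longrightarrow> \<bar>(deriv ^^ 2) f s - poly ((pderiv ^^ 2) p) s\<bar> \<le> e"
    and y: "\<And>b c. b < n \<Longrightarrow> c < n \<Longrightarrow> cmod (y b c) \<le> K"
  shows "\<bar>2 * Qd n f d y - 2 * Qd n (poly p) d y\<bar> \<le> real n ^ 3 * K\<^sup>2 * e"
proof -
  have "\<bar>Re (cnj (y b a) * y b c) * divdiff [d a, d b, d c] f - Re (cnj (y b a) * y b c) * divdiff [d a, d b, d c] (poly p)\<bar> \<le> K\<^sup>2 * (e / 2)"
    if abc: "a < n" "b < n" "c < n" for a b c
  proof -
    have "\<bar>Re (cnj (y b a) * y b c)\<bar> \<le> K * K"
      using abs_Re_le_cmod[of "cnj (y b a) * y b c"] mult_mono[OF y y, of b a b c] abc y[of b a]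
        order_trans[OF norm_ge_zero y[of b a]]
      by (simp add: norm_mult del: times_complex.sel)
    moreover have "\<bar>divdiff [d a, d b, d c] f - divdiff [d a, d b, d c] (poly p)\<bar> \<le> e / 2"
      using abc by (intro divdiff_3_approx[OF f I] d p)
    ultimately show ?thesis unfolding right_diff_distrib[symmetric] abs_mult power2_eq_square
      by (intro mult_mono) auto
  qed
  then have "\<bar>Qd n f d y - Qd n (poly p) d y\<bar> \<le> (\<Sum>b<n. \<Sum>a<n. \<Sum>c<n. K\<^sup>2 * (e / 2))"
    unfolding Qd_def sum_subtractf[symmetric]
    by (intro order_trans[OF sum_abs] sum_mono) auto
  also have "\<dots> = real n ^ 3 * K\<^sup>2 * e / 2" by (simp add: power3_eq_cube)
  finally show ?thesis by linarith
qed

section \<open>Eigenvalues as Rayleigh quotients\<close>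

definition vnorm2 :: "nat \<Rightarrow> complex vec \<Rightarrow> real" where "vnorm2 n v = (\<Sum>i<n. (cmod (v $ i))\<^sup>2)"

lemma vnorm2_nonneg: "0 \<le> vnorm2 n v" by (simp add: vnorm2_def sum_nonneg)

lemma qform_bounds:
  assumes sp: "spectral n A U d" and d: "\<And>k. k < n \<Longrightarrow> d k \<in> {\<alpha>..\<beta>}"
  shows "\<alpha> * vnorm2 n v \<le> qform n A v" "qform n A v \<le> \<beta> * vnorm2 n v"
  unfolding qform_spectral[OF sp] vnorm2_def ucoef_norm[OF spectralD(2)[OF sp], symmetric] sum_distrib_left
  using d by (auto intro!: sum_mono mult_right_mono)

lemma eigenvalue_qform:
  assumes sp: "spectral n A U d" and k: "k < n"
  shows "qform n A (col U k) = d k" "vnorm2 n (col U k) = 1"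
proof -
  have Uc: "U \<in> carrier_mat n n" by (rule spectralD(3)[OF sp])
  have "ucoef n U (col U k) l = (if l = k then 1 else 0)" if "l < n" for l
  proof -
    have "ucoef n U (col U k) l = (\<Sum>i<n. cnj (U $$ (i, l)) * U $$ (i, k))"
      unfolding ucoef_def using Uc k by (intro sum.cong refl) auto
    then show ?thesis using unitaryD(3)[OF spectralD(2)[OF sp] that k] by simp
  qed
  then have *: "(cmod (ucoef n U (col U k) l))\<^sup>2 = (if l = k then 1 else 0)" if "l < n" for l using that by simp
  have "qform n A (col U k) = (\<Sum>l<n. if l = k then d k else 0)"
    unfolding qform_spectral[OF sp] by (intro sum.cong refl) (simp add: *)
  then show "qform n A (col U k) = d k" using k by simp
  have "vnorm2 n (col U k) = (\<Sum>l<n. if l = k then 1 else 0)"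
    unfolding vnorm2_def ucoef_norm[OF spectralD(2)[OF sp], symmetric] by (intro sum.cong refl) (simp add: *)
  then show "vnorm2 n (col U k) = 1" using k by simp
qed

lemma qform_fun_approx:
  assumes sp: "spectral n A U d" and d: "\<And>k. k < n \<Longrightarrow> d k \<in> S"
    and fg: "\<And>s. s \<in> S \<Longrightarrow> \<bar>f s - g s\<bar> \<le> e"
  shows "\<bar>qform n (mat_fun f A) v - qform n (mat_fun g A) v\<bar> \<le> e * vnorm2 n v"
proof -
  have "qform n (mat_fun f A) v - qform n (mat_fun g A) v = (\<Sum>k<n. (f (d k) - g (d k)) * (cmod (ucoef n U v k))\<^sup>2)"
    unfolding qform_spectral[OF mat_fun_spectral[OF sp]] by (simp add: sum_subtractf[symmetric] left_diff_distrib)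
  also have "\<bar>\<dots>\<bar> \<le> (\<Sum>k<n. e * (cmod (ucoef n U v k))\<^sup>2)"
    by (intro order_trans[OF sum_abs] sum_mono) (simp add: abs_mult, intro mult_right_mono fg d, auto)
  also have "\<dots> = e * vnorm2 n v"
    unfolding vnorm2_def ucoef_norm[OF spectralD(2)[OF sp], symmetric] sum_distrib_left ..
  finally show ?thesis .
qed

lemma qform_unit_bound:
  assumes "vnorm2 n v = 1" shows "\<bar>qform n H v\<bar> \<le> hnorm n H"
proof -
  have v: "cmod (v $ i) \<le> 1" if "i < n" for i
  proof -
    have "(cmod (v $ i))\<^sup>2 \<le> vnorm2 n v" unfolding vnorm2_def using that by (intro member_le_sum) auto
    then show ?thesis using assms using power2_le_imp_le[of _ "1 :: real"] by simp
  qed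
  have "cmod (H $$ (i, j) * v $ j * cnj (v $ i)) \<le> cmod (H $$ (i, j))" if "i < n" "j < n" for i j
  proof -
    have "cmod (v $ j) * cmod (v $ i) \<le> 1" using mult_mono[OF v v, of j i] that by simp
    then show ?thesis by (simp add: norm_mult mult.assoc mult_left_le)
  qed
  then have "cmod (\<Sum>i<n. \<Sum>j<n. H $$ (i, j) * v $ j * cnj (v $ i)) \<le> hnorm n H"
    unfolding hnorm_def by (intro order_trans[OF norm_sum] sum_mono) auto
  then show ?thesis unfolding qform_def using abs_Re_le_cmod order_trans by blast
qed

text \<open>Positive semidefiniteness of the matrices \<open>[x, y, l]\<close> over \<open>X\<close>
  for \<open>l\<close> in \<open>X\<close>. The weights are functions on the nodes, so that
  \<open>X\<close> needs no enumeration.\<close>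

definition kraus :: "nat \<Rightarrow> real set \<Rightarrow> (real \<Rightarrow> real) \<Rightarrow> bool" where
  "kraus n I f \<longleftrightarrow> (\<forall>X l r. finite X \<and> X \<subseteq> I \<and> card X = n \<and> l \<in> X \<longrightarrow>
    0 \<le> (\<Sum>x\<in>X. \<Sum>y\<in>X. r x * r y * divdiff [x, y, l] f))"

section \<open>Kraus matrices and convexity along matrix segments\<close>

lemma compact_interval_hull:
  assumes I: "open I" "convex (I :: real set)" and S: "finite S" "S \<subseteq> I" "S \<noteq> {}"
  obtains \<alpha> \<beta> r where "r > 0" "{\<alpha> - r..\<beta> + r} \<subseteq> I" "S \<subseteq> {\<alpha>..\<beta>}" "\<alpha> \<le> \<beta>"
proof -
  let ?a = "Min S" and ?b = "Max S"
  have ab: "?a \<in> I" "?b \<in> I" "?a \<le> ?b" "S \<subseteq> {?a..?b}" using S by (auto simp: subset_iff)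
  obtain r1 where r1: "r1 > 0" "cball ?a r1 \<subseteq> I" using I ab open_contains_cball by blast
  obtain r2 where r2: "r2 > 0" "cball ?b r2 \<subseteq> I" using I ab open_contains_cball by blast
  define r where "r = min r1 r2"
  have "?a - r \<in> I" "?b + r \<in> I" using r1 r2 by (auto simp: r_def subset_iff dist_real_def)
  then have "{?a - r..?b + r} \<subseteq> I"
    using I(2) ab(3) r1 r2 closed_segment_subset[of "?a - r" I "?b + r"]
    by (auto simp: closed_segment_eq_real_ivl r_def split: if_splits)
  with ab r1 r2 show ?thesis by (intro that[of r ?a ?b]) (auto simp: r_def)
qed

text \<open>Eigenvalues may coincide, whereas Kraus matrices have distinct nodes. The perturbation
  \<open>d a + \<epsilon> a\<close> separates them for small \<open>\<epsilon>\<close>, and the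
  limit exists because three-point divided differences are continuous.\<close>

lemma kraus_slice_nonneg:
  assumes k: "kraus n I f" and f: "C_k_on 2 f I" and I: "open I" "convex I"
    and d: "\<And>a. a < n \<Longrightarrow> d a \<in> I" and b: "b < n"
  shows "0 \<le> (\<Sum>a<n. \<Sum>c<n. r a * r c * divdiff [d a, d b, d c] f)"
proof -
  have inj: "0 \<le> (\<Sum>a<n. \<Sum>c<n. r a * r c * divdiff [e a, e b, e c] f)"
    if e: "inj_on e {..<n}" "\<And>a. a < n \<Longrightarrow> e a \<in> I" for e
  proof -
    let ?X = "e ` {..<n}" and ?r = "\<lambda>x. r (the_inv_into {..<n} e x)"
    have "0 \<le> (\<Sum>x\<in>?X. \<Sum>y\<in>?X. ?r x * ?r y * divdiff [x, y, e b] f)"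
      by (rule k[unfolded kraus_def, rule_format]) (use e b in \<open>auto simp: card_image\<close>)
    also have "\<dots> = (\<Sum>a<n. \<Sum>c<n. r a * r c * divdiff [e a, e c, e b] f)"
      unfolding sum.reindex[OF e(1)] by (intro sum.cong refl) (simp add: the_inv_into_f_f[OF e(1)])
    finally show ?thesis by (simp add: divdiff_3_swap(2))
  qed
  obtain \<alpha> \<beta> \<rho> where h: "\<rho> > 0" "{\<alpha> - \<rho>..\<beta> + \<rho>} \<subseteq> I" "d ` {..<n} \<subseteq> {\<alpha>..\<beta>}" "\<alpha> \<le> \<beta>"
    by (rule compact_interval_hull[OF I, of "d ` {..<n}"]) (use d b in auto)
  define e where "e = (\<lambda>\<epsilon> a. d a + \<epsilon> * real a)"
  have lim: "((\<lambda>\<epsilon>. e \<epsilon> a) \<longlongrightarrow> d a) (at_right 0)" for a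
    unfolding e_def by (auto intro!: tendsto_eq_intros)
  have evI: "\<forall>\<^sub>F \<epsilon> in at_right 0. e \<epsilon> a \<in> {\<alpha> - \<rho>..\<beta> + \<rho>}" if "a < n" for a
  proof -
    have "d a \<in> {\<alpha> - \<rho><..<\<beta> + \<rho>}" using h that by fastforce
    then have "\<forall>\<^sub>F \<epsilon> in at_right 0. e \<epsilon> a \<in> {\<alpha> - \<rho><..<\<beta> + \<rho>}" by (intro topological_tendstoD[OF lim]) auto
    then show ?thesis by eventually_elim auto
  qed
  have evne: "\<forall>\<^sub>F \<epsilon> in at_right 0. e \<epsilon> a \<noteq> e \<epsilon> c" if "a \<noteq> c" for a c
  proof (cases "d a = d c")
    case True
    show ?thesis using eventually_at_right_less[of 0] by eventually_elim (use True that in \<open>auto simp: e_def\<close>)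
  next
    case False
    have "((\<lambda>\<epsilon>. e \<epsilon> a - e \<epsilon> c) \<longlongrightarrow> d a - d c) (at_right 0)" by (intro tendsto_diff lim)
    then have "\<forall>\<^sub>F \<epsilon> in at_right 0. e \<epsilon> a - e \<epsilon> c \<in> - {0}"
      using False by (intro topological_tendstoD) auto
    then show ?thesis by eventually_elim auto
  qed
  have evinj: "\<forall>\<^sub>F \<epsilon> in at_right 0. inj_on (e \<epsilon>) {..<n}"
  proof -
    have "\<forall>\<^sub>F \<epsilon> in at_right 0. \<forall>a\<in>{..<n}. \<forall>c\<in>{..<n}. a \<noteq> c \<longrightarrow> e \<epsilon> a \<noteq> e \<epsilon> c"
    proof (intro eventually_ball_finite ballI finite_lessThan)
      show "\<forall>\<^sub>F \<epsilon> in at_right 0. a \<noteq> c \<longrightarrow> e \<epsilon> a \<noteq> e \<epsilon> c" for a c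
        using evne[of a c] by (cases "a = c") auto
    qed
    then show ?thesis by eventually_elim (auto simp: inj_on_def)
  qed
  have evall: "\<forall>\<^sub>F \<epsilon> in at_right 0. \<forall>a\<in>{..<n}. e \<epsilon> a \<in> {\<alpha> - \<rho>..\<beta> + \<rho>}"
    using evI by (intro eventually_ball_finite) auto
  have "((\<lambda>\<epsilon>. \<Sum>a<n. \<Sum>c<n. r a * r c * divdiff [e \<epsilon> a, e \<epsilon> b, e \<epsilon> c] f) \<longlongrightarrow>
      (\<Sum>a<n. \<Sum>c<n. r a * r c * divdiff [d a, d b, d c] f)) (at_right 0)"
  proof (intro tendsto_sum tendsto_mult tendsto_const)
    fix a c assume ac: "a \<in> {..<n}" "c \<in> {..<n}"
    have dm: "d i \<in> {\<alpha> - \<rho>..\<beta> + \<rho>}" if "i < n" for i using h that by fastforce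
    show "((\<lambda>\<epsilon>. divdiff [e \<epsilon> a, e \<epsilon> b, e \<epsilon> c] f) \<longlongrightarrow> divdiff [d a, d b, d c] f) (at_right 0)"
      using ac b by (intro tendsto_divdiff_3[OF f I(1) h(2) lim lim lim evI evI evI] dm) auto
  qed
  moreover have "\<forall>\<^sub>F \<epsilon> in at_right 0. 0 \<le> (\<Sum>a<n. \<Sum>c<n. r a * r c * divdiff [e \<epsilon> a, e \<epsilon> b, e \<epsilon> c] f)"
    using evinj evall by eventually_elim (use inj h(2) in blast)
  ultimately show ?thesis by (rule tendsto_lowerbound) simp
qed

text \<open>For each \<open>b\<close> the real and the imaginary part of the row \<open>y b\<close>
  serve as real weights in the form with middle node \<open>d b\<close>.\<close>

lemma kraus_Qd_nonneg:
  assumes k: "kraus n I f" and f: "C_k_on 2 f I" and I: "open I" "convex I" and d: "\<And>a. a < n \<Longrightarrow> d a \<in> I"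
  shows "0 \<le> Qd n f d y"
  unfolding Qd_def
proof (rule sum_nonneg)
  fix b assume "b \<in> {..<n}"
  then have b: "b < n" by simp
  have "(\<Sum>a<n. \<Sum>c<n. Re (cnj (y b a) * y b c) * divdiff [d a, d b, d c] f) =
      (\<Sum>a<n. \<Sum>c<n. Re (y b a) * Re (y b c) * divdiff [d a, d b, d c] f) +
      (\<Sum>a<n. \<Sum>c<n. Im (y b a) * Im (y b c) * divdiff [d a, d b, d c] f)"
    unfolding sum.distrib[symmetric] by (intro sum.cong refl) (simp add: algebra_simps)
  moreover have "0 \<le> (\<Sum>a<n. \<Sum>c<n. Re (y b a) * Re (y b c) * divdiff [d a, d b, d c] f)"
    by (rule kraus_slice_nonneg[OF k f I d b])
  moreover have "0 \<le> (\<Sum>a<n. \<Sum>c<n. Im (y b a) * Im (y b c) * divdiff [d a, d b, d c] f)"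
    by (rule kraus_slice_nonneg[OF k f I d b])
  ultimately show "0 \<le> (\<Sum>a<n. \<Sum>c<n. Re (cnj (y b a) * y b c) * divdiff [d a, d b, d c] f)" by simp
qed

text \<open>Along the segment the second derivative for an approximating polynomial is at least
  \<open>- \<delta>\<close>, where \<open>\<delta>\<close> is proportional to the error
  \<open>e\<close>. Adding \<open>\<delta> / 2 * s^2\<close> makes the path function convex;
  comparing its values at \<open>0\<close>, \<open>t\<close> and \<open>1\<close> and returning to
  \<open>f\<close> costs a multiple of \<open>e\<close>.\<close>

theorem kraus_imp_n_convex:
  assumes k: "kraus n I f" and f: "C_k_on 2 f I" and I: "open I" "convex I" and n: "n > 0"
  shows "n_convex_on n I f"
  unfolding n_convex_on_iff_qform
proof (intro allI impI, elim conjE)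
  fix t :: real and A B and v :: "complex vec"
  assume t: "0 \<le> t" "t \<le> 1" and A: "hermitian n A" and B: "hermitian n B"
    and sA: "spectrum A \<subseteq> complex_of_real ` I" and sB: "spectrum B \<subseteq> complex_of_real ` I" and v: "v \<in> carrier_vec n"
  have c: "A \<in> carrier_mat n n" "B \<in> carrier_mat n n" using A B by (auto simp: hermitian_def)
  define H where "H = A - B"
  have H: "hermitian n H" unfolding H_def by (rule hermitian_combination(2)[OF A B])
  have L: "lin B H s = complex_of_real s \<cdot>\<^sub>m A + complex_of_real (1 - s) \<cdot>\<^sub>m B" for s
    unfolding H_def by (rule lin_segment[OF c])
  have L1: "lin B H 1 = A" "lin B H 0 = B" unfolding L using c by (auto intro!: eq_matI)
  obtain UA dA where spA: "spectral n A UA dA" using hermitian_spectral[OF A] by blast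
  obtain UB dB where spB: "spectral n B UB dB" using hermitian_spectral[OF B] by blast
  have dI: "\<And>k. k < n \<Longrightarrow> dA k \<in> I" "\<And>k. k < n \<Longrightarrow> dB k \<in> I"
    using sA sB spectral_spectrum_subset[OF spA] spectral_spectrum_subset[OF spB] by auto
  obtain \<alpha> \<beta> r where h: "r > 0" "{\<alpha> - r..\<beta> + r} \<subseteq> I" "dA ` {..<n} \<union> dB ` {..<n} \<subseteq> {\<alpha>..\<beta>}" "\<alpha> \<le> \<beta>"
    by (rule compact_interval_hull[OF I, of "dA ` {..<n} \<union> dB ` {..<n}"]) (use dI n in auto)
  have ab: "{\<alpha>..\<beta>} \<subseteq> I" using h(1,2) by (auto simp: subset_iff)
  have dm: "\<And>k. k < n \<Longrightarrow> dA k \<in> {\<alpha>..\<beta>}" "\<And>k. k < n \<Longrightarrow> dB k \<in> {\<alpha>..\<beta>}"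
    using h(3) by (auto simp: image_subset_iff)
  \<comment> \<open>An eigenvalue of the convex combination is its Rayleigh quotient at a unit
    eigenvector, hence a convex combination of Rayleigh quotients of \<open>A\<close> and
    \<open>B\<close>.\<close>
  have path: "d k \<in> {\<alpha>..\<beta>}" if s: "0 \<le> s" "s \<le> 1" and sp: "spectral n (lin B H s) U d" and kn: "k < n" for s U d k
  proof -
    let ?u = "col U k"
    have "d k = qform n (lin B H s) ?u" using eigenvalue_qform(1)[OF sp kn] by simp
    also have "\<dots> = s * qform n A ?u + (1 - s) * qform n B ?u"
      unfolding L by (rule qform_combination(1)[OF c])
    finally have "d k = s * qform n A ?u + (1 - s) * qform n B ?u" .
    moreover have "\<alpha> \<le> qform n A ?u" "qform n A ?u \<le> \<beta>"
      using qform_bounds[OF spA dm(1), of ?u] eigenvalue_qform(2)[OF sp kn] by auto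
    moreover have "\<alpha> \<le> qform n B ?u" "qform n B ?u \<le> \<beta>"
      using qform_bounds[OF spB dm(2), of ?u] eigenvalue_qform(2)[OF sp kn] by auto
    moreover have "s * \<alpha> + (1 - s) * \<alpha> = \<alpha>" "s * \<beta> + (1 - s) * \<beta> = \<beta>" by (auto simp: algebra_simps)
    moreover have "s * a \<le> s * b" "(1 - s) * a \<le> (1 - s) * b" if "a \<le> b" for a b
      using s that by (auto intro!: mult_left_mono)
    ultimately show ?thesis by (smt (verit) atLeastAtMost_iff)
  qed
  define K where "K = hnorm n H * (\<Sum>i<n. cmod (v $ i))"
  define V where "V = vnorm2 n v"
  \<comment> \<open>The total error divided by \<open>e\<close>: one \<open>V\<close> for passing
    from \<open>f\<close> to the polynomial at \<open>t\<close>, one for passing back at the ends,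
    and half of \<open>\<delta>\<close>. The summand 1 makes \<open>C\<close> positive.\<close>
  define C where "C = real n ^ 3 * K\<^sup>2 / 2 + 2 * V + 1"
  have C: "C > 0" using vnorm2_nonneg[of n v] by (auto simp: C_def V_def intro!: add_nonneg_pos)
  let ?\<psi> = "\<lambda>f s. qform n (mat_fun f (lin B H s)) v"
  have "?\<psi> f t \<le> t * ?\<psi> f 1 + (1 - t) * ?\<psi> f 0"
  proof (rule field_le_epsilon)
    fix e0 :: real assume e0: "e0 > 0"
    define e where "e = e0 / C"
    have e: "e > 0" "e * C = e0" using e0 C by (auto simp: e_def)
    obtain p where p: "\<And>s. s \<in> {\<alpha>..\<beta>} \<Longrightarrow> \<bar>f s - poly p s\<bar> \<le> e"
      "\<And>s. s \<in> {\<alpha>..\<beta>} \<Longrightarrow> \<bar>(deriv ^^ 2) f s - poly ((pderiv ^^ 2) p) s\<bar> \<le> e"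
      using C2_poly_approx[OF f ab h(4) e(1)] by metis
    obtain \<phi>1 \<phi>2 where \<phi>: "\<And>s. (?\<psi> (poly p) has_real_derivative \<phi>1 s) (at s)"
      "\<And>s. (\<phi>1 has_real_derivative \<phi>2 s) (at s)"
      "\<And>s U d. spectral n (lin B H s) U d \<Longrightarrow> \<phi>2 s = 2 * Qd n (poly p) d (yvec n H U v)"
      using poly_path_derivatives[OF B H, of p v] by metis
    define \<delta> where "\<delta> = real n ^ 3 * K\<^sup>2 * e"
    have low: "- \<delta> \<le> \<phi>2 s" if s: "0 \<le> s" "s \<le> 1" for s
    proof -
      obtain U d where sp: "spectral n (lin B H s) U d" using hermitian_spectral[OF lin_hermitian[OF B H]] by blast
      have dk: "\<And>k. k < n \<Longrightarrow> d k \<in> {\<alpha>..\<beta>}" using path[OF s sp] .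
      have "\<bar>2 * Qd n f d (yvec n H U v) - 2 * Qd n (poly p) d (yvec n H U v)\<bar> \<le> \<delta>"
        unfolding \<delta>_def
        by (rule Qd_approx[OF f I(1) ab dk p(2)]) (auto simp: K_def intro: yvec_bound[OF spectralD(2)[OF sp]])
      moreover have "0 \<le> Qd n f d (yvec n H U v)" using kraus_Qd_nonneg[OF k f I] dk ab by blast
      ultimately show ?thesis unfolding \<phi>(3)[OF sp] by linarith
    qed
    have "convex_on {0..1} (\<lambda>s. ?\<psi> (poly p) s + \<delta> / 2 * s\<^sup>2)"
    proof (rule f''_ge0_imp_convex)
      show "((\<lambda>s. ?\<psi> (poly p) s + \<delta> / 2 * s\<^sup>2) has_real_derivative \<phi>1 s + \<delta> * s) (at s)" for s
        by (auto intro!: derivative_eq_intros \<phi>(1))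
      show "((\<lambda>s. \<phi>1 s + \<delta> * s) has_real_derivative \<phi>2 s + \<delta>) (at s)" for s
        by (auto intro!: derivative_eq_intros \<phi>(2))
      show "0 \<le> \<phi>2 s + \<delta>" if "s \<in> {0..1}" for s
      proof -
        have "- \<delta> \<le> \<phi>2 s" by (rule low) (use that in auto)
        then show ?thesis by linarith
      qed
    qed simp
    from convex_onD[OF this, of t 0 1]
    have cv: "?\<psi> (poly p) t + \<delta> / 2 * t\<^sup>2 \<le> (1 - t) * ?\<psi> (poly p) 0 + t * (?\<psi> (poly p) 1 + \<delta> / 2)"
      using t by simp
    have \<delta>0: "0 \<le> \<delta>" using e(1) by (simp add: \<delta>_def)
    have ap: "\<bar>?\<psi> f s - ?\<psi> (poly p) s\<bar> \<le> e * V" if s: "0 \<le> s" "s \<le> 1" for s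
    proof -
      obtain U d where sp: "spectral n (lin B H s) U d" using hermitian_spectral[OF lin_hermitian[OF B H]] by blast
      show ?thesis unfolding V_def by (rule qform_fun_approx[OF sp path[OF s sp] p(1)])
    qed
    have "?\<psi> f t \<le> ?\<psi> (poly p) t + e * V" using ap[OF t] by linarith
    also have "?\<psi> (poly p) t \<le> (1 - t) * ?\<psi> (poly p) 0 + t * (?\<psi> (poly p) 1 + \<delta> / 2)"
      using cv \<delta>0 by (smt (verit) mult_nonneg_nonneg zero_le_power2 divide_nonneg_pos)
    also have "\<dots> \<le> (1 - t) * (?\<psi> f 0 + e * V) + t * (?\<psi> f 1 + e * V + \<delta> / 2)"
      using t ap[of 0] ap[of 1] by (intro add_mono mult_left_mono) (auto simp: abs_le_iff)
    also have "\<dots> = t * ?\<psi> f 1 + (1 - t) * ?\<psi> f 0 + e * V + t * (\<delta> / 2)" by (simp add: algebra_simps)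
    also have "t * (\<delta> / 2) \<le> 1 * (\<delta> / 2)" using t \<delta>0 by (intro mult_right_mono) auto
    finally have "?\<psi> f t \<le> t * ?\<psi> f 1 + (1 - t) * ?\<psi> f 0 + (2 * (e * V) + \<delta> / 2)" by (simp add: algebra_simps)
    also have "2 * (e * V) + \<delta> / 2 \<le> e * C" using e(1) by (simp add: C_def \<delta>_def algebra_simps)
    finally show "?\<psi> f t \<le> t * ?\<psi> f 1 + (1 - t) * ?\<psi> f 0 + e0" using e(2) by simp
  qed
  then show "qform n (mat_fun f (complex_of_real t \<cdot>\<^sub>m A + complex_of_real (1 - t) \<cdot>\<^sub>m B)) v
      \<le> t * qform n (mat_fun f A) v + (1 - t) * qform n (mat_fun f B) v"
    by (simp only: L1 L[of t])
qed

text \<open>A negative value \<open>- \<eta>\<close> would make the path function strictly concave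
  near \<open>s = 0\<close>, against midpoint convexity. Two approximations are needed:
  \<open>p1\<close> has a continuous second derivative along the path and so fixes an interval of
  radius \<open>s1\<close> on which the sign persists, while \<open>p2\<close> has to be accurate
  compared with \<open>s1^2\<close> and can be chosen only afterwards.\<close>

lemma n_convex_Qd_nonneg:
  assumes nc: "n_convex_on n I f" and f: "C_k_on 2 f I" and I: "open I" "convex I" and n: "n > 0"
    and A: "hermitian n A" and H: "hermitian n H" and v: "v \<in> carrier_vec n"
    and sp0: "spectral n A U0 d0" and d0: "\<And>k. k < n \<Longrightarrow> d0 k \<in> I"
  shows "0 \<le> Qd n f d0 (yvec n H U0 v)"
proof (rule ccontr)
  assume neg0: "\<not> ?thesis"
  define \<eta> where "\<eta> = - Qd n f d0 (yvec n H U0 v)"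
  have \<eta>: "\<eta> > 0" using neg0 by (simp add: \<eta>_def)
  have c: "A \<in> carrier_mat n n" "H \<in> carrier_mat n n" using A H by (auto simp: hermitian_def)
  obtain \<alpha> \<beta> r where h: "r > 0" "{\<alpha> - r..\<beta> + r} \<subseteq> I" "d0 ` {..<n} \<subseteq> {\<alpha>..\<beta>}" "\<alpha> \<le> \<beta>"
    by (rule compact_interval_hull[OF I, of "d0 ` {..<n}"]) (use d0 n in auto)
  have dm: "\<And>k. k < n \<Longrightarrow> d0 k \<in> {\<alpha>..\<beta>}" using h(3) by (auto simp: image_subset_iff)
  let ?J = "{\<alpha> - r..\<beta> + r}"
  have h0: "0 \<le> hnorm n H" by (simp add: hnorm_def sum_nonneg)
  \<comment> \<open>Within this radius the eigenvalues leave \<open>[\<alpha>, \<beta>]\<close> by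
    at most \<open>r\<close>, since the form of \<open>H\<close> at unit vectors is bounded by
    \<open>hnorm\<close>.\<close>
  define s0 where "s0 = r / (hnorm n H + 1)"
  have s0: "s0 > 0" "s0 * hnorm n H \<le> r" using h(1) h0 by (auto simp: s0_def field_simps)
  have path: "d k \<in> ?J" if s: "\<bar>s\<bar> \<le> s0" and sp: "spectral n (lin A H s) U d" and kn: "k < n" for s U d k
  proof -
    let ?u = "col U k"
    have "d k = qform n A ?u + s * qform n H ?u"
      using eigenvalue_qform(1)[OF sp kn] qform_lin[OF c] by simp
    moreover have "\<alpha> \<le> qform n A ?u" "qform n A ?u \<le> \<beta>"
      using qform_bounds[OF sp0 dm, of ?u] eigenvalue_qform(2)[OF sp kn] by auto
    moreover have "\<bar>s * qform n H ?u\<bar> \<le> s0 * hnorm n H"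
      unfolding abs_mult using s qform_unit_bound[OF eigenvalue_qform(2)[OF sp kn]] s0 by (intro mult_mono) auto
    ultimately show ?thesis using s0(2) by (auto simp: abs_le_iff)
  qed
  define K where "K = hnorm n H * (\<Sum>i<n. cmod (v $ i))"
  define V where "V = vnorm2 n v"
  define Kc where "Kc = real n ^ 3 * K\<^sup>2"
  have Kc: "Kc \<ge> 0" by (simp add: Kc_def)
  have V: "V \<ge> 0" by (simp add: V_def vnorm2_nonneg)
  let ?\<psi> = "\<lambda>f s. qform n (mat_fun f (lin A H s)) v"
  have spec: "\<exists>U d. spectral n (lin A H s) U d" for s by (rule hermitian_spectral[OF lin_hermitian[OF A H]])
  have close: "\<bar>2 * Qd n f d (yvec n H U v) - 2 * Qd n (poly p) d (yvec n H U v)\<bar> \<le> Kc * e"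
    if "\<bar>s\<bar> \<le> s0" "spectral n (lin A H s) U d"
      "\<And>s. s \<in> ?J \<Longrightarrow> \<bar>(deriv ^^ 2) f s - poly ((pderiv ^^ 2) p) s\<bar> \<le> e" for s U d p e
    unfolding Kc_def
    by (rule Qd_approx[OF f I(1) h(2) path[OF that(1,2)] that(3)]) (auto simp: K_def intro: yvec_bound[OF spectralD(2)[OF that(2)]])
  have ab: "\<alpha> - r \<le> \<beta> + r" using h by simp
  define e1 where "e1 = \<eta> / (2 * (Kc + 1))"
  have e1: "e1 > 0" "Kc * e1 \<le> \<eta> / 2" using \<eta> Kc by (auto simp: e1_def field_simps)
  obtain p1 where p1: "\<And>s. s \<in> ?J \<Longrightarrow> \<bar>(deriv ^^ 2) f s - poly ((pderiv ^^ 2) p1) s\<bar> \<le> e1"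
    using C2_poly_approx[OF f h(2) ab e1(1)] by metis
  obtain \<phi>2 where \<phi>2: "continuous_on UNIV \<phi>2"
    "\<And>s U d. spectral n (lin A H s) U d \<Longrightarrow> \<phi>2 s = 2 * Qd n (poly p1) d (yvec n H U v)"
    using poly_path_derivatives[OF A H, of p1 v] by metis
  have sp00: "spectral n (lin A H 0) U0 d0" using sp0 lin_zero[OF c] by simp
  have "\<phi>2 0 \<le> - 2 * \<eta> + \<eta> / 2"
    using close[OF _ sp00 p1] \<phi>2(2)[OF sp00] s0(1) e1(2) by (simp add: \<eta>_def abs_le_iff)
  then have "\<phi>2 0 < - \<eta>" using \<eta> by simp
  moreover have "isCont \<phi>2 0" using \<phi>2(1) by (simp add: continuous_on_eq_continuous_at)
  ultimately have "\<forall>\<^sub>F s in nhds 0. \<phi>2 s < - \<eta>"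
    by (intro order_tendstoD(2)) (auto simp: isCont_def tendsto_at_iff_tendsto_nhds)
  then obtain s2 where s2: "s2 > 0" "\<And>s. \<bar>s\<bar> < s2 \<Longrightarrow> \<phi>2 s < - \<eta>"
    unfolding eventually_nhds_metric by (auto simp: dist_real_def)
  define s1 where "s1 = min s0 (s2 / 2)"
  have s1: "s1 > 0" "s1 \<le> s0" "s1 < s2" using s0 s2 by (auto simp: s1_def)
  \<comment> \<open>The first bound keeps the second derivative for \<open>p2\<close> below
    \<open>- \<eta> / 4\<close>. The second limits the four errors in function values to
    \<open>\<eta> s1^2 / 8\<close> altogether, half of the concavity gap
    \<open>\<eta> s1^2 / 4\<close>.\<close>
  define e2 where "e2 = min (\<eta> / (4 * (Kc + 1))) (\<eta> * s1\<^sup>2 / (32 * (V + 1)))"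
  have "\<eta> * s1\<^sup>2 > 0" using \<eta> s1 by simp
  then have e2: "e2 > 0" using \<eta> Kc V by (simp add: e2_def)
  have "Kc * e2 \<le> Kc * (\<eta> / (4 * (Kc + 1)))" using Kc by (intro mult_left_mono) (auto simp: e2_def)
  also have "\<dots> \<le> \<eta> / 4" using \<eta> Kc by (simp add: field_simps)
  finally have e2a: "Kc * e2 \<le> \<eta> / 4" .
  have "V * e2 \<le> V * (\<eta> * s1\<^sup>2 / (32 * (V + 1)))" using V by (intro mult_left_mono) (auto simp: e2_def)
  also have "\<dots> \<le> \<eta> * s1\<^sup>2 / 32" using \<open>\<eta> * s1\<^sup>2 > 0\<close> V by (simp add: field_simps)
  finally have e2b: "e2 * V \<le> \<eta> * s1\<^sup>2 / 32" by (simp add: mult.commute)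
  obtain p2 where p2: "\<And>s. s \<in> ?J \<Longrightarrow> \<bar>f s - poly p2 s\<bar> \<le> e2"
    "\<And>s. s \<in> ?J \<Longrightarrow> \<bar>(deriv ^^ 2) f s - poly ((pderiv ^^ 2) p2) s\<bar> \<le> e2"
    using C2_poly_approx[OF f h(2) ab e2] by metis
  obtain \<chi>1 \<chi>2 where \<chi>: "\<And>s. (?\<psi> (poly p2) has_real_derivative \<chi>1 s) (at s)"
    "\<And>s. (\<chi>1 has_real_derivative \<chi>2 s) (at s)"
    "\<And>s U d. spectral n (lin A H s) U d \<Longrightarrow> \<chi>2 s = 2 * Qd n (poly p2) d (yvec n H U v)"
    using poly_path_derivatives[OF A H, of p2 v] by metis
  have neg: "\<chi>2 s \<le> - \<eta> / 4" if s: "\<bar>s\<bar> \<le> s1" for s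
  proof -
    obtain U d where sp: "spectral n (lin A H s) U d" using spec by blast
    have s': "\<bar>s\<bar> \<le> s0" using s s1 by simp
    show ?thesis
      using close[OF s' sp p1] close[OF s' sp p2(2)] s2(2)[of s] s s1 \<phi>2(2)[OF sp] \<chi>(3)[OF sp] e1(2) e2a
      by (simp add: abs_le_iff)
  qed
  have "convex_on {- s1..s1} (\<lambda>s. - ?\<psi> (poly p2) s - \<eta> / 8 * s\<^sup>2)"
  proof (rule f''_ge0_imp_convex)
    show "((\<lambda>s. - ?\<psi> (poly p2) s - \<eta> / 8 * s\<^sup>2) has_real_derivative - \<chi>1 s - \<eta> / 4 * s) (at s)" for s
      by (auto intro!: derivative_eq_intros \<chi>(1))
    show "((\<lambda>s. - \<chi>1 s - \<eta> / 4 * s) has_real_derivative - \<chi>2 s - \<eta> / 4) (at s)" for s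
      by (auto intro!: derivative_eq_intros \<chi>(2))
    show "0 \<le> - \<chi>2 s - \<eta> / 4" if "s \<in> {- s1..s1}" for s
    proof -
      have "\<bar>s\<bar> \<le> s1" using that by auto
      from neg[OF this] show ?thesis by simp
    qed
  qed simp
  from convex_onD[OF this, of "1 / 2" "- s1" s1]
  have "- ?\<psi> (poly p2) 0 \<le> (- ?\<psi> (poly p2) (- s1) - \<eta> * s1\<^sup>2 / 8) / 2 + (- ?\<psi> (poly p2) s1 - \<eta> * s1\<^sup>2 / 8) / 2"
    using s1 by simp
  moreover have "y + x + w / 4 \<le> 2 * z" if "- z \<le> (- x - w / 8) / 2 + (- y - w / 8) / 2" for x y z w :: real
    using that by (simp add: field_simps)
  ultimately have conc: "?\<psi> (poly p2) s1 + ?\<psi> (poly p2) (- s1) + \<eta> * s1\<^sup>2 / 4 \<le> 2 * ?\<psi> (poly p2) 0" by blast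
  have ap: "\<bar>?\<psi> f s - ?\<psi> (poly p2) s\<bar> \<le> e2 * V" if s: "\<bar>s\<bar> \<le> s0" for s
  proof -
    obtain U d where sp: "spectral n (lin A H s) U d" using spec by blast
    show ?thesis unfolding V_def by (rule qform_fun_approx[OF sp path[OF s sp] p2(1)])
  qed
  have spI: "spectrum (lin A H s) \<subseteq> complex_of_real ` I" if s: "\<bar>s\<bar> \<le> s0" for s
  proof -
    obtain U d where sp: "spectral n (lin A H s) U d" using spec by blast
    show ?thesis unfolding spectral_spectrum_subset[OF sp] using path[OF s sp] h(2) by blast
  qed
  have "?\<psi> f (1 / 2 * s1 + (1 - 1 / 2) * - s1) \<le> 1 / 2 * ?\<psi> f s1 + (1 - 1 / 2) * ?\<psi> f (- s1)"
    unfolding lin_combination[OF c, symmetric]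
    using nc[unfolded n_convex_on_iff_qform, rule_format, of "1 / 2" "lin A H s1" "lin A H (- s1)" v]
      lin_hermitian[OF A H] spI[of s1] spI[of "- s1"] s1 v by simp
  then have "2 * ?\<psi> f 0 \<le> ?\<psi> f s1 + ?\<psi> f (- s1)" by simp
  moreover have "\<eta> * s1\<^sup>2 / 8 \<ge> 4 * (e2 * V)" using e2b by simp
  ultimately show False using conc ap[of 0] ap[of s1] ap[of "- s1"] s1 s0 \<open>\<eta> * s1\<^sup>2 > 0\<close>
    by (simp add: abs_le_iff)
qed

section \<open>Smoothing\<close>

lemma spectral_real_diag: "spectral n (real_diag n d) (1\<^sub>m n) d"
proof -
  have a: "mat_adjoint (1\<^sub>m n :: complex mat) = 1\<^sub>m n"
    using adjoint_carrier[OF one_carrier_mat] by (intro eq_matI) (auto simp: adjoint_index[OF one_carrier_mat])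
  show ?thesis by (simp add: spectral_def unitary_def a left_mult_one_mat[OF real_diag_carrier] right_mult_one_mat[OF real_diag_carrier])
qed

lemma ucoef_one: "k < n \<Longrightarrow> ucoef n (1\<^sub>m n) v k = v $ k"
proof -
  assume k: "k < n"
  have "ucoef n (1\<^sub>m n) v k = (\<Sum>i<n. if i = k then v $ k else 0)"
    unfolding ucoef_def using k by (intro sum.cong) auto
  then show ?thesis using k by simp
qed

lemma ht_one:
  assumes "b < n" "c < n" shows "ht n H (1\<^sub>m n) b c = H $$ (b, c)"
proof -
  have "(\<Sum>j<n. H $$ (k, j) * 1\<^sub>m n $$ (j, c)) = (\<Sum>j<n. if j = c then H $$ (k, c) else 0)" for k
    using assms by (intro sum.cong) auto
  then have "(\<Sum>j<n. H $$ (k, j) * 1\<^sub>m n $$ (j, c)) = H $$ (k, c)" for k using assms by simp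
  then have "ht n H (1\<^sub>m n) b c = (\<Sum>k<n. if k = b then H $$ (b, c) else 0)"
    unfolding ht_def using assms by (intro sum.cong) auto
  then show ?thesis using assms by simp
qed

text \<open>\<open>A\<close> is diagonal with the nodes as eigenvalues, so that row \<open>b\<close>
  of \<open>yvec\<close> has the entries \<open>H b c * v c\<close> and can be prescribed. The
  weights stand in row \<open>b0\<close> of \<open>H\<close>; the entries that symmetry forces into
  column \<open>b0\<close> are multiplied by the small coordinate of \<open>v\<close>, so the other
  slices contribute \<open>e^2 * W\<close> only.\<close>

theorem n_convex_imp_kraus:
  assumes nc: "n_convex_on n I f" and f: "C_k_on 2 f I" and I: "open I" "convex I"
  shows "kraus n I f"
  unfolding kraus_def
proof (intro allI impI, elim conjE)
  fix X l r assume X: "finite X" "X \<subseteq> I" "card X = n" and l: "l \<in> X"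
  have n: "n > 0" using X l card_gt_0_iff by blast
  obtain h where h: "bij_betw h {..<n} X" using ex_strict_mono_enum[OF X(1)] X(3) by metis
  then have hinj: "inj_on h {..<n}" and hX: "h ` {..<n} = X" by (auto simp: bij_betw_def)
  obtain b0 where b0: "b0 < n" "h b0 = l" using l hX by auto
  define S where "S = (\<Sum>a<n. \<Sum>c<n. r (h a) * r (h c) * divdiff [h a, l, h c] f)"
  define W where "W = (\<Sum>b\<in>{..<n} - {b0}. (r (h b) * r l)\<^sup>2 * divdiff [l, h b, l] f)"
  have "0 \<le> S + e\<^sup>2 * W" if e: "e > 0" for e
  proof -
    \<comment> \<open>The entry \<open>1 / e\<close> balances the factor \<open>e\<close> in \<open>v\<close>, so that row \<open>b0\<close> of \<open>yvec\<close> is \<open>r\<close> and the others are \<open>O(e)\<close>.\<close>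
    define v where "v = vec n (\<lambda>i. if i = b0 then complex_of_real (e * r l) else 1)"
    define g where "g = (\<lambda>i j. if i = b0 \<and> j = b0 then 1 / e else if i = b0 then r (h j) else if j = b0 then r (h i) else 0)"
    define H where "H = mat n n (\<lambda>(i, j). complex_of_real (g i j))"
    have H: "hermitian n H" by (auto simp: hermitian_index H_def g_def)
    have v: "v \<in> carrier_vec n" by (simp add: v_def)
    let ?y = "yvec n H (1\<^sub>m n) v"
    define z where "z = (\<lambda>b c. if b = b0 then r (h c) else if c = b0 then r (h b) * (e * r l) else 0)"
    have y: "?y b c = complex_of_real (z b c)" if "b < n" "c < n" for b c
      using that e b0 by (simp add: yvec_def ht_one ucoef_one H_def v_def g_def z_def)
    have "0 \<le> Qd n f h ?y"
      using hX X(2) by (intro n_convex_Qd_nonneg[OF nc f I n spectral_hermitian[OF spectral_real_diag] H v spectral_real_diag]) auto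
    also have "Qd n f h ?y = (\<Sum>b<n. \<Sum>a<n. \<Sum>c<n. z b a * z b c * divdiff [h a, h b, h c] f)"
      unfolding Qd_def by (intro sum.cong refl) (simp add: y)
    also have "\<dots> = (\<Sum>a<n. \<Sum>c<n. z b0 a * z b0 c * divdiff [h a, h b0, h c] f)
        + (\<Sum>b\<in>{..<n} - {b0}. \<Sum>a<n. \<Sum>c<n. z b a * z b c * divdiff [h a, h b, h c] f)"
      by (rule sum.remove) (use b0 in auto)
    also have "(\<Sum>a<n. \<Sum>c<n. z b0 a * z b0 c * divdiff [h a, h b0, h c] f) = S"
      unfolding S_def b0(2) by (simp add: z_def)
    also have "(\<Sum>b\<in>{..<n} - {b0}. \<Sum>a<n. \<Sum>c<n. z b a * z b c * divdiff [h a, h b, h c] f) = e\<^sup>2 * W"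
      unfolding W_def sum_distrib_left
    proof (rule sum.cong[OF refl])
      fix b assume b: "b \<in> {..<n} - {b0}"
      have "(\<Sum>a<n. \<Sum>c<n. z b a * z b c * divdiff [h a, h b, h c] f) =
          (\<Sum>a<n. if a = b0 then (\<Sum>c<n. if c = b0 then (r (h b) * (e * r l)) * (r (h b) * (e * r l)) * divdiff [l, h b, l] f else 0) else 0)"
      proof (rule sum.cong[OF refl])
        fix a assume "a \<in> {..<n}"
        show "(\<Sum>c<n. z b a * z b c * divdiff [h a, h b, h c] f) =
          (if a = b0 then (\<Sum>c<n. if c = b0 then (r (h b) * (e * r l)) * (r (h b) * (e * r l)) * divdiff [l, h b, l] f else 0) else 0)"
        proof (cases "a = b0")
          case True
          show ?thesis unfolding True if_P[OF refl]
            by (rule sum.cong[OF refl]) (use b b0 in \<open>simp add: z_def\<close>)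
        qed (use b in \<open>simp add: z_def\<close>)
      qed
      then show "(\<Sum>a<n. \<Sum>c<n. z b a * z b c * divdiff [h a, h b, h c] f) = e\<^sup>2 * ((r (h b) * r l)\<^sup>2 * divdiff [l, h b, l] f)"
        using b0 by (simp add: power2_eq_square mult_ac)
    qed
    finally show ?thesis .
  qed
  then have "\<forall>\<^sub>F e in at_right 0. 0 \<le> S + e\<^sup>2 * W"
    using eventually_at_right_less[of "0 :: real"] by (auto elim: eventually_mono)
  moreover have "((\<lambda>e. S + e\<^sup>2 * W) \<longlongrightarrow> S) (at_right 0)" by (auto intro!: tendsto_eq_intros)
  ultimately have "0 \<le> S" by (intro tendsto_lowerbound[where f = "\<lambda>e. S + e\<^sup>2 * W"]) auto
  also have "S = (\<Sum>x\<in>X. \<Sum>y\<in>X. r x * r y * divdiff [x, y, l] f)"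
    unfolding S_def hX[symmetric] sum.reindex[OF hinj] by (simp add: divdiff_3_swap(2)[of _ l])
  finally show "0 \<le> (\<Sum>x\<in>X. \<Sum>y\<in>X. r x * r y * divdiff [x, y, l] f)" .
qed

section \<open>Averages over translates\<close>

lemma n_convex_on_mono: "n_convex_on n S f \<Longrightarrow> T \<subseteq> S \<Longrightarrow> n_convex_on n T f"
  unfolding n_convex_on_def by (meson image_mono order_trans)

text \<open>Tested on multiples of the identity matrix. This supplies the continuity that integral
  averages rely on, before any differentiability is known.\<close>

lemma n_convex_imp_convex:
  assumes nc: "n_convex_on n I f" and I: "convex I" and n: "n > 0"
  shows "convex_on I f"
proof (rule convex_onI[OF _ I])
  fix t x y :: real assume t: "0 < t" "t < 1" and xy: "x \<in> I" "y \<in> I"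
  let ?D = "\<lambda>x. real_diag n (\<lambda>_. x)" and ?v = "unit_vec n 0 :: complex vec"
  have q: "qform n (mat_fun f (?D x)) ?v = f x" for x
  proof -
    have "qform n (mat_fun f (?D x)) ?v = (\<Sum>k<n. if k = 0 then f x else 0)"
      unfolding qform_spectral[OF mat_fun_spectral[OF spectral_real_diag]]
      using n by (intro sum.cong) (auto simp: ucoef_one)
    then show ?thesis using n by simp
  qed
  have sp: "spectrum (?D x) \<subseteq> complex_of_real ` I" if "x \<in> I" for x
    using spectral_spectrum_subset[OF spectral_real_diag] that by blast
  have "complex_of_real t \<cdot>\<^sub>m ?D y + complex_of_real (1 - t) \<cdot>\<^sub>m ?D x = ?D (t * y + (1 - t) * x)"
    by (auto simp: real_diag_def intro!: eq_matI)
  then show "f ((1 - t) *\<^sub>R x + t *\<^sub>R y) \<le> (1 - t) * f x + t * f y"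
    using nc[unfolded n_convex_on_iff_qform, rule_format, of t "?D y" "?D x" ?v] t
      spectral_hermitian[OF spectral_real_diag] sp[OF xy(1)] sp[OF xy(2)]
    by (simp add: q add.commute)
qed

lemma spectral_shift:
  assumes sp: "spectral n A U d"
  shows "spectral n (lin A (1\<^sub>m n) \<tau>) U (\<lambda>k. d k + \<tau>)"
proof -
  have A: "A \<in> carrier_mat n n" and U: "unitary n U" "U \<in> carrier_mat n n" using spectralD[OF sp] by auto
  have "lin A (1\<^sub>m n) \<tau> = U * real_diag n (\<lambda>k. d k + \<tau>) * mat_adjoint U"
  proof (rule eq_matI)
    fix i j assume "i < dim_row (U * real_diag n (\<lambda>k. d k + \<tau>) * mat_adjoint U)" "j < dim_col (U * real_diag n (\<lambda>k. d k + \<tau>) * mat_adjoint U)"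
    then have ij: "i < n" "j < n" using U(2) adjoint_carrier[OF U(2)] by auto
    have "(\<Sum>k<n. U $$ (i, k) * of_real (d k + \<tau>) * cnj (U $$ (j, k))) =
        (\<Sum>k<n. U $$ (i, k) * of_real (d k) * cnj (U $$ (j, k))) + of_real \<tau> * (\<Sum>k<n. U $$ (i, k) * cnj (U $$ (j, k)))"
      unfolding sum_distrib_left sum.distrib[symmetric] by (intro sum.cong refl) (simp add: algebra_simps)
    then show "lin A (1\<^sub>m n) \<tau> $$ (i, j) = (U * real_diag n (\<lambda>k. d k + \<tau>) * mat_adjoint U) $$ (i, j)"
      unfolding conj_diag_index[OF U(2) ij] lin_index[OF A one_carrier_mat ij]
      using spectralD(4)[OF sp ij] unitaryD(2)[OF U(1) ij] ij by simp
  qed (use A U(2) adjoint_carrier[OF U(2)] in \<open>auto simp: lin_def\<close>)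
  then show ?thesis using U by (simp add: spectral_def)
qed

lemma lin_one_combination:
  assumes "A \<in> carrier_mat n n" "B \<in> carrier_mat n n"
  shows "lin (complex_of_real t \<cdot>\<^sub>m A + complex_of_real (1 - t) \<cdot>\<^sub>m B) (1\<^sub>m n) \<tau>
    = complex_of_real t \<cdot>\<^sub>m lin A (1\<^sub>m n) \<tau> + complex_of_real (1 - t) \<cdot>\<^sub>m lin B (1\<^sub>m n) \<tau>"
  using assms by (intro eq_matI) (auto simp: lin_def algebra_simps)

text \<open>Steklov averages: an average of the functions \<open>x \<mapsto> f (x + h u)\<close> inherits \<open>n\<close>-convexity, because
  shifting the argument amounts to adding \<open>h u\<close> times the identity matrix, and every average gains one
  derivative.\<close>

definition steklov :: "real \<Rightarrow> (real \<Rightarrow> real) \<Rightarrow> real \<Rightarrow> real" where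
  "steklov h f x = integral {0..1} (\<lambda>u. f (x + h * u))"

lemma mult_unit_interval: fixes h :: real assumes "h > 0" "u \<in> {0..1}" shows "0 \<le> h * u" "h * u \<le> (h :: real)"
  using assms by (auto simp: mult_left_le)

lemma steklov_integrable:
  fixes f :: "real \<Rightarrow> real"
  assumes "continuous_on {c<..<d} f" "h > 0" "x \<in> {c<..<d - h}"
  shows "continuous_on {0..1} (\<lambda>u. f (x + h * u))"
proof (rule continuous_on_compose2[OF assms(1)])
  show "(\<lambda>u. x + h * u) ` {0..1} \<subseteq> {c<..<d}"
  proof
    fix z assume "z \<in> (\<lambda>u. x + h * u) ` {0..1}"
    then obtain u where u: "u \<in> {0..1}" "z = x + h * u" by auto
    then show "z \<in> {c<..<d}" using mult_unit_interval[OF assms(2) u(1)] assms(3) by auto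
  qed
qed (intro continuous_intros)

lemma steklov_n_convex:
  assumes nc: "n_convex_on n {c<..<d} f" and f: "continuous_on {c<..<d} f" and h: "h > 0"
  shows "n_convex_on n {c<..<d - h} (steklov h f)"
  unfolding n_convex_on_iff_qform
proof (intro allI impI, elim conjE)
  fix t :: real and A B and v :: "complex vec"
  assume t: "0 \<le> t" "t \<le> 1" and A: "hermitian n A" and B: "hermitian n B"
    and sA: "spectrum A \<subseteq> complex_of_real ` {c<..<d - h}" and sB: "spectrum B \<subseteq> complex_of_real ` {c<..<d - h}"
    and v: "v \<in> carrier_vec n"
  have cr: "A \<in> carrier_mat n n" "B \<in> carrier_mat n n" using A B by (auto simp: hermitian_def)
  let ?C = "complex_of_real t \<cdot>\<^sub>m A + complex_of_real (1 - t) \<cdot>\<^sub>m B"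
  have C: "hermitian n ?C" by (rule hermitian_combination(1)[OF A B])
  let ?q = "\<lambda>A u. qform n (mat_fun f (lin A (1\<^sub>m n) (h * u))) v"
  have main: "qform n (mat_fun (steklov h f) M) v = integral {0..1} (?q M) \<and> ?q M integrable_on {0..1} \<and>
      (\<forall>u\<in>{0..1}. hermitian n (lin M (1\<^sub>m n) (h * u)) \<and> spectrum (lin M (1\<^sub>m n) (h * u)) \<subseteq> complex_of_real ` {c<..<d})"
    if M: "hermitian n M" and sM: "spectrum M \<subseteq> complex_of_real ` {c<..<d - h}" for M
  proof -
    obtain U e where sp: "spectral n M U e" using hermitian_spectral[OF M] by blast
    have e: "e k \<in> {c<..<d - h}" if "k < n" for k using spectral_spectrum_subset[OF sp] sM that by blast
    have q: "?q M u = (\<Sum>k<n. f (e k + h * u) * (cmod (ucoef n U v k))\<^sup>2)" for u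
      using qform_spectral[OF mat_fun_spectral[OF spectral_shift[OF sp]]] by simp
    have int: "(\<lambda>u. f (e k + h * u)) integrable_on {0..1}" if "k < n" for k
      by (rule integrable_continuous_real[OF steklov_integrable[OF f h e[OF that]]])
    have "qform n (mat_fun (steklov h f) M) v = (\<Sum>k<n. integral {0..1} (\<lambda>u. f (e k + h * u) * (cmod (ucoef n U v k))\<^sup>2))"
      unfolding qform_spectral[OF mat_fun_spectral[OF sp]] by (simp add: steklov_def)
    also have "\<dots> = integral {0..1} (?q M)"
      unfolding q using int by (intro integral_sum[symmetric]) (auto intro: integrable_on_mult_left)
    finally have 1: "qform n (mat_fun (steklov h f) M) v = integral {0..1} (?q M)" .
    have 2: "?q M integrable_on {0..1}"
      unfolding q using int by (intro integrable_sum) (auto intro: integrable_on_mult_left)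
    have 3: "hermitian n (lin M (1\<^sub>m n) (h * u)) \<and> spectrum (lin M (1\<^sub>m n) (h * u)) \<subseteq> complex_of_real ` {c<..<d}"
      if u: "u \<in> {0..1}" for u
    proof -
      have "e k + h * u \<in> {c<..<d}" if "k < n" for k using e[OF that] mult_unit_interval[OF h u] by auto
      then show ?thesis
        using spectral_spectrum_subset[OF spectral_shift[OF sp]] spectral_hermitian[OF spectral_shift[OF sp]] by blast
    qed
    from 1 2 3 show ?thesis by blast
  qed
  \<comment> \<open>Rayleigh quotients again: the eigenvalues of the combination lie between the
    extreme eigenvalues of \<open>A\<close> and \<open>B\<close>.\<close>
  have sC: "spectrum ?C \<subseteq> complex_of_real ` {c<..<d - h}"
  proof -
    obtain UA dA where spA: "spectral n A UA dA" using hermitian_spectral[OF A] by blast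
    obtain UB dB where spB: "spectral n B UB dB" using hermitian_spectral[OF B] by blast
    obtain U e where sp: "spectral n ?C U e" using hermitian_spectral[OF C] by blast
    have dA: "dA k \<in> {c<..<d - h}" and dB: "dB k \<in> {c<..<d - h}" if "k < n" for k
      using spectral_spectrum_subset[OF spA] spectral_spectrum_subset[OF spB] sA sB that by blast+
    have "e k \<in> {c<..<d - h}" if k: "k < n" for k
    proof -
      let ?S = "dA ` {..<n} \<union> dB ` {..<n}"
      have S: "finite ?S" "?S \<noteq> {}" using k by auto
      define \<alpha> \<beta> where "\<alpha> = Min ?S" and "\<beta> = Max ?S"
      have "\<alpha> \<in> ?S" unfolding \<alpha>_def by (rule Min_in[OF S])
      moreover have "\<beta> \<in> ?S" unfolding \<beta>_def by (rule Max_in[OF S])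
      ultimately have ab: "c < \<alpha>" "\<beta> < d - h" using dA dB by auto
      have "dA k \<in> {\<alpha>..\<beta>}" "dB k \<in> {\<alpha>..\<beta>}" if "k < n" for k
        unfolding \<alpha>_def \<beta>_def using S that by auto
      from qform_bounds[OF spA this(1), of "col U k"] qform_bounds[OF spB this(2), of "col U k"]
      have b: "\<alpha> \<le> qform n A (col U k)" "qform n A (col U k) \<le> \<beta>" "\<alpha> \<le> qform n B (col U k)" "qform n B (col U k) \<le> \<beta>"
        using eigenvalue_qform(2)[OF sp k] by auto
      have ek: "e k = t * qform n A (col U k) + (1 - t) * qform n B (col U k)"
        using eigenvalue_qform(1)[OF sp k] unfolding qform_combination(1)[OF cr] by simp
      have "t * a \<le> t * b" "(1 - t) * a \<le> (1 - t) * b" if "a \<le> b" for a b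
        using t that by (auto intro!: mult_left_mono)
      then have "t * \<alpha> + (1 - t) * \<alpha> \<le> e k" "e k \<le> t * \<beta> + (1 - t) * \<beta>" unfolding ek using b by (auto intro!: add_mono)
      then show ?thesis using ab by (simp add: algebra_simps)
    qed
    then show ?thesis using spectral_spectrum_subset[OF sp] by blast
  qed
  note mA = main[OF A sA] and mB = main[OF B sB] and mC = main[OF C sC]
  have "integral {0..1} (?q ?C) \<le> integral {0..1} (\<lambda>u. t * ?q A u + (1 - t) * ?q B u)"
  proof (rule integral_le)
    show "(\<lambda>u. t * ?q A u + (1 - t) * ?q B u) integrable_on {0..1}"
      using mA mB by (intro integrable_add integrable_on_mult_right) auto
    show "?q ?C u \<le> t * ?q A u + (1 - t) * ?q B u" if u: "u \<in> {0..1}" for u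
      unfolding lin_one_combination[OF cr]
      using nc[unfolded n_convex_on_iff_qform, rule_format] mA mB u t v by blast
  qed (use mC in blast)
  also have "\<dots> = t * integral {0..1} (?q A) + (1 - t) * integral {0..1} (?q B)"
    using mA mB by (subst integral_add) (auto intro: integrable_on_mult_right)
  finally show "qform n (mat_fun (steklov h f) ?C) v \<le> t * qform n (mat_fun (steklov h f) A) v + (1 - t) * qform n (mat_fun (steklov h f) B) v"
    using mA mB mC by simp
qed

text \<open>After a substitution the average is \<open>(F (x + h) - F x) / h\<close> for an
  antiderivative \<open>F\<close> of \<open>f\<close>.\<close>

lemma steklov_derivative:
  assumes f: "continuous_on {c<..<d} f" and h: "h > 0" and x0: "x0 \<in> {c<..<d - h}"
  shows "(steklov h f has_real_derivative (f (x0 + h) - f x0) / h) (at x0)"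
proof -
  \<comment> \<open>\<open>[p, q]\<close> is compact in the domain and contains
    \<open>[x0, x0 + h]\<close> in its interior, so one antiderivative serves all points near
    \<open>x0\<close>.\<close>
  define p q where "p = (c + x0) / 2" and "q = (x0 + h + d) / 2"
  have pq: "c < p" "p < x0" "x0 + h < q" "q < d" using x0 h by (auto simp: p_def q_def)
  have fc: "continuous_on {p..q} f" using f by (rule continuous_on_subset) (use pq in auto)
  define F where "F = (\<lambda>x. integral {p..x} f)"
  have Fw: "(F has_real_derivative f x) (at x within {p..q})" if "x \<in> {p..q}" for x
    unfolding F_def by (rule integral_has_real_derivative[OF fc that])
  have F: "(F has_real_derivative f x) (at x)" if "x \<in> {p<..<q}" for x
    using Fw[of x] that at_within_interior[of x "{p..q}"] by auto
  have eq: "steklov h f x = (F (x + h) - F x) / h" if x: "x \<in> {p<..<q - h}" for x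
  proof -
    have "((\<lambda>u. f (x + h * u)) has_integral (F (x + h * 1) / h - F (x + h * 0) / h)) {0..1}"
    proof (rule fundamental_theorem_of_calculus)
      fix u :: real assume u: "u \<in> {0..1}"
      have "x + h * u \<in> {p<..<q}" using x mult_unit_interval[OF h u] by auto
      then have "((\<lambda>u. F (x + h * u) / h) has_real_derivative f (x + h * u) * h / h) (at u)"
        by (intro DERIV_cdivide DERIV_chain2[where f = F] F) (auto intro!: derivative_eq_intros)
      then show "((\<lambda>u. F (x + h * u) / h) has_vector_derivative f (x + h * u)) (at u within {0..1})"
        using h by (simp add: has_real_derivative_iff_has_vector_derivative has_vector_derivative_at_within)
    qed simp
    then show ?thesis unfolding steklov_def by (simp add: integral_unique diff_divide_distrib)
  qed
  have "((\<lambda>x. (F (x + h) - F x) / h) has_real_derivative (f (x0 + h) * 1 - f x0) / h) (at x0)"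
    by (intro DERIV_cdivide DERIV_diff DERIV_chain2[where f = F] F) (use pq h in \<open>auto intro!: derivative_eq_intros\<close>)
  then have der: "((\<lambda>x. (F (x + h) - F x) / h) has_real_derivative (f (x0 + h) - f x0) / h) (at x0)" by simp
  have "\<forall>\<^sub>F x in nhds x0. x \<in> {p<..<q - h}" using pq by (intro eventually_nhds_in_open) auto
  then have "\<forall>\<^sub>F x in nhds x0. steklov h f x = (F (x + h) - F x) / h" by eventually_elim (rule eq)
  from DERIV_cong_ev[OF refl this refl] der show ?thesis by blast
qed

lemma C_k_on_cong_imp:
  assumes I: "open I" and eq: "\<And>x. x \<in> I \<Longrightarrow> f x = g x" and f: "C_k_on k f I"
  shows "C_k_on k g I"
proof -
  have h: "(deriv ^^ j) f x = (deriv ^^ j) g x" if "x \<in> I" for j x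
    using that by (induction j arbitrary: x) (auto intro: eq higher_deriv_cong[OF I])
  have "(deriv ^^ j) g differentiable (at x)" if "j < k" "x \<in> I" for j x
  proof -
    have "((deriv ^^ j) g has_real_derivative (deriv ^^ Suc j) f x) (at x)"
      by (rule DERIV_cong_ev[THEN iffD1, OF refl _ refl C_k_onD[OF f that]])
        (use that h I in \<open>auto simp: eventually_nhds intro!: exI[of _ I]\<close>)
    then show ?thesis by (auto simp: real_differentiable_def)
  qed
  moreover have "continuous_on I ((deriv ^^ k) g)"
    using f h by (subst continuous_on_cong[OF refl h[symmetric]]) (auto simp: C_k_on_def)
  ultimately show ?thesis by (auto simp: C_k_on_def deriv_dom_def)
qed

lemma C_k_on_subset:
  assumes "C_k_on k f I" "J \<subseteq> I" shows "C_k_on k f J"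
  using assms continuous_on_subset unfolding C_k_on_def deriv_dom_def by blast

lemma C_k_on_translate:
  assumes f: "C_k_on k f I" and J: "\<And>x. x \<in> J \<Longrightarrow> x + h \<in> I"
  shows "C_k_on k (\<lambda>x. f (x + h)) J"
proof -
  have d: "deriv (\<lambda>x. g (x + h)) = (\<lambda>x. deriv g (x + h))" for g :: "real \<Rightarrow> real"
    by (rule ext) (simp add: deriv_def DERIV_shift)
  have h: "(deriv ^^ j) (\<lambda>x. f (x + h)) = (\<lambda>x. (deriv ^^ j) f (x + h))" for j
    by (induction j) (auto simp: d)
  have "(deriv ^^ j) (\<lambda>x. f (x + h)) differentiable (at x)" if "j < k" "x \<in> J" for j x
    unfolding h using C_k_onD[OF f that(1) J[OF that(2)]] by (auto simp: DERIV_shift real_differentiable_def)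
  moreover have "continuous_on J ((deriv ^^ k) (\<lambda>x. f (x + h)))"
    unfolding h
  proof (rule continuous_on_compose2[where g = "(deriv ^^ k) f" and f = "\<lambda>x. x + h"])
    show "continuous_on I ((deriv ^^ k) f)" using f by (simp add: C_k_on_def)
    show "continuous_on J (\<lambda>x. x + h)" by (intro continuous_intros)
  qed (use J in auto)
  ultimately show ?thesis by (auto simp: C_k_on_def deriv_dom_def)
qed

lemma steklov_C_k_on:
  assumes f: "C_k_on k f {c<..<d}" and h: "h > 0"
  shows "C_k_on (Suc k) (steklov h f) {c<..<d - h}"
proof -
  have fc: "continuous_on {c<..<d} f" using C_k_on_mono[OF f, of 0] by (simp add: C_k_on_def)
  have der: "(steklov h f has_real_derivative (f (x + h) - f x) / h) (at x)" if "x \<in> {c<..<d - h}" for x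
    by (rule steklov_derivative[OF fc h that])
  have "C_k_on k (\<lambda>x. (1 / h) * f (x + h) + (- 1 / h) * f x) {c<..<d - h}"
    by (intro C_k_on_lincomb C_k_on_translate[OF f] C_k_on_subset[OF f]) (use h in auto)
  then have "C_k_on k (deriv (steklov h f)) {c<..<d - h}"
    by (rule C_k_on_cong_imp[rotated 2]) (auto simp: DERIV_imp_deriv[OF der] diff_divide_distrib)
  moreover have "steklov h f differentiable (at x)" if "x \<in> {c<..<d - h}" for x
    using der[OF that] unfolding real_differentiable_def by blast
  ultimately show ?thesis by (simp add: C_k_on_Suc)
qed

lemma steklov_iter:
  assumes nc: "n_convex_on n {c<..<d} f" and f: "continuous_on {c<..<d} f" and h: "h > 0"
  shows "n_convex_on n {c<..<d - real k * h} ((steklov h ^^ k) f) \<and> C_k_on k ((steklov h ^^ k) f) {c<..<d - real k * h}"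
proof (induction k)
  case 0
  have "deriv_dom {c<..<d} f 0 = {c<..<d}" by (auto simp: deriv_dom_def)
  then show ?case using nc f by (simp add: C_k_on_def)
next
  case (Suc k)
  then have "continuous_on {c<..<d - real k * h} ((steklov h ^^ k) f)"
    using C_k_on_mono[of k "(steklov h ^^ k) f" _ 0] by (simp add: C_k_on_def)
  moreover have e: "d - real (Suc k) * h = d - real k * h - h" by (simp add: algebra_simps)
  ultimately show ?case unfolding e using Suc steklov_n_convex[of n c "d - real k * h" "(steklov h ^^ k) f" h]
    steklov_C_k_on[of k "(steklov h ^^ k) f" c "d - real k * h" h] h by simp
qed

text \<open>The iterated average at \<open>y\<close> involves only values of \<open>f\<close> on
  \<open>[y, y + k h]\<close>, so an estimate valid there is inherited.\<close>

lemma steklov_iter_approx: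
  assumes nc: "n_convex_on n {c<..<d} f" and f: "continuous_on {c<..<d} f" and h: "h > 0"
    and x: "c < x" "x + \<delta> < d" and close: "\<And>y. x \<le> y \<Longrightarrow> y \<le> x + \<delta> \<Longrightarrow> \<bar>f y - z\<bar> \<le> e"
  shows "x \<le> y \<Longrightarrow> y + real k * h \<le> x + \<delta> \<Longrightarrow> \<bar>(steklov h ^^ k) f y - z\<bar> \<le> e"
proof (induction k arbitrary: y)
  case 0 then show ?case using close by simp
next
  case (Suc k)
  let ?g = "(steklov h ^^ k) f"
  have g: "continuous_on {c<..<d - real k * h} ?g"
    using steklov_iter[OF nc f h, of k] C_k_on_mono[of k ?g _ 0] by (simp add: C_k_on_def)
  have kh: "real (Suc k) * h = real k * h + h" by (simp add: algebra_simps)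
  have int: "(\<lambda>u. ?g (y + h * u)) integrable_on {0..1}"
    by (rule integrable_continuous_real[OF steklov_integrable[OF g h]]) (use Suc.prems x kh in auto)
  have b: "\<bar>?g (y + h * u) - z\<bar> \<le> e" if "u \<in> {0..1}" for u
  proof (rule Suc.IH)
    show "x \<le> y + h * u" "y + h * u + real k * h \<le> x + \<delta>"
      using Suc.prems kh mult_unit_interval[OF h that] by auto
  qed
  have "integral {0..1} (\<lambda>u::real. z - e) \<le> integral {0..1} (\<lambda>u. ?g (y + h * u))"
    by (rule integral_le[OF _ int]) (use b in \<open>auto simp: abs_le_iff diff_le_eq add.commute algebra_simps\<close>)
  moreover have "integral {0..1} (\<lambda>u. ?g (y + h * u)) \<le> integral {0..1} (\<lambda>u::real. z + e)"
    by (rule integral_le[OF int]) (use b in \<open>auto simp: abs_le_iff diff_le_eq add.commute algebra_simps\<close>)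
  moreover have "(steklov h ^^ Suc k) f y = integral {0..1} (\<lambda>u. ?g (y + h * u))" by (simp add: steklov_def[of h ?g])
  ultimately show ?case by (simp add: abs_le_iff)
qed

section \<open>Merging nodes and passing back to distinct nodes\<close>

definition dd_nonneg :: "nat \<Rightarrow> real set \<Rightarrow> (real \<Rightarrow> real) \<Rightarrow> bool" where
  "dd_nonneg n I f \<longleftrightarrow> (\<forall>q. degree q < n \<longrightarrow> kconv (2 * n) I (\<lambda>s. f s * (poly q s)\<^sup>2))"

lemma dd_eq_L_pairing:
  assumes "finite S" "S \<noteq> {}" shows "dd S g = L_pairing g (\<lambda>z. 1 / (\<Prod>s\<in>S. z - s))"
proof -
  obtain xs where xs: "set xs = S" "distinct xs" using finite_distinct_list[OF assms(1)] by blast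
  moreover have "xs \<noteq> []" using xs assms(2) by auto
  ultimately have "dd S g = divdiff xs g" using divdiff_distinct[of xs g] by (simp add: dd_def)
  moreover have "(\<Prod>y\<leftarrow>xs. z - y) = (\<Prod>s\<in>S. z - s)" for z
    using xs by (metis prod.distinct_set_conv_list)
  ultimately show ?thesis by (simp add: divdiff_def)
qed

text \<open>By \<open>L_pairing_square\<close> with \<open>Y = X\<close> this is the divided
  difference of \<open>f q^2\<close> over the doubled nodes \<open>X\<close> and the node
  \<open>w\<close>.\<close>

definition quadform :: "(real \<Rightarrow> real) \<Rightarrow> real set \<Rightarrow> real poly \<Rightarrow> real \<Rightarrow> real" where
  "quadform f X q w = (\<Sum>x\<in>X. \<Sum>y\<in>X. lcoef X q x * lcoef X q y * divdiff [x, y, w] f)"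

text \<open>\<open>2 n + 1\<close> distinct nodes that merge, as \<open>\<epsilon>\<close> tends to \<open>0\<close>, into \<open>X\<close> taken twice and \<open>w\<close>.\<close>

definition spread :: "real set \<Rightarrow> real \<Rightarrow> real \<Rightarrow> real set" where
  "spread X w \<epsilon> = insert (w + 2 * \<epsilon>) (X \<union> (\<lambda>x. x + \<epsilon>) ` X)"

lemma eventually_ne_right: "\<forall>\<^sub>F \<epsilon> in at_right (0::real). \<epsilon> \<noteq> c"
proof (cases "c > 0")
  case True
  have "\<forall>\<^sub>F \<epsilon> in at_right 0. \<epsilon> \<in> {0<..<c}" by (rule eventually_at_right_real[OF True])
  then show ?thesis by eventually_elim auto
next
  case False
  then show ?thesis using eventually_at_right_less[of "0::real"] by (auto elim: eventually_mono)
qed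

text \<open>Two of the moving nodes collide for finitely many values of \<open>\<epsilon>\<close>
  only. The factor 2 keeps \<open>w + 2 \<epsilon>\<close> away from \<open>w + \<epsilon>\<close>
  when \<open>w\<close> belongs to \<open>X\<close>.\<close>

lemma spread_eventually:
  assumes I: "open I" and X: "finite X" "X \<subseteq> I" "card X = n" and w: "w \<in> I"
  shows "\<forall>\<^sub>F \<epsilon> in at_right 0. \<epsilon> > 0 \<and> spread X w \<epsilon> \<subseteq> I \<and> X \<inter> (\<lambda>x. x + \<epsilon>) ` X = {} \<and>
    w + 2 * \<epsilon> \<notin> X \<union> (\<lambda>x. x + \<epsilon>) ` X \<and> card (spread X w \<epsilon>) = Suc (2 * n)"
proof -
  have 1: "\<forall>\<^sub>F \<epsilon> in at_right 0. \<forall>x\<in>X. x + \<epsilon> \<in> I"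
  proof (intro eventually_ball_finite[OF X(1)] ballI)
    fix x assume "x \<in> X"
    have "((\<lambda>\<epsilon>. x + \<epsilon>) \<longlongrightarrow> x) (at_right 0)" by (auto intro!: tendsto_eq_intros)
    then show "\<forall>\<^sub>F \<epsilon> in at_right 0. x + \<epsilon> \<in> I" by (rule topological_tendstoD) (use I X \<open>x \<in> X\<close> in auto)
  qed
  have "((\<lambda>\<epsilon>. w + 2 * \<epsilon>) \<longlongrightarrow> w) (at_right 0)" by (auto intro!: tendsto_eq_intros)
  then have 2: "\<forall>\<^sub>F \<epsilon> in at_right 0. w + 2 * \<epsilon> \<in> I" by (rule topological_tendstoD) (use I w in auto)
  have 3: "\<forall>\<^sub>F \<epsilon> in at_right 0. \<forall>x\<in>X. \<forall>y\<in>X. \<epsilon> \<noteq> x - y"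
    by (intro eventually_ball_finite[OF X(1)] ballI eventually_ne_right)
  have 4: "\<forall>\<^sub>F \<epsilon> in at_right 0. \<forall>x\<in>X. \<epsilon> \<noteq> (x - w) / 2"
    by (intro eventually_ball_finite[OF X(1)] ballI eventually_ne_right)
  have 5: "\<forall>\<^sub>F \<epsilon> in at_right 0. \<forall>x\<in>X. \<epsilon> \<noteq> x - w"
    by (intro eventually_ball_finite[OF X(1)] ballI eventually_ne_right)
  show ?thesis using 1 2 3 4 5 eventually_at_right_less[of "0::real"]
  proof eventually_elim
    case (elim \<epsilon>)
    let ?Y = "(\<lambda>x. x + \<epsilon>) ` X"
    have dis: "X \<inter> ?Y = {}" using elim(3) by (auto simp: algebra_simps)
    have wn: "w + 2 * \<epsilon> \<notin> X \<union> ?Y" using elim(4,5) by (auto simp: field_simps)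
    have "card ?Y = n" using X by (simp add: card_image inj_on_def)
    then have "card (spread X w \<epsilon>) = Suc (2 * n)"
      using wn dis X by (simp add: spread_def card_Un_disjoint)
    moreover have "spread X w \<epsilon> \<subseteq> I" using elim X by (auto simp: spread_def)
    ultimately show ?case using elim dis wn by blast
  qed
qed

text \<open>In \<open>L_pairing_square\<close> with the translate of \<open>X\<close> as second set,
  the differences of nodes inside that set do not depend on \<open>\<epsilon>\<close>. What varies
  is the value of \<open>q\<close> and a three-point divided difference, and both are
  continuous.\<close>

lemma spread_limit:
  assumes I: "open I" "convex I" and f: "C_k_on 2 f I" and X: "finite X" "X \<subseteq> I" "card X = n"
    and w: "w \<in> I" and q: "degree q < n"
  shows "((\<lambda>\<epsilon>. dd (spread X w \<epsilon>) (\<lambda>s. f s * (poly q s)\<^sup>2)) \<longlongrightarrow> quadform f X q w) (at_right 0)"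
proof -
  define A where "A = (\<lambda>\<epsilon>. \<Sum>x\<in>X. \<Sum>y\<in>X. lcoef X q x * (poly q (y + \<epsilon>) / (\<Prod>u\<in>X - {y}. y - u)) * divdiff [x, y + \<epsilon>, w + 2 * \<epsilon>] f)"
  have ev: "\<forall>\<^sub>F \<epsilon> in at_right 0. A \<epsilon> = dd (spread X w \<epsilon>) (\<lambda>s. f s * (poly q s)\<^sup>2)"
    using spread_eventually[OF I(1) X w]
  proof eventually_elim
    case (elim \<epsilon>)
    let ?t = "\<lambda>x. x + \<epsilon>" and ?g = "\<lambda>s. f s * (poly q s)\<^sup>2"
    let ?Y = "?t ` X"
    have inj: "inj_on ?t A" for A by (simp add: inj_on_def)
    have sub: "?Y \<subseteq> I" "w + 2 * \<epsilon> \<in> I" using elim by (auto simp: spread_def)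
    have cY: "finite ?Y" "card X = card ?Y" using X inj by (auto simp: card_image)
    have "dd (spread X w \<epsilon>) ?g = L_pairing ?g (\<lambda>z. 1 / (\<Prod>s\<in>spread X w \<epsilon>. z - s))"
      using X by (intro dd_eq_L_pairing) (auto simp: spread_def)
    also have "(\<lambda>z. 1 / (\<Prod>s\<in>spread X w \<epsilon>. z - s)) = (\<lambda>z. 1 / ((\<Prod>x\<in>X. z - x) * (\<Prod>y\<in>?Y. z - y) * (z - (w + 2 * \<epsilon>))))"
    proof
      fix z
      have "(\<Prod>s\<in>spread X w \<epsilon>. z - s) = (z - (w + 2 * \<epsilon>)) * ((\<Prod>x\<in>X. z - x) * (\<Prod>y\<in>?Y. z - y))"
        unfolding spread_def using elim X by (subst prod.insert) (auto simp: prod.union_disjoint)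
      then show "1 / (\<Prod>s\<in>spread X w \<epsilon>. z - s) = 1 / ((\<Prod>x\<in>X. z - x) * (\<Prod>y\<in>?Y. z - y) * (z - (w + 2 * \<epsilon>)))"
        by (simp add: mult_ac)
    qed
    also have "L_pairing ?g (\<lambda>z. 1 / ((\<Prod>x\<in>X. z - x) * (\<Prod>y\<in>?Y. z - y) * (z - (w + 2 * \<epsilon>))))
        = (\<Sum>x\<in>X. \<Sum>y\<in>?Y. lcoef X q x * lcoef ?Y q y * divdiff [x, y, w + 2 * \<epsilon>] f)"
      by (rule L_pairing_square[OF I(1) X(2) sub f X(1) cY]) (use q X in simp)
    also have "\<dots> = A \<epsilon>"
    proof -
      have "lcoef ?Y q (y + \<epsilon>) = poly q (y + \<epsilon>) / (\<Prod>u\<in>X - {y}. y - u)" for y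
      proof -
        have "?Y - {y + \<epsilon>} = ?t ` (X - {y})" by auto
        then show ?thesis by (simp add: lcoef_def prod.reindex[OF inj])
      qed
      then show ?thesis unfolding A_def sum.reindex[OF inj] by simp
    qed
    finally show ?case by simp
  qed
  obtain \<alpha> \<beta> r where h: "r > 0" "{\<alpha> - r..\<beta> + r} \<subseteq> I" "insert w X \<subseteq> {\<alpha>..\<beta>}" "\<alpha> \<le> \<beta>"
    by (rule compact_interval_hull[OF I, of "insert w X"]) (use X w in auto)
  have mem: "\<forall>\<^sub>F \<epsilon> in at_right 0. g \<epsilon> \<in> {\<alpha> - r..\<beta> + r}" if "(g \<longlongrightarrow> y) (at_right 0)" "y \<in> insert w X" for g :: "real \<Rightarrow> real" and y
  proof -
    have "y \<in> {\<alpha> - r<..<\<beta> + r}" using that(2) h by fastforce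
    then have "\<forall>\<^sub>F \<epsilon> in at_right 0. g \<epsilon> \<in> {\<alpha> - r<..<\<beta> + r}" by (intro topological_tendstoD[OF that(1)]) auto
    then show ?thesis by eventually_elim auto
  qed
  have "(A \<longlongrightarrow> (\<Sum>x\<in>X. \<Sum>y\<in>X. lcoef X q x * (poly q (y + 0) / (\<Prod>u\<in>X - {y}. y - u)) * divdiff [x, y, w] f)) (at_right 0)"
    unfolding A_def
  proof (intro tendsto_sum tendsto_mult tendsto_const tendsto_divide)
    fix x y assume xy: "x \<in> X" "y \<in> X"
    have l1: "((\<lambda>\<epsilon>. y + \<epsilon>) \<longlongrightarrow> y) (at_right 0)" by (auto intro!: tendsto_eq_intros)
    have l2: "((\<lambda>\<epsilon>. w + 2 * \<epsilon>) \<longlongrightarrow> w) (at_right 0)" by (auto intro!: tendsto_eq_intros)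
    show "((\<lambda>\<epsilon>. poly q (y + \<epsilon>)) \<longlongrightarrow> poly q (y + 0)) (at_right 0)" by (intro tendsto_intros)
    show "(\<Prod>u\<in>X - {y}. y - u) \<noteq> 0" using X by auto
    show "((\<lambda>\<epsilon>. divdiff [x, y + \<epsilon>, w + 2 * \<epsilon>] f) \<longlongrightarrow> divdiff [x, y, w] f) (at_right 0)"
    proof (rule tendsto_divdiff_3[OF f I(1) h(2) tendsto_const l1 l2])
      show "\<forall>\<^sub>F k in at_right 0. y + k \<in> {\<alpha> - r..\<beta> + r}" by (rule mem[OF l1]) (use xy in auto)
      show "\<forall>\<^sub>F k in at_right 0. w + 2 * k \<in> {\<alpha> - r..\<beta> + r}" by (rule mem[OF l2]) auto
      have "{\<alpha>..\<beta>} \<subseteq> {\<alpha> - r..\<beta> + r}" using h(1) by auto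
      then show mems: "x \<in> {\<alpha> - r..\<beta> + r}" "y \<in> {\<alpha> - r..\<beta> + r}" "w \<in> {\<alpha> - r..\<beta> + r}" using h(3) xy by blast+
      show "\<forall>\<^sub>F k in at_right (0::real). x \<in> {\<alpha> - r..\<beta> + r}" using mems(1) by simp
    qed
  qed
  then have "(A \<longlongrightarrow> quadform f X q w) (at_right 0)" by (simp add: quadform_def lcoef_def)
  then show ?thesis by (rule Lim_transform_eventually[OF _ ev])
qed

lemma dd_nonneg_imp_quadform:
  assumes I: "open I" "convex I" and f: "C_k_on 2 f I" and k: "dd_nonneg n I f"
    and X: "finite X" "X \<subseteq> I" "card X = n" and w: "w \<in> I" and q: "degree q < n"
  shows "0 \<le> quadform f X q w"
proof (rule tendsto_lowerbound[OF spread_limit[OF I f X w q]])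
  show "\<forall>\<^sub>F \<epsilon> in at_right 0. 0 \<le> dd (spread X w \<epsilon>) (\<lambda>s. f s * (poly q s)\<^sup>2)"
    using spread_eventually[OF I(1) X w]
  proof eventually_elim
    case (elim \<epsilon>)
    have "finite (spread X w \<epsilon>)" using X by (simp add: spread_def)
    then show ?case using k q elim unfolding dd_nonneg_def kconv_def by blast
  qed
qed simp

text \<open>If the derivative of order \<open>2 n\<close> were negative at \<open>t\<close>, it
  would be at most some \<open>- \<delta>\<close> near \<open>t\<close>, and so would
  \<open>(2 n)!\<close> times every divided difference over nearby nodes. Letting the nodes merge
  into doubled ones with \<open>w\<close> in \<open>X\<close> contradicts the Kraus condition. Once
  the derivative is nonnegative, the mean value theorem handles all node sets.\<close>

lemma kraus_imp_dd_nonneg_smooth: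
  assumes I: "open I" "convex I" and f: "C_k_on (2 * n) f I" and k: "kraus n I f" and n: "n > 0"
  shows "dd_nonneg n I f"
  unfolding dd_nonneg_def
proof (intro allI impI)
  fix q :: "real poly" assume q: "degree q < n"
  let ?g = "\<lambda>s. f s * (poly q s)\<^sup>2"
  have f2: "C_k_on 2 f I" by (rule C_k_on_mono[OF f]) (use n in simp)
  have g: "C_k_on (2 * n) ?g I" using C_k_on_mult_poly[OF I(1) f, of "q\<^sup>2"] by simp
  have nonneg: "0 \<le> (deriv ^^ (2 * n)) ?g t" if t: "t \<in> I" for t
  proof (rule ccontr)
    assume neg: "\<not> 0 \<le> (deriv ^^ (2 * n)) ?g t"
    define \<delta> where "\<delta> = - (deriv ^^ (2 * n)) ?g t / 2"
    have \<delta>: "\<delta> > 0" using neg by (simp add: \<delta>_def)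
    have "isCont ((deriv ^^ (2 * n)) ?g) t"
      using g t I(1) continuous_on_eq_continuous_at unfolding C_k_on_def by blast
    then have "((deriv ^^ (2 * n)) ?g \<longlongrightarrow> (deriv ^^ (2 * n)) ?g t) (nhds t)"
      by (simp add: isCont_def tendsto_at_iff_tendsto_nhds)
    then have "\<forall>\<^sub>F s in nhds t. (deriv ^^ (2 * n)) ?g s < - \<delta>"
      by (rule order_tendstoD(2)) (use \<delta> in \<open>simp add: \<delta>_def\<close>)
    moreover have "\<forall>\<^sub>F s in nhds t. s \<in> I" using I(1) t by (rule eventually_nhds_in_open)
    ultimately have "\<forall>\<^sub>F s in nhds t. (deriv ^^ (2 * n)) ?g s < - \<delta> \<and> s \<in> I" by (rule eventually_conj)
    then obtain \<rho> where \<rho>: "\<rho> > 0" "\<And>s. dist s t < \<rho> \<Longrightarrow> (deriv ^^ (2 * n)) ?g s < - \<delta> \<and> s \<in> I"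
      unfolding eventually_nhds_metric by blast
    define J where "J = ball t \<rho>"
    have J: "open J" "convex J" "J \<subseteq> I" "infinite J"
      using \<rho> by (auto simp: J_def dist_commute)
        (metis \<rho>(1) ball_eq_greaterThanLessThan infinite_Ioo less_add_same_cancel1 less_trans diff_less_eq)
    obtain X where X: "finite X" "card X = n" "X \<subseteq> J" using infinite_arbitrarily_large[OF J(4)] by blast
    obtain w where w: "w \<in> X" using X n by fastforce
    have kr: "0 \<le> quadform f X q w"
      using k X J(3) w unfolding kraus_def quadform_def by blast
    have "quadform f X q w \<le> - \<delta> / fact (2 * n)"
    proof (rule tendsto_upperbound[OF spread_limit[OF J(1,2) C_k_on_subset[OF f2 J(3)] X(1,3,2) _ q]])
      show wJ: "w \<in> J" using w X by blast
      show "\<forall>\<^sub>F \<epsilon> in at_right 0. dd (spread X w \<epsilon>) ?g \<le> - \<delta> / fact (2 * n)"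
      proof (rule eventually_mono[OF spread_eventually[OF J(1) X(1,3,2) wJ]])
        fix \<epsilon> assume e: "\<epsilon> > 0 \<and> spread X w \<epsilon> \<subseteq> J \<and> X \<inter> (\<lambda>x. x + \<epsilon>) ` X = {} \<and>
            w + 2 * \<epsilon> \<notin> X \<union> (\<lambda>x. x + \<epsilon>) ` X \<and> card (spread X w \<epsilon>) = Suc (2 * n)"
        have "\<exists>\<xi>\<in>J. dd (spread X w \<epsilon>) ((deriv ^^ 0) ?g) = (deriv ^^ (2 * n)) ?g \<xi> / fact (2 * n)"
          by (rule dd_mean_value[where G = "\<lambda>j. (deriv ^^ j) ?g", OF J(2)])
            (use e X J C_k_onD[OF g] in \<open>auto simp: spread_def simp del: funpow.simps\<close>)
        then obtain \<xi> where "\<xi> \<in> J" "dd (spread X w \<epsilon>) ?g = (deriv ^^ (2 * n)) ?g \<xi> / fact (2 * n)" by auto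
        moreover have "(deriv ^^ (2 * n)) ?g \<xi> \<le> - \<delta>"
          using \<rho>(2)[of \<xi>] \<open>\<xi> \<in> J\<close> by (simp add: J_def dist_commute)
        ultimately show "dd (spread X w \<epsilon>) ?g \<le> - \<delta> / fact (2 * n)" using divide_right_mono[of "(deriv ^^ (2 * n)) ?g \<xi>" "- \<delta>" "fact (2 * n)"] by simp
      qed
    qed simp
    moreover have "- \<delta> / fact (2 * n) < 0" using \<delta> by (simp add: divide_neg_pos)
    ultimately show False using kr by linarith
  qed
  show "kconv (2 * n) I ?g" unfolding kconv_def
  proof (intro allI impI, elim conjE)
    fix S assume S: "finite S" "S \<subseteq> I" "card S = Suc (2 * n)"
    have "\<exists>\<xi>\<in>I. dd S ((deriv ^^ 0) ?g) = (deriv ^^ (2 * n)) ?g \<xi> / fact (2 * n)"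
      by (rule dd_mean_value[where G = "\<lambda>j. (deriv ^^ j) ?g", OF I(2) S]) (use C_k_onD[OF g] in auto)
    then show "0 \<le> dd S ?g" using nonneg by auto
  qed
qed

text \<open>A divided difference over a fixed node set uses finitely many values of the function, so
  pointwise convergence of the averages suffices. The \<open>2 n\<close> averages provide the
  \<open>2 n\<close> derivatives that the smooth case requires.\<close>

theorem n_convex_imp_dd_nonneg:
  assumes nc: "n_convex_on n I f" and I: "open I" "convex I" and n: "n > 0"
  shows "dd_nonneg n I f"
  unfolding dd_nonneg_def kconv_def
proof (intro allI impI, elim conjE)
  fix q :: "real poly" and S assume q: "degree q < n" and S: "finite S" "S \<subseteq> I" "card S = Suc (2 * n)"
  have fc: "continuous_on I f" by (rule convex_on_continuous[OF I(1) n_convex_imp_convex[OF nc I(2) n]])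
  have "S \<noteq> {}" using S(3) by auto
  obtain \<alpha> \<beta> r where h: "r > 0" "{\<alpha> - r..\<beta> + r} \<subseteq> I" "S \<subseteq> {\<alpha>..\<beta>}" "\<alpha> \<le> \<beta>"
    by (rule compact_interval_hull[OF I S(1,2) \<open>S \<noteq> {}\<close>])
  let ?c = "\<alpha> - r" and ?d = "\<beta> + r"
  let ?k = "2 * n"
  have sub: "{?c<..<?d} \<subseteq> I" using h(2) by (auto simp: subset_iff)
  have nc': "n_convex_on n {?c<..<?d} f" by (rule n_convex_on_mono[OF nc sub])
  have fc': "continuous_on {?c<..<?d} f" by (rule continuous_on_subset[OF fc sub])
  define fh where "fh = (\<lambda>\<epsilon>. (steklov \<epsilon> ^^ ?k) f)"
  \<comment> \<open>\<open>2 n\<close> averages move the right end of the domain by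
    \<open>2 n \<epsilon>\<close>; for \<open>\<epsilon> < e0\<close> this is less than
    \<open>r\<close>, so the nodes stay inside.\<close>
  define e0 where "e0 = r / (real ?k + 1)"
  have e0: "e0 > 0" using h(1) by (simp add: e0_def)
  have lim: "((\<lambda>\<epsilon>. fh \<epsilon> x) \<longlongrightarrow> f x) (at_right 0)" if x: "x \<in> S" for x
  proof (rule tendstoI)
    fix e :: real assume e: "e > 0"
    have "x \<in> {\<alpha>..\<beta>}" using x h(3) by blast
    then have xI: "x \<in> {?c<..<?d}" using h(1) by simp
    have "isCont f x" using fc' xI by (simp add: continuous_on_eq_continuous_at[OF open_greaterThanLessThan])
    then have "\<forall>\<^sub>F y in nhds x. dist (f y) (f x) < e / 2"
      using e by (intro tendstoD) (auto simp: isCont_def tendsto_at_iff_tendsto_nhds)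
    then obtain \<delta>0 where \<delta>0: "\<delta>0 > 0" "\<And>y. dist y x < \<delta>0 \<Longrightarrow> dist (f y) (f x) < e / 2"
      unfolding eventually_nhds_metric by blast
    define \<delta> where "\<delta> = min (\<delta>0 / 2) ((?d - x) / 2)"
    have \<delta>: "\<delta> > 0" "\<delta> < \<delta>0" "x + \<delta> < ?d" using \<delta>0(1) xI by (auto simp: \<delta>_def min_def field_simps)
    have "\<forall>\<^sub>F \<epsilon> in at_right 0. \<epsilon> \<in> {0<..<\<delta> / (real ?k + 1)}"
      by (rule eventually_at_right_real) (use \<delta> in simp)
    then show "\<forall>\<^sub>F \<epsilon> in at_right 0. dist (fh \<epsilon> x) (f x) < e"
    proof eventually_elim
      case (elim \<epsilon>)
      have "real ?k * \<epsilon> \<le> \<delta>"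
      proof -
        have "(real ?k + 1) * \<epsilon> < \<delta>" using elim by (simp add: field_simps)
        then show ?thesis using elim by (simp add: algebra_simps)
      qed
      moreover have "\<bar>f y - f x\<bar> \<le> e / 2" if "x \<le> y" "y \<le> x + \<delta>" for y
        using \<delta>0(2)[of y] that \<delta> by (auto simp: dist_real_def)
      ultimately have "\<bar>(steklov \<epsilon> ^^ ?k) f x - f x\<bar> \<le> e / 2"
        using elim xI \<delta> by (intro steklov_iter_approx[OF nc' fc', of \<epsilon> x \<delta> "f x" "e / 2" x ?k]) auto
      then show ?case using e by (simp add: fh_def dist_real_def)
    qed
  qed
  have "((\<lambda>\<epsilon>. dd S (\<lambda>s. fh \<epsilon> s * (poly q s)\<^sup>2)) \<longlongrightarrow> dd S (\<lambda>s. f s * (poly q s)\<^sup>2)) (at_right 0)"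
    unfolding dd_def using S(1) by (intro tendsto_sum tendsto_divide tendsto_mult tendsto_const lim) auto
  moreover have "\<forall>\<^sub>F \<epsilon> in at_right 0. 0 \<le> dd S (\<lambda>s. fh \<epsilon> s * (poly q s)\<^sup>2)"
  proof -
    have "\<forall>\<^sub>F \<epsilon> in at_right 0. \<epsilon> \<in> {0<..<e0}" by (rule eventually_at_right_real[OF e0])
    then show ?thesis
    proof eventually_elim
      case (elim \<epsilon>)
      let ?J = "{?c<..<?d - real ?k * \<epsilon>}"
      have J: "n_convex_on n ?J (fh \<epsilon>)" "C_k_on ?k (fh \<epsilon>) ?J"
        using steklov_iter[OF nc' fc', of \<epsilon> ?k] elim by (auto simp: fh_def)
      have "(real ?k + 1) * \<epsilon> < r" using elim by (simp add: e0_def field_simps)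
      then have "real ?k * \<epsilon> < r" using elim by (simp add: algebra_simps)
      then have SJ: "S \<subseteq> ?J" using h by fastforce
      have "kraus n ?J (fh \<epsilon>)"
        by (rule n_convex_imp_kraus[OF J(1) C_k_on_mono[OF J(2)]]) (use n in auto)
      then have "dd_nonneg n ?J (fh \<epsilon>)" by (intro kraus_imp_dd_nonneg_smooth[OF _ _ J(2) _ n]) auto
      then show ?case using q S SJ unfolding dd_nonneg_def kconv_def by blast
    qed
  qed
  ultimately show "0 \<le> dd S (\<lambda>s. f s * (poly q s)\<^sup>2)" by (rule tendsto_lowerbound) simp
qed

section \<open>The equivalences\<close>

lemma poly_map_Re_Im:
  "poly (map_poly Re q) s = Re (poly q (complex_of_real s))"
  "poly (map_poly Im q) s = Im (poly q (complex_of_real s))"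
  by (induction q) (auto simp: map_poly_pCons)

lemma poly_Npoly: "poly (Npoly q) s = (poly (map_poly Re q) s)\<^sup>2 + (poly (map_poly Im q) s)\<^sup>2"
proof -
  have c: "poly (map_poly cnj q) (complex_of_real s) = cnj (poly q (complex_of_real s))"
    by (induction q) (auto simp: map_poly_pCons)
  have "poly (Npoly q) s = Re (poly (q * map_poly cnj q) (complex_of_real s))"
    by (simp only: Npoly_def poly_map_Re_Im)
  then show ?thesis unfolding poly_mult c poly_map_Re_Im by (simp add: power2_eq_square)
qed

lemma poly_Npoly_of_real: "poly (Npoly (map_poly complex_of_real q)) s = (poly q s)\<^sup>2"
proof -
  have "map_poly Re (map_poly complex_of_real q) = q" "map_poly Im (map_poly complex_of_real q) = 0"
    by (auto intro!: poly_eqI simp: coeff_map_poly)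
  then show ?thesis by (simp add: poly_Npoly)
qed

lemma kconv_iff_divdiff:
  "kconv m I g \<longleftrightarrow> (\<forall>x. strict_mono_on {0..m} x \<and> x ` {0..m} \<subseteq> I \<longrightarrow> 0 \<le> divdiff (map x [0..<m+1]) g)"
proof -
  have eq: "divdiff (map x [0..<m+1]) g = dd (x ` {0..m}) g" "finite (x ` {0..m})" "card (x ` {0..m}) = Suc m"
    if "strict_mono_on {0..m} x" for x
  proof -
    have inj: "inj_on x {0..m}" by (rule strict_mono_on_imp_inj_on[OF that])
    have s: "set [0..<m+1] = {0..m}" by auto
    have "distinct (map x [0..<m+1])" unfolding distinct_map s using inj by simp
    from divdiff_distinct[OF this, of g] show "divdiff (map x [0..<m+1]) g = dd (x ` {0..m}) g"
      unfolding set_map s dd_def by simp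
    show "card (x ` {0..m}) = Suc m" using card_image[OF inj] by simp
  qed simp
  show ?thesis
  proof
    assume k: "kconv m I g"
    show "\<forall>x. strict_mono_on {0..m} x \<and> x ` {0..m} \<subseteq> I \<longrightarrow> 0 \<le> divdiff (map x [0..<m+1]) g"
    proof (intro allI impI, elim conjE)
      fix x assume x: "strict_mono_on {0..m} x" "x ` {0..m} \<subseteq> I"
      show "0 \<le> divdiff (map x [0..<m+1]) g" using k x(2) eq[OF x(1)] unfolding kconv_def by metis
    qed
  next
    assume x: "\<forall>x. strict_mono_on {0..m} x \<and> x ` {0..m} \<subseteq> I \<longrightarrow> 0 \<le> divdiff (map x [0..<m+1]) g"
    show "kconv m I g" unfolding kconv_def
    proof (intro allI impI, elim conjE)
      fix S assume S: "finite S" "S \<subseteq> I" "card S = Suc m"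
      have s: "{..<Suc m} = {0..m}" by auto
      obtain h where "bij_betw h {..<card S} S" "strict_mono_on {..<card S} h" using ex_strict_mono_enum[OF S(1)] .
      then have h: "h ` {0..m} = S" "strict_mono_on {0..m} h" unfolding S(3) s by (auto simp: bij_betw_def)
      show "0 \<le> dd S g" using x[rule_format, of h] h S(2) eq(1)[OF h(2)] by simp
    qed
  qed
qed

lemma kconv_add: "kconv m I f \<Longrightarrow> kconv m I g \<Longrightarrow> kconv m I (\<lambda>s. f s + g s)"
  unfolding kconv_def dd_def by (auto simp: add_divide_distrib sum.distrib)

lemma dd_nonneg_Npoly:
  assumes k: "dd_nonneg n I f" and q: "degree q < n"
  shows "kconv (2 * n) I (\<lambda>s. f s * poly (Npoly q) s)"
proof -
  have "degree (map_poly Re q) < n" "degree (map_poly Im q) < n"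
    using q degree_map_poly_le[of Re q] degree_map_poly_le[of Im q] by linarith+
  then have "kconv (2 * n) I (\<lambda>s. f s * (poly (map_poly Re q) s)\<^sup>2 + f s * (poly (map_poly Im q) s)\<^sup>2)"
    using k unfolding dd_nonneg_def by (intro kconv_add) auto
  then show ?thesis by (simp add: poly_Npoly algebra_simps)
qed

lemma degree_map_complex_of_real [simp]: "degree (map_poly complex_of_real q) = degree q"
  by (rule degree_map_poly) simp

text \<open>The constant 1 is an admissible \<open>q\<close>, so \<open>f\<close> itself is convex
  of order \<open>2 n\<close>. The third claim uses \<open>2 n - 2 \<ge> 2\<close>.\<close>

lemma dd_nonneg_regularity:
  assumes I: "open I" "convex I" and k: "dd_nonneg n I f" and n: "n \<ge> 2"
  shows "C_k_on (2 * n - 2) f I" "convex_on I ((deriv ^^ (2 * n - 2)) f)" "C_k_on 2 f I"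
proof -
  have "kconv (2 * n) I (\<lambda>s. f s * (poly 1 s)\<^sup>2)" using k n unfolding dd_nonneg_def by (metis degree_1 not_gr_zero not_numeral_le_zero)
  moreover have "2 * n = Suc (Suc (2 * n - 2))" using n by simp
  ultimately have "kconv (Suc (Suc (2 * n - 2))) I f" by simp
  from kconv_regularity[OF I this] show C: "C_k_on (2 * n - 2) f I" and "convex_on I ((deriv ^^ (2 * n - 2)) f)" by auto
  show "C_k_on 2 f I" by (rule C_k_on_mono[OF C]) (use n in simp)
qed

text \<open>Additivity is inherited from \<open>pf_value\<close> once an expansion with poles of
  order at most 3 is at hand, where only derivatives up to order 2 occur. Splitting
  \<open>q = 1\<close> as in \<open>pf_repr_square\<close> supplies it.\<close>

lemma L_pairing_double_add:
  assumes I: "open I" "X \<subseteq> I" "w \<in> I" and X: "finite X" "X \<noteq> {}" and f: "C_k_on 2 f I" "C_k_on 2 g I"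
  shows "L_pairing (\<lambda>s. f s + g s) (\<lambda>z. 1 / ((\<Prod>x\<in>X. z - x) * (\<Prod>x\<in>X. z - x) * (z - w)))
    = L_pairing f (\<lambda>z. 1 / ((\<Prod>x\<in>X. z - x) * (\<Prod>x\<in>X. z - x) * (z - w)))
    + L_pairing g (\<lambda>z. 1 / ((\<Prod>x\<in>X. z - x) * (\<Prod>x\<in>X. z - x) * (z - w)))"
proof -
  let ?C = "insert w (X \<union> X)"
  have "\<forall>x\<in>X. \<forall>y\<in>X. \<exists>\<alpha>. pf_repr (\<lambda>t. 1 / ((t - x) * (t - y) * (t - w))) ?C 3 \<alpha>"
    using X by (intro ballI triple_repr) auto
  then obtain \<alpha> where \<alpha>: "\<And>x y. x \<in> X \<Longrightarrow> y \<in> X \<Longrightarrow> pf_repr (\<lambda>t. 1 / ((t - x) * (t - y) * (t - w))) ?C 3 (\<alpha> x y)"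
    by metis
  have "\<exists>\<beta>. pf_repr (\<lambda>z. 1 / ((\<Prod>x\<in>X. z - x) * (\<Prod>x\<in>X. z - x) * (z - w))) ?C 3 \<beta>"
    using pf_repr_square[OF X(1) X(1) refl _ \<alpha>, of 1] X by (auto simp: card_gt_0_iff)
  then obtain \<beta> where \<beta>: "pf_repr (\<lambda>z. 1 / ((\<Prod>x\<in>X. z - x) * (\<Prod>x\<in>X. z - x) * (z - w))) ?C 3 \<beta>" ..
  have "pf_value (\<lambda>s. 1 * f s + 1 * g s) ?C 3 \<beta> = 1 * pf_value f ?C 3 \<beta> + 1 * pf_value g ?C 3 \<beta>"
    by (rule pf_value_lincomb[OF I(1) _ f]) (use I in auto)
  then show ?thesis by (simp add: L_pairing_eq[OF \<beta>])
qed

lemma prod_list_map_concat: "prod_list (map h (concat xss)) = prod_list (map (\<lambda>xs. prod_list (map h xs)) xss)"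
  by (induction xss) auto

lemma divdiff_double:
  assumes "inj_on x {1..n}"
  shows "divdiff (concat (map (\<lambda>i. [x i, x i]) [1..<n+1]) @ [w]) g =
    L_pairing g (\<lambda>z. 1 / ((\<Prod>u\<in>x ` {1..n}. z - u) * (\<Prod>u\<in>x ` {1..n}. z - u) * (z - w)))"
proof -
  have "(\<Prod>y\<leftarrow>concat (map (\<lambda>i. [x i, x i]) [1..<n+1]) @ [w]. z - y)
      = (\<Prod>u\<in>x ` {1..n}. z - u) * (\<Prod>u\<in>x ` {1..n}. z - u) * (z - w)" for z
  proof -
    have s: "set [1..<n+1] = {1..n}" by auto
    have "(\<Prod>y\<leftarrow>concat (map (\<lambda>i. [x i, x i]) [1..<n+1]). z - y) = (\<Prod>i\<leftarrow>[1..<n+1]. (z - x i) * (z - x i))"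
      by (simp add: prod_list_map_concat comp_def)
    also have "\<dots> = (\<Prod>i\<in>{1..n}. (z - x i) * (z - x i))"
      using prod.distinct_set_conv_list[OF distinct_upt, of "\<lambda>i. (z - x i) * (z - x i)" 1 "n + 1"] s by simp
    also have "\<dots> = (\<Prod>u\<in>x ` {1..n}. z - u) * (\<Prod>u\<in>x ` {1..n}. z - u)"
      by (simp only: prod.reindex[OF assms] prod.distrib o_def)
    finally show ?thesis unfolding map_append prod_list.append by simp
  qed
  then show ?thesis by (simp only: divdiff_def)
qed

lemma divdiff_double_nonneg_iff:
  assumes I: "open I" and f: "C_k_on 2 f I" and X: "finite X" "X \<subseteq> I" "card X = n" "n > 0" and w: "w \<in> I"
  shows "(\<forall>q. degree q < n \<longrightarrow>
      0 \<le> L_pairing (\<lambda>s. f s * poly (Npoly q) s) (\<lambda>z. 1 / ((\<Prod>u\<in>X. z - u) * (\<Prod>u\<in>X. z - u) * (z - w))))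
    \<longleftrightarrow> (\<forall>q. degree q < n \<longrightarrow> 0 \<le> quadform f X q w)"
proof -
  let ?r = "\<lambda>z. 1 / ((\<Prod>u\<in>X. z - u) * (\<Prod>u\<in>X. z - u) * (z - w))"
  have sq: "L_pairing (\<lambda>s. f s * (poly q s)\<^sup>2) ?r = quadform f X q w" if "degree q < n" for q
    unfolding quadform_def by (rule L_pairing_square[OF I X(2) X(2) w f X(1) X(1) refl]) (use that X in simp)
  have C: "C_k_on 2 (\<lambda>s. f s * (poly q s)\<^sup>2) I" for q
    using C_k_on_mult_poly[OF I f, of "q\<^sup>2"] by simp
  have N: "L_pairing (\<lambda>s. f s * poly (Npoly q) s) ?r = quadform f X (map_poly Re q) w + quadform f X (map_poly Im q) w"
    if "degree q < n" for q
  proof -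
    have d: "degree (map_poly Re q) < n" "degree (map_poly Im q) < n"
      using that degree_map_poly_le[of Re q] degree_map_poly_le[of Im q] by linarith+
    have "(\<lambda>s. f s * poly (Npoly q) s) = (\<lambda>s. f s * (poly (map_poly Re q) s)\<^sup>2 + f s * (poly (map_poly Im q) s)\<^sup>2)"
      by (simp add: poly_Npoly algebra_simps)
    moreover have "X \<noteq> {}" using X by auto
    ultimately show ?thesis using L_pairing_double_add[OF I X(2) w X(1) \<open>X \<noteq> {}\<close> C C, of "map_poly Re q" "map_poly Im q"]
      by (simp only: sq[OF d(1)] sq[OF d(2)])
  qed
  have R: "0 \<le> quadform f X q w" if "degree q < n" "0 \<le> L_pairing (\<lambda>s. f s * poly (Npoly (map_poly complex_of_real q)) s) ?r" for q
    using that(2) sq[OF that(1)] by (simp add: poly_Npoly_of_real)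
  show ?thesis
  proof
    assume *: "\<forall>q. degree q < n \<longrightarrow> 0 \<le> L_pairing (\<lambda>s. f s * poly (Npoly q) s) ?r"
    show "\<forall>q. degree q < n \<longrightarrow> 0 \<le> quadform f X q w"
      by (intro allI impI R *[rule_format]) simp_all
  next
    assume *: "\<forall>q. degree q < n \<longrightarrow> 0 \<le> quadform f X q w"
    show "\<forall>q. degree q < n \<longrightarrow> 0 \<le> L_pairing (\<lambda>s. f s * poly (Npoly q) s) ?r"
    proof (intro allI impI)
      fix q :: "complex poly" assume q: "degree q < n"
      have d: "degree (map_poly Re q) < n" "degree (map_poly Im q) < n"
        using q degree_map_poly_le[of Re q] degree_map_poly_le[of Im q] by linarith+
      show "0 \<le> L_pairing (\<lambda>s. f s * poly (Npoly q) s) ?r" unfolding N[OF q] using * d by (simp add: add_nonneg_nonneg)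
    qed
  qed
qed

section \<open>Kraus matrices as quadratic forms\<close>

definition kraus_at :: "(real \<Rightarrow> real) \<Rightarrow> real set \<Rightarrow> real \<Rightarrow> bool" where
  "kraus_at f X w \<longleftrightarrow> (\<forall>r. 0 \<le> (\<Sum>x\<in>X. \<Sum>y\<in>X. r x * r y * divdiff [x, y, w] f))"

lemma kraus_at_iff_quadform:
  assumes X: "finite X" "X \<noteq> {}"
  shows "kraus_at f X w \<longleftrightarrow> (\<forall>q. degree q < card X \<longrightarrow> 0 \<le> quadform f X q w)"
proof
  assume "kraus_at f X w"
  then show "\<forall>q. degree q < card X \<longrightarrow> 0 \<le> quadform f X q w" by (simp add: kraus_at_def quadform_def)
next
  assume *: "\<forall>q. degree q < card X \<longrightarrow> 0 \<le> quadform f X q w"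
  show "kraus_at f X w" unfolding kraus_at_def
  proof
    fix r :: "real \<Rightarrow> real"
    \<comment> \<open>The interpolated values cancel the denominators in \<open>lcoef\<close>, so
      that these coefficients become \<open>r\<close>.\<close>
    define q where "q = lagr X (\<lambda>x. r x * (\<Prod>u\<in>X - {x}. x - u))"
    have "degree q < card X"
      using degree_lagr[OF X(1), of "\<lambda>x. r x * (\<Prod>u\<in>X - {x}. x - u)"] X card_gt_0_iff[of X] unfolding q_def by linarith
    moreover have "lcoef X q x = r x" if "x \<in> X" for x
      using X(1) that by (simp add: lcoef_def q_def poly_lagr)
    then have "quadform f X q w = (\<Sum>x\<in>X. \<Sum>y\<in>X. r x * r y * divdiff [x, y, w] f)" by (simp add: quadform_def)
    ultimately show "0 \<le> (\<Sum>x\<in>X. \<Sum>y\<in>X. r x * r y * divdiff [x, y, w] f)" using * by metis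
  qed
qed

lemma psd_real_iff:
  fixes g :: "nat \<Rightarrow> nat \<Rightarrow> real"
  assumes "\<And>i j. i < n \<Longrightarrow> j < n \<Longrightarrow> g i j = g j i"
  shows "psd n (mat n n (\<lambda>(i, j). g i j)) \<longleftrightarrow> (\<forall>v. 0 \<le> (\<Sum>i<n. \<Sum>j<n. v i * v j * g i j))"
proof -
  let ?M = "mat n n (\<lambda>(i, j). g i j)"
  have h: "hermitian n ?M"
    unfolding hermitian_def by (auto simp: mat_adjoint_def mat_of_rows_def assms intro!: eq_matI)
  have q: "(?M *\<^sub>v v) \<bullet>c v = (\<Sum>i<n. \<Sum>j<n. v $ i * v $ j * g i j)" if "v \<in> carrier_vec n" for v
    using that by (auto simp: scalar_prod_def atLeast0LessThan sum_distrib_left sum_distrib_right mult_ac intro!: sum.cong)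
  show ?thesis
  proof
    assume "psd n ?M"
    show "\<forall>v. 0 \<le> (\<Sum>i<n. \<Sum>j<n. v i * v j * g i j)"
    proof
      fix v :: "nat \<Rightarrow> real"
      have "0 \<le> (?M *\<^sub>v vec n v) \<bullet>c vec n v" using \<open>psd n ?M\<close> by (simp add: psd_def)
      then show "0 \<le> (\<Sum>i<n. \<Sum>j<n. v i * v j * g i j)" by (subst (asm) q) auto
    qed
  next
    assume *: "\<forall>v. 0 \<le> (\<Sum>i<n. \<Sum>j<n. v i * v j * g i j)"
    show "psd n ?M" unfolding psd_def
    proof (intro conjI h ballI)
      fix v :: "real vec" assume v: "v \<in> carrier_vec n"
      show "0 \<le> (?M *\<^sub>v v) \<bullet>c v" unfolding q[OF v] by (rule *[rule_format])
    qed
  qed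
qed

text \<open>Matrix indices start at 0 and nodes at 1. As \<open>x\<close> is injective, vectors of
  weights and functions on the nodes correspond to each other.\<close>

lemma psd_iff_kraus_at:
  assumes x: "inj_on x {1..n}"
  shows "psd n (mat n n (\<lambda>(i, j). divdiff [x (i + 1), x (j + 1), w] f)) \<longleftrightarrow> kraus_at f (x ` {1..n}) w"
proof -
  let ?h = "\<lambda>i. x (i + 1)"
  have inj: "inj_on ?h {..<n}"
  proof (rule inj_onI)
    fix i j assume "i \<in> {..<n}" "j \<in> {..<n}" "?h i = ?h j"
    then show "i = j" using inj_onD[OF x, of "i + 1" "j + 1"] by simp
  qed
  have im: "x ` {1..n} = ?h ` {..<n}"
    using image_image[of x Suc "{..<n}"] by (simp only: image_Suc_lessThan Suc_eq_plus1)
  have "(\<forall>v. 0 \<le> (\<Sum>i<n. \<Sum>j<n. v i * v j * divdiff [?h i, ?h j, w] f)) \<longleftrightarrow>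
      (\<forall>r. 0 \<le> (\<Sum>i<n. \<Sum>j<n. r (?h i) * r (?h j) * divdiff [?h i, ?h j, w] f))"
  proof
    assume *: "\<forall>r. 0 \<le> (\<Sum>i<n. \<Sum>j<n. r (?h i) * r (?h j) * divdiff [?h i, ?h j, w] f)"
    show "\<forall>v. 0 \<le> (\<Sum>i<n. \<Sum>j<n. v i * v j * divdiff [?h i, ?h j, w] f)"
    proof
      fix v
      show "0 \<le> (\<Sum>i<n. \<Sum>j<n. v i * v j * divdiff [?h i, ?h j, w] f)"
        using *[rule_format, of "\<lambda>u. v (the_inv_into {..<n} ?h u)"] by (simp add: the_inv_into_f_f[OF inj, simplified] cong: sum.cong_simp)
    qed
  next
    assume *: "\<forall>v. 0 \<le> (\<Sum>i<n. \<Sum>j<n. v i * v j * divdiff [?h i, ?h j, w] f)"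
    show "\<forall>r. 0 \<le> (\<Sum>i<n. \<Sum>j<n. r (?h i) * r (?h j) * divdiff [?h i, ?h j, w] f)"
    proof
      fix r
      show "0 \<le> (\<Sum>i<n. \<Sum>j<n. r (?h i) * r (?h j) * divdiff [?h i, ?h j, w] f)"
        by (rule *[rule_format, of "\<lambda>i. r (?h i)"])
    qed
  qed
  then show ?thesis
    unfolding kraus_at_def im sum.reindex[OF inj] o_def
    by (subst psd_real_iff) (auto simp: divdiff_3_swap(1))
qed

lemma kraus_iff_kraus_at:
  "kraus n I f \<longleftrightarrow> (\<forall>x l. strict_mono_on {1..n} x \<and> x ` {1..n} \<subseteq> I \<and> l \<in> {1..n} \<longrightarrow> kraus_at f (x ` {1..n}) (x l))"
proof
  assume k: "kraus n I f"
  show "\<forall>x l. strict_mono_on {1..n} x \<and> x ` {1..n} \<subseteq> I \<and> l \<in> {1..n} \<longrightarrow> kraus_at f (x ` {1..n}) (x l)"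
  proof (intro allI impI, elim conjE)
    fix x l assume x: "strict_mono_on {1..n} x" "x ` {1..n} \<subseteq> I" "l \<in> {1..n}"
    have "card (x ` {1..n}) = n" using card_image[OF strict_mono_on_imp_inj_on[OF x(1)]] by simp
    then show "kraus_at f (x ` {1..n}) (x l)" using k x unfolding kraus_def kraus_at_def by simp
  qed
next
  assume *: "\<forall>x l. strict_mono_on {1..n} x \<and> x ` {1..n} \<subseteq> I \<and> l \<in> {1..n} \<longrightarrow> kraus_at f (x ` {1..n}) (x l)"
  show "kraus n I f" unfolding kraus_def
  proof (intro allI impI, elim conjE)
    fix X l r assume X: "finite X" "X \<subseteq> I" "card X = n" and l: "l \<in> X"
    obtain h where "bij_betw h {..<card X} X" "strict_mono_on {..<card X} h" using ex_strict_mono_enum[OF X(1)] .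
    then have h: "h ` {..<n} = X" "strict_mono_on {..<n} h" using X(3) by (auto simp: bij_betw_def)
    let ?x = "\<lambda>i. h (i - 1)"
    have im: "?x ` {1..n} = X"
    proof -
      have "?x ` {1..n} = (\<lambda>i. ?x (Suc i)) ` {..<n}"
        using image_image[of ?x Suc "{..<n}"] by (simp only: image_Suc_lessThan)
      then show ?thesis using h(1) by simp
    qed
    have sm: "strict_mono_on {1..n} ?x"
      by (rule strict_mono_onI) (use strict_mono_onD[OF h(2)] in auto)
    obtain i where "i \<in> {1..n}" "?x i = l" using l im by blast
    then have "kraus_at f X l" using *[rule_format, of ?x i] sm im X(2) by auto
    then show "0 \<le> (\<Sum>x\<in>X. \<Sum>y\<in>X. r x * r y * divdiff [x, y, l] f)" by (simp add: kraus_at_def)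
  qed
qed

section \<open>The conditions that hold almost everywhere\<close>

lemma degree_pcompose_shift: "degree (p \<circ>\<^sub>p [:c, 1:]) = degree (p :: real poly)"
  by (simp add: degree_pcompose)

lemma pcompose_shift_shift: "(p \<circ>\<^sub>p [:t, 1:]) \<circ>\<^sub>p [:- t, 1:] = (p :: real poly)"
proof -
  have "[:t, 1:] \<circ>\<^sub>p [:- t, 1:] = [:0, 1 :: real:]" by (simp add: pcompose_pCons)
  then show ?thesis by (simp flip: pcompose_assoc)
qed

lemma poly_eq_sum_monom_rev:
  fixes p :: "real poly"
  assumes "degree p < n"
  shows "p = (\<Sum>i<n. monom (coeff p (n - 1 - i)) (n - 1 - i))"
proof -
  have "p = (\<Sum>i\<le>n - 1. monom (coeff p i) i)" using assms by (intro poly_as_sum_of_monoms'[symmetric]) simp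
  also have "{..n - 1} = {..<n}" using assms by auto
  also have "(\<Sum>i<n. monom (coeff p i) i) = (\<Sum>i<n. monom (coeff p (n - 1 - i)) (n - 1 - i))"
    by (rule sum.reindex_bij_witness[of _ "\<lambda>i. n - 1 - i" "\<lambda>i. n - 1 - i"]) auto
  finally show ?thesis .
qed

lemma degree_sum_monom_rev: "n > 0 \<Longrightarrow> degree (\<Sum>i<n. monom (v i :: real) (n - 1 - i)) < n"
  by (rule le_less_trans[OF degree_sum_le[of _ _ "n - 1"]]) (auto intro: order_trans[OF degree_monom_le])

lemma dd_nonneg_of_squares_ae:
  assumes I: "open I" "convex I" and C: "C_k_on N f I" and cv: "convex_on I ((deriv ^^ N) f)"
    and N: "2 * n = Suc (Suc N)"
    and ae: "\<And>q. degree q < n \<Longrightarrow> negligible {t \<in> I. \<not> (\<exists>d\<ge>0. (leibniz (jet f I N) (q\<^sup>2) (Suc N) has_real_derivative d) (at t))}"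
  shows "dd_nonneg n I f"
  unfolding dd_nonneg_def
proof (intro allI impI)
  fix q :: "real poly" assume q: "degree q < n"
  have "kconv (Suc (Suc N)) I (\<lambda>s. f s * poly (q\<^sup>2) s)"
    by (rule kconv_product[OF I C cv _ ae[OF q]]) simp
  then show "kconv (2 * n) I (\<lambda>s. f s * (poly q s)\<^sup>2)" by (simp add: N)
qed

text \<open>Off a further null set the right derivative of \<open>f\<close> at the top order is
  differentiable, and there the derivative over the partial domain coincides with that of the
  Leibniz expression. The hypothesis thus reaches the everywhere defined function to which the
  increment argument applies.\<close>

theorem dd_nonneg_iff_derivative_Npoly:
  assumes I: "open I" "convex I" and n: "n \<ge> 2"
  shows "dd_nonneg n I f \<longleftrightarrow> C_k_on (2 * n - 2) f I \<and> convex_on I ((deriv ^^ (2 * n - 2)) f) \<and>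
    (\<forall>q :: complex poly. degree q < n \<longrightarrow> (AE t in lborel. t \<in> I \<longrightarrow>
      (\<exists>d. has_kth_deriv I (2 * n) (\<lambda>s. f s * poly (Npoly q) s) d t \<and> 0 \<le> d)))"
proof -
  define N where "N = 2 * n - 2"
  have N: "2 * n = Suc (Suc N)" using n by (simp add: N_def)
  have set: "{t. \<not> (t \<in> I \<longrightarrow> Q t)} = {t \<in> I. \<not> Q t}" for Q by auto
  show ?thesis
  proof
    assume k: "dd_nonneg n I f"
    show "C_k_on (2 * n - 2) f I \<and> convex_on I ((deriv ^^ (2 * n - 2)) f) \<and>
    (\<forall>q :: complex poly. degree q < n \<longrightarrow> (AE t in lborel. t \<in> I \<longrightarrow>
      (\<exists>d. has_kth_deriv I (2 * n) (\<lambda>s. f s * poly (Npoly q) s) d t \<and> 0 \<le> d)))"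
      using dd_nonneg_regularity[OF I k n] dd_nonneg_Npoly[OF k] kconv_has_kth_deriv_ae[OF I]
      unfolding AE_lborel_iff_negligible set N by blast
  next
    assume "C_k_on (2 * n - 2) f I \<and> convex_on I ((deriv ^^ (2 * n - 2)) f) \<and>
    (\<forall>q :: complex poly. degree q < n \<longrightarrow> (AE t in lborel. t \<in> I \<longrightarrow>
      (\<exists>d. has_kth_deriv I (2 * n) (\<lambda>s. f s * poly (Npoly q) s) d t \<and> 0 \<le> d)))"
    then have C: "C_k_on N f I" and cv: "convex_on I ((deriv ^^ N) f)"
      and ae: "\<And>q. degree q < n \<Longrightarrow>
        negligible {t \<in> I. \<not> (\<exists>d. has_kth_deriv I (Suc (Suc N)) (\<lambda>s. f s * poly (Npoly q) s) d t \<and> 0 \<le> d)}"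
      unfolding N_def[symmetric] unfolding AE_lborel_iff_negligible set N by blast+
    show "dd_nonneg n I f"
    proof (rule dd_nonneg_of_squares_ae[OF I C cv N])
      fix q :: "real poly" assume q: "degree q < n"
      have eq: "(\<lambda>s. f s * poly (Npoly (map_poly complex_of_real q)) s) = (\<lambda>s. f s * poly (q\<^sup>2) s)"
        by (simp add: poly_Npoly_of_real)
      have A: "negligible {t \<in> I. \<not> (\<exists>d. has_kth_deriv I (Suc (Suc N)) (\<lambda>s. f s * poly (q\<^sup>2) s) d t \<and> 0 \<le> d)}"
        using ae[of "map_poly complex_of_real q"] q unfolding eq by simp
      show "negligible {t \<in> I. \<not> (\<exists>d\<ge>0. (leibniz (jet f I N) (q\<^sup>2) (Suc N) has_real_derivative d) (at t))}"
      proof (rule negligible_subset[OF negligible_Un[OF A negligible_not_twice_differentiable[OF I C cv]]], rule subsetI, rule ccontr)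
        fix t
        let ?F = "leibniz (jet f I N) (q\<^sup>2) (Suc N)"
        assume "t \<in> {t \<in> I. \<not> (\<exists>d\<ge>0. (?F has_real_derivative d) (at t))}"
          and nt: "t \<notin> {t \<in> I. \<not> (\<exists>d. has_kth_deriv I (Suc (Suc N)) (\<lambda>s. f s * poly (q\<^sup>2) s) d t \<and> 0 \<le> d)}
            \<union> {t \<in> I. \<not> rderiv I ((deriv ^^ N) f) differentiable (at t)}"
        then have t: "t \<in> I" and no: "\<not> (\<exists>d\<ge>0. (?F has_real_derivative d) (at t))" by auto
        obtain d where d: "has_kth_deriv I (Suc (Suc N)) (\<lambda>s. f s * poly (q\<^sup>2) s) d t" "0 \<le> d" using nt t by blast
        obtain h where h: "(rderiv I ((deriv ^^ N) f) has_real_derivative h) (at t)"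
          using nt t by (auto simp: real_differentiable_def)
        have diff: "(deriv ^^ N) f differentiable (at t)"
          by (rule differentiable_of_rderiv[OF I C cv t]) (use h real_differentiable_def in blast)
        note e = leibniz_top_derivative[OF I C cv t h, of "q\<^sup>2"]
        show False using has_kth_deriv_product[OF I C cv t e diff d(1)] e no d(2) by blast
      qed
    qed
  qed
qed

text \<open>The matrix at \<open>t\<close> tests all \<open>q\<close> at once, with polynomials
  centred at \<open>t\<close>. No union over uncountably many null sets arises: the sign is known at
  every point where the right derivative is differentiable, and this set does not depend on
  \<open>q\<close>.\<close>

theorem dd_nonneg_iff_derivative_matrix:
  assumes I: "open I" "convex I" and n: "n \<ge> 2"
  shows "dd_nonneg n I f \<longleftrightarrow> C_k_on (2 * n - 2) f I \<and> convex_on I ((deriv ^^ (2 * n - 2)) f) \<and>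
    (AE t in lborel. t \<in> I \<longrightarrow> (\<exists>d. (\<forall>k\<in>{2..2 * n}. has_kth_deriv I k f (d k) t) \<and>
      psd n (mat n n (\<lambda>(i, j). d (i + j + 2) / fact (i + j + 2)))))"
proof -
  define N where "N = 2 * n - 2"
  have N: "2 * n = Suc (Suc N)" using n by (simp add: N_def)
  have set: "{t. \<not> (t \<in> I \<longrightarrow> Q t)} = {t \<in> I. \<not> Q t}" for Q by auto
  let ?H = "rderiv I ((deriv ^^ N) f)"
  \<comment> \<open>The derivatives of \<open>f\<close> available at \<open>t\<close>: the ordinary
    ones up to order \<open>N\<close>, the right derivative at order \<open>N + 1\<close>, and the
    number \<open>h\<close> at order \<open>2 n\<close>.\<close>
  define a where "a = (\<lambda>h. (jet f I N)(Suc (Suc N) := \<lambda>_. h))"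
  define P where "P = (\<lambda>t d. \<forall>k\<in>{2..2 * n}. has_kth_deriv I k f (d k) t)"
  define M where "M = (\<lambda>d :: nat \<Rightarrow> real. psd n (mat n n (\<lambda>(i, j). d (i + j + 2) / fact (i + j + 2))))"
  have M: "M d \<longleftrightarrow> (\<forall>v. 0 \<le> (\<Sum>i<n. \<Sum>j<n. v i * v j * (d (i + j + 2) / fact (i + j + 2))))" for d
    unfolding M_def by (rule psd_real_iff) (simp add: add.commute)
  have der: "P t d \<longleftrightarrow> (\<forall>k\<in>{2..2 * n}. d k = a h k t)"
    if C: "C_k_on N f I" and cv: "convex_on I ((deriv ^^ N) f)" and t: "t \<in> I" and h: "(?H has_real_derivative h) (at t)"
    for t h d
  proof -
    have diff: "(deriv ^^ N) f differentiable (at t)"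
      by (rule differentiable_of_rderiv[OF I C cv t]) (use h real_differentiable_def in blast)
    have "has_kth_deriv I k f (d k) t \<longleftrightarrow> d k = a h k t" if "k \<in> {2..2 * n}" for k
    proof (cases "k = Suc (Suc N)")
      case True
      then show ?thesis using has_kth_deriv_top[OF I C cv t h, of "d k"] by (simp add: a_def)
    next
      case False
      moreover have "2 \<le> k" "k \<le> Suc (Suc N)" using that unfolding N by auto
      ultimately obtain j where "k = Suc j" "j \<le> N" by (cases k) auto
      then show ?thesis using has_kth_deriv_lower[OF I C cv t diff, of j "d k"] by (simp add: a_def)
    qed
    then show ?thesis by (simp add: P_def)
  qed
  have sq: "leibniz (a h) ((r \<circ>\<^sub>p [:- t, 1:])\<^sup>2) (2 * n) t =
      fact (2 * n) * (\<Sum>i<n. \<Sum>j<n. v i * v j * (a h (i + j + 2) t / fact (i + j + 2)))"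
    if "r = (\<Sum>i<n. monom (v i) (n - 1 - i))" for h r v t
  proof -
    have "2 * n - 2 * (n - 1) + i + j = i + j + 2" for i j using n by simp
    then show ?thesis using leibniz_square[of n "2 * n" r v "a h" t] n that by simp
  qed
  have "dd_nonneg n I f \<longleftrightarrow> C_k_on N f I \<and> convex_on I ((deriv ^^ N) f) \<and> negligible {t \<in> I. \<not> (\<exists>d. P t d \<and> M d)}"
  proof
    assume k: "dd_nonneg n I f"
    note C = dd_nonneg_regularity(1)[OF I k n, folded N_def] and cv = dd_nonneg_regularity(2)[OF I k n, folded N_def]
    have "\<exists>d. P t d \<and> M d" if t: "t \<in> I" and H: "?H differentiable (at t)" for t
    proof -
      obtain h where h: "(?H has_real_derivative h) (at t)" using H by (auto simp: real_differentiable_def)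
      have "0 \<le> (\<Sum>i<n. \<Sum>j<n. v i * v j * (a h (i + j + 2) t / fact (i + j + 2)))" for v
      proof -
        define r where "r = (\<Sum>i<n. monom (v i) (n - 1 - i))"
        let ?q = "r \<circ>\<^sub>p [:- t, 1:]"
        have "degree ?q < n" using degree_sum_monom_rev[of n v] n by (simp add: degree_pcompose_shift r_def)
        then have "kconv (Suc (Suc N)) I (\<lambda>s. f s * poly (?q\<^sup>2) s)" using k unfolding dd_nonneg_def N by simp
        then have "0 \<le> leibniz (a h) (?q\<^sup>2) (2 * n) t"
          using leibniz_top_derivative_nonneg[OF I C cv _ t leibniz_top_derivative[OF I C cv t h]] by (simp add: a_def N)
        then show ?thesis unfolding sq[OF r_def] zero_le_mult_iff
          using fact_gt_zero[of "2 * n", where 'a = real] by linarith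
      qed
      then have "M (\<lambda>k. a h k t)" by (simp add: M)
      moreover have "P t (\<lambda>k. a h k t)" by (simp add: der[OF C cv t h])
      ultimately show ?thesis by blast
    qed
    then have "{t \<in> I. \<not> (\<exists>d. P t d \<and> M d)} \<subseteq> {t \<in> I. \<not> ?H differentiable (at t)}" by blast
    with C cv show "C_k_on N f I \<and> convex_on I ((deriv ^^ N) f) \<and> negligible {t \<in> I. \<not> (\<exists>d. P t d \<and> M d)}"
      using negligible_subset[OF negligible_not_twice_differentiable[OF I C cv]] by blast
  next
    assume "C_k_on N f I \<and> convex_on I ((deriv ^^ N) f) \<and> negligible {t \<in> I. \<not> (\<exists>d. P t d \<and> M d)}"
    then have C: "C_k_on N f I" and cv: "convex_on I ((deriv ^^ N) f)" and ae: "negligible {t \<in> I. \<not> (\<exists>d. P t d \<and> M d)}" by auto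
    show "dd_nonneg n I f"
    proof (rule dd_nonneg_of_squares_ae[OF I C cv N])
      fix q :: "real poly" assume q: "degree q < n"
      have "\<exists>d\<ge>0. (leibniz (jet f I N) (q\<^sup>2) (Suc N) has_real_derivative d) (at t)"
        if t: "t \<in> I" and H: "?H differentiable (at t)" and PM: "\<exists>d. P t d \<and> M d" for t
      proof -
        obtain h where h: "(?H has_real_derivative h) (at t)" using H by (auto simp: real_differentiable_def)
        obtain d where d: "\<forall>k\<in>{2..2 * n}. d k = a h k t" "M d" using PM der[OF C cv t h] by blast
        define r where "r = q \<circ>\<^sub>p [:t, 1:]"
        have r: "r = (\<Sum>i<n. monom (coeff r (n - 1 - i)) (n - 1 - i))"
          by (rule poly_eq_sum_monom_rev) (use q in \<open>simp add: r_def degree_pcompose_shift\<close>)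
        let ?v = "\<lambda>i. coeff r (n - 1 - i)"
        have "(\<Sum>i<n. \<Sum>j<n. ?v i * ?v j * (a h (i + j + 2) t / fact (i + j + 2)))
            = (\<Sum>i<n. \<Sum>j<n. ?v i * ?v j * (d (i + j + 2) / fact (i + j + 2)))"
        proof (intro sum.cong refl)
          fix i j assume "i \<in> {..<n}" "j \<in> {..<n}"
          then have "i + j + 2 \<in> {2..2 * n}" by auto
          with d(1) show "?v i * ?v j * (a h (i + j + 2) t / fact (i + j + 2)) = ?v i * ?v j * (d (i + j + 2) / fact (i + j + 2))"
            by metis
        qed
        also have "0 \<le> \<dots>" by (rule d(2)[unfolded M, rule_format, of ?v])
        finally have "0 \<le> leibniz (a h) ((r \<circ>\<^sub>p [:- t, 1:])\<^sup>2) (2 * n) t" unfolding sq[OF r] by (intro mult_nonneg_nonneg) auto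
        then have "0 \<le> leibniz (a h) (q\<^sup>2) (2 * n) t" by (simp add: r_def pcompose_shift_shift)
        then show ?thesis using leibniz_top_derivative[OF I C cv t h, of "q\<^sup>2"] unfolding a_def N by blast
      qed
      then have "{t \<in> I. \<not> (\<exists>d\<ge>0. (leibniz (jet f I N) (q\<^sup>2) (Suc N) has_real_derivative d) (at t))}
          \<subseteq> {t \<in> I. \<not> (\<exists>d. P t d \<and> M d)} \<union> {t \<in> I. \<not> ?H differentiable (at t)}" by blast
      then show "negligible {t \<in> I. \<not> (\<exists>d\<ge>0. (leibniz (jet f I N) (q\<^sup>2) (Suc N) has_real_derivative d) (at t))}"
        by (rule negligible_subset[OF negligible_Un[OF ae negligible_not_twice_differentiable[OF I C cv]]])
    qed
  qed
  then show ?thesis unfolding AE_lborel_iff_negligible set N_def P_def M_def .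
qed

text \<open>A cycle closes the equivalence: \<open>n\<close>-convexity gives nonnegative divided
  differences, these give positive Kraus forms for every extra node in \<open>I\<close>, in
  particular for nodes of \<open>X\<close>, and the latter give back
  \<open>n\<close>-convexity.\<close>

theorem n_convex_iff_kraus:
  assumes I: "open I" "convex I" and n: "n \<ge> 2"
  shows "n_convex_on n I f \<longleftrightarrow> C_k_on 2 f I \<and> kraus n I f" "n_convex_on n I f \<longleftrightarrow> dd_nonneg n I f"
    "n_convex_on n I f \<longleftrightarrow> C_k_on 2 f I \<and> (\<forall>x x0. strict_mono_on {1..n} x \<and> x ` {1..n} \<subseteq> I \<and> x0 \<in> I \<longrightarrow> kraus_at f (x ` {1..n}) x0)"
proof -
  let ?A = "\<forall>x x0. strict_mono_on {1..n} x \<and> x ` {1..n} \<subseteq> I \<and> x0 \<in> I \<longrightarrow> kraus_at f (x ` {1..n}) x0"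
  have n0: "n > 0" using n by simp
  have 1: "dd_nonneg n I f" if "n_convex_on n I f" by (rule n_convex_imp_dd_nonneg[OF that I n0])
  have 2: "C_k_on 2 f I \<and> ?A" if k: "dd_nonneg n I f"
  proof (intro conjI allI impI, rule dd_nonneg_regularity(3)[OF I k n], elim conjE)
    fix x x0 assume x: "strict_mono_on {1..n} x" "x ` {1..n} \<subseteq> I" "x0 \<in> I"
    have c: "card (x ` {1..n}) = n" using card_image[OF strict_mono_on_imp_inj_on[OF x(1)]] by simp
    have "x ` {1..n} \<noteq> {}" using n0 by auto
    from kraus_at_iff_quadform[OF finite_imageI[OF finite_atLeastAtMost] this, of f x0, unfolded c]
    show "kraus_at f (x ` {1..n}) x0"
      using dd_nonneg_imp_quadform[OF I dd_nonneg_regularity(3)[OF I k n] k _ x(2) c x(3)] by blast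
  qed
  have 3: "kraus n I f" if ?A unfolding kraus_iff_kraus_at using that by blast
  have 4: "n_convex_on n I f" if "C_k_on 2 f I" "kraus n I f" by (rule kraus_imp_n_convex[OF that(2,1) I n0])
  show "n_convex_on n I f \<longleftrightarrow> C_k_on 2 f I \<and> kraus n I f" "n_convex_on n I f \<longleftrightarrow> dd_nonneg n I f" "n_convex_on n I f \<longleftrightarrow> C_k_on 2 f I \<and> ?A"
    using 1 2 3 4 by blast+
qed

lemma divdiff_double_nonneg_iff_kraus_at:
  assumes I: "open I" and f: "C_k_on 2 f I" and x: "strict_mono_on {1..n} x" "x ` {1..n} \<subseteq> I" and w: "w \<in> I" and n: "n > 0"
  shows "(\<forall>q. degree q \<le> n - 1 \<longrightarrow>
      0 \<le> divdiff (concat (map (\<lambda>i. [x i, x i]) [1..<n+1]) @ [w]) (\<lambda>s. f s * poly (Npoly q) s))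
    \<longleftrightarrow> kraus_at f (x ` {1..n}) w"
proof -
  have inj: "inj_on x {1..n}" by (rule strict_mono_on_imp_inj_on[OF x(1)])
  have c: "card (x ` {1..n}) = n" using card_image[OF inj] by simp
  have d: "m \<le> n - 1 \<longleftrightarrow> m < n" for m using n by auto
  have "x ` {1..n} \<noteq> {}" using n by auto
  from kraus_at_iff_quadform[OF finite_imageI[OF finite_atLeastAtMost] this, of f w, unfolded c]
  show ?thesis unfolding divdiff_double[OF inj] d using divdiff_double_nonneg_iff[OF I f _ x(2) c n w] by blast
qed

theorem theorem5p3:
  fixes n :: nat and a b :: ereal and f :: "real \<Rightarrow> real" and I :: "real set"
  assumes n: "2 \<le> n"
    and ab: "a < b"
    and I: "I = einterval a b"
  shows "(n_convex_on n I f \<longleftrightarrow>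
      (\<forall>x q. strict_mono_on {0..2*n} x \<and> x ` {0..2*n} \<subseteq> I \<and> degree (q :: real poly) \<le> n - 1 \<longrightarrow>
        0 \<le> divdiff (map x [0..<2*n+1]) (\<lambda>s. f s * (poly q s)\<^sup>2))) \<and>
    (n_convex_on n I f \<longleftrightarrow>
      (\<forall>x q. strict_mono_on {0..2*n} x \<and> x ` {0..2*n} \<subseteq> I \<and> degree (q :: complex poly) \<le> n - 1 \<longrightarrow>
        0 \<le> divdiff (map x [0..<2*n+1]) (\<lambda>s. f s * poly (Npoly q) s))) \<and>
    (n_convex_on n I f \<longleftrightarrow>
      C_k_on 2 f I \<and>
      (\<forall>x l q. strict_mono_on {1..n} x \<and> x ` {1..n} \<subseteq> I \<and> l \<in> {1..n}
          \<and> degree (q :: complex poly) \<le> n - 1 \<longrightarrow>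
        0 \<le> divdiff (concat (map (\<lambda>i. [x i, x i]) [1..<n+1]) @ [x l])
              (\<lambda>s. f s * poly (Npoly q) s))) \<and>
    (n_convex_on n I f \<longleftrightarrow>
      C_k_on 2 f I \<and>
      (\<forall>x x0 q. strict_mono_on {1..n} x \<and> x ` {1..n} \<subseteq> I \<and> x0 \<in> I
          \<and> degree (q :: complex poly) \<le> n - 1 \<longrightarrow>
        0 \<le> divdiff (concat (map (\<lambda>i. [x i, x i]) [1..<n+1]) @ [x0])
              (\<lambda>s. f s * poly (Npoly q) s))) \<and>
    (n_convex_on n I f \<longleftrightarrow>
      C_k_on 2 f I \<and>
      (\<forall>x l. strict_mono_on {1..n} x \<and> x ` {1..n} \<subseteq> I \<and> l \<in> {1..n} \<longrightarrow>
        psd n (mat n n (\<lambda>(i, j). divdiff [x (i + 1), x (j + 1), x l] f)))) \<and>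
    (n_convex_on n I f \<longleftrightarrow>
      C_k_on 2 f I \<and>
      (\<forall>x x0. strict_mono_on {1..n} x \<and> x ` {1..n} \<subseteq> I \<and> x0 \<in> I \<longrightarrow>
        psd n (mat n n (\<lambda>(i, j). divdiff [x (i + 1), x (j + 1), x0] f)))) \<and>
    (n_convex_on n I f \<longleftrightarrow>
      C_k_on (2*n - 2) f I \<and> convex_on I ((deriv ^^ (2*n - 2)) f) \<and>
      (\<forall>q :: complex poly. degree q \<le> n - 1 \<longrightarrow>
        (AE t in lborel. t \<in> I \<longrightarrow>
          (\<exists>d. has_kth_deriv I (2*n) (\<lambda>s. f s * poly (Npoly q) s) d t \<and> 0 \<le> d)))) \<and>
    (n_convex_on n I f \<longleftrightarrow>
      C_k_on (2*n - 2) f I \<and> convex_on I ((deriv ^^ (2*n - 2)) f) \<and>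
      (AE t in lborel. t \<in> I \<longrightarrow>
        (\<exists>d. (\<forall>k\<in>{2..2*n}. has_kth_deriv I k f (d k) t) \<and>
          psd n (mat n n (\<lambda>(i, j). d (i + j + 2) / fact (i + j + 2))))))"
proof -
  have Io: "open I" unfolding I by simp
  have Ic: "convex I" unfolding I by (auto simp: is_interval_convex_1[symmetric] is_interval_1 einterval_iff)
      (meson ereal_less_eq(3) less_le_trans le_less_trans)+
  have n0: "n > 0" and d: "m \<le> n - 1 \<longleftrightarrow> m < n" for m using n by auto
  note NC = n_convex_iff_kraus[OF Io Ic n, of f]
  have c2: "dd_nonneg n I f \<longleftrightarrow> (\<forall>x q. strict_mono_on {0..2*n} x \<and> x ` {0..2*n} \<subseteq> I \<and> degree (q :: real poly) \<le> n - 1 \<longrightarrow>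
        0 \<le> divdiff (map x [0..<2*n+1]) (\<lambda>s. f s * (poly q s)\<^sup>2))"
    unfolding dd_nonneg_def kconv_iff_divdiff d by blast
  have c3: "dd_nonneg n I f \<longleftrightarrow> (\<forall>x q. strict_mono_on {0..2*n} x \<and> x ` {0..2*n} \<subseteq> I \<and> degree (q :: complex poly) \<le> n - 1 \<longrightarrow>
        0 \<le> divdiff (map x [0..<2*n+1]) (\<lambda>s. f s * poly (Npoly q) s))" (is "_ \<longleftrightarrow> ?R")
  proof -
    have "?R \<longleftrightarrow> (\<forall>q. degree q < n \<longrightarrow> kconv (2 * n) I (\<lambda>s. f s * poly (Npoly q) s))"
      unfolding kconv_iff_divdiff d by blast
    moreover have "dd_nonneg n I f" if k: "\<forall>q. degree q < n \<longrightarrow> kconv (2 * n) I (\<lambda>s. f s * poly (Npoly q) s)"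
      unfolding dd_nonneg_def
    proof (intro allI impI)
      fix q :: "real poly" assume "degree q < n"
      then show "kconv (2 * n) I (\<lambda>s. f s * (poly q s)\<^sup>2)"
        using k[rule_format, of "map_poly complex_of_real q"] by (simp add: poly_Npoly_of_real)
    qed
    ultimately show ?thesis using dd_nonneg_Npoly by blast
  qed
  have D: "(\<forall>q. degree q \<le> n - 1 \<longrightarrow>
      0 \<le> divdiff (concat (map (\<lambda>i. [x i, x i]) [1..<n+1]) @ [w]) (\<lambda>s. f s * poly (Npoly q) s)) \<longleftrightarrow> kraus_at f (x ` {1..n}) w"
    if "C_k_on 2 f I" "strict_mono_on {1..n} x" "x ` {1..n} \<subseteq> I" "w \<in> I" for x w
    by (rule divdiff_double_nonneg_iff_kraus_at[OF Io that n0])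
  have M: "psd n (mat n n (\<lambda>(i, j). divdiff [x (i + 1), x (j + 1), w] f)) \<longleftrightarrow> kraus_at f (x ` {1..n}) w"
    if "strict_mono_on {1..n} x" for x w
    by (rule psd_iff_kraus_at[OF strict_mono_on_imp_inj_on[OF that]])
  have in_I: "x l \<in> I" if "x ` {1..n} \<subseteq> I" "l \<in> {1..n}" for x :: "nat \<Rightarrow> real" and l using that by blast
  have c4: "C_k_on 2 f I \<and> kraus n I f \<longleftrightarrow> C_k_on 2 f I \<and>
      (\<forall>x l q. strict_mono_on {1..n} x \<and> x ` {1..n} \<subseteq> I \<and> l \<in> {1..n} \<and> degree (q :: complex poly) \<le> n - 1 \<longrightarrow>
        0 \<le> divdiff (concat (map (\<lambda>i. [x i, x i]) [1..<n+1]) @ [x l]) (\<lambda>s. f s * poly (Npoly q) s))"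
    unfolding kraus_iff_kraus_at using D in_I by meson
  have c5: "n_convex_on n I f \<longleftrightarrow> C_k_on 2 f I \<and>
      (\<forall>x x0 q. strict_mono_on {1..n} x \<and> x ` {1..n} \<subseteq> I \<and> x0 \<in> I \<and> degree (q :: complex poly) \<le> n - 1 \<longrightarrow>
        0 \<le> divdiff (concat (map (\<lambda>i. [x i, x i]) [1..<n+1]) @ [x0]) (\<lambda>s. f s * poly (Npoly q) s))"
    unfolding NC(3) using D by meson
  have c6: "C_k_on 2 f I \<and> kraus n I f \<longleftrightarrow> C_k_on 2 f I \<and>
      (\<forall>x l. strict_mono_on {1..n} x \<and> x ` {1..n} \<subseteq> I \<and> l \<in> {1..n} \<longrightarrow>
        psd n (mat n n (\<lambda>(i, j). divdiff [x (i + 1), x (j + 1), x l] f)))"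
    unfolding kraus_iff_kraus_at using M by meson
  have c7: "n_convex_on n I f \<longleftrightarrow> C_k_on 2 f I \<and>
      (\<forall>x x0. strict_mono_on {1..n} x \<and> x ` {1..n} \<subseteq> I \<and> x0 \<in> I \<longrightarrow>
        psd n (mat n n (\<lambda>(i, j). divdiff [x (i + 1), x (j + 1), x0] f)))"
    unfolding NC(3) using M by meson
  note c8 = dd_nonneg_iff_derivative_Npoly[OF Io Ic n, of f, folded d]
  note c9 = dd_nonneg_iff_derivative_matrix[OF Io Ic n, of f]
  show ?thesis
    by (intro conjI NC(2)[unfolded c2] NC(2)[unfolded c3] NC(1)[unfolded c4] c5 NC(1)[unfolded c6] c7
      NC(2)[unfolded c8] NC(2)[unfolded c9])
qed

end
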